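(* Let $\Phi_1$ be either a quasi-Young function with $p_{\Phi_1}<\infty$, or a Young function (possibly with $p_{\Phi_1}=\infty$). Let $\Phi_2$ and $\Psi$ be quasi-Young functions, let $m\in\mathscr S'(\mathbb R^d)$, and suppose that the Fourier multiplier $m(D):L^{\Phi_1}(\mathbb R^d)\to L^{\Phi_2}(\mathbb R^d)$ is bounded. Then $m(D)$ is also bounded from $M^{\Phi_1,\Psi}(\mathbb R^d)$ to $M^{\Phi_2,\Psi}(\mathbb R^d)$.
   Context: A Young function is a convex function $\Phi:[0,\infty)\to[0,\infty]$ with $\Phi(0)=0$, $\Phi(t)<\infty$ for some $t>0$, and $\lim_{t\to\infty}\Phi(t)=+\infty$. A function $\Phi:[0,\infty)\to[0,\infty]$ is a quasi-Young function if there is $r\in(0,1]$ such that $t\mapsto\Phi(t^{1/r})$ is a Young function; the largest such $r$ is called the order of $\Phi$. With $\Omega=\{t>0:0<\Phi(t)<\infty\}$ and $\Phi'_+$ the right derivative, $p_\Phi=\sup_{t\in\Omega}\frac{t\Phi'_+(t)}{\Phi(t)}$ if $\Omega=(0,\infty)$, and $p_\Phi=\infty$ otherwise. $L^\Phi(\mathbb R^d)$ is the space of (classes of) Lebesgue measurable $f:\mathbb R^d\to\mathbb C$ with $\|f\|_{L^\Phi}=\inf\{\lambda>0:\int\Phi(|f(x)|/\lambda)\,dx\le1\}<\infty$. $L^{\Phi,\Psi}(\mathbb R^{2d})$ is the space of measurable $F$ on $\mathbb R^{2d}$ with $\|F\|_{L^{\Phi,\Psi}}=\big\|\xi\mapsto\|F(\cdot,\xi)\|_{L^\Phi}\big\|_{L^\Psi}<\infty$.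 $\mathscr F f(\xi)=\hat f(\xi)=(2\pi)^{-d/2}\int f(x)e^{-i\langle x,\xi\rangle}dx$. For $\varphi\in\mathscr S(\mathbb R^d)\setminus\{0\}$ (a window) and $f\in\mathscr S'(\mathbb R^d)$, $V_\varphi f(x,\xi)=(2\pi)^{-d/2}\int f(y)\overline{\varphi(y-x)}e^{-i\langle y,\xi\rangle}dy$ (in the distributional sense), and $\tilde V_\varphi f(x,\xi)=(2\pi)^{-d/2}\int f(y+x)\overline{\varphi(y)}e^{-i\langle y,\xi\rangle}dy$. $M^{\Phi,\Psi}(\mathbb R^d)$ consists of all $f\in\mathscr S'(\mathbb R^d)$ with $\|f\|_{M^{\Phi,\Psi}}=\|V_\varphi f\|_{L^{\Phi,\Psi}}<\infty$, for a fixed window $\varphi$ (different windows give equivalent quasi-norms). For $m\in\mathscr S'(\mathbb R^d)$, the Fourier multiplier with symbol $m$ is $m(D)=\mathscr F^{-1}\circ(m\,\cdot)\circ\mathscr F:\mathscr S(\mathbb R^d)\to\mathscr S'(\mathbb R^d)$. If $p_{\Phi_1}<\infty$, then $C_c^\infty(\mathbb R^d)$ is dense in $L^{\Phi_1}(\mathbb R^d)$, and $m(D):L^{\Phi_1}\to L^{\Phi_2}$ is defined by continuous extension from $C_c^\infty(\mathbb R^d)$. If $\Phi_1$ is a Young function with $p_{\Phi_1}=\infty$, then $L^{\Phi_1}\subseteq\mathscr S'$ and $m(D)g=\mathscr F^{-1}(m\hat g)$; its being well defined on $L^{\Phi_1}$ is part of the hypothesis. On $M^{\Phi_1,\Psi}$,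 $m(D)f$ is understood as the tempered distribution satisfying $\tilde V_\varphi(m(D)f)(\cdot,\xi)=m(D)\big(\tilde V_\varphi f(\cdot,\xi)\big)$ for almost every $\xi$ and every window $\varphi$ (for $f\in\mathscr S$ this agrees with the definition above). A linear map $T:X\to Y$ of quasi-normed spaces is bounded if there is $C>0$ with $\|Tf\|_Y\le C\|f\|_X$ for all $f\in X$. *)

theory Defs
  imports "HOL-Analysis.Analysis"
begin

section \<open>Young and quasi-Young functions, Orlicz spaces\<close>

text \<open>Functions \<open>[0,\<infinity>) \<rightarrow> [0,\<infinity>]\<close> are rendered as functions of type \<open>real \<Rightarrow> ennreal\<close>; the values at
  negative arguments are never used.  The library constant \<open>convex_on\<close> covers finite-valued
  functions only; in the inequality below \<open>0 * \<infinity> = 0\<close>.\<close>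

definition young_function :: "(real \<Rightarrow> ennreal) \<Rightarrow> bool" where
  "young_function \<Phi> \<longleftrightarrow>
     (\<forall>s\<ge>0. \<forall>t\<ge>0. \<forall>u\<in>{0..1}.
        \<Phi> (u * s + (1 - u) * t) \<le> ennreal u * \<Phi> s + ennreal (1 - u) * \<Phi> t) \<and>
     \<Phi> 0 = 0 \<and> (\<exists>t>0. \<Phi> t < \<infinity>) \<and> (\<Phi> \<longlongrightarrow> \<infinity>) at_top"

definition quasi_young_function :: "(real \<Rightarrow> ennreal) \<Rightarrow> bool" where
  "quasi_young_function \<Phi> \<longleftrightarrow> (\<exists>r. 0 < r \<and> r \<le> 1 \<and> young_function (\<lambda>t. \<Phi> (t powr (1 / r))))"

definition right_deriv :: "(real \<Rightarrow> ennreal) \<Rightarrow> real \<Rightarrow> real" where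
  "right_deriv \<Phi> t = vector_derivative (\<lambda>s. enn2real (\<Phi> s)) (at_right t)"

definition upper_index :: "(real \<Rightarrow> ennreal) \<Rightarrow> ereal" where
  "upper_index \<Phi> =
     (let \<Omega> = {t. 0 < t \<and> 0 < \<Phi> t \<and> \<Phi> t < \<infinity>}
      in if \<Omega> = {0<..} then (SUP t\<in>\<Omega>. ereal (t * right_deriv \<Phi> t / enn2real (\<Phi> t))) else \<infinity>)"

text \<open>The Luxemburg quasi-norm is defined for \<open>[0,\<infinity>]\<close>-valued functions, so that it can be iterated;
  the argument \<open>\<infinity>\<close> is given the value \<open>\<Phi>(\<infinity>) = \<infinity>\<close>, the limit of \<open>\<Phi>\<close> at infinity.\<close>

definition orlicz_norm :: "(real \<Rightarrow> ennreal) \<Rightarrow> ('a::euclidean_space \<Rightarrow> ennreal) \<Rightarrow> ennreal" where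
  "orlicz_norm \<Phi> g =
     (let \<Phi>' = (\<lambda>t. if t = \<infinity> then \<infinity> else \<Phi> (enn2real t))
      in INF l\<in>{l::real. 0 < l \<and> (\<integral>\<^sup>+x. \<Phi>' (g x / ennreal l) \<partial>lebesgue) \<le> 1}. ennreal l)"

definition lnorm :: "(real \<Rightarrow> ennreal) \<Rightarrow> ('a::euclidean_space \<Rightarrow> complex) \<Rightarrow> ennreal" where
  "lnorm \<Phi> f = orlicz_norm \<Phi> (\<lambda>x. ennreal (norm (f x)))"

text \<open>Spaces are sets of functions, not of classes of functions modulo null sets.\<close>

definition orlicz_space :: "(real \<Rightarrow> ennreal) \<Rightarrow> ('a::euclidean_space \<Rightarrow> complex) set" where
  "orlicz_space \<Phi> = {f \<in> borel_measurable lebesgue. lnorm \<Phi> f < \<infinity>}"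

definition mixed_norm ::
    "(real \<Rightarrow> ennreal) \<Rightarrow> (real \<Rightarrow> ennreal) \<Rightarrow> ((real^'n) \<times> (real^'n) \<Rightarrow> complex) \<Rightarrow> ennreal" where
  "mixed_norm \<Phi> \<Psi> F = orlicz_norm \<Psi> (\<lambda>\<xi>. lnorm \<Phi> (\<lambda>x. F (x, \<xi>)))"

definition mixed_space ::
    "(real \<Rightarrow> ennreal) \<Rightarrow> (real \<Rightarrow> ennreal) \<Rightarrow> ((real^'n) \<times> (real^'n) \<Rightarrow> complex) set" where
  "mixed_space \<Phi> \<Psi> = {F \<in> borel_measurable lebesgue. mixed_norm \<Phi> \<Psi> F < \<infinity>}"


section \<open>Schwartz functions and tempered distributions\<close>

definition partial_deriv :: "'n \<Rightarrow> (real^'n \<Rightarrow> complex) \<Rightarrow> real^'n \<Rightarrow> complex" where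
  "partial_deriv i f x = frechet_derivative f (at x) (axis i 1)"

text \<open>Iterated partial derivatives are indexed by lists of coordinates instead of multi-indices.\<close>

definition partial_derivs :: "'n list \<Rightarrow> (real^'n \<Rightarrow> complex) \<Rightarrow> real^'n \<Rightarrow> complex" where
  "partial_derivs is f = foldr partial_deriv is f"

definition smooth :: "(real^'n \<Rightarrow> complex) \<Rightarrow> bool" where
  "smooth f \<longleftrightarrow> (\<forall>is x. partial_derivs is f differentiable (at x))"

definition test_function :: "(real^'n \<Rightarrow> complex) \<Rightarrow> bool" where
  "test_function f \<longleftrightarrow> smooth f \<and> compact (closure {x. f x \<noteq> 0})"

definition schwartz :: "(real^'n \<Rightarrow> complex) \<Rightarrow> bool" where
  "schwartz f \<longleftrightarrow>
     smooth f \<and> (\<forall>k is. bdd_above (range (\<lambda>x. norm x ^ k * norm (partial_derivs is f x))))"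

definition schwartz_seminorm :: "nat \<Rightarrow> 'n list \<Rightarrow> (real^'n \<Rightarrow> complex) \<Rightarrow> real" where
  "schwartz_seminorm k is f = (SUP x. norm x ^ k * norm (partial_derivs is f x))"

text \<open>A tempered distribution acts on arbitrary functions, but only its values on Schwartz functions
  matter: two of them are identified if they satisfy \<open>dist_eq\<close>.  The pairing is bilinear.\<close>

type_synonym 'n dist = "(real^'n \<Rightarrow> complex) \<Rightarrow> complex"

definition tempered :: "'n::finite dist \<Rightarrow> bool" where
  "tempered u \<longleftrightarrow>
     (\<forall>\<psi> \<eta>. schwartz \<psi> \<and> schwartz \<eta> \<longrightarrow> u (\<lambda>x. \<psi> x + \<eta> x) = u \<psi> + u \<eta>) \<and>
     (\<forall>c \<psi>. schwartz \<psi> \<longrightarrow> u (\<lambda>x. c * \<psi> x) = c * u \<psi>) \<and>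
     (\<exists>C N. \<forall>\<psi>. schwartz \<psi> \<longrightarrow>
        norm (u \<psi>) \<le> C * (\<Sum>k\<le>N. \<Sum>is | length is \<le> N. schwartz_seminorm k is \<psi>))"

definition dist_eq :: "'n::finite dist \<Rightarrow> 'n dist \<Rightarrow> bool" where
  "dist_eq u v \<longleftrightarrow> (\<forall>\<psi>. schwartz \<psi> \<longrightarrow> u \<psi> = v \<psi>)"

text \<open>The distribution \<open>u\<close> is given by the function \<open>h\<close>, which is necessarily locally integrable.\<close>

definition represents :: "(real^'n \<Rightarrow> complex) \<Rightarrow> 'n::finite dist \<Rightarrow> bool" where
  "represents h u \<longleftrightarrow> h \<in> borel_measurable lebesgue \<and>
     (\<forall>\<psi>. test_function \<psi> \<longrightarrow>
        integrable lebesgue (\<lambda>x. h x * \<psi> x) \<and> u \<psi> = (LINT x|lebesgue. h x * \<psi> x))"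


section \<open>Fourier transform and short-time Fourier transform\<close>

definition ft_const :: "'n::finite itself \<Rightarrow> complex" where
  "ft_const _ = complex_of_real ((2 * pi) powr (- (real CARD('n) / 2)))"

definition fourier :: "(real^'n \<Rightarrow> complex) \<Rightarrow> real^'n \<Rightarrow> complex" where
  "fourier f \<xi> = ft_const TYPE('n) * (LINT x|lebesgue. f x * exp (- \<i> * complex_of_real (x \<bullet> \<xi>)))"

definition inv_fourier :: "(real^'n \<Rightarrow> complex) \<Rightarrow> real^'n \<Rightarrow> complex" where
  "inv_fourier f x = ft_const TYPE('n) * (LINT \<xi>|lebesgue. f \<xi> * exp (\<i> * complex_of_real (x \<bullet> \<xi>)))"

definition dist_fourier :: "'n::finite dist \<Rightarrow> 'n dist" where
  "dist_fourier u = (\<lambda>\<psi>. u (fourier \<psi>))"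

definition dist_inv_fourier :: "'n::finite dist \<Rightarrow> 'n dist" where
  "dist_inv_fourier u = (\<lambda>\<psi>. u (inv_fourier \<psi>))"

definition dist_times :: "'n::finite dist \<Rightarrow> (real^'n \<Rightarrow> complex) \<Rightarrow> 'n dist" where
  "dist_times u a = (\<lambda>\<psi>. u (\<lambda>x. a x * \<psi> x))"

definition window :: "(real^'n \<Rightarrow> complex) \<Rightarrow> bool" where
  "window \<phi> \<longleftrightarrow> schwartz \<phi> \<and> (\<exists>x. \<phi> x \<noteq> 0)"

definition stft :: "(real^'n \<Rightarrow> complex) \<Rightarrow> 'n::finite dist \<Rightarrow> (real^'n) \<times> (real^'n) \<Rightarrow> complex" where
  "stft \<phi> f = (\<lambda>(x, \<xi>). ft_const TYPE('n) *
     f (\<lambda>y. cnj (\<phi> (y - x)) * exp (- \<i> * complex_of_real (y \<bullet> \<xi>))))"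

text \<open>In the second form of the transform the distribution is translated, \<open>f(\<cdot> + x)\<close>, which
  amounts to translating the function it is applied to in the opposite direction.\<close>

definition stft' :: "(real^'n \<Rightarrow> complex) \<Rightarrow> 'n::finite dist \<Rightarrow> (real^'n) \<times> (real^'n) \<Rightarrow> complex" where
  "stft' \<phi> f = (\<lambda>(x, \<xi>). ft_const TYPE('n) *
     f (\<lambda>y. cnj (\<phi> (y - x)) * exp (- \<i> * complex_of_real ((y - x) \<bullet> \<xi>))))"

definition modulation_norm ::
    "(real^'n \<Rightarrow> complex) \<Rightarrow> (real \<Rightarrow> ennreal) \<Rightarrow> (real \<Rightarrow> ennreal) \<Rightarrow> 'n::finite dist \<Rightarrow> ennreal" where
  "modulation_norm \<phi> \<Phi> \<Psi> f = mixed_norm \<Phi> \<Psi> (stft \<phi> f)"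

definition modulation_space ::
    "(real^'n \<Rightarrow> complex) \<Rightarrow> (real \<Rightarrow> ennreal) \<Rightarrow> (real \<Rightarrow> ennreal) \<Rightarrow> 'n::finite dist set" where
  "modulation_space \<phi> \<Phi> \<Psi> = {f. tempered f \<and> stft \<phi> f \<in> mixed_space \<Phi> \<Psi>}"


section \<open>Fourier multipliers\<close>

definition multiplier :: "'n::finite dist \<Rightarrow> (real^'n \<Rightarrow> complex) \<Rightarrow> 'n dist" where
  "multiplier m f = dist_inv_fourier (dist_times m (fourier f))"

text \<open>\<open>times_hat m g q\<close>: for a function \<open>g\<close>, the product of the tempered distributions \<open>m\<close> and
  \<open>\<F>g\<close> is well defined, and it is \<open>q\<close>.  For Schwartz functions \<open>\<psi>\<close>, the distribution
  \<open>\<F>(m\<psi>)\<close> is given by a function \<open>w\<close>, and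
  \<open>\<langle>m \<F>g, \<psi>\<rangle> = \<langle>\<F>g, m\<psi>\<rangle> = \<langle>g, \<F>(m\<psi>)\<rangle> = \<integral> g w\<close>;
  the product is well defined if these integrals converge absolutely and give a tempered
  distribution.\<close>

definition times_hat :: "'n::finite dist \<Rightarrow> (real^'n \<Rightarrow> complex) \<Rightarrow> 'n dist \<Rightarrow> bool" where
  "times_hat m g q \<longleftrightarrow> tempered q \<and>
     (\<forall>\<psi>. schwartz \<psi> \<longrightarrow>
        (\<exists>w. represents w (dist_fourier (dist_times m \<psi>)) \<and>
             integrable lebesgue (\<lambda>x. g x * w x) \<and>
             q \<psi> = (LINT x|lebesgue. g x * w x)))"

text \<open>\<open>orlicz_multiplier m \<Phi>\<^sub>1 \<Phi>\<^sub>2 g h\<close> expresses that \<open>m(D)g\<close> is defined for \<open>g \<in> L\<^bsup>\<Phi>\<^sub>1\<^esup>\<close>, belongs to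
  \<open>L\<^bsup>\<Phi>\<^sub>2\<^esup>\<close>, and equals \<open>h\<close> almost everywhere.  In the first case this is the extension by
  continuity from test functions: along \<^emph>\<open>every\<close> approximating sequence the images tend to \<open>h\<close>.
  (With a constant sequence this includes that the distribution \<open>m(D)f\<close> is a function in \<open>L\<^bsup>\<Phi>\<^sub>2\<^esup>\<close>
  for each test function \<open>f\<close>.)\<close>

definition orlicz_multiplier ::
    "'n::finite dist \<Rightarrow> (real \<Rightarrow> ennreal) \<Rightarrow> (real \<Rightarrow> ennreal) \<Rightarrow>
     (real^'n \<Rightarrow> complex) \<Rightarrow> (real^'n \<Rightarrow> complex) \<Rightarrow> bool" where
  "orlicz_multiplier m \<Phi>\<^sub>1 \<Phi>\<^sub>2 g h \<longleftrightarrow> g \<in> orlicz_space \<Phi>\<^sub>1 \<and> h \<in> orlicz_space \<Phi>\<^sub>2 \<and>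
     (if upper_index \<Phi>\<^sub>1 < \<infinity> then
        (\<forall>f. (\<forall>n::nat. test_function (f n)) \<and> (\<lambda>n. lnorm \<Phi>\<^sub>1 (\<lambda>x. f n x - g x)) \<longlonglongrightarrow> 0 \<longrightarrow>
           (\<exists>k. (\<forall>n. k n \<in> orlicz_space \<Phi>\<^sub>2 \<and> represents (k n) (multiplier m (f n))) \<and>
                (\<lambda>n. lnorm \<Phi>\<^sub>2 (\<lambda>x. k n x - h x)) \<longlonglongrightarrow> 0))
      else
        (\<exists>q. times_hat m g q \<and> represents h (dist_inv_fourier q)))"

definition orlicz_multiplier_bounded ::
    "'n::finite dist \<Rightarrow> (real \<Rightarrow> ennreal) \<Rightarrow> (real \<Rightarrow> ennreal) \<Rightarrow> bool" where
  "orlicz_multiplier_bounded m \<Phi>\<^sub>1 \<Phi>\<^sub>2 \<longleftrightarrow>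
     (\<exists>C::real. 0 < C \<and> (\<forall>g\<in>orlicz_space \<Phi>\<^sub>1. \<exists>h.
        orlicz_multiplier m \<Phi>\<^sub>1 \<Phi>\<^sub>2 g h \<and> lnorm \<Phi>\<^sub>2 h \<le> ennreal C * lnorm \<Phi>\<^sub>1 g))"

text \<open>\<open>u\<close> is the tempered distribution \<open>m(D)f\<close> for \<open>f\<close> in a modulation space.\<close>

definition modulation_multiplier ::
    "'n::finite dist \<Rightarrow> (real \<Rightarrow> ennreal) \<Rightarrow> (real \<Rightarrow> ennreal) \<Rightarrow> 'n dist \<Rightarrow> 'n dist \<Rightarrow> bool" where
  "modulation_multiplier m \<Phi>\<^sub>1 \<Phi>\<^sub>2 f u \<longleftrightarrow> tempered u \<and>
     (\<forall>\<phi>. window \<phi> \<longrightarrow>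
        (AE \<xi> in lebesgue.
           orlicz_multiplier m \<Phi>\<^sub>1 \<Phi>\<^sub>2 (\<lambda>x. stft' \<phi> f (x, \<xi>)) (\<lambda>x. stft' \<phi> u (x, \<xi>))))"

text \<open>Boundedness on the modulation spaces defined by the window \<open>\<phi>\<close>; existence and
  uniqueness of \<open>m(D)f\<close> are part of it.\<close>

definition modulation_multiplier_bounded ::
    "(real^'n \<Rightarrow> complex) \<Rightarrow> 'n::finite dist \<Rightarrow>
     (real \<Rightarrow> ennreal) \<Rightarrow> (real \<Rightarrow> ennreal) \<Rightarrow> (real \<Rightarrow> ennreal) \<Rightarrow> bool" where
  "modulation_multiplier_bounded \<phi> m \<Phi>\<^sub>1 \<Phi>\<^sub>2 \<Psi> \<longleftrightarrow>
     (\<exists>C::real. 0 < C \<and> (\<forall>f\<in>modulation_space \<phi> \<Phi>\<^sub>1 \<Psi>. \<exists>u\<in>modulation_space \<phi> \<Phi>\<^sub>2 \<Psi>.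
        modulation_multiplier m \<Phi>\<^sub>1 \<Phi>\<^sub>2 f u \<and>
        (\<forall>v. modulation_multiplier m \<Phi>\<^sub>1 \<Phi>\<^sub>2 f v \<longrightarrow> dist_eq v u) \<and>
        modulation_norm \<phi> \<Phi>\<^sub>2 \<Psi> u \<le> ennreal C * modulation_norm \<phi> \<Phi>\<^sub>1 \<Psi> f))"

end

theory Submission
  imports Defs
begin

text \<open>
  Convolution with a Schwartz function \<open>\<psi>\<close> commutes with \<open>m(D)\<close>, and the slices
  \<open>V\<^sub>\<phi> f(\<cdot>, \<xi>)\<close> of the short-time Fourier transform are, up to a unimodular factor, convolutions of \<open>f\<close>
  with Schwartz functions.  So \<open>m(D)f\<close> has to be the tempered distribution \<open>U\<close> with
  \<open>U * \<psi> = m(D)(f * \<psi>)\<close> for all \<open>\<psi>\<close>, where the right-hand side is the multiplier on the Orlicz space.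
  Once \<open>U\<close> exists, the hypothesis bounds the \<open>L\<^bsup>\<Phi>\<^sub>2\<^esup>\<close> quasi-norm of \<open>V\<^sub>\<phi> U(\<cdot>, \<xi>)\<close> by that of
  \<open>V\<^sub>\<phi> f(\<cdot>, \<xi>)\<close> for each \<open>\<xi>\<close>, with a constant independent of \<open>\<xi>\<close>, and the estimate in the
  modulation space follows because \<open>L\<^bsup>\<Psi>\<^esup>\<close> is monotone.  Uniqueness holds because a distribution is
  determined by its short-time Fourier transforms, which are continuous (\<open>modulation_multiplier_unique\<close>).

  What has to be proved is that \<open>f * \<psi>\<close> belongs to \<open>L\<^bsup>\<Phi>\<^sub>1\<^esup>\<close> and that \<open>U\<close> exists.  Schwartz functions
  need not be dense in the modulation space, so \<open>U\<close> is constructed as a weak limit.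

  By the reproducing formula of the short-time Fourier transform, the values of
  \<open>V = V\<^sub>\<phi> f\<close> satisfy a mean value property in phase space: \<open>\<bar>V Z\<bar>\<^sup>r\<close> is dominated by a weighted integral
  of \<open>\<bar>V Y\<bar>\<^sup>r\<close> over \<open>Y\<close>, for every \<open>r \<le> 1\<close> (\<open>tempered_peetre\<close>).  For \<open>r\<close> so small that
  \<open>\<Phi>\<^sub>1\<close>, \<open>\<Phi>\<^sub>2\<close>, \<open>\<Psi>\<close> are all convex functions of \<open>t\<^sup>r\<close>, Jensen's inequality turns this into a bound
  \<open>\<bar>V Y\<bar> \<le> E x (1 + \<bar>(x, 0) - Y\<bar>)\<^sup>L\<close> for all \<open>x\<close> and \<open>Y\<close>, with \<open>E\<close> in \<open>L\<^bsup>\<Phi>\<^sub>1\<^esup>\<close> (\<open>orlicz_envelope\<close>).  The same bound, up to a constant,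
  holds for all other windows, whence \<open>f * \<psi>\<close> is dominated by a multiple of \<open>E\<close>; it also holds,
  uniformly, for Schwartz functions \<open>g\<^sub>n\<close> that converge to \<open>f\<close> weakly (\<open>envelope_approximation\<close>).

  Applied to the convolutions of \<open>g\<^sub>n\<close> with the atoms of the short-time Fourier transform, the hypothesis
  bounds the slices of \<open>V\<^sub>\<phi>(m(D)g\<^sub>n)\<close> in \<open>L\<^bsup>\<Phi>\<^sub>2\<^esup>\<close>, polynomially in the frequency.  The mean value property now
  yields pointwise bounds, so that the distributions \<open>m(D)g\<^sub>n\<close> are uniformly tempered
  (\<open>multiplier_uniformly_tempered\<close>).  Finally \<open>m(D)(g\<^sub>n * \<psi>)\<close> converges weakly to \<open>m(D)(f * \<psi>)\<close>, since \<open>g\<^sub>n * \<psi>\<close> tends to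
  \<open>f * \<psi>\<close> pointwise with the majorant \<open>E\<close> (\<open>schwartz_multiplier_limit\<close>).  With the uniform bounds this
  gives the limit \<open>U\<close> of \<open>m(D)g\<^sub>n\<close> and its characteristic property (\<open>multiplier_image\<close>).

  Schwartz seminorms, Fourier inversion and the fundamental properties of tempered distributions are
  developed on the way.  Phase space points are pairs \<open>X = (x, \<xi>)\<close>, and every short-time Fourier transform is
  expressed by \<open>u (tf \<theta> X)\<close>, the pairing of a distribution with a time-frequency shift.
\<close>

type_synonym 'n cfun = "real^'n \<Rightarrow> complex"
type_synonym 'n phase = "(real^'n) \<times> (real^'n)"

section \<open>Iterated partial derivatives\<close>

lemma partial_derivs_Nil [simp]: "partial_derivs [] f = f"
  by (simp add: partial_derivs_def)

lemma partial_derivs_Cons: "partial_derivs (i # is) f = partial_deriv i (partial_derivs is f)"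
  by (simp add: partial_derivs_def)

lemma partial_derivs_append: "partial_derivs (is @ js) f = partial_derivs is (partial_derivs js f)"
  by (simp add: partial_derivs_def)

lemma partial_derivs_snoc: "partial_derivs (is @ [i]) f = partial_derivs is (partial_deriv i f)"
  by (simp add: partial_derivs_append partial_derivs_Cons)

lemma smooth_differentiable: "smooth f \<Longrightarrow> f differentiable (at x)"
  unfolding smooth_def by (metis partial_derivs_Nil)

lemma smooth_partial_derivs: "smooth f \<Longrightarrow> smooth (partial_derivs js f)"
  unfolding smooth_def by (metis partial_derivs_append)

lemma smooth_partial_deriv: "smooth f \<Longrightarrow> smooth (partial_deriv i f)"
  using smooth_partial_derivs[of f "[i]"] by (simp add: partial_derivs_Cons)

text \<open>Smoothness is the largest property that implies differentiability and passes to partial derivatives.\<close>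

lemma smooth_coinduct:
  assumes "P f"
    and D: "\<And>f x. P f \<Longrightarrow> f differentiable (at x)"
    and S: "\<And>f i. P f \<Longrightarrow> P (partial_deriv i f)"
  shows "smooth f"
proof -
  have "P (partial_derivs is f)" for "is"
    by (induction "is") (auto simp: partial_derivs_Cons assms)
  then show ?thesis unfolding smooth_def using D by blast
qed

lemma partial_deriv_eq:
  assumes "(f has_derivative f') (at x)"
  shows "partial_deriv i f x = f' (axis i 1)"
  using frechet_derivative_at[OF assms] by (simp add: partial_deriv_def)

lemma differentiable_has_derivative:
  fixes f :: "'n::finite cfun"
  assumes "f differentiable (at x)"
  shows "(f has_derivative (\<lambda>h. \<Sum>i\<in>UNIV. (h $ i) *\<^sub>R partial_deriv i f x)) (at x)"
proof -
  let ?D = "frechet_derivative f (at x)"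
  have D: "(f has_derivative ?D) (at x)" using assms frechet_derivative_works by blast
  then have lin: "linear ?D" by (rule has_derivative_linear)
  have "?D h = (\<Sum>i\<in>UNIV. (h $ i) *\<^sub>R partial_deriv i f x)" for h
  proof -
    have "?D h = ?D (\<Sum>i\<in>UNIV. h $ i *\<^sub>R axis i 1)"
      using basis_expansion[of h] by (simp add: scalar_mult_eq_scaleR)
    also have "\<dots> = (\<Sum>i\<in>UNIV. (h $ i) *\<^sub>R partial_deriv i f x)"
      unfolding linear_sum[OF lin] partial_deriv_def by (simp add: linear_cmul[OF lin])
    finally show ?thesis .
  qed
  then have "?D = (\<lambda>h. \<Sum>i\<in>UNIV. (h $ i) *\<^sub>R partial_deriv i f x)" by blast
  then show ?thesis using D by metis
qed

lemmas smooth_has_derivative = differentiable_has_derivative[OF smooth_differentiable]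

lemma smooth_continuous: "smooth f \<Longrightarrow> continuous_on S f"
  by (meson continuous_at_imp_continuous_on differentiable_imp_continuous_within smooth_differentiable)

lemma smooth_isCont: "smooth f \<Longrightarrow> isCont f x"
  by (meson differentiable_imp_continuous_within smooth_differentiable)

lemma smooth_borel: "smooth f \<Longrightarrow> f \<in> borel_measurable borel"
  by (intro borel_measurable_continuous_onI smooth_continuous)

lemma partial_deriv_add:
  assumes "f differentiable (at x)" "g differentiable (at x)"
  shows "partial_deriv i (\<lambda>t. f t + g t) x = partial_deriv i f x + partial_deriv i g x"
  using partial_deriv_eq[OF has_derivative_add[OF assms[unfolded frechet_derivative_works]]]
  by (simp add: partial_deriv_def)

lemma partial_deriv_mult:
  assumes "f differentiable (at x)" "g differentiable (at x)"
  shows "partial_deriv i (\<lambda>t. f t * g t) x = partial_deriv i f x * g x + f x * partial_deriv i g x"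
  using partial_deriv_eq[OF has_derivative_mult[OF assms[unfolded frechet_derivative_works]]]
  by (simp add: partial_deriv_def)

lemma partial_deriv_const: "partial_deriv i (\<lambda>t. c) = (\<lambda>t. 0)"
  using partial_deriv_eq[OF has_derivative_const] by fastforce

lemma partial_deriv_cmult:
  assumes "f differentiable (at x)"
  shows "partial_deriv i (\<lambda>t. c * f t) x = c * partial_deriv i f x"
  using partial_deriv_mult[of "\<lambda>_. c" x f i] assms by (simp add: partial_deriv_const)

lemma partial_deriv_cnj:
  assumes "f differentiable (at x)"
  shows "partial_deriv i (\<lambda>t. cnj (f t)) x = cnj (partial_deriv i f x)"
  using partial_deriv_eq[OF has_derivative_cnj[OF assms[unfolded frechet_derivative_works]]]
  by (simp add: partial_deriv_def)

lemma partial_deriv_affine: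
  fixes f :: "'n::finite cfun" and s :: real
  assumes "f differentiable (at (s *\<^sub>R x + b))"
  shows "(\<lambda>t. f (s *\<^sub>R t + b)) differentiable (at x)"
    and "partial_deriv i (\<lambda>t. f (s *\<^sub>R t + b)) x = of_real s * partial_deriv i f (s *\<^sub>R x + b)"
proof -
  have 1: "((\<lambda>t. s *\<^sub>R t + b) has_derivative (\<lambda>h. s *\<^sub>R h)) (at x)"
    by (auto intro!: derivative_eq_intros)
  have 2: "(f has_derivative (\<lambda>h. \<Sum>i\<in>UNIV. (h $ i) *\<^sub>R partial_deriv i f (s *\<^sub>R x + b)))
      (at (s *\<^sub>R x + b))"
    by (rule differentiable_has_derivative[OF assms])
  have 3: "((\<lambda>t. f (s *\<^sub>R t + b)) has_derivative
      (\<lambda>h. \<Sum>i\<in>UNIV. ((s *\<^sub>R h) $ i) *\<^sub>R partial_deriv i f (s *\<^sub>R x + b))) (at x)"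
    using has_derivative_compose[OF 1 2] .
  then show "(\<lambda>t. f (s *\<^sub>R t + b)) differentiable (at x)"
    unfolding differentiable_def by blast
  show "partial_deriv i (\<lambda>t. f (s *\<^sub>R t + b)) x = of_real s * partial_deriv i f (s *\<^sub>R x + b)"
    unfolding partial_deriv_eq[OF 3]
    by (subst sum.remove[of _ i]) (auto simp: axis_def scaleR_conv_of_real[where 'a=complex] intro!: sum.neutral)
qed

lemma smooth_const: "smooth (\<lambda>t. c)"
proof (rule smooth_coinduct[where P="\<lambda>f. \<exists>c. f = (\<lambda>t. c)"])
qed (auto simp: partial_deriv_const)

text \<open>The Leibniz rule keeps derivatives within the algebra generated by a class of functions; so smoothness of
  sums and products, and of the bump functions below, only has to be seen on generators.\<close>

inductive generated :: "('n::finite cfun \<Rightarrow> bool) \<Rightarrow> 'n cfun \<Rightarrow> bool" for B where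
  base: "B f \<Longrightarrow> generated B f"
| add: "generated B f \<Longrightarrow> generated B g \<Longrightarrow> generated B (\<lambda>t. f t + g t)"
| mult: "generated B f \<Longrightarrow> generated B g \<Longrightarrow> generated B (\<lambda>t. f t * g t)"

lemma generated_smooth:
  assumes "generated B f"
    and D: "\<And>f x. B f \<Longrightarrow> f differentiable (at x)"
    and S: "\<And>f i. B f \<Longrightarrow> generated B (partial_deriv i f)"
  shows "smooth f"
proof (rule smooth_coinduct[where P="generated B"])
  show dif: "f differentiable (at x)" if "generated B f" for f x
    using that by (induction rule: generated.induct) (auto intro: D derivative_intros)
  show "generated B (partial_deriv i f)" if "generated B f" for f i
    using that
  proof (induction rule: generated.induct)
    case (base f)
    then show ?case by (rule S)
  next
    case (add f g)
    have "partial_deriv i (\<lambda>t. f t + g t) = (\<lambda>t. partial_deriv i f t + partial_deriv i g t)"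
      by (rule ext, rule partial_deriv_add) (use dif add in auto)
    then show ?case using generated.add[OF add.IH] by simp
  next
    case (mult f g)
    have "partial_deriv i (\<lambda>t. f t * g t) = (\<lambda>t. partial_deriv i f t * g t + f t * partial_deriv i g t)"
      by (rule ext, rule partial_deriv_mult) (use dif mult in auto)
    then show ?case
      using generated.add[OF generated.mult[OF mult.IH(1) mult.hyps(2)]
        generated.mult[OF mult.hyps(1) mult.IH(2)]] by simp
  qed
qed (rule assms)

lemma smooth_add: "smooth f \<Longrightarrow> smooth g \<Longrightarrow> smooth (\<lambda>t. f t + g t)"
  by (rule generated_smooth[where B=smooth])
     (auto intro: generated.intros smooth_partial_deriv smooth_differentiable)

lemma smooth_mult: "smooth f \<Longrightarrow> smooth g \<Longrightarrow> smooth (\<lambda>t. f t * g t)"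
  by (rule generated_smooth[where B=smooth])
     (auto intro: generated.intros smooth_partial_deriv smooth_differentiable)

lemma smooth_cmult: "smooth f \<Longrightarrow> smooth (\<lambda>t. c * f t)"
  by (rule smooth_mult[OF smooth_const])

lemma smooth_diff: "smooth f \<Longrightarrow> smooth g \<Longrightarrow> smooth (\<lambda>t. f t - g t)"
  using smooth_add[OF _ smooth_cmult[of g "-1"], of f] by simp

lemma partial_derivs_add:
  assumes "smooth f" "smooth g"
  shows "partial_derivs is (\<lambda>t. f t + g t) = (\<lambda>t. partial_derivs is f t + partial_derivs is g t)"
  by (induction "is")
     (auto simp: partial_derivs_Cons intro!: ext partial_deriv_add smooth_differentiable
        smooth_partial_derivs assms)

lemma partial_derivs_cmult:
  assumes "smooth f"
  shows "partial_derivs is (\<lambda>t. c * f t) = (\<lambda>t. c * partial_derivs is f t)"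
  by (induction "is")
     (auto simp: partial_derivs_Cons intro!: ext partial_deriv_cmult smooth_differentiable
        smooth_partial_derivs assms)

lemma partial_derivs_diff:
  assumes "smooth f" "smooth g"
  shows "partial_derivs is (\<lambda>t. f t - g t) = (\<lambda>t. partial_derivs is f t - partial_derivs is g t)"
  using partial_derivs_add[OF assms(1) smooth_cmult[OF assms(2), of "-1"], of "is"]
  unfolding partial_derivs_cmult[OF assms(2)] by simp

lemma partial_derivs_cnj:
  assumes "smooth f"
  shows "partial_derivs is (\<lambda>t. cnj (f t)) = (\<lambda>t. cnj (partial_derivs is f t))"
  by (induction "is")
     (auto simp: partial_derivs_Cons intro!: ext partial_deriv_cnj smooth_differentiable
        smooth_partial_derivs assms)

lemma smooth_cnj:
  assumes "smooth f"
  shows "smooth (\<lambda>t. cnj (f t))"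
  unfolding smooth_def partial_derivs_cnj[OF assms]
  using assms has_derivative_cnj unfolding smooth_def differentiable_def by blast

lemma partial_derivs_affine:
  fixes f :: "'n::finite cfun" and s :: real
  assumes "smooth f"
  shows "partial_derivs is (\<lambda>t. f (s *\<^sub>R t + b)) =
    (\<lambda>t. of_real s ^ length is * partial_derivs is f (s *\<^sub>R t + b))"
proof (induction "is")
  case Nil
  then show ?case by simp
next
  case (Cons i "is")
  have d: "partial_derivs is f differentiable (at y)" for y
    by (intro smooth_differentiable smooth_partial_derivs assms)
  show ?case
    unfolding partial_derivs_Cons Cons.IH
    by (simp add: fun_eq_iff partial_deriv_cmult partial_deriv_affine[OF d])
qed

lemma smooth_affine:
  fixes f :: "'n::finite cfun" and s :: real
  assumes "smooth f"
  shows "smooth (\<lambda>t. f (s *\<^sub>R t + b))"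
proof -
  have "partial_derivs is f differentiable (at y)" for y "is"
    by (intro smooth_differentiable smooth_partial_derivs assms)
  then show ?thesis
    unfolding smooth_def partial_derivs_affine[OF assms]
    using partial_deriv_affine(1) by (intro allI differentiable_mult differentiable_const) blast
qed

section \<open>Jets\<close>

text \<open>All derivatives up to order \<open>N\<close> at one point.  Words in the coordinates are counted with multiplicity,
  which affects only constants.\<close>

definition jet :: "nat \<Rightarrow> 'n::finite cfun \<Rightarrow> real^'n \<Rightarrow> real" where
  "jet N f t = (\<Sum>is | length is \<le> N. norm (partial_derivs is f t))"

lemma finite_words: "finite {is::'n::finite list. length is \<le> N}"
  using finite_lists_length_le[of "UNIV::'n set" N] by simp

lemma partial_derivs_le_jet: "length is \<le> N \<Longrightarrow> norm (partial_derivs is f t) \<le> jet N f t"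
  unfolding jet_def by (rule member_le_sum[of "is"]) (auto simp: finite_words)

lemma norm_le_jet: "norm (f t) \<le> jet N f t"
  using partial_derivs_le_jet[of "[]" N f t] by simp

lemma jet_nonneg [simp]: "0 \<le> jet N f t"
  unfolding jet_def by (rule sum_nonneg) simp

lemma jet_mono: "M \<le> N \<Longrightarrow> jet M f t \<le> jet N f t"
  unfolding jet_def by (rule sum_mono2) (auto simp: finite_words)

lemma jet_0 [simp]: "jet 0 f t = norm (f t)"
  by (simp add: jet_def)

lemma jet_partial_deriv: "jet N (partial_deriv i f) t \<le> jet (Suc N) f t"
proof -
  have "jet N (partial_deriv i f) t = (\<Sum>is\<in>(\<lambda>is. is @ [i]) ` {is. length is \<le> N}. norm (partial_derivs is f t))"
    by (subst sum.reindex) (auto simp: inj_on_def jet_def partial_derivs_snoc)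
  also have "\<dots> \<le> jet (Suc N) f t"
    unfolding jet_def by (rule sum_mono2) (auto simp: finite_words)
  finally show ?thesis .
qed

lemma jet_leI:
  fixes f :: "'n::finite cfun"
  assumes "\<And>is. length is \<le> N \<Longrightarrow> norm (partial_derivs is f t) \<le> c"
  shows "jet N f t \<le> real (card {is::'n list. length is \<le> N}) * c"
  unfolding jet_def using sum_bounded_above[of "{is::'n list. length is \<le> N}" "\<lambda>is. norm (partial_derivs is f t)" c] assms by auto

lemma jet_add:
  assumes "smooth f" "smooth g"
  shows "jet N (\<lambda>t. f t + g t) t \<le> jet N f t + jet N g t"
  unfolding jet_def sum.distrib[symmetric] partial_derivs_add[OF assms]
  by (intro sum_mono norm_triangle_ineq)

lemma jet_cmult:
  assumes "smooth f"
  shows "jet N (\<lambda>t. c * f t) t = norm c * jet N f t"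
  unfolding jet_def sum_distrib_left partial_derivs_cmult[OF assms] by (simp add: norm_mult)

lemma jet_cnj:
  assumes "smooth f"
  shows "jet N (\<lambda>t. cnj (f t)) t = jet N f t"
  unfolding jet_def partial_derivs_cnj[OF assms] by simp

lemma jet_affine:
  fixes s :: real
  assumes "smooth f" "\<bar>s\<bar> \<le> 1"
  shows "jet N (\<lambda>t. f (s *\<^sub>R t + b)) t \<le> jet N f (s *\<^sub>R t + b)"
  unfolding jet_def partial_derivs_affine[OF assms(1)]
proof (rule sum_mono)
  fix "is" :: "'a list"
  have "\<bar>s\<bar> ^ length is \<le> 1" using assms(2) by (simp add: power_le_one)
  then show "norm (of_real s ^ length is * partial_derivs is f (s *\<^sub>R t + b)) \<le> norm (partial_derivs is f (s *\<^sub>R t + b))"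
    by (simp add: norm_mult norm_power mult_left_le_one_le)
qed

lemma partial_derivs_mult_le:
  fixes f g :: "'n::finite cfun" and "is" :: "'n list"
  assumes "smooth f" "smooth g"
  shows "norm (partial_derivs is (\<lambda>t. f t * g t) t) \<le> 2 ^ length is * (jet (length is) f t * jet (length is) g t)"
  using assms
proof (induction "is" arbitrary: f g rule: rev_induct)
  case Nil
  then show ?case by (simp add: norm_mult)
next
  case (snoc i "is")
  let ?n = "length is"
  have eq: "partial_deriv i (\<lambda>t. f t * g t) = (\<lambda>t. partial_deriv i f t * g t + f t * partial_deriv i g t)"
    by (rule ext, rule partial_deriv_mult) (use snoc.prems smooth_differentiable in auto)
  have sm: "smooth (partial_deriv i f)" "smooth (partial_deriv i g)"
    using snoc.prems smooth_partial_deriv by auto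
  have "norm (partial_derivs (is @ [i]) (\<lambda>t. f t * g t) t)
     \<le> norm (partial_derivs is (\<lambda>t. partial_deriv i f t * g t) t) + norm (partial_derivs is (\<lambda>t. f t * partial_deriv i g t) t)"
    unfolding partial_derivs_snoc eq
    using partial_derivs_add[OF smooth_mult[OF sm(1) snoc.prems(2)] smooth_mult[OF snoc.prems(1) sm(2)], of "is"]
    by (simp add: norm_triangle_ineq)
  also have "\<dots> \<le> 2 ^ ?n * (jet ?n (partial_deriv i f) t * jet ?n g t) + 2 ^ ?n * (jet ?n f t * jet ?n (partial_deriv i g) t)"
    by (intro add_mono snoc.IH sm snoc.prems)
  also have "\<dots> \<le> 2 ^ ?n * (jet (Suc ?n) f t * jet (Suc ?n) g t) + 2 ^ ?n * (jet (Suc ?n) f t * jet (Suc ?n) g t)"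
    by (intro add_mono mult_left_mono mult_mono jet_partial_deriv jet_mono) auto
  finally show ?case by (simp add: algebra_simps)
qed

definition jet_const :: "'n::finite itself \<Rightarrow> nat \<Rightarrow> real" where
  "jet_const _ N = real (card {is::'n list. length is \<le> N}) * 2 ^ N"

lemma jet_const_nonneg [simp]: "0 \<le> jet_const TYPE('n::finite) N"
  by (simp add: jet_const_def)

lemma jet_mult:
  fixes f g :: "'n::finite cfun"
  assumes "smooth f" "smooth g"
  shows "jet N (\<lambda>t. f t * g t) t \<le> jet_const TYPE('n) N * (jet N f t * jet N g t)"
proof -
  have "jet N (\<lambda>t. f t * g t) t \<le> real (card {is::'n list. length is \<le> N}) * (2 ^ N * (jet N f t * jet N g t))"
  proof (rule jet_leI)
    fix "is" :: "'n list" assume l: "length is \<le> N"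
    have "norm (partial_derivs is (\<lambda>t. f t * g t) t) \<le> 2 ^ length is * (jet (length is) f t * jet (length is) g t)"
      by (rule partial_derivs_mult_le[OF assms])
    also have "\<dots> \<le> 2 ^ N * (jet N f t * jet N g t)"
      by (intro mult_mono jet_mono l power_increasing) auto
    finally show "norm (partial_derivs is (\<lambda>t. f t * g t) t) \<le> 2 ^ N * (jet N f t * jet N g t)" .
  qed
  then show ?thesis by (simp add: jet_const_def mult.assoc)
qed

section \<open>Mean value estimates\<close>

lemma smooth_mean_value:
  fixes f :: "'n::finite cfun"
  assumes sm: "smooth f" and B: "\<And>s. s \<in> closed_segment t (t + h) \<Longrightarrow> jet 1 f s \<le> B"
  shows "norm (f (t + h) - f t) \<le> B * norm h"
proof -
  have "norm (f (t + h) - f t) \<le> B * norm ((t + h) - t)"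
  proof (rule differentiable_bound[OF convex_closed_segment])
    show "(f has_derivative (\<lambda>h. \<Sum>i\<in>UNIV. (h $ i) *\<^sub>R partial_deriv i f s)) (at s within closed_segment t (t + h))" for s
      by (rule has_derivative_at_withinI[OF smooth_has_derivative[OF sm]])
    fix s assume s: "s \<in> closed_segment t (t + h)"
    have "norm (\<Sum>i\<in>UNIV. (k $ i) *\<^sub>R partial_deriv i f s) \<le> B * norm k" for k :: "real^'n"
    proof -
      have "norm (\<Sum>i\<in>UNIV. (k $ i) *\<^sub>R partial_deriv i f s) \<le> (\<Sum>i\<in>UNIV. norm k * norm (partial_deriv i f s))"
        by (rule sum_norm_le) (auto intro!: mult_right_mono simp: component_le_norm_cart)
      also have "\<dots> = norm k * (\<Sum>is\<in>range (\<lambda>i. [i]). norm (partial_derivs is f s))"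
        by (subst sum.reindex) (auto simp: inj_on_def sum_distrib_left partial_derivs_Cons)
      also have "\<dots> \<le> norm k * jet 1 f s"
        unfolding jet_def by (intro mult_left_mono sum_mono2) (auto simp: finite_words)
      also have "\<dots> \<le> norm k * B" by (intro mult_left_mono B s) auto
      finally show ?thesis by (simp add: mult.commute)
    qed
    then show "onorm (\<lambda>h. \<Sum>i\<in>UNIV. (h $ i) *\<^sub>R partial_deriv i f s) \<le> B" by (rule onorm_le)
  qed auto
  then show ?thesis by simp
qed

lemma smooth_taylor2:
  fixes f :: "'n::finite cfun"
  assumes sm: "smooth f" and B: "\<And>s. s \<in> closed_segment t (t + h) \<Longrightarrow> jet 2 f s \<le> B"
  shows "norm (f (t + h) - f t - (\<Sum>i\<in>UNIV. (h $ i) *\<^sub>R partial_deriv i f t)) \<le> real CARD('n) * B * norm h ^ 2"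
proof -
  define L where "L k = (\<Sum>i\<in>UNIV. (k $ i) *\<^sub>R partial_deriv i f t)" for k :: "real^'n"
  have linL: "linear L"
    unfolding L_def by (rule linearI) (auto simp: scaleR_left_distrib sum.distrib scaleR_sum_right)
  have bl: "bounded_linear L" using linL linear_conv_bounded_linear by blast
  have "norm ((\<lambda>s. f s - L s) (t + h) - (\<lambda>s. f s - L s) t) \<le> (real CARD('n) * B * norm h) * norm ((t + h) - t)"
  proof (rule differentiable_bound[OF convex_closed_segment])
    show "((\<lambda>s. f s - L s) has_derivative (\<lambda>h. (\<Sum>i\<in>UNIV. (h $ i) *\<^sub>R partial_deriv i f s) - L h)) (at s within closed_segment t (t + h))" for s
      by (intro has_derivative_diff has_derivative_at_withinI[OF smooth_has_derivative[OF sm]]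
          bounded_linear.has_derivative[OF bl] has_derivative_ident)
    fix s assume s: "s \<in> closed_segment t (t + h)"
    have sh: "closed_segment t s \<subseteq> closed_segment t (t + h)"
      using s by (simp add: subset_closed_segment)
    have ns: "norm (s - t) \<le> norm h"
      using segment_bound1[OF s] by simp
    have d: "norm (partial_deriv i f s - partial_deriv i f t) \<le> B * norm h" for i
    proof -
      have "norm (partial_deriv i f (t + (s - t)) - partial_deriv i f t) \<le> B * norm (s - t)"
      proof (rule smooth_mean_value[OF smooth_partial_deriv[OF sm]])
        fix r assume "r \<in> closed_segment t (t + (s - t))"
        then have "r \<in> closed_segment t (t + h)" using sh by auto
        then show "jet 1 (partial_deriv i f) r \<le> B"
          using B[of r] jet_partial_deriv[of 1 i f r] by (simp add: numeral_2_eq_2)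
      qed
      also have "\<dots> \<le> B * norm h"
        using B[of t] ns order_trans[OF jet_nonneg[of 2 f t] B[of t]] by (intro mult_left_mono) auto
      finally show ?thesis by simp
    qed
    have "norm ((\<Sum>i\<in>UNIV. (k $ i) *\<^sub>R partial_deriv i f s) - L k) \<le> (real CARD('n) * B * norm h) * norm k" for k :: "real^'n"
    proof -
      have "(\<Sum>i\<in>UNIV. (k $ i) *\<^sub>R partial_deriv i f s) - L k = (\<Sum>i\<in>UNIV. (k $ i) *\<^sub>R (partial_deriv i f s - partial_deriv i f t))"
        unfolding L_def by (simp add: scaleR_diff_right sum_subtractf)
      also have "norm \<dots> \<le> (\<Sum>i\<in>(UNIV::'n set). norm k * (B * norm h))"
        by (rule sum_norm_le) (auto intro!: mult_mono d simp: component_le_norm_cart)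
      finally show ?thesis by (simp add: algebra_simps)
    qed
    then show "onorm (\<lambda>h. (\<Sum>i\<in>UNIV. (h $ i) *\<^sub>R partial_deriv i f s) - L h) \<le> real CARD('n) * B * norm h"
      by (rule onorm_le)
  qed auto
  then show ?thesis
    using linear_add[OF linL, of t h] by (simp add: L_def power2_eq_square algebra_simps)
qed

section \<open>Weights\<close>

definition br :: "'a::real_normed_vector \<Rightarrow> real" where
  "br x = 1 + norm x"

lemma br_ge1: "1 \<le> br x" and br_pos [simp]: "0 < br x" and br_nonneg [simp]: "0 \<le> br x"
  and br_neq0 [simp]: "br x \<noteq> 0" and br_0 [simp]: "br 0 = 1" and br_minus [simp]: "br (- x) = br x"
  and norm_le_br: "norm x \<le> br x"
  by (auto simp: br_def add_nonneg_eq_0_iff add_pos_nonneg)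

lemma br_power_ge1: "1 \<le> br x ^ k"
  by (simp add: one_le_power br_ge1)

lemma br_power_mono: "k \<le> l \<Longrightarrow> br x ^ k \<le> br x ^ l"
  by (rule power_increasing[OF _ br_ge1])

lemma br_add: "br (x + y) \<le> br x * br y"
proof -
  have "br x * br y = 1 + norm x + norm y + norm x * norm y" by (simp add: br_def algebra_simps)
  moreover have "0 \<le> norm x * norm y" by (rule mult_nonneg_nonneg) auto
  ultimately show ?thesis using norm_triangle_ineq[of x y] unfolding br_def by linarith
qed

lemma br_add_power: "br (x + y) ^ k \<le> br x ^ k * br y ^ k"
  using power_mono[OF br_add[of x y], of k] by (simp add: power_mult_distrib)

lemma br_diff_power: "br (x - y) ^ k \<le> br x ^ k * br y ^ k"
  using br_add_power[of x "- y" k] by simp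

lemma br_commute: "br (x - y) = br (y - x)"
  by (simp add: br_def norm_minus_commute)

lemma br_power_le: "br x ^ k \<le> 2 ^ k * (1 + norm x ^ k)"
proof -
  have "br x \<le> 2 * max 1 (norm x)" by (simp add: br_def)
  then have "br x ^ k \<le> (2 * max 1 (norm x)) ^ k" by (rule power_mono) simp
  also have "\<dots> \<le> 2 ^ k * (1 + norm x ^ k)"
    by (simp add: power_mult_distrib max_def)
  finally show ?thesis .
qed

lemma br_fst: "br (fst X) \<le> br X" and br_snd: "br (snd X) \<le> br X"
  using norm_fst_le[of "fst X" "snd X"] norm_snd_le[of "snd X" "fst X"] by (auto simp: br_def)

lemma br_borel [measurable]: "br \<in> borel_measurable borel"
  unfolding br_def by measurable

section \<open>Schwartz seminorms\<close>

definition sn :: "nat \<Rightarrow> nat \<Rightarrow> 'n::finite cfun \<Rightarrow> real" where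
  "sn k N f = (SUP t. br t ^ k * jet N f t)"

lemma schwartz_smooth: "schwartz f \<Longrightarrow> smooth f"
  by (simp add: schwartz_def)

lemma schwartz_bdd:
  fixes f :: "'n::finite cfun"
  assumes "schwartz f"
  shows "bdd_above (range (\<lambda>t. br t ^ k * jet N f t))"
proof -
  have "\<exists>c. \<forall>t. norm t ^ l * norm (partial_derivs is f t) \<le> c" for l "is"
    using assms unfolding schwartz_def bdd_above_def by (auto simp: image_iff)
  then obtain c where c: "\<And>l is t. norm t ^ l * norm (partial_derivs is f t) \<le> c l is" by metis
  have "br t ^ k * jet N f t \<le> (\<Sum>is | length is \<le> N. 2 ^ k * (c 0 is + c k is))" for t
    unfolding jet_def sum_distrib_left
  proof (rule sum_mono)
    fix "is" :: "'n list"
    have "br t ^ k * norm (partial_derivs is f t) \<le> (2 ^ k * (1 + norm t ^ k)) * norm (partial_derivs is f t)"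
      by (intro mult_right_mono br_power_le) auto
    also have "\<dots> = 2 ^ k * (norm t ^ 0 * norm (partial_derivs is f t) + norm t ^ k * norm (partial_derivs is f t))"
      by (simp add: algebra_simps)
    also have "\<dots> \<le> 2 ^ k * (c 0 is + c k is)" by (intro mult_left_mono add_mono c) auto
    finally show "br t ^ k * norm (partial_derivs is f t) \<le> 2 ^ k * (c 0 is + c k is)" .
  qed
  then show ?thesis by (rule bdd_aboveI2)
qed

lemma sn_bound: "schwartz f \<Longrightarrow> br t ^ k * jet N f t \<le> sn k N f"
  unfolding sn_def by (rule cSUP_upper[OF UNIV_I schwartz_bdd])

lemma jet_le_sn: "schwartz f \<Longrightarrow> jet N f t \<le> sn k N f / br t ^ k"
  using sn_bound[of f t k N] by (simp add: field_simps)

lemma norm_le_sn: "schwartz f \<Longrightarrow> norm (f t) \<le> sn k N f / br t ^ k"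
  using jet_le_sn norm_le_jet order_trans by blast

lemma sn_leI: "(\<And>t. br t ^ k * jet N f t \<le> c) \<Longrightarrow> sn k N f \<le> c"
  unfolding sn_def by (rule cSUP_least) auto

lemma sn_nonneg: "schwartz f \<Longrightarrow> 0 \<le> sn k N f"
  using sn_bound[of f 0 k N] by (meson br_nonneg jet_nonneg mult_nonneg_nonneg order_trans zero_le_power)

lemma sn_mono:
  assumes "schwartz f" "k \<le> k'" "N \<le> N'"
  shows "sn k N f \<le> sn k' N' f"
proof (rule sn_leI)
  fix t
  have "br t ^ k * jet N f t \<le> br t ^ k' * jet N' f t"
    by (intro mult_mono br_power_mono jet_mono assms) auto
  then show "br t ^ k * jet N f t \<le> sn k' N' f" using sn_bound[OF assms(1)] order_trans by blast
qed

lemma schwartzI: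
  fixes f :: "'n::finite cfun"
  assumes "smooth f" and "\<And>k N. \<exists>c. \<forall>t. br t ^ k * jet N f t \<le> c"
  shows "schwartz f"
  unfolding schwartz_def
proof (intro conjI allI)
  fix k and "is" :: "'n list"
  obtain c where c: "\<And>t. br t ^ k * jet (length is) f t \<le> c" using assms(2) by blast
  have "norm t ^ k * norm (partial_derivs is f t) \<le> c" for t
  proof -
    have "norm t ^ k * norm (partial_derivs is f t) \<le> br t ^ k * jet (length is) f t"
      by (intro mult_mono power_mono norm_le_br partial_derivs_le_jet) auto
    then show ?thesis using c order_trans by blast
  qed
  then show "bdd_above (range (\<lambda>x. norm x ^ k * norm (partial_derivs is f x)))" by (rule bdd_aboveI2)
qed (rule assms(1))

lemma seminorm_le_sn:
  assumes "schwartz f" "length is \<le> N"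
  shows "schwartz_seminorm k is f \<le> sn k N f"
  unfolding schwartz_seminorm_def
proof (rule cSUP_least)
  fix t
  have "norm t ^ k * norm (partial_derivs is f t) \<le> br t ^ k * jet N f t"
    by (intro mult_mono power_mono norm_le_br partial_derivs_le_jet assms) auto
  then show "norm t ^ k * norm (partial_derivs is f t) \<le> sn k N f"
    using sn_bound[OF assms(1)] order_trans by blast
qed auto

lemma seminorm_bound:
  assumes "schwartz f"
  shows "norm t ^ k * norm (partial_derivs is f t) \<le> schwartz_seminorm k is f"
  using assms unfolding schwartz_def schwartz_seminorm_def by (auto intro: cSUP_upper2)

lemma seminorm_nonneg: "schwartz f \<Longrightarrow> 0 \<le> schwartz_seminorm k is f"
  using seminorm_bound[of f 0 k "is"] by (meson mult_nonneg_nonneg norm_ge_zero order_trans zero_le_power)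

lemma tempered_bound:
  fixes u :: "'n::finite dist"
  assumes "tempered u"
  obtains C N where "0 \<le> C" "\<And>\<psi>. schwartz \<psi> \<Longrightarrow> norm (u \<psi>) \<le> C * sn N N \<psi>"
proof -
  obtain C N where C: "\<And>\<psi>. schwartz \<psi> \<Longrightarrow> norm (u \<psi>) \<le> C * (\<Sum>k\<le>N. \<Sum>is | length is \<le> N. schwartz_seminorm k is \<psi>)"
    using assms unfolding tempered_def by blast
  define K where "K = (\<Sum>k\<le>N. \<Sum>is\<in>{is::'n list. length is \<le> N}. 1::real)"
  have K: "0 \<le> K" unfolding K_def by (intro sum_nonneg) auto
  show ?thesis
  proof (rule that[of "\<bar>C\<bar> * K" N])
    show "0 \<le> \<bar>C\<bar> * K" using K by simp
    fix \<psi> :: "'n cfun" assume s: "schwartz \<psi>"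
    have "(\<Sum>k\<le>N. \<Sum>is | length is \<le> N. schwartz_seminorm k is \<psi>) \<le> (\<Sum>k\<le>N. \<Sum>is\<in>{is::'n list. length is \<le> N}. sn N N \<psi>)"
      by (intro sum_mono order_trans[OF seminorm_le_sn[OF s, where N=N] sn_mono[OF s]]) auto
    also have "\<dots> = K * sn N N \<psi>" unfolding K_def by (simp add: sum_distrib_right)
    finally have 1: "(\<Sum>k\<le>N. \<Sum>is | length is \<le> N. schwartz_seminorm k is \<psi>) \<le> K * sn N N \<psi>" .
    have 0: "0 \<le> (\<Sum>k\<le>N. \<Sum>is | length is \<le> N. schwartz_seminorm k is \<psi>)"
      by (intro sum_nonneg seminorm_nonneg s)
    have "norm (u \<psi>) \<le> \<bar>C\<bar> * (\<Sum>k\<le>N. \<Sum>is | length is \<le> N. schwartz_seminorm k is \<psi>)"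
      using C[OF s] mult_right_mono[OF abs_ge_self 0] order_trans by blast
    also have "\<dots> \<le> \<bar>C\<bar> * (K * sn N N \<psi>)" by (rule mult_left_mono[OF 1]) simp
    finally show "norm (u \<psi>) \<le> \<bar>C\<bar> * K * sn N N \<psi>" by (simp add: mult.assoc)
  qed
qed

lemma temperedI:
  fixes u :: "'n::finite dist"
  assumes add: "\<And>\<psi> \<eta>. schwartz \<psi> \<Longrightarrow> schwartz \<eta> \<Longrightarrow> u (\<lambda>x. \<psi> x + \<eta> x) = u \<psi> + u \<eta>"
    and scale: "\<And>c \<psi>. schwartz \<psi> \<Longrightarrow> u (\<lambda>x. c * \<psi> x) = c * u \<psi>"
    and bound: "\<And>\<psi>. schwartz \<psi> \<Longrightarrow> norm (u \<psi>) \<le> C * sn k N \<psi>" and C: "0 \<le> C"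
  shows "tempered u"
  unfolding tempered_def
proof (intro conjI allI impI)
  define M where "M = max k N"
  show "\<exists>C N. \<forall>\<psi>. schwartz \<psi> \<longrightarrow> norm (u \<psi>) \<le> C * (\<Sum>k\<le>N. \<Sum>is | length is \<le> N. schwartz_seminorm k is \<psi>)"
  proof (intro exI allI impI)
    fix \<psi> :: "'n cfun" assume s: "schwartz \<psi>"
    let ?S = "\<lambda>k. \<Sum>is | length is \<le> M. schwartz_seminorm k is \<psi>"
    let ?T = "\<Sum>k\<le>M. ?S k"
    have "?S l \<le> ?T" if "l \<le> M" for l
      by (rule member_le_sum) (auto intro!: sum_nonneg seminorm_nonneg s simp: that)
    then have "2 ^ k * (?S 0 + ?S k) \<le> 2 ^ k * (?T + ?T)" by (intro mult_left_mono add_mono) (auto simp: M_def)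
    moreover have "sn k N \<psi> \<le> 2 ^ k * (?S 0 + ?S k)"
    proof (rule sn_leI)
      fix t
      have "br t ^ k * jet N \<psi> t \<le> (2 ^ k * (1 + norm t ^ k)) * jet M \<psi> t"
        by (intro mult_mono br_power_le jet_mono) (auto simp: M_def)
      also have "\<dots> = 2 ^ k * (\<Sum>is | length is \<le> M. norm t ^ 0 * norm (partial_derivs is \<psi> t) + norm t ^ k * norm (partial_derivs is \<psi> t))"
        by (simp add: jet_def sum_distrib_left algebra_simps sum.distrib)
      also have "\<dots> \<le> 2 ^ k * (\<Sum>is | length is \<le> M. schwartz_seminorm 0 is \<psi> + schwartz_seminorm k is \<psi>)"
        by (intro mult_left_mono sum_mono add_mono seminorm_bound s) auto
      finally show "br t ^ k * jet N \<psi> t \<le> 2 ^ k * (?S 0 + ?S k)" by (simp add: sum.distrib)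
    qed
    ultimately have "C * sn k N \<psi> \<le> C * (2 ^ k * (?T + ?T))" using C by (intro mult_left_mono) (rule order_trans, assumption+)
    then show "norm (u \<psi>) \<le> (C * 2 ^ k * 2) * ?T" using bound[OF s] by (simp add: algebra_simps)
  qed
qed (use add scale in auto)

lemma tempered_add: "tempered u \<Longrightarrow> schwartz \<psi> \<Longrightarrow> schwartz \<eta> \<Longrightarrow> u (\<lambda>x. \<psi> x + \<eta> x) = u \<psi> + u \<eta>"
  and tempered_cmult: "tempered u \<Longrightarrow> schwartz \<psi> \<Longrightarrow> u (\<lambda>x. c * \<psi> x) = c * u \<psi>"
  unfolding tempered_def by auto

section \<open>Closure properties of Schwartz functions\<close>

text \<open>Smooth functions all of whose derivatives grow polynomially multiply Schwartz functions.\<close>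

lemma schwartz_mult_bound:
  fixes f g :: "'n::finite cfun"
  assumes sf: "smooth f" and sg: "schwartz g" and c: "\<And>t. jet N f t \<le> c * br t ^ d"
  shows "br t ^ k * jet N (\<lambda>t. f t * g t) t \<le> jet_const TYPE('n) N * (c * sn (k + d) N g)"
proof -
  have c0: "0 \<le> c * br t ^ d" using c[of t] jet_nonneg order_trans by blast
  have "br t ^ k * jet N (\<lambda>t. f t * g t) t \<le> br t ^ k * (jet_const TYPE('n) N * (jet N f t * jet N g t))"
    by (intro mult_left_mono jet_mult sf schwartz_smooth sg) auto
  also have "\<dots> \<le> br t ^ k * (jet_const TYPE('n) N * ((c * br t ^ d) * jet N g t))"
    by (intro mult_left_mono mult_right_mono c) auto
  also have "\<dots> = jet_const TYPE('n) N * (c * (br t ^ (k + d) * jet N g t))"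
    by (simp add: power_add algebra_simps)
  also have "\<dots> \<le> jet_const TYPE('n) N * (c * sn (k + d) N g)"
  proof -
    have "0 \<le> c" using c0 zero_le_mult_iff[of c "br t ^ d"] zero_less_power[OF br_pos[of t], of d] by linarith
    then show ?thesis by (intro mult_left_mono sn_bound sg) auto
  qed
  finally show ?thesis .
qed

lemma schwartz_mult_slow:
  fixes f g :: "'n::finite cfun"
  assumes sf: "smooth f" and sg: "schwartz g" and c: "\<And>N. \<exists>c d. \<forall>t. jet N f t \<le> c * br t ^ d"
  shows "schwartz (\<lambda>t. f t * g t)"
proof (rule schwartzI)
  show "smooth (\<lambda>t. f t * g t)" by (rule smooth_mult[OF sf schwartz_smooth[OF sg]])
  fix k N
  obtain c d where "\<And>t. jet N f t \<le> c * br t ^ d" using c by metis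
  then show "\<exists>c. \<forall>t. br t ^ k * jet N (\<lambda>t. f t * g t) t \<le> c"
    using schwartz_mult_bound[OF sf sg] by blast
qed

lemma schwartz_mult: "schwartz f \<Longrightarrow> schwartz g \<Longrightarrow> schwartz (\<lambda>t. f t * g t)"
  using jet_le_sn[where k=0, of f]
  by (intro schwartz_mult_slow[OF schwartz_smooth]) (auto intro!: exI[of _ "sn 0 _ f"] exI[of _ "0::nat"])

lemma schwartz_add:
  assumes "schwartz f" "schwartz g" shows "schwartz (\<lambda>t. f t + g t)"
    and "sn k N (\<lambda>t. f t + g t) \<le> sn k N f + sn k N g"
proof -
  have *: "br t ^ k * jet N (\<lambda>t. f t + g t) t \<le> sn k N f + sn k N g" for t k N
  proof -
    have "br t ^ k * jet N (\<lambda>t. f t + g t) t \<le> br t ^ k * (jet N f t + jet N g t)"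
      by (intro mult_left_mono jet_add assms schwartz_smooth) auto
    then show ?thesis using sn_bound[OF assms(1), of t k N] sn_bound[OF assms(2), of t k N]
      by (simp add: algebra_simps)
  qed
  show "schwartz (\<lambda>t. f t + g t)" by (rule schwartzI[OF smooth_add[OF assms[THEN schwartz_smooth]]]) (use * in blast)
  show "sn k N (\<lambda>t. f t + g t) \<le> sn k N f + sn k N g" using * by (rule sn_leI)
qed

lemma schwartz_cmult:
  assumes "schwartz f" shows "schwartz (\<lambda>t. c * f t)" and "sn k N (\<lambda>t. c * f t) \<le> norm c * sn k N f"
proof -
  have *: "br t ^ k * jet N (\<lambda>t. c * f t) t \<le> norm c * sn k N f" for t k N
    using mult_left_mono[OF sn_bound[OF assms, of t k N] norm_ge_zero[of c]]
    by (simp add: jet_cmult[OF schwartz_smooth[OF assms]] algebra_simps)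
  show "schwartz (\<lambda>t. c * f t)" by (rule schwartzI[OF smooth_cmult[OF schwartz_smooth[OF assms]]]) (use * in blast)
  show "sn k N (\<lambda>t. c * f t) \<le> norm c * sn k N f" using * by (rule sn_leI)
qed

lemma schwartz_diff:
  assumes "schwartz f" "schwartz g" shows "schwartz (\<lambda>t. f t - g t)"
  using schwartz_add(1)[OF assms(1) schwartz_cmult(1)[OF assms(2), of "-1"]] by simp

lemma tempered_diff: "tempered u \<Longrightarrow> schwartz \<psi> \<Longrightarrow> schwartz \<eta> \<Longrightarrow> u (\<lambda>x. \<psi> x - \<eta> x) = u \<psi> - u \<eta>"
  using tempered_add[OF _ _ schwartz_cmult(1)[of \<eta> "-1"], of u \<psi>] tempered_cmult[of u \<eta> "-1"] by simp

lemma schwartz_cnj: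
  assumes "schwartz f" shows "schwartz (\<lambda>t. cnj (f t))"
  using sn_bound[OF assms]
  by (intro schwartzI[OF smooth_cnj[OF schwartz_smooth[OF assms]]])
    (auto simp: jet_cnj[OF schwartz_smooth[OF assms]])

lemma schwartz_affine:
  fixes f :: "'n::finite cfun"
  assumes "schwartz f" "\<bar>s\<bar> = 1"
  shows "schwartz (\<lambda>t. f (s *\<^sub>R t + b))" and "sn k N (\<lambda>t. f (s *\<^sub>R t + b)) \<le> br b ^ k * sn k N f"
proof -
  have *: "br t ^ k * jet N (\<lambda>t. f (s *\<^sub>R t + b)) t \<le> br b ^ k * sn k N f" for t k N
  proof -
    have "br t = br ((s *\<^sub>R t + b) - b)" using assms(2) by (simp add: br_def)
    then have "br t ^ k \<le> br (s *\<^sub>R t + b) ^ k * br b ^ k" using br_diff_power by metis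
    then have "br t ^ k * jet N (\<lambda>t. f (s *\<^sub>R t + b)) t \<le> (br (s *\<^sub>R t + b) ^ k * br b ^ k) * jet N f (s *\<^sub>R t + b)"
      by (intro mult_mono jet_affine schwartz_smooth assms) (auto simp: assms)
    also have "\<dots> = br b ^ k * (br (s *\<^sub>R t + b) ^ k * jet N f (s *\<^sub>R t + b))" by simp
    also have "\<dots> \<le> br b ^ k * sn k N f" by (intro mult_left_mono sn_bound assms) auto
    finally show ?thesis .
  qed
  show "schwartz (\<lambda>t. f (s *\<^sub>R t + b))" by (rule schwartzI[OF smooth_affine[OF schwartz_smooth[OF assms(1)]]]) (use * in blast)
  show "sn k N (\<lambda>t. f (s *\<^sub>R t + b)) \<le> br b ^ k * sn k N f" using * by (rule sn_leI)
qed

lemma schwartz_translate: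
  assumes "schwartz f"
  shows "schwartz (\<lambda>t. f (t - b))" "schwartz (\<lambda>t. f (t + b))" "schwartz (\<lambda>t. f (b - t))" "schwartz (\<lambda>t. f (- t))"
  using schwartz_affine(1)[OF assms, of 1 "-b"] schwartz_affine(1)[OF assms, of 1 b]
    schwartz_affine(1)[OF assms, of "-1" b] schwartz_affine(1)[OF assms, of "-1" 0] by simp_all

lemma schwartz_partial_deriv:
  fixes f :: "'n::finite cfun"
  assumes "schwartz f" shows "schwartz (partial_deriv i f)"
proof (rule schwartzI)
  show "smooth (partial_deriv i f)" by (rule smooth_partial_deriv[OF schwartz_smooth[OF assms]])
  fix k N
  have "br t ^ k * jet N (partial_deriv i f) t \<le> sn k (Suc N) f" for t
    by (rule order_trans[OF mult_left_mono[OF jet_partial_deriv] sn_bound[OF assms]]) auto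
  then show "\<exists>c. \<forall>t. br t ^ k * jet N (partial_deriv i f) t \<le> c" by blast
qed

section \<open>Exponentials and time-frequency shifts\<close>

definition ee :: "real^'n \<Rightarrow> 'n::finite cfun" where
  "ee \<xi> t = exp (- \<i> * complex_of_real (t \<bullet> \<xi>))"

lemma ee_0 [simp]: "ee 0 t = 1" "ee \<xi> 0 = 1" by (auto simp: ee_def)
lemma norm_ee [simp]: "norm (ee \<xi> t) = 1" by (simp add: ee_def norm_exp_i_times)
lemma ee_add: "ee (\<xi> + \<eta>) t = ee \<xi> t * ee \<eta> t"
  by (simp add: ee_def inner_add_right ring_distribs exp_add[symmetric])
lemma ee_add2: "ee \<xi> (t + s) = ee \<xi> t * ee \<xi> s"
  by (simp add: ee_def inner_add_left ring_distribs exp_add[symmetric])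
lemma cnj_ee: "cnj (ee \<xi> t) = ee (- \<xi>) t"
  by (simp add: ee_def exp_cnj)
lemma ee_swap: "ee \<xi> t = ee t \<xi>" by (simp add: ee_def inner_commute)
lemma ee_minus: "ee (- \<xi>) t = ee \<xi> (- t)" by (simp add: ee_def)
lemma ee_borel [measurable]: "(\<lambda>(t, \<xi>). ee \<xi> t) \<in> borel_measurable (borel \<Otimes>\<^sub>M borel)"
  unfolding ee_def split_beta' by measurable

lemma ee_has_derivative: "(ee \<xi> has_derivative (\<lambda>h. - \<i> * complex_of_real (h \<bullet> \<xi>) * ee \<xi> t)) (at t)"
proof -
  have "((\<lambda>t. - \<i> * complex_of_real (t \<bullet> \<xi>)) has_derivative (\<lambda>h. - \<i> * complex_of_real (h \<bullet> \<xi>))) (at t)"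
    by (intro has_derivative_mult_right has_derivative_of_real has_derivative_inner_left has_derivative_ident)
  from has_derivative_compose[OF this has_field_derivative_imp_has_derivative[OF DERIV_exp]] show ?thesis
    unfolding ee_def by (simp add: algebra_simps)
qed

lemma partial_deriv_ee: "partial_deriv i (ee \<xi>) = (\<lambda>t. (- \<i> * complex_of_real (\<xi> $ i)) * ee \<xi> t)"
  by (rule ext, subst partial_deriv_eq[OF ee_has_derivative]) (simp add: inner_commute cart_eq_inner_axis)

lemma ee_differentiable: "ee \<xi> differentiable (at t)"
  using ee_has_derivative differentiable_def by blast

lemma smooth_ee: "smooth (ee \<xi>)"
proof (rule smooth_coinduct[where P="\<lambda>f. \<exists>c. f = (\<lambda>t. c * ee \<xi> t)"])
  show "\<exists>c. ee \<xi> = (\<lambda>t. c * ee \<xi> t)" by (rule exI[of _ 1]) simp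
  fix f x i assume "\<exists>c. f = (\<lambda>t. c * ee \<xi> t)"
  then obtain c where c: "f = (\<lambda>t. c * ee \<xi> t)" by blast
  show "f differentiable at x" unfolding c by (intro differentiable_mult differentiable_const ee_differentiable)
  have "partial_deriv i f = (\<lambda>t. (c * (- \<i> * complex_of_real (\<xi> $ i))) * ee \<xi> t)"
    unfolding c by (rule ext) (simp add: partial_deriv_cmult[OF ee_differentiable] partial_deriv_ee)
  then show "\<exists>c. partial_deriv i f = (\<lambda>t. c * ee \<xi> t)" by blast
qed

lemma partial_derivs_ee: "partial_derivs is (ee \<xi>) = (\<lambda>t. (\<Prod>i\<leftarrow>is. - \<i> * complex_of_real (\<xi> $ i)) * ee \<xi> t)"
proof (induction "is")
  case (Cons i "is")
  show ?case unfolding partial_derivs_Cons Cons.IH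
    by (rule ext) (simp add: partial_deriv_cmult[OF ee_differentiable] partial_deriv_ee)
qed simp

lemma norm_partial_derivs_ee: "norm (partial_derivs is (ee \<xi>) t) \<le> norm \<xi> ^ length is"
proof -
  have "norm (\<Prod>i\<leftarrow>is. - \<i> * complex_of_real (\<xi> $ i)) \<le> norm \<xi> ^ length is"
    by (induction "is") (auto simp: norm_mult intro!: mult_mono component_le_norm_cart)
  then show ?thesis by (simp add: partial_derivs_ee norm_mult)
qed

lemma jet_ee: "jet N (ee \<xi> :: 'n::finite cfun) t \<le> jet_const TYPE('n) N * br \<xi> ^ N"
proof -
  have "jet N (ee \<xi>) t \<le> real (card {is::'n list. length is \<le> N}) * br \<xi> ^ N"
  proof (rule jet_leI)
    fix "is" :: "'n list" assume l: "length is \<le> N"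
    have "norm \<xi> ^ length is \<le> br \<xi> ^ length is" by (intro power_mono norm_le_br) auto
    also have "\<dots> \<le> br \<xi> ^ N" by (rule br_power_mono[OF l])
    finally show "norm (partial_derivs is (ee \<xi>) t) \<le> br \<xi> ^ N"
      using norm_partial_derivs_ee order_trans by blast
  qed
  also have "\<dots> \<le> jet_const TYPE('n) N * br \<xi> ^ N"
    unfolding jet_const_def by (intro mult_right_mono) (auto simp: mult_le_cancel_left1)
  finally show ?thesis .
qed

lemma norm_ee_minus_1: "norm (ee \<xi> t - 1) \<le> norm \<xi> * norm t"
proof -
  have "norm (ee \<xi> t - ee \<xi> 0) \<le> norm \<xi> * norm (t - 0)"
  proof (rule differentiable_bound[OF convex_UNIV has_derivative_at_withinI[OF ee_has_derivative]])
    fix s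
    show "onorm (\<lambda>h. - \<i> * complex_of_real (h \<bullet> \<xi>) * ee \<xi> s) \<le> norm \<xi>"
      using Cauchy_Schwarz_ineq2[of _ \<xi>] by (intro onorm_le) (simp add: norm_mult mult.commute)
  qed auto
  then show ?thesis by simp
qed

text \<open>The time-frequency shift of \<open>f\<close> by \<open>X\<close>.  The short-time Fourier transform of \<open>u\<close> at \<open>X\<close> is a multiple of
  \<open>u (tf \<phi> X)\<close>, with the conjugate window as \<open>\<phi>\<close>.\<close>

definition tf :: "'n::finite cfun \<Rightarrow> 'n phase \<Rightarrow> 'n cfun" where
  "tf f X t = ee (snd X) t * f (t - fst X)"

lemma schwartz_tf:
  fixes f :: "'n::finite cfun"
  assumes "schwartz f"
  shows "schwartz (tf f X)"
    and "sn k N (tf f X) \<le> (jet_const TYPE('n) N)\<^sup>2 * br (fst X) ^ k * br (snd X) ^ N * sn k N f"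
proof -
  have t: "schwartz (\<lambda>t. f (t - fst X))" by (rule schwartz_translate[OF assms])
  show "schwartz (tf f X)" unfolding tf_def
  proof (rule schwartz_mult_slow[OF smooth_ee t])
    fix N
    show "\<exists>c d. \<forall>t. jet N (ee (snd X)) t \<le> c * br t ^ d"
      using jet_ee[of N "snd X"] by (intro exI[of _ "jet_const TYPE('n) N * br (snd X) ^ N"] exI[of _ "0::nat"]) simp
  qed
  have "sn k N (tf f X) \<le> jet_const TYPE('n) N * ((jet_const TYPE('n) N * br (snd X) ^ N) * sn (k + 0) N (\<lambda>t. f (t - fst X)))"
    unfolding tf_def by (rule sn_leI, rule schwartz_mult_bound[OF smooth_ee t]) (use jet_ee in auto)
  also have "\<dots> \<le> jet_const TYPE('n) N * ((jet_const TYPE('n) N * br (snd X) ^ N) * (br (fst X) ^ k * sn k N f))"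
    using schwartz_affine(2)[OF assms, where s=1 and b="- fst X" and k=k and N=N] by (intro mult_left_mono) auto
  finally show "sn k N (tf f X) \<le> (jet_const TYPE('n) N)\<^sup>2 * br (fst X) ^ k * br (snd X) ^ N * sn k N f"
    by (simp add: power2_eq_square algebra_simps)
qed

lemma jet_ee_minus_1:
  fixes \<xi> :: "real^'n::finite"
  assumes "norm \<xi> \<le> 1"
  shows "jet N (\<lambda>t. ee \<xi> t - 1) t \<le> jet_const TYPE('n) N * (norm \<xi> * br t)"
proof -
  have "jet N (\<lambda>t. ee \<xi> t - 1) t \<le> real (card {is::'n list. length is \<le> N}) * (norm \<xi> * br t)"
  proof (rule jet_leI)
    fix "is" :: "'n list" assume l: "length is \<le> N"
    show "norm (partial_derivs is (\<lambda>t. ee \<xi> t - 1) t) \<le> norm \<xi> * br t"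
    proof (cases "is" rule: rev_cases)
      case Nil
      then show ?thesis using norm_ee_minus_1[of \<xi> t] mult_left_mono[OF norm_le_br[of t] norm_ge_zero[of \<xi>]] by simp
    next
      case (snoc js j)
      have "partial_deriv j (\<lambda>t. ee \<xi> t - 1) = partial_deriv j (ee \<xi>)"
        using partial_deriv_add[OF ee_differentiable differentiable_const, of j \<xi> "-1"]
        by (simp add: fun_eq_iff partial_deriv_const)
      then have "norm (partial_derivs is (\<lambda>t. ee \<xi> t - 1) t) = norm (partial_derivs is (ee \<xi>) t)"
        by (simp add: snoc partial_derivs_snoc)
      also have "\<dots> \<le> norm \<xi> ^ length is" by (rule norm_partial_derivs_ee)
      also have "\<dots> \<le> norm \<xi> ^ 1" using assms snoc by (intro power_decreasing) auto
      also have "\<dots> \<le> norm \<xi> * br t" using br_ge1[of t] by (simp add: mult_le_cancel_left1)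
      finally show ?thesis .
    qed
  qed
  also have "\<dots> \<le> jet_const TYPE('n) N * (norm \<xi> * br t)"
    unfolding jet_const_def by (intro mult_right_mono) (auto simp: mult_le_cancel_left1)
  finally show ?thesis .
qed

lemma jet_difference:
  fixes f :: "'n::finite cfun"
  assumes "schwartz f" "norm h \<le> 1"
  shows "br t ^ k * jet N (\<lambda>t. f (t - h) - f t) t \<le> jet_const TYPE('n) N * (2 ^ k * sn k (Suc N) f * norm h)"
proof -
  have sm: "smooth f" using assms(1) by (rule schwartz_smooth)
  have sm': "smooth (\<lambda>t. f (t - h))" using schwartz_smooth[OF schwartz_translate(1)[OF assms(1)]] .
  have "jet N (\<lambda>t. f (t - h) - f t) t \<le> real (card {is::'n list. length is \<le> N}) * (2 ^ k * sn k (Suc N) f / br t ^ k * norm h)"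
  proof (rule jet_leI)
    fix "is" :: "'n list" assume l: "length is \<le> N"
    have "partial_derivs is (\<lambda>t. f (t - h) - f t) t = partial_derivs is f (t + (- h)) - partial_derivs is f t"
      using partial_derivs_affine[OF sm, of "is" 1 "-h"] by (simp add: partial_derivs_diff[OF sm' sm])
    also have "norm \<dots> \<le> 2 ^ k * sn k (Suc N) f / br t ^ k * norm (- h)"
    proof (rule smooth_mean_value[OF smooth_partial_derivs[OF sm]])
      fix s assume "s \<in> closed_segment t (t + - h)"
      then have ns: "norm (t - s) \<le> 1" using segment_bound1[of s t "t + - h"] assms(2) by (simp add: norm_minus_commute)
      have "jet 1 (partial_derivs is f) s \<le> jet (Suc N) f s"
      proof -
        have "jet 1 (partial_derivs js f) s \<le> jet (1 + length js) f s" for js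
        proof (induction js arbitrary: f rule: rev_induct)
          case Nil then show ?case by simp
        next
          case (snoc i js)
          show ?case unfolding partial_derivs_snoc
            using snoc.IH[of "partial_deriv i f"] jet_partial_deriv[of "1 + length js" i f s] by simp
        qed
        then show ?thesis using l jet_mono[of "1 + length is" "Suc N" f s] order_trans by fastforce
      qed
      moreover have "br t ^ k \<le> br s ^ k * 2 ^ k"
      proof -
        have "br (s + (t - s)) ^ k \<le> br s ^ k * br (t - s) ^ k" by (rule br_add_power)
        also have "\<dots> \<le> br s ^ k * 2 ^ k" using ns by (intro mult_left_mono power_mono) (auto simp: br_def)
        finally show ?thesis by simp
      qed
      ultimately have "jet 1 (partial_derivs is f) s * br t ^ k \<le> jet (Suc N) f s * (br s ^ k * 2 ^ k)"
        by (intro mult_mono) auto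
      also have "\<dots> \<le> 2 ^ k * sn k (Suc N) f"
        using sn_bound[OF assms(1), of s k "Suc N"] by (simp add: algebra_simps)
      finally show "jet 1 (partial_derivs is f) s \<le> 2 ^ k * sn k (Suc N) f / br t ^ k"
        by (simp add: field_simps)
    qed
    finally show "norm (partial_derivs is (\<lambda>t. f (t - h) - f t) t) \<le> 2 ^ k * sn k (Suc N) f / br t ^ k * norm h" by simp
  qed
  also have "\<dots> \<le> jet_const TYPE('n) N * (2 ^ k * sn k (Suc N) f / br t ^ k * norm h)"
    unfolding jet_const_def
    by (intro mult_right_mono) (auto simp: mult_le_cancel_left1 sn_nonneg[OF assms(1)])
  finally have "br t ^ k * jet N (\<lambda>t. f (t - h) - f t) t \<le> br t ^ k * (jet_const TYPE('n) N * (2 ^ k * sn k (Suc N) f / br t ^ k * norm h))"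
    by (intro mult_left_mono) auto
  then show ?thesis by simp
qed

text \<open>Time-frequency shifts depend Lipschitz continuously on the shift, with polynomial constants:
  a change of \<open>X\<close> by \<open>(h, \<delta>)\<close> is a translation by \<open>h\<close>, applied first, followed by
  multiplication with the character \<open>ee \<delta>\<close>.\<close>

lemma sn_tf_diff:
  fixes f :: "'n::finite cfun"
  assumes f: "schwartz f"
  obtains C where "0 \<le> C" "\<And>X X'. norm (X' - X) \<le> 1 \<Longrightarrow>
    sn k N (\<lambda>t. tf f X' t - tf f X t) \<le> C * br X ^ (k + 1 + N) * norm (X' - X)"
proof -
  define J where "J = jet_const TYPE('n) N"
  have J: "0 \<le> J" by (simp add: J_def)
  define A where "A = J\<^sup>2 * 2 ^ N * (J * (2 ^ k * sn k (Suc N) f))"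
  define B where "B = J\<^sup>2 * (J\<^sup>2 * sn (k + 1) N f)"
  have A: "0 \<le> A" and B: "0 \<le> B" using f by (auto simp: A_def B_def J intro!: mult_nonneg_nonneg sn_nonneg)
  show ?thesis
  proof (rule that[of "A + B"])
    show "0 \<le> A + B" using A B by simp
    fix X X' :: "'n phase" assume XX: "norm (X' - X) \<le> 1"
    define x x' \<xi> \<xi>' where xs: "x = fst X" "x' = fst X'" "\<xi> = snd X" "\<xi>' = snd X'"
    define h d where hd: "h = x' - x" "d = \<xi>' - \<xi>"
    have h: "norm h \<le> norm (X' - X)" and d: "norm d \<le> norm (X' - X)"
      unfolding hd xs by (metis fst_diff norm_fst_le prod.collapse, metis snd_diff norm_snd_le prod.collapse)
    have h1: "norm h \<le> 1" and d1: "norm d \<le> 1" using h d XX by auto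
    define g where "g = (\<lambda>t. f (t - x))"
    have g: "schwartz g" unfolding g_def by (rule schwartz_translate[OF f])
    define D where "D = (\<lambda>t. g (t - h) - g t)"
    have D: "schwartz D" unfolding D_def by (intro schwartz_diff schwartz_translate g)
    have sg: "sn l M g \<le> br x ^ l * sn l M f" for l M
      unfolding g_def using schwartz_affine(2)[OF f, where s=1 and b="-x" and k=l and N=M] by simp
    have tX: "tf f X = (\<lambda>t. ee \<xi> t * g t)" by (auto simp: tf_def g_def xs)
    have eq: "tf f X' t - tf f X t = ee \<xi>' t * D t + (ee d t - 1) * tf f X t" for t
    proof -
      have "ee \<xi>' t = ee d t * ee \<xi> t" by (simp add: hd ee_add[symmetric])
      then show ?thesis by (simp add: tf_def g_def D_def hd xs algebra_simps)
    qed
    have sm1: "smooth (\<lambda>t. ee d t - 1)" by (intro smooth_diff smooth_ee smooth_const)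
    show "sn k N (\<lambda>t. tf f X' t - tf f X t) \<le> (A + B) * br X ^ (k + 1 + N) * norm (X' - X)"
    proof (rule sn_leI)
      fix t
      have "br t ^ k * jet N (\<lambda>t. ee \<xi>' t * D t) t \<le> br t ^ k * (J * ((J * br \<xi>' ^ N) * jet N D t))"
        unfolding J_def
        by (intro mult_left_mono order_trans[OF jet_mult] mult_right_mono jet_ee smooth_ee schwartz_smooth D) auto
      also have "\<dots> = J\<^sup>2 * br \<xi>' ^ N * (br t ^ k * jet N D t)" by (simp add: power2_eq_square algebra_simps)
      also have "\<dots> \<le> J\<^sup>2 * (2 ^ N * br \<xi> ^ N) * (J * (2 ^ k * (br x ^ k * sn k (Suc N) f) * norm h))"
      proof (rule mult_mono)
        have "br \<xi>' \<le> 2 * br \<xi>"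
          using d1 norm_triangle_ineq[of \<xi> d] norm_ge_zero[of \<xi>] by (simp add: br_def hd del: norm_ge_zero)
        then have "br \<xi>' ^ N \<le> 2 ^ N * br \<xi> ^ N"
          using power_mono[of "br \<xi>'" "2 * br \<xi>" N] by (simp add: power_mult_distrib)
        then show "J\<^sup>2 * br \<xi>' ^ N \<le> J\<^sup>2 * (2 ^ N * br \<xi> ^ N)" by (rule mult_left_mono) simp
        have "br t ^ k * jet N D t \<le> J * (2 ^ k * sn k (Suc N) g * norm h)"
          unfolding D_def J_def by (rule jet_difference[OF g h1])
        also have "\<dots> \<le> J * (2 ^ k * (br x ^ k * sn k (Suc N) f) * norm h)"
          by (intro mult_left_mono mult_right_mono sg J) auto
        finally show "br t ^ k * jet N D t \<le> J * (2 ^ k * (br x ^ k * sn k (Suc N) f) * norm h)" .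
      qed (auto simp: J)
      also have "\<dots> = A * (br \<xi> ^ N * br x ^ k) * norm h" by (simp add: A_def algebra_simps)
      also have "\<dots> \<le> A * (br X ^ N * br X ^ (k + 1)) * norm (X' - X)"
      proof -
        have "br x ^ k \<le> br X ^ k" unfolding xs by (intro power_mono br_fst) auto
        also have "\<dots> \<le> br X ^ (k + 1)" by (intro br_power_mono) auto
        finally show ?thesis unfolding xs using A h by (intro mult_mono power_mono br_snd) (auto simp: xs)
      qed
      finally have T1: "br t ^ k * jet N (\<lambda>t. ee \<xi>' t * D t) t \<le> A * br X ^ (k + 1 + N) * norm (X' - X)"
        by (simp add: power_add algebra_simps)
      have "br t ^ k * jet N (\<lambda>t. (ee d t - 1) * tf f X t) t \<le> J * ((J * norm d) * sn (k + 1) N (tf f X))"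
        using jet_ee_minus_1[OF d1, of N] unfolding J_def
        by (intro schwartz_mult_bound sm1 schwartz_tf f) (simp add: algebra_simps)
      also have "\<dots> \<le> J * ((J * norm (X' - X)) * (J\<^sup>2 * br x ^ (k + 1) * br \<xi> ^ N * sn (k + 1) N f))"
        unfolding J_def xs using d by (intro mult_mono schwartz_tf f) (auto intro!: mult_nonneg_nonneg sn_nonneg schwartz_tf f)
      also have "\<dots> = B * (br x ^ (k + 1) * br \<xi> ^ N) * norm (X' - X)" by (simp add: B_def power2_eq_square algebra_simps)
      also have "\<dots> \<le> B * (br X ^ (k + 1) * br X ^ N) * norm (X' - X)"
        unfolding xs using B by (intro mult_left_mono mult_right_mono mult_mono power_mono br_fst br_snd) auto
      finally have T2: "br t ^ k * jet N (\<lambda>t. (ee d t - 1) * tf f X t) t \<le> B * br X ^ (k + 1 + N) * norm (X' - X)"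
        by (simp add: power_add algebra_simps)
      have "br t ^ k * jet N (\<lambda>t. tf f X' t - tf f X t) t
          \<le> br t ^ k * (jet N (\<lambda>t. ee \<xi>' t * D t) t + jet N (\<lambda>t. (ee d t - 1) * tf f X t) t)"
        unfolding eq
        by (intro mult_left_mono jet_add smooth_mult smooth_ee schwartz_smooth[OF D] sm1 schwartz_smooth[OF schwartz_tf(1)[OF f]]) auto
      also have "\<dots> \<le> (A + B) * br X ^ (k + 1 + N) * norm (X' - X)"
        using T1 T2 by (simp add: algebra_simps)
      finally show "br t ^ k * jet N (\<lambda>t. tf f X' t - tf f X t) t \<le> (A + B) * br X ^ (k + 1 + N) * norm (X' - X)" .
    qed
  qed
qed

lemma sn_tf_growth:
  fixes f :: "'n::finite cfun"
  assumes f: "schwartz f"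
  shows "sn k N (tf f X) \<le> ((jet_const TYPE('n) N)\<^sup>2 * sn k N f) * br X ^ (k + N)"
proof -
  have "sn k N (tf f X) \<le> (jet_const TYPE('n) N)\<^sup>2 * br (fst X) ^ k * br (snd X) ^ N * sn k N f" by (rule schwartz_tf(2)[OF f])
  also have "\<dots> \<le> (jet_const TYPE('n) N)\<^sup>2 * br X ^ k * br X ^ N * sn k N f"
    using sn_nonneg[OF f] by (intro mult_right_mono mult_mono power_mono br_fst br_snd) auto
  finally show ?thesis by (simp add: power_add algebra_simps)
qed

lemma tempered_tf_growth:
  fixes u :: "'n::finite dist"
  assumes bound: "\<And>\<psi>. schwartz \<psi> \<Longrightarrow> norm (u \<psi>) \<le> C * sn k N \<psi>" and "0 \<le> C" and f: "schwartz f"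
  shows "norm (u (tf f X)) \<le> (C * (jet_const TYPE('n) N)\<^sup>2 * sn k N f) * br X ^ (k + N)"
  using order_trans[OF bound[OF schwartz_tf(1)[OF f]] mult_left_mono[OF sn_tf_growth[OF f] \<open>0 \<le> C\<close>]]
  by (simp add: mult.assoc)

lemma tempered_tf_continuous:
  fixes u :: "'n::finite dist"
  assumes u: "tempered u" and f: "schwartz f"
  shows "continuous_on UNIV (\<lambda>X. u (tf f X))"
proof -
  obtain C N where C: "0 \<le> C" "\<And>\<psi>. schwartz \<psi> \<Longrightarrow> norm (u \<psi>) \<le> C * sn N N \<psi>"
    using tempered_bound[OF u] by blast
  obtain L where L: "0 \<le> L" "\<And>X X'. norm (X' - X) \<le> 1 \<Longrightarrow>
    sn N N (\<lambda>t. tf f X' t - tf f X t) \<le> L * br X ^ (N + 1 + N) * norm (X' - X)"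
    using sn_tf_diff[OF f, of N N] by blast
  have "((\<lambda>X'. u (tf f X')) \<longlongrightarrow> u (tf f X)) (at X)" for X
  proof (rule LIM_zero_cancel, rule Lim_null_comparison)
    show "((\<lambda>X'. C * (L * br X ^ (N + 1 + N) * norm (X' - X))) \<longlongrightarrow> 0) (at X)"
      by (auto intro!: tendsto_eq_intros)
    have "norm (u (tf f X') - u (tf f X)) \<le> C * (L * br X ^ (N + 1 + N) * norm (X' - X))"
      if "norm (X' - X) \<le> 1" for X'
    proof -
      have "norm (u (tf f X') - u (tf f X)) \<le> C * sn N N (\<lambda>t. tf f X' t - tf f X t)"
        unfolding tempered_diff[OF u schwartz_tf(1)[OF f] schwartz_tf(1)[OF f], symmetric]
        by (intro C schwartz_diff schwartz_tf f)
      also have "\<dots> \<le> C * (L * br X ^ (N + 1 + N) * norm (X' - X))"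
        by (intro mult_left_mono L that C)
      finally show ?thesis .
    qed
    then show "\<forall>\<^sub>F X' in at X. norm (u (tf f X') - u (tf f X)) \<le> C * (L * br X ^ (N + 1 + N) * norm (X' - X))"
      unfolding eventually_at by (intro exI[of _ 1]) (auto simp: dist_norm)
  qed
  then show ?thesis by (simp add: continuous_on_def)
qed

section \<open>Integrability of the weights\<close>

lemma nn_integral_weight_line: "(\<integral>\<^sup>+s. ennreal (1 / (1 + \<bar>s::real\<bar>)\<^sup>2) \<partial>lborel) < \<infinity>"
proof -
  define f where "f = (\<lambda>s::real. ennreal (1 / (1 + \<bar>s\<bar>)\<^sup>2))"
  have f[measurable]: "f \<in> borel_measurable borel" unfolding f_def by measurable
  have "(\<integral>\<^sup>+s. ennreal (1 / (1 + \<bar>s\<bar>)\<^sup>2) * indicator {0..} s \<partial>lborel) = 0 - (- 1 / (1 + 0::real))"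
  proof (rule nn_integral_FTC_atLeast[where F="\<lambda>s. - 1 / (1 + s)"])
    show "((\<lambda>s. - 1 / (1 + s::real)) has_real_derivative 1 / (1 + \<bar>s\<bar>)\<^sup>2) (at s)" if "0 \<le> s" for s
      using that by (auto intro!: derivative_eq_intros simp: power2_eq_square)
    have "filterlim (\<lambda>s::real. 1 + s) at_infinity at_top"
      by (intro filterlim_at_top_imp_at_infinity filterlim_tendsto_add_at_top[OF tendsto_const] filterlim_ident)
    then show "((\<lambda>s. - 1 / (1 + s::real)) \<longlongrightarrow> 0) at_top"
      by (rule tendsto_divide_0[OF tendsto_const])
  qed auto
  then have half: "(\<integral>\<^sup>+s. f s * indicator {0..} s \<partial>lborel) = 1" by (simp add: f_def)
  have "(\<integral>\<^sup>+s. f s * indicator {0..} s \<partial>lborel) = ennreal \<bar>-1\<bar> * (\<integral>\<^sup>+s. f (0 + (-1) * s) * indicator {0..} (0 + (-1) * s) \<partial>lborel)"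
    by (rule nn_integral_real_affine) auto
  then have half': "(\<integral>\<^sup>+s. f (- s) * indicator {0..} (- s) \<partial>lborel) = 1" using half by simp
  have "(\<integral>\<^sup>+s. f s \<partial>lborel) \<le> (\<integral>\<^sup>+s. f s * indicator {0..} s + f (- s) * indicator {0..} (- s) \<partial>lborel)"
    by (rule nn_integral_mono) (auto simp: f_def indicator_def)
  also have "\<dots> = 1 + 1"
    using half half' by (subst nn_integral_add) auto
  finally show ?thesis unfolding f_def[symmetric] using le_less_trans by fastforce
qed

lemma ennreal_prod_less_top_weight:
  "(c::ennreal) < \<infinity> \<Longrightarrow> (\<Prod>b\<in>A. c) < \<infinity>"
  by (induction A rule: infinite_finite_induct) (auto simp: ennreal_mult_less_top)

lemma norm_integral_le:
  fixes f :: "'y \<Rightarrow> 'b::{banach, second_countable_topology}"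
  assumes "integrable M f" "integrable M g" "\<And>x. norm (f x) \<le> g x"
  shows "norm (LINT x|M. f x) \<le> (LINT x|M. g x)"
  by (rule order_trans[OF integral_norm_bound integral_mono]) (use assms in auto)

lemma integrable_weight:
  assumes "2 * DIM('a) \<le> k"
  shows "integrable lborel (\<lambda>x::'a::euclidean_space. 1 / br x ^ k)"
proof (rule integrableI_bounded)
  show "(\<lambda>x::'a. 1 / br x ^ k) \<in> borel_measurable lborel" by simp
  have "(\<integral>\<^sup>+(x::'a). ennreal (norm (1 / br x ^ k)) \<partial>lborel) \<le> (\<integral>\<^sup>+(x::'a). (\<Prod>b\<in>Basis. ennreal (1 / (1 + \<bar>x \<bullet> b\<bar>)\<^sup>2)) \<partial>lborel)"
  proof (rule nn_integral_mono)
    fix x :: 'a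
    have "(\<Prod>b\<in>Basis. (1 + \<bar>x \<bullet> b\<bar>)\<^sup>2) \<le> (\<Prod>b\<in>(Basis::'a set). (br x)\<^sup>2)"
      by (intro prod_mono conjI power_mono) (auto simp: br_def Basis_le_norm)
    also have "\<dots> = br x ^ (2 * DIM('a))" by (simp add: power_mult)
    also have "\<dots> \<le> br x ^ k" by (rule br_power_mono[OF assms])
    finally have le: "(\<Prod>b\<in>Basis. (1 + \<bar>x \<bullet> b\<bar>)\<^sup>2) \<le> br x ^ k" .
    have "0 < (\<Prod>b\<in>Basis. (1 + \<bar>x \<bullet> b\<bar>)\<^sup>2)" by (intro prod_pos) (auto simp: add_pos_nonneg)
    with le have "1 / br x ^ k \<le> 1 / (\<Prod>b\<in>Basis. (1 + \<bar>x \<bullet> b\<bar>)\<^sup>2)" by (intro divide_left_mono) auto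
    also have "\<dots> = (\<Prod>b\<in>Basis. 1 / (1 + \<bar>x \<bullet> b\<bar>)\<^sup>2)" by (simp add: prod_dividef)
    finally show "ennreal (norm (1 / br x ^ k)) \<le> (\<Prod>b\<in>Basis. ennreal (1 / (1 + \<bar>x \<bullet> b\<bar>)\<^sup>2))"
      by (simp add: prod_ennreal ennreal_leI)
  qed
  also have "\<dots> = (\<Prod>b\<in>(Basis::'a set). (\<integral>\<^sup>+s. ennreal (1 / (1 + \<bar>s\<bar>)\<^sup>2) \<partial>lborel))"
    by (rule nn_integral_lborel_prod) auto
  also have "\<dots> < \<infinity>"
    using nn_integral_weight_line by (intro ennreal_prod_less_top_weight)
  finally show "(\<integral>\<^sup>+(x::'a). ennreal (norm (1 / br x ^ k)) \<partial>lborel) < \<infinity>" .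
qed

definition wint :: "'a::euclidean_space itself \<Rightarrow> nat \<Rightarrow> real" where
  "wint _ k = (LINT x|lborel. 1 / br (x::'a) ^ k)"

lemma wint_nonneg [simp]: "0 \<le> wint T k"
  unfolding wint_def by (rule integral_nonneg_AE) simp

lemma weight_bound:
  fixes f :: "'a::euclidean_space \<Rightarrow> 'b::{banach, second_countable_topology}"
  assumes f: "f \<in> borel_measurable borel" and c: "\<And>x. norm (f x) \<le> c / br x ^ k" and k: "2 * DIM('a) \<le> k"
  shows integrable_by_weight: "integrable lborel f"
    and integral_by_weight: "norm (LINT x|lborel. f x) \<le> c * wint TYPE('a) k"
    and norm_integral_by_weight: "(LINT x|lborel. norm (f x)) \<le> c * wint TYPE('a) k"
proof -
  have I: "integrable lborel (\<lambda>x::'a. c * (1 / br x ^ k))" by (intro integrable_mult_right integrable_weight k)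
  have "norm (f x) \<le> norm (c * (1 / br x ^ k))" for x
    using c[of x] by (metis abs_ge_self order_trans real_norm_def times_divide_eq_right mult.right_neutral)
  then show i: "integrable lborel f"
    by (intro Bochner_Integration.integrable_bound[OF I]) (use f in auto)
  have "(LINT x|lborel. norm (f x)) \<le> (LINT x|lborel. c * (1 / br (x::'a) ^ k))"
    by (rule integral_mono[OF integrable_norm[OF i] I]) (use c in auto)
  also have "\<dots> = c * wint TYPE('a) k" unfolding wint_def by (rule integral_mult_right_zero)
  finally show "(LINT x|lborel. norm (f x)) \<le> c * wint TYPE('a) k" .
  then show "norm (LINT x|lborel. f x) \<le> c * wint TYPE('a) k"
    using integral_norm_bound order_trans by blast
qed

lemma lborel_affine_integral:
  fixes f :: "'a::euclidean_space \<Rightarrow> 'b::{banach, second_countable_topology}"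
  assumes [measurable]: "f \<in> borel_measurable borel" and "c \<noteq> 0"
  shows "(LINT x|lborel. f (b + c *\<^sub>R x)) = (1 / \<bar>c\<bar> ^ DIM('a)) *\<^sub>R (LINT x|lborel. f x)"
    and "integrable lborel (\<lambda>x. f (b + c *\<^sub>R x)) \<longleftrightarrow> integrable lborel f"
proof -
  have "(LINT x|lborel. f x) = (LINT x|density (distr lborel borel (\<lambda>x. b + c *\<^sub>R x)) (\<lambda>_. ennreal (\<bar>c\<bar> ^ DIM('a))). f x)"
    using lborel_affine[OF assms(2), of b] by simp
  also have "\<dots> = \<bar>c\<bar> ^ DIM('a) *\<^sub>R (LINT x|lborel. f (b + c *\<^sub>R x))"
    by (subst integral_density) (auto simp: integral_distr)
  finally show "(LINT x|lborel. f (b + c *\<^sub>R x)) = (1 / \<bar>c\<bar> ^ DIM('a)) *\<^sub>R (LINT x|lborel. f x)"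
    using assms(2) by simp
  have "integrable lborel f \<longleftrightarrow> integrable (density (distr lborel borel (\<lambda>x. b + c *\<^sub>R x)) (\<lambda>_. ennreal (\<bar>c\<bar> ^ DIM('a)))) f"
    using lborel_affine[OF assms(2), of b] by simp
  also have "\<dots> \<longleftrightarrow> integrable lborel (\<lambda>x. f (b + c *\<^sub>R x))"
  proof -
    have "integrable lborel (\<lambda>x. \<bar>c\<bar> ^ DIM('a) *\<^sub>R f (b + c *\<^sub>R x)) \<longleftrightarrow> integrable lborel (\<lambda>x. f (b + c *\<^sub>R x))"
    proof
      assume "integrable lborel (\<lambda>x. \<bar>c\<bar> ^ DIM('a) *\<^sub>R f (b + c *\<^sub>R x))"
      from integrable_scaleR_right[OF this, of "1 / \<bar>c\<bar> ^ DIM('a)"]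
      show "integrable lborel (\<lambda>x. f (b + c *\<^sub>R x))" using assms(2) by simp
    qed simp
    then show ?thesis by (subst integrable_density) (auto simp: integrable_distr_eq)
  qed
  finally show "integrable lborel (\<lambda>x. f (b + c *\<^sub>R x)) \<longleftrightarrow> integrable lborel f" by simp
qed

lemma lborel_shift_integral:
  fixes f :: "'a::euclidean_space \<Rightarrow> 'b::{banach, second_countable_topology}"
  assumes "f \<in> borel_measurable borel"
  shows "(LINT x|lborel. f (x + b)) = (LINT x|lborel. f x)" "(LINT x|lborel. f (x - b)) = (LINT x|lborel. f x)"
    "(LINT x|lborel. f (b - x)) = (LINT x|lborel. f x)" "(LINT x|lborel. f (- x)) = (LINT x|lborel. f x)"
  using lborel_affine_integral(1)[OF assms, of 1 b] lborel_affine_integral(1)[OF assms, of 1 "-b"]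
    lborel_affine_integral(1)[OF assms, of "-1" b] lborel_affine_integral(1)[OF assms, of "-1" 0]
  by (simp_all add: add.commute)

lemma Fubini_by_bound:
  fixes H :: "'a::euclidean_space \<Rightarrow> 'b::euclidean_space \<Rightarrow> complex"
  assumes H: "(\<lambda>(x, y). H x y) \<in> borel_measurable (borel \<Otimes>\<^sub>M borel)"
    and a: "integrable lborel a" and b: "integrable lborel b"
    and bd: "\<And>x y. norm (H x y) \<le> a x * b y"
  shows "(LINT x|lborel. LINT y|lborel. H x y) = (LINT y|lborel. LINT x|lborel. H x y)"
    and "integrable lborel (\<lambda>x. LINT y|lborel. H x y)"
proof -
  have H1[measurable]: "(\<lambda>(x, y). H x y) \<in> borel_measurable (lborel \<Otimes>\<^sub>M lborel)" using H by simp
  have [measurable]: "H x \<in> borel_measurable borel" for x using H by measurable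
  have bd': "norm (H x y) \<le> norm (a x * b y)" for x y
    using bd[of x y] abs_ge_self[of "a x * b y"] unfolding real_norm_def by linarith
  have i2: "integrable lborel (\<lambda>y. H x y)" for x
    by (rule Bochner_Integration.integrable_bound[OF integrable_mult_right[OF b, of "a x"]])
      (use bd' in auto)
  have I: "integrable (lborel \<Otimes>\<^sub>M lborel) (\<lambda>(x, y). H x y)"
  proof (rule lborel_pair.Fubini_integrable[OF H1])
    show "AE x in lborel. integrable lborel (\<lambda>y. case (x, y) of (x, y) \<Rightarrow> H x y)" using i2 by simp
    show "integrable lborel (\<lambda>x. LINT y|lborel. norm (case (x, y) of (x, y) \<Rightarrow> H x y))"
    proof (rule Bochner_Integration.integrable_bound)
      show "integrable lborel (\<lambda>x. a x * (LINT y|lborel. b y))" by (intro integrable_mult_left a)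
      have "norm (LINT y|lborel. norm (H x y)) \<le> norm (a x * (LINT y|lborel. b y))" for x
      proof -
        have "(LINT y|lborel. norm (H x y)) \<le> (LINT y|lborel. a x * b y)"
          by (intro integral_mono integrable_norm i2 integrable_mult_right b bd)
        then show ?thesis using abs_ge_self[of "a x * (LINT y|lborel. b y)"] by simp
      qed
      then show "AE x in lborel. norm (LINT y|lborel. norm (case (x, y) of (x, y) \<Rightarrow> H x y)) \<le> norm (a x * (LINT y|lborel. b y))"
        by simp
    qed measurable
  qed
  from lborel_pair.Fubini_integral[OF I]
  show "(LINT x|lborel. LINT y|lborel. H x y) = (LINT y|lborel. LINT x|lborel. H x y)" by simp
  from lborel_pair.integrable_fst[OF I] show "integrable lborel (\<lambda>x. LINT y|lborel. H x y)" by simp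
qed

lemma schwartz_borel [measurable_dest]: "schwartz f \<Longrightarrow> f \<in> borel_measurable borel"
  by (intro smooth_borel schwartz_smooth)

lemma schwartz_integrable:
  fixes f :: "'n::finite cfun"
  assumes "schwartz f" shows "integrable lborel f"
  by (rule integrable_by_weight[OF schwartz_borel[OF assms] norm_le_sn[OF assms] order_refl])

section \<open>Integrals depending on a parameter\<close>

lemma has_derivative_quadratic:
  fixes f :: "'a::real_normed_vector \<Rightarrow> 'b::real_normed_vector"
  assumes "bounded_linear L" and "\<And>h. norm (f (x + h) - f x - L h) \<le> C * (norm h)\<^sup>2"
  shows "(f has_derivative L) (at x)"
  unfolding has_derivative_iff_norm
proof (intro conjI assms(1))
  show "((\<lambda>y. norm (f y - f x - L (y - x)) / norm (y - x)) \<longlongrightarrow> 0) (at x)"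
  proof (rule Lim_null_comparison)
    show "((\<lambda>y. C * norm (y - x)) \<longlongrightarrow> 0) (at x)" by (auto intro!: tendsto_eq_intros)
    have "norm (f y - f x - L (y - x)) / norm (y - x) \<le> C * norm (y - x)" if "y \<noteq> x" for y
      using assms(2)[of "y - x"] that by (simp add: power2_eq_square field_simps)
    then show "\<forall>\<^sub>F y in at x. norm (norm (f y - f x - L (y - x)) / norm (y - x)) \<le> C * norm (y - x)"
      unfolding eventually_at by (intro exI[of _ 1]) auto
  qed
qed

text \<open>The hypotheses for differentiating under the integral sign to any order.\<close>

definition param_family :: "'y measure \<Rightarrow> ('y \<Rightarrow> 'n::finite cfun) \<Rightarrow> bool" where
  "param_family M \<Theta> \<longleftrightarrow> (\<forall>y. smooth (\<Theta> y)) \<and>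
     (\<forall>is t. (\<lambda>y. partial_derivs is (\<Theta> y) t) \<in> borel_measurable M) \<and>
     (\<forall>N. \<exists>b. integrable M b \<and> (\<forall>y t. jet N (\<Theta> y) t \<le> b y))"

lemma param_family_bound:
  assumes "param_family M \<Theta>"
  obtains b where "integrable M b" "\<And>y t. jet N (\<Theta> y) t \<le> b y"
proof -
  have "\<exists>b. integrable M b \<and> (\<forall>y t. jet N (\<Theta> y) t \<le> b y)"
    using assms by (simp add: param_family_def)
  then show thesis using that by auto
qed

lemma param_family_partial:
  assumes "param_family M \<Theta>" shows "param_family M (\<lambda>y. partial_deriv i (\<Theta> y))"
  unfolding param_family_def
proof (intro conjI allI)
  show "smooth (partial_deriv i (\<Theta> y))" for y
    using assms smooth_partial_deriv unfolding param_family_def by blast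
  show "(\<lambda>y. partial_derivs is (partial_deriv i (\<Theta> y)) t) \<in> borel_measurable M" for "is" t
    using assms unfolding param_family_def partial_derivs_snoc[symmetric] by blast
  fix N
  obtain b where "integrable M b" "\<And>y t. jet (Suc N) (\<Theta> y) t \<le> b y"
    by (rule param_family_bound[OF assms, where N="Suc N"]) (rule that, auto)
  then show "\<exists>b. integrable M b \<and> (\<forall>y t. jet N (partial_deriv i (\<Theta> y)) t \<le> b y)"
    by (intro exI[of _ b] conjI allI order_trans[OF jet_partial_deriv])
qed

lemma param_family_integrable:
  assumes "param_family M \<Theta>" shows "integrable M (\<lambda>y. partial_derivs is (\<Theta> y) t)"
proof -
  obtain b where b: "integrable M b" "\<And>y t. jet (length is) (\<Theta> y) t \<le> b y"
    by (rule param_family_bound[OF assms, where N="length is"]) (rule that, auto)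
  have "norm (partial_derivs is (\<Theta> y) t) \<le> norm (b y)" for y
    using b(2)[of y t] partial_derivs_le_jet[of "is" "length is" "\<Theta> y" t] by simp
  then show ?thesis
    using assms unfolding param_family_def by (intro Bochner_Integration.integrable_bound[OF b(1)]) auto
qed

text \<open>The second order Taylor bound is integrable in the parameter and gives a quadratic error term for the integral.\<close>

lemma param_integral_derivative:
  fixes \<Theta> :: "'y \<Rightarrow> 'n::finite cfun"
  assumes P: "param_family M \<Theta>"
  shows "(\<lambda>t. LINT y|M. \<Theta> y t) differentiable (at t)"
    and "partial_deriv i (\<lambda>t. LINT y|M. \<Theta> y t) t = (LINT y|M. partial_deriv i (\<Theta> y) t)"
proof -
  define c where "c i = (LINT y|M. partial_deriv i (\<Theta> y) t)" for i
  obtain b where b: "integrable M b" "\<And>y t. jet 2 (\<Theta> y) t \<le> b y"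
    by (rule param_family_bound[OF P, where N=2]) (rule that, auto)
  have sm: "smooth (\<Theta> y)" for y using P unfolding param_family_def by blast
  have I0: "integrable M (\<lambda>y. \<Theta> y t)" for t using param_family_integrable[OF P, of "[]"] by simp
  have I1: "integrable M (\<lambda>y. partial_deriv i (\<Theta> y) t)" for t i
    using param_family_integrable[OF P, of "[i]"] by (simp add: partial_derivs_Cons)
  have D: "((\<lambda>t. LINT y|M. \<Theta> y t) has_derivative (\<lambda>h. \<Sum>i\<in>UNIV. (h $ i) *\<^sub>R c i)) (at t)"
  proof (rule has_derivative_quadratic)
    have "linear (\<lambda>h. \<Sum>i\<in>UNIV. (h $ i) *\<^sub>R c i)"
      by (rule linearI) (auto simp: scaleR_left_distrib sum.distrib scaleR_sum_right)
    then show "bounded_linear (\<lambda>h. \<Sum>i\<in>UNIV. (h $ i) *\<^sub>R c i)" using linear_conv_bounded_linear by blast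
    fix h :: "real^'n"
    have "(LINT y|M. \<Theta> y (t + h)) - (LINT y|M. \<Theta> y t) - (\<Sum>i\<in>UNIV. (h $ i) *\<^sub>R c i)
       = (LINT y|M. \<Theta> y (t + h) - \<Theta> y t - (\<Sum>i\<in>UNIV. (h $ i) *\<^sub>R partial_deriv i (\<Theta> y) t))"
      unfolding c_def using I0 I1 by simp
    also have "norm \<dots> \<le> (LINT y|M. real CARD('n) * b y * norm h ^ 2)"
    proof (rule norm_integral_le)
      show "integrable M (\<lambda>y. \<Theta> y (t + h) - \<Theta> y t - (\<Sum>i\<in>UNIV. (h $ i) *\<^sub>R partial_deriv i (\<Theta> y) t))"
        using I0 I1 by auto
      show "norm (\<Theta> y (t + h) - \<Theta> y t - (\<Sum>i\<in>UNIV. (h $ i) *\<^sub>R partial_deriv i (\<Theta> y) t)) \<le> real CARD('n) * b y * norm h ^ 2" for y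
        by (rule smooth_taylor2[OF sm b(2)])
    qed (use b in auto)
    finally show "norm ((LINT y|M. \<Theta> y (t + h)) - (LINT y|M. \<Theta> y t) - (\<Sum>i\<in>UNIV. (h $ i) *\<^sub>R c i))
      \<le> (real CARD('n) * (LINT y|M. b y)) * (norm h)\<^sup>2" by simp
  qed
  then show "(\<lambda>t. LINT y|M. \<Theta> y t) differentiable (at t)" unfolding differentiable_def by blast
  show "partial_deriv i (\<lambda>t. LINT y|M. \<Theta> y t) t = (LINT y|M. partial_deriv i (\<Theta> y) t)"
    unfolding partial_deriv_eq[OF D] c_def[symmetric]
    by (subst sum.remove[of _ i]) (auto simp: axis_def intro!: sum.neutral)
qed

lemma param_integral:
  fixes \<Theta> :: "'y \<Rightarrow> 'n::finite cfun"
  assumes P: "param_family M \<Theta>"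
  shows smooth_param_integral: "smooth (\<lambda>t. LINT y|M. \<Theta> y t)"
    and partial_derivs_param_integral:
      "partial_derivs is (\<lambda>t. LINT y|M. \<Theta> y t) = (\<lambda>t. LINT y|M. partial_derivs is (\<Theta> y) t)"
proof -
  show "smooth (\<lambda>t. LINT y|M. \<Theta> y t)"
  proof (rule smooth_coinduct[where P="\<lambda>f. \<exists>\<Theta>. param_family M \<Theta> \<and> f = (\<lambda>t. LINT y|M. \<Theta> y t)"])
    show "\<exists>\<Theta>'. param_family M \<Theta>' \<and> (\<lambda>t. LINT y|M. \<Theta> y t) = (\<lambda>t. LINT y|M. \<Theta>' y t)"
      by (intro exI[of _ \<Theta>] conjI P refl)
  next
    fix f x assume "\<exists>\<Theta>. param_family M \<Theta> \<and> f = (\<lambda>t. LINT y|M. \<Theta> y t)"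
    then obtain \<Theta> where f: "param_family M \<Theta>" "f = (\<lambda>t. LINT y|M. \<Theta> y t)" by (elim exE conjE)
    show "f differentiable (at x)" unfolding f(2) by (rule param_integral_derivative[OF f(1)])
  next
    fix f i assume "\<exists>\<Theta>. param_family M \<Theta> \<and> f = (\<lambda>t. LINT y|M. \<Theta> y t)"
    then obtain \<Theta> where f: "param_family M \<Theta>" "f = (\<lambda>t. LINT y|M. \<Theta> y t)" by (elim exE conjE)
    have "partial_deriv i f = (\<lambda>t. LINT y|M. partial_deriv i (\<Theta> y) t)"
      unfolding f(2) by (rule ext, rule param_integral_derivative[OF f(1)])
    then show "\<exists>\<Theta>. param_family M \<Theta> \<and> partial_deriv i f = (\<lambda>t. LINT y|M. \<Theta> y t)"
      by (intro exI[of _ "\<lambda>y. partial_deriv i (\<Theta> y)"] conjI param_family_partial f(1))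
  qed
  show "partial_derivs is (\<lambda>t. LINT y|M. \<Theta> y t) = (\<lambda>t. LINT y|M. partial_derivs is (\<Theta> y) t)"
    using P
  proof (induction "is" arbitrary: \<Theta> rule: rev_induct)
    case (snoc i "is")
    have eq: "partial_deriv i (\<lambda>t. LINT y|M. \<Theta> y t) = (\<lambda>t. LINT y|M. partial_deriv i (\<Theta> y) t)"
      by (rule ext, rule param_integral_derivative[OF snoc.prems])
    show ?case
      unfolding partial_derivs_snoc eq by (rule snoc.IH[OF param_family_partial[OF snoc.prems]])
  qed (simp only: partial_derivs_Nil)
qed

lemma schwartz_param_integral:
  fixes \<Theta> :: "'y \<Rightarrow> 'n::finite cfun"
  assumes sm: "\<And>y. smooth (\<Theta> y)"
    and meas: "\<And>is t. (\<lambda>y. partial_derivs is (\<Theta> y) t) \<in> borel_measurable M"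
    and bd: "\<And>k N. \<exists>b. integrable M b \<and> (\<forall>y t. br t ^ k * jet N (\<Theta> y) t \<le> b y)"
  shows "schwartz (\<lambda>t. LINT y|M. \<Theta> y t)" and "param_family M \<Theta>"
    and "\<And>b. integrable M b \<Longrightarrow> (\<And>y t. br t ^ k * jet N (\<Theta> y) t \<le> b y) \<Longrightarrow> sn k N (\<lambda>t. LINT y|M. \<Theta> y t) \<le> (LINT y|M. b y)"
proof -
  show P: "param_family M \<Theta>"
    unfolding param_family_def
  proof (intro conjI allI sm meas)
    fix N show "\<exists>b. integrable M b \<and> (\<forall>y t. jet N (\<Theta> y) t \<le> b y)" using bd[of 0 N] by simp
  qed
  have *: "br t ^ k * jet N (\<lambda>t. LINT y|M. \<Theta> y t) t \<le> (LINT y|M. b y)"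
    if b: "integrable M b" "\<And>y t. br t ^ k * jet N (\<Theta> y) t \<le> b y" for k N b t
  proof -
    have I: "integrable M (\<lambda>y. norm (partial_derivs is (\<Theta> y) t))" for "is"
      by (rule integrable_norm[OF param_family_integrable[OF P]])
    have "jet N (\<lambda>t. LINT y|M. \<Theta> y t) t \<le> (\<Sum>is | length is \<le> N. LINT y|M. norm (partial_derivs is (\<Theta> y) t))"
      unfolding jet_def partial_derivs_param_integral[OF P] by (intro sum_mono integral_norm_bound)
    also have "\<dots> = (LINT y|M. jet N (\<Theta> y) t)"
      unfolding jet_def using I by simp
    finally have "br t ^ k * jet N (\<lambda>t. LINT y|M. \<Theta> y t) t \<le> (LINT y|M. br t ^ k * jet N (\<Theta> y) t)"
      by (simp add: mult_left_mono)
    also have "\<dots> \<le> (LINT y|M. b y)"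
      unfolding jet_def using I b by (intro integral_mono) (auto simp: jet_def)
    finally show ?thesis .
  qed
  show "schwartz (\<lambda>t. LINT y|M. \<Theta> y t)"
  proof (rule schwartzI[OF smooth_param_integral[OF P]])
    fix k N
    obtain b where "integrable M b" "\<And>y t. br t ^ k * jet N (\<Theta> y) t \<le> b y" using bd[of k N] by auto
    from *[OF this] show "\<exists>c. \<forall>t. br t ^ k * jet N (\<lambda>t. LINT y|M. \<Theta> y t) t \<le> c" by (intro exI allI)
  qed
  show "\<And>b. integrable M b \<Longrightarrow> (\<And>y t. br t ^ k * jet N (\<Theta> y) t \<le> b y) \<Longrightarrow> sn k N (\<lambda>t. LINT y|M. \<Theta> y t) \<le> (LINT y|M. b y)"
    by (rule sn_leI) (rule *)
qed

section \<open>The Fourier transform of Schwartz functions\<close>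

lemma coord_has_derivative:
  "((\<lambda>t. complex_of_real (t $ j)) has_derivative (\<lambda>h. complex_of_real (h $ j))) (at t)"
  by (intro has_derivative_of_real bounded_linear.has_derivative[OF bounded_linear_vec_nth] has_derivative_ident)

lemma partial_derivs_const: "partial_derivs is (\<lambda>t. c) = (\<lambda>t. if is = [] then c else 0)"
  by (induction "is") (auto simp: partial_derivs_Cons partial_deriv_const)

lemma partial_deriv_coord: "partial_deriv i (\<lambda>t. complex_of_real (t $ j)) = (\<lambda>t. if i = j then 1 else 0)"
  by (rule ext, subst partial_deriv_eq[OF coord_has_derivative]) (simp add: axis_def)

lemma smooth_coord: "smooth (\<lambda>t. complex_of_real (t $ j))"
proof (rule smooth_coinduct[where P="\<lambda>f. f = (\<lambda>t. complex_of_real (t $ j)) \<or> (\<exists>c. f = (\<lambda>t. c))"])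
  fix f x assume "f = (\<lambda>t. complex_of_real (t $ j)) \<or> (\<exists>c. f = (\<lambda>t. c))"
  moreover have "(\<lambda>t. complex_of_real (t $ j)) differentiable at x"
    unfolding differentiable_def by (rule exI, rule coord_has_derivative)
  ultimately show "f differentiable at x" by auto
next
  fix f i assume "f = (\<lambda>t. complex_of_real (t $ j)) \<or> (\<exists>c. f = (\<lambda>t. c))"
  then show "partial_deriv i f = (\<lambda>t. complex_of_real (t $ j)) \<or> (\<exists>c. partial_deriv i f = (\<lambda>t. c))"
    by (auto simp: partial_deriv_coord partial_deriv_const)
qed simp

lemma jet_coord: "jet N (\<lambda>t. complex_of_real (t $ j)) (t::real^'n::finite) \<le> jet_const TYPE('n) N * br t"
proof -
  have "jet N (\<lambda>t. complex_of_real (t $ j)) t \<le> real (card {is::'n list. length is \<le> N}) * br t"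
  proof (rule jet_leI)
    fix "is" :: "'n list"
    show "norm (partial_derivs is (\<lambda>t. complex_of_real (t $ j)) t) \<le> br t"
    proof (cases "is" rule: rev_cases)
      case Nil
      then show ?thesis using component_le_norm_cart[of t j] norm_le_br[of t] by simp
    next
      case (snoc js i)
      then show ?thesis using br_ge1[of t]
        by (simp add: partial_derivs_snoc partial_deriv_coord partial_derivs_const)
    qed
  qed
  also have "\<dots> \<le> jet_const TYPE('n) N * br t"
    unfolding jet_const_def by (intro mult_right_mono) (auto simp: mult_le_cancel_left1)
  finally show ?thesis .
qed

text \<open>The factor that \<open>is\<close>-fold differentiation of \<open>ft q\<close> produces under the integral.\<close>

definition mon :: "'n list \<Rightarrow> 'n::finite cfun" where
  "mon is t = (\<Prod>i\<leftarrow>is. - \<i> * complex_of_real (t $ i))"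

lemma mon_simps [simp]: "mon [] t = 1" "mon (i # is) t = - \<i> * complex_of_real (t $ i) * mon is t"
  by (auto simp: mon_def)

lemma schwartz_mon:
  fixes q :: "'n::finite cfun"
  assumes "schwartz q"
  shows "schwartz (\<lambda>t. mon is t * q t)"
    and "sn k N (\<lambda>t. mon is t * q t) \<le> ((jet_const TYPE('n) N)\<^sup>2) ^ length is * sn (k + length is) N q"
proof (induction "is" arbitrary: k)
  case (Cons i "is")
  let ?J = "jet_const TYPE('n) N"
  let ?c = "\<lambda>t::real^'n. - \<i> * complex_of_real (t $ i)"
  let ?q = "\<lambda>t. mon is t * q t"
  have sm: "smooth ?c" by (rule smooth_cmult[OF smooth_coord])
  have jc: "jet M ?c t \<le> jet_const TYPE('n) M * br t ^ 1" for t M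
  proof -
    have "jet M ?c t = norm (- \<i>) * jet M (\<lambda>t. complex_of_real (t $ i)) t"
      by (rule jet_cmult[OF smooth_coord])
    then show ?thesis using jet_coord[of M i t] by (simp only: norm_minus_cancel norm_ii mult_1 power_one_right)
  qed
  have eq: "(\<lambda>t. mon (i # is) t * q t) = (\<lambda>t. ?c t * ?q t)" by (simp add: fun_eq_iff)
  { case 1 show ?case unfolding eq by (rule schwartz_mult_slow[OF sm Cons.IH(1)]) (use jc in blast) }
  { case 2
    have "sn k N (\<lambda>t. ?c t * ?q t) \<le> ?J * (?J * sn (k + 1) N ?q)"
      by (rule sn_leI, rule schwartz_mult_bound[OF sm Cons.IH(1) jc])
    also have "\<dots> \<le> ?J * (?J * ((?J\<^sup>2) ^ length is * sn (k + 1 + length is) N q))"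
      by (intro mult_left_mono Cons.IH) auto
    finally show ?case unfolding eq by (simp add: power2_eq_square algebra_simps) }
qed (use assms in auto)

text \<open>The Fourier transform without its normalising constant.\<close>

definition ft :: "'n::finite cfun \<Rightarrow> 'n cfun" where
  "ft q \<xi> = (LINT t|lborel. q t * ee \<xi> t)"

lemma ee_borel1 [measurable]: "ee \<xi> \<in> borel_measurable borel"
  by (rule smooth_borel[OF smooth_ee])

lemma ee_borel2 [measurable]: "(\<lambda>\<xi>. ee \<xi> t) \<in> borel_measurable borel"
  using ee_borel1[of t] by (simp add: ee_swap[of _ t])

lemma schwartz_ee: "schwartz q \<Longrightarrow> schwartz (\<lambda>t. ee \<xi> t * q t)"
  using schwartz_tf(1)[of q "(0, \<xi>)"] by (simp add: tf_def[abs_def])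

lemma schwartz_ee': "schwartz q \<Longrightarrow> schwartz (\<lambda>t. q t * ee \<xi> t)"
  using schwartz_ee by (simp add: mult.commute)

lemma ft_integrable: "schwartz q \<Longrightarrow> integrable lborel (\<lambda>t. q t * ee \<xi> t)"
  by (intro schwartz_integrable schwartz_ee')

lemma smooth_ft:
  fixes q :: "'n::finite cfun"
  assumes q: "schwartz q"
  shows "smooth (ft q)" and "partial_derivs is (ft q) \<xi> = ft (\<lambda>t. mon is t * q t) \<xi>"
proof -
  let ?\<Theta> = "\<lambda>t \<xi>. q t * ee t \<xi>"
  have pd: "partial_derivs is (?\<Theta> t) = (\<lambda>\<xi>. q t * (mon is t * ee t \<xi>))" for t "is"
    by (simp add: partial_derivs_cmult[OF smooth_ee] partial_derivs_ee mon_def)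
  have P: "param_family lborel ?\<Theta>"
    unfolding param_family_def
  proof (intro conjI allI)
    show "smooth (?\<Theta> t)" for t by (rule smooth_cmult[OF smooth_ee])
    show "(\<lambda>t. partial_derivs is (?\<Theta> t) \<xi>) \<in> borel_measurable lborel" for "is" \<xi>
    proof -
      have "(\<lambda>t. (mon is t * q t) * ee \<xi> t) \<in> borel_measurable borel"
        by (intro schwartz_borel schwartz_ee' schwartz_mon q)
      then show ?thesis unfolding pd by (simp add: ee_swap[of _ \<xi>] mult.commute mult.left_commute)
    qed
    fix N
    have "jet N (?\<Theta> t) \<xi> \<le> norm (q t) * (jet_const TYPE('n) N * br t ^ N)" for t \<xi>
      unfolding jet_cmult[OF smooth_ee] by (intro mult_left_mono jet_ee) auto
    moreover have "integrable lborel (\<lambda>t. norm (q t) * (jet_const TYPE('n) N * br t ^ N))"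
    proof (rule integrable_by_weight)
      show "(\<lambda>t. norm (q t) * (jet_const TYPE('n) N * br t ^ N)) \<in> borel_measurable borel"
        using schwartz_borel[OF q] by measurable
      show "norm (norm (q t) * (jet_const TYPE('n) N * br t ^ N)) \<le> (sn (2 * DIM(real^'n) + N) 0 q * jet_const TYPE('n) N) / br t ^ (2 * DIM(real^'n))" for t
      proof -
        have "norm (q t) * (jet_const TYPE('n) N * br t ^ N) \<le> sn (2 * DIM(real^'n) + N) 0 q / br t ^ (2 * DIM(real^'n) + N) * (jet_const TYPE('n) N * br t ^ N)"
          by (intro mult_right_mono norm_le_sn q) auto
        then show ?thesis by (simp add: power_add field_simps norm_mult)
      qed
    qed simp
    ultimately show "\<exists>b. integrable lborel b \<and> (\<forall>t \<xi>. jet N (?\<Theta> t) \<xi> \<le> b t)"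
      by (intro exI[of _ "\<lambda>t. norm (q t) * (jet_const TYPE('n) N * br t ^ N)"] conjI allI)
  qed
  have ft: "ft q = (\<lambda>\<xi>. LINT t|lborel. ?\<Theta> t \<xi>)" by (rule ext) (simp add: ft_def ee_swap)
  show "smooth (ft q)" unfolding ft by (rule smooth_param_integral[OF P])
  have "partial_derivs is (ft q) \<xi> = (LINT t|lborel. q t * (mon is t * ee t \<xi>))"
    unfolding ft partial_derivs_param_integral[OF P] pd ..
  also have "\<dots> = ft (\<lambda>t. mon is t * q t) \<xi>"
    unfolding ft_def by (rule Bochner_Integration.integral_cong) (auto simp: ee_swap[of _ \<xi>])
  finally show "partial_derivs is (ft q) \<xi> = ft (\<lambda>t. mon is t * q t) \<xi>" .
qed

text \<open>Translation invariance of the integral gives \<open>\<integral> (Q(t + s e\<^sub>i) - Q(t)) dt = 0\<close> for all \<open>s\<close>;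
  the first-order term in \<open>s\<close> must therefore vanish.\<close>

lemma integral_partial_deriv:
  fixes Q :: "'n::finite cfun"
  assumes Q: "schwartz Q"
  shows "(LINT t|lborel. partial_deriv i Q t) = 0"
proof -
  define I where "I = (LINT t|lborel. partial_deriv i Q t)"
  let ?k = "2 * DIM(real^'n)"
  define B where "B = real CARD('n) * (2 ^ ?k * sn ?k 2 Q) * wint TYPE(real^'n) ?k"
  have bound: "s * norm I \<le> B * s\<^sup>2" if s: "0 < s" "s \<le> 1" for s :: real
  proof -
    define h where "h = s *\<^sub>R (axis i 1 :: real^'n)"
    have nh: "norm h = s" using s by (simp add: h_def)
    have i1: "integrable lborel (\<lambda>t. Q (t + h))" "integrable lborel Q" "integrable lborel (partial_deriv i Q)"
      by (intro schwartz_integrable schwartz_translate schwartz_partial_deriv Q)+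
    have "- (s *\<^sub>R I) = (LINT t|lborel. Q (t + h) - Q t - s *\<^sub>R partial_deriv i Q t)"
      using i1 lborel_shift_integral(1)[OF schwartz_borel[OF Q], of h] by (simp add: I_def)
    moreover have "norm \<dots> \<le> (real CARD('n) * (2 ^ ?k * sn ?k 2 Q) * s\<^sup>2) * wint TYPE(real^'n) ?k"
    proof (rule integral_by_weight[OF _ _ order_refl])
      show "(\<lambda>t. Q (t + h) - Q t - s *\<^sub>R partial_deriv i Q t) \<in> borel_measurable borel"
        using i1 by (auto dest: borel_measurable_integrable)
      fix t
      have eq: "(\<Sum>j\<in>UNIV. (h $ j) *\<^sub>R partial_deriv j Q t) = s *\<^sub>R partial_deriv i Q t"
        unfolding h_def by (subst sum.remove[of _ i]) (auto simp: axis_def intro!: sum.neutral)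
      have "norm (Q (t + h) - Q t - (\<Sum>j\<in>UNIV. (h $ j) *\<^sub>R partial_deriv j Q t))
          \<le> real CARD('n) * (2 ^ ?k * sn ?k 2 Q / br t ^ ?k) * norm h ^ 2"
      proof (rule smooth_taylor2[OF schwartz_smooth[OF Q]])
        fix r assume "r \<in> closed_segment t (t + h)"
        then have "norm (t - r) \<le> 1" using segment_bound1[of r t "t + h"] nh s by (simp add: norm_minus_commute)
        then have "br r ^ ?k * 2 ^ ?k \<ge> br t ^ ?k"
          using order_trans[OF br_add_power[of r "t - r" ?k] mult_left_mono[OF power_mono[of "br (t - r)" 2 ?k]]]
          by (simp add: br_def)
        then have "br t ^ ?k * jet 2 Q r \<le> (br r ^ ?k * 2 ^ ?k) * jet 2 Q r" by (rule mult_right_mono) simp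
        also have "\<dots> \<le> 2 ^ ?k * sn ?k 2 Q" using sn_bound[OF Q, of r ?k 2] by (simp add: algebra_simps)
        finally show "jet 2 Q r \<le> 2 ^ ?k * sn ?k 2 Q / br t ^ ?k" by (simp add: field_simps)
      qed
      then show "norm (Q (t + h) - Q t - s *\<^sub>R partial_deriv i Q t) \<le> real CARD('n) * (2 ^ ?k * sn ?k 2 Q) * s\<^sup>2 / br t ^ ?k"
        unfolding eq nh by simp
    qed
    ultimately have "norm (- (s *\<^sub>R I)) \<le> B * s\<^sup>2" by (simp add: B_def algebra_simps)
    then show ?thesis using s by simp
  qed
  have "norm I \<le> B * s" if "0 < s" "s \<le> 1" for s
    using bound[OF that] that by (simp add: power2_eq_square)
  then have "eventually (\<lambda>s. norm I \<le> B * s) (at_right 0)"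
    unfolding eventually_at by (intro exI[of _ 1]) (auto simp: dist_real_def)
  moreover have "((\<lambda>s. B * s) \<longlongrightarrow> B * 0) (at_right 0)" by (intro tendsto_intros)
  ultimately have "norm I \<le> B * 0" by (intro tendsto_lowerbound) auto
  then show ?thesis by (simp add: I_def)
qed

lemma ft_partial_deriv:
  assumes q: "schwartz q"
  shows "ft (partial_deriv i q) \<xi> = \<i> * complex_of_real (\<xi> $ i) * ft q \<xi>"
proof -
  have "partial_deriv i (\<lambda>t. q t * ee \<xi> t) t = partial_deriv i q t * ee \<xi> t - \<i> * complex_of_real (\<xi> $ i) * (q t * ee \<xi> t)" for t
    using partial_deriv_mult[OF smooth_differentiable[OF schwartz_smooth[OF q], of t] ee_differentiable[of \<xi> t], of i]
    by (simp add: partial_deriv_ee algebra_simps)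
  then have "0 = (LINT t|lborel. partial_deriv i q t * ee \<xi> t - \<i> * complex_of_real (\<xi> $ i) * (q t * ee \<xi> t))"
    using integral_partial_deriv[OF schwartz_ee'[OF q, of \<xi>], of i] by simp
  also have "\<dots> = ft (partial_deriv i q) \<xi> - \<i> * complex_of_real (\<xi> $ i) * ft q \<xi>"
    unfolding ft_def using ft_integrable[OF q] ft_integrable[OF schwartz_partial_deriv[OF q]] by simp
  finally show ?thesis by simp
qed

lemma norm_ft_iterated_deriv:
  assumes q: "schwartz q"
  shows "norm (ft (partial_derivs (replicate k i) q) \<xi>) = \<bar>\<xi> $ i\<bar> ^ k * norm (ft q \<xi>)"
proof (induction k)
  case (Suc k)
  have "schwartz (partial_derivs (replicate k i) q)"
    by (induction k) (auto simp: partial_derivs_Cons q intro: schwartz_partial_deriv)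
  then show ?case using Suc by (simp add: partial_derivs_Cons ft_partial_deriv norm_mult)
qed simp

lemma jet_borel: "smooth q \<Longrightarrow> jet N q \<in> borel_measurable borel"
proof -
  assume q: "smooth q"
  have [measurable]: "partial_derivs is q \<in> borel_measurable borel" for "is"
    by (rule smooth_borel[OF smooth_partial_derivs[OF q]])
  show "jet N q \<in> borel_measurable borel" unfolding jet_def[abs_def] by measurable
qed

lemma jet_integrable:
  assumes q: "schwartz (q :: 'n::finite cfun)"
  shows "integrable lborel (jet N q)"
    and "(LINT t|lborel. jet N q t) \<le> sn (2 * DIM(real^'n)) N q * wint TYPE(real^'n) (2 * DIM(real^'n))"
proof -
  have b: "norm (jet N q t) \<le> sn (2 * DIM(real^'n)) N q / br t ^ (2 * DIM(real^'n))" for t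
    using jet_le_sn[OF q] by simp
  have m: "jet N q \<in> borel_measurable borel" by (rule jet_borel[OF schwartz_smooth[OF q]])
  show "integrable lborel (jet N q)" by (rule integrable_by_weight[OF m b order_refl])
  show "(LINT t|lborel. jet N q t) \<le> sn (2 * DIM(real^'n)) N q * wint TYPE(real^'n) (2 * DIM(real^'n))"
    using norm_integral_by_weight[OF m b order_refl] by simp
qed

lemma norm_ft_le:
  assumes q: "schwartz q"
  shows "norm (ft q \<xi>) \<le> (LINT t|lborel. jet N q t)"
  unfolding ft_def
  by (rule norm_integral_le[OF ft_integrable[OF q] jet_integrable(1)[OF q]]) (simp add: norm_mult norm_le_jet)

definition decay_const :: "'n::finite itself \<Rightarrow> nat \<Rightarrow> real" where
  "decay_const _ k = 2 ^ k * (1 + real CARD('n) ^ k)"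

lemma decay_const_nonneg [simp]: "0 \<le> decay_const T k"
  by (simp add: decay_const_def)

lemma ft_decay:
  fixes q :: "'n::finite cfun"
  assumes q: "schwartz q"
  shows "br \<xi> ^ k * norm (ft q \<xi>) \<le> decay_const TYPE('n) k * (LINT t|lborel. jet k q t)"
proof -
  let ?f = "\<lambda>j. \<bar>\<xi> $ j\<bar>"
  have "Max (range ?f) \<in> range ?f" by (rule Max_in) auto
  then obtain i where "Max (range ?f) = ?f i" by blast
  then have i: "?f j \<le> ?f i" for j using Max_ge[of "range ?f" "?f j"] by simp
  have "norm \<xi> \<le> (\<Sum>j\<in>UNIV. \<bar>\<xi> $ j\<bar>)" by (rule norm_le_l1_cart)
  also have "\<dots> \<le> (\<Sum>j\<in>(UNIV::'n set). \<bar>\<xi> $ i\<bar>)" by (intro sum_mono i)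
  finally have "norm \<xi> ^ k \<le> (real CARD('n) * \<bar>\<xi> $ i\<bar>) ^ k" by (intro power_mono) auto
  then have "norm \<xi> ^ k * norm (ft q \<xi>) \<le> real CARD('n) ^ k * (\<bar>\<xi> $ i\<bar> ^ k * norm (ft q \<xi>))"
    by (metis mult.assoc mult_right_mono norm_ge_zero power_mult_distrib)
  also have "\<bar>\<xi> $ i\<bar> ^ k * norm (ft q \<xi>) = norm (ft (partial_derivs (replicate k i) q) \<xi>)"
    by (rule norm_ft_iterated_deriv[OF q, symmetric])
  also have "\<dots> \<le> (LINT t|lborel. jet k q t)"
  proof -
    have S: "schwartz (partial_derivs (replicate k i) q)"
      by (induction k) (auto simp: partial_derivs_Cons q intro: schwartz_partial_deriv)
    have "norm (partial_derivs (replicate k i) q t * ee \<xi> t) \<le> jet k q t" for t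
      using partial_derivs_le_jet[of "replicate k i" k q t] by (simp add: norm_mult)
    then show ?thesis unfolding ft_def
      by (rule norm_integral_le[OF ft_integrable[OF S] jet_integrable(1)[OF q]])
  qed
  finally have 1: "norm \<xi> ^ k * norm (ft q \<xi>) \<le> real CARD('n) ^ k * (LINT t|lborel. jet k q t)"
    by (simp add: mult_left_mono)
  have "br \<xi> ^ k * norm (ft q \<xi>) \<le> (2 ^ k * (1 + norm \<xi> ^ k)) * norm (ft q \<xi>)"
    by (intro mult_right_mono br_power_le) auto
  also have "\<dots> = 2 ^ k * (norm (ft q \<xi>) + norm \<xi> ^ k * norm (ft q \<xi>))" by (simp add: algebra_simps)
  also have "\<dots> \<le> 2 ^ k * ((LINT t|lborel. jet k q t) + real CARD('n) ^ k * (LINT t|lborel. jet k q t))"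
    by (intro mult_left_mono add_mono 1 norm_ft_le q) auto
  finally show ?thesis by (simp add: decay_const_def algebra_simps)
qed

lemma schwartz_ft:
  fixes q :: "'n::finite cfun"
  assumes q: "schwartz q"
  shows "schwartz (ft q)"
    and "\<exists>C\<ge>0. \<forall>q :: 'n cfun. schwartz q \<longrightarrow> sn k N (ft q) \<le> C * sn (2 * DIM(real^'n) + N) k q"
proof -
  let ?d = "2 * DIM(real^'n)"
  define C where "C k N = real (card {is::'n list. length is \<le> N}) * (decay_const TYPE('n) k * ((1 + (jet_const TYPE('n) k)\<^sup>2) ^ N * wint TYPE(real^'n) ?d))" for k N
  have C: "0 \<le> C k N" for k N by (auto simp: C_def intro!: mult_nonneg_nonneg)
  have *: "br \<xi> ^ k * jet N (ft q) \<xi> \<le> C k N * sn (?d + N) k q" if q: "schwartz q" for q :: "'n cfun" and \<xi> k N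
  proof -
    have "norm (partial_derivs is (ft q) \<xi>) \<le> decay_const TYPE('n) k * ((1 + (jet_const TYPE('n) k)\<^sup>2) ^ N * wint TYPE(real^'n) ?d) * sn (?d + N) k q / br \<xi> ^ k" (is "_ \<le> ?R / _")
      if l: "length is \<le> N" for "is"
    proof -
      let ?J = "(jet_const TYPE('n) k)\<^sup>2"
      have S: "schwartz (\<lambda>t. mon is t * q t)" by (rule schwartz_mon[OF q])
      have "br \<xi> ^ k * norm (partial_derivs is (ft q) \<xi>) \<le> decay_const TYPE('n) k * (LINT t|lborel. jet k (\<lambda>t. mon is t * q t) t)"
        unfolding smooth_ft(2)[OF q] by (rule ft_decay[OF S])
      also have "\<dots> \<le> decay_const TYPE('n) k * (sn ?d k (\<lambda>t. mon is t * q t) * wint TYPE(real^'n) ?d)"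
        by (intro mult_left_mono jet_integrable S) auto
      also have "\<dots> \<le> decay_const TYPE('n) k * ((?J ^ length is * sn (?d + length is) k q) * wint TYPE(real^'n) ?d)"
        by (intro mult_left_mono mult_right_mono schwartz_mon q) auto
      also have "\<dots> \<le> decay_const TYPE('n) k * (((1 + ?J) ^ N * sn (?d + N) k q) * wint TYPE(real^'n) ?d)"
      proof (intro mult_left_mono mult_right_mono mult_mono)
        have "?J ^ length is \<le> (1 + ?J) ^ length is" by (intro power_mono) auto
        also have "\<dots> \<le> (1 + ?J) ^ N" by (intro power_increasing l) auto
        finally show "?J ^ length is \<le> (1 + ?J) ^ N" .
        show "sn (?d + length is) k q \<le> sn (?d + N) k q" using l by (intro sn_mono q) auto
      qed (auto intro: sn_nonneg q)
      finally show ?thesis by (simp add: field_simps)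
    qed
    then have "jet N (ft q) \<xi> \<le> real (card {is::'n list. length is \<le> N}) * (?R / br \<xi> ^ k)" by (rule jet_leI)
    then show ?thesis by (simp add: C_def field_simps)
  qed
  show "schwartz (ft q)" by (rule schwartzI[OF smooth_ft(1)[OF q]]) (intro exI allI, rule *[OF q])
  show "\<exists>C\<ge>0. \<forall>q :: 'n cfun. schwartz q \<longrightarrow> sn k N (ft q) \<le> C * sn (?d + N) k q"
    by (intro exI[of _ "C k N"] conjI C allI impI sn_leI *)
qed

lemma ft_add: "schwartz f \<Longrightarrow> schwartz g \<Longrightarrow> ft (\<lambda>t. f t + g t) \<xi> = ft f \<xi> + ft g \<xi>"
  and ft_diff: "schwartz f \<Longrightarrow> schwartz g \<Longrightarrow> ft (\<lambda>t. f t - g t) \<xi> = ft f \<xi> - ft g \<xi>"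
  and ft_cmult: "ft (\<lambda>t. c * f t) \<xi> = c * ft f \<xi>"
  using ft_integrable[of f \<xi>] ft_integrable[of g \<xi>] by (auto simp: ft_def ring_distribs mult.assoc)

lemma ft_translate:
  assumes q: "schwartz q" shows "ft (\<lambda>t. q (t - x)) \<xi> = ee \<xi> x * ft q \<xi>"
proof -
  have "(\<lambda>t. q (t - x) * ee \<xi> t) \<in> borel_measurable borel"
    by (intro schwartz_borel schwartz_ee' schwartz_translate q)
  from lborel_shift_integral(1)[OF this, of x]
  have "ft (\<lambda>t. q (t - x)) \<xi> = (LINT t|lborel. q t * ee \<xi> (t + x))" by (simp add: ft_def)
  also have "\<dots> = (LINT t|lborel. ee \<xi> x * (q t * ee \<xi> t))" by (simp add: ee_add2 mult_ac)
  finally show ?thesis by (simp add: ft_def)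
qed

lemma ft_reflect:
  assumes q: "schwartz q" shows "ft (\<lambda>t. q (- t)) \<xi> = ft q (- \<xi>)"
proof -
  have "(\<lambda>t. q (- t) * ee \<xi> t) \<in> borel_measurable borel"
    by (intro schwartz_borel schwartz_ee' schwartz_translate q)
  from lborel_shift_integral(4)[OF this] show ?thesis by (simp add: ft_def ee_minus)
qed

lemma ft_modulate: "ft (\<lambda>t. ee \<eta> t * q t) \<xi> = ft q (\<xi> + \<eta>)"
  unfolding ft_def by (rule Bochner_Integration.integral_cong) (auto simp: ee_add)

lemma ft_cnj: "ft (\<lambda>t. cnj (q t)) \<xi> = cnj (ft q (- \<xi>))"
  by (simp add: ft_def Bochner_Integration.integral_cnj[symmetric] cnj_ee del: Bochner_Integration.integral_cnj)

lemma ft_multiplication_formula: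
  assumes q: "schwartz q" and p: "schwartz p"
  shows "(LINT \<xi>|lborel. ft q \<xi> * p \<xi>) = (LINT t|lborel. q t * ft p t)"
proof -
  have [measurable]: "q \<in> borel_measurable borel" "p \<in> borel_measurable borel" using p q schwartz_borel by auto
  have "(LINT t|lborel. LINT \<xi>|lborel. q t * (p \<xi> * ee \<xi> t)) = (LINT \<xi>|lborel. LINT t|lborel. q t * (p \<xi> * ee \<xi> t))"
  proof (rule Fubini_by_bound(1))
    show "(\<lambda>(t, \<xi>). q t * (p \<xi> * ee \<xi> t)) \<in> borel_measurable (borel \<Otimes>\<^sub>M borel)"
      using ee_borel by measurable
    show "integrable lborel (\<lambda>t. norm (q t))" "integrable lborel (\<lambda>t. norm (p t))"
      by (intro integrable_norm schwartz_integrable p q)+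
  qed (simp add: norm_mult)
  moreover have "(LINT t|lborel. LINT \<xi>|lborel. q t * (p \<xi> * ee \<xi> t)) = (LINT t|lborel. q t * ft p t)"
    by (simp add: ft_def ee_swap)
  moreover have "(LINT \<xi>|lborel. LINT t|lborel. q t * (p \<xi> * ee \<xi> t)) = (LINT \<xi>|lborel. ft q \<xi> * p \<xi>)"
    by (simp add: ft_def mult.left_commute mult.commute[of _ "p _"] mult.assoc)
  ultimately show ?thesis by simp
qed

definition cv :: "'n::finite cfun \<Rightarrow> 'n cfun \<Rightarrow> 'n cfun" where
  "cv g \<psi> x = (LINT t|lborel. g t * \<psi> (x - t))"

lemma schwartz_cv:
  fixes g \<psi> :: "'n::finite cfun"
  assumes g: "schwartz g" and p: "schwartz \<psi>"
  shows "schwartz (cv g \<psi>)"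
proof -
  let ?\<Theta> = "\<lambda>t x. g t * \<psi> (x - t)"
  have pt: "schwartz (\<lambda>x. \<psi> (x - t))" for t by (rule schwartz_translate[OF p])
  have pd: "partial_derivs is (?\<Theta> t) x = g t * partial_derivs is \<psi> (x - t)" for t x "is"
    using partial_derivs_affine[OF schwartz_smooth[OF p], of "is" 1 "-t"]
    by (simp add: partial_derivs_cmult[OF schwartz_smooth[OF pt]])
  have "schwartz (\<lambda>x. LINT t|lborel. ?\<Theta> t x)"
  proof (rule schwartz_param_integral(1))
    show "smooth (?\<Theta> t)" for t by (rule smooth_cmult[OF schwartz_smooth[OF pt]])
    show "(\<lambda>t. partial_derivs is (?\<Theta> t) x) \<in> borel_measurable lborel" for "is" x
      unfolding pd using schwartz_borel[OF g] smooth_borel[OF smooth_partial_derivs[OF schwartz_smooth[OF p], of "is"]]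
      by measurable
    fix k N
    let ?b = "\<lambda>t. norm (g t) * (br t ^ k * sn k N \<psi>)"
    have "integrable lborel ?b"
    proof (rule integrable_by_weight[OF _ _ order_refl])
      show "?b \<in> borel_measurable borel" using schwartz_borel[OF g] by measurable
      show "norm (?b t) \<le> (sn (2 * DIM(real^'n) + k) 0 g * sn k N \<psi>) / br t ^ (2 * DIM(real^'n))" for t
      proof -
        have "?b t \<le> sn (2 * DIM(real^'n) + k) 0 g / br t ^ (2 * DIM(real^'n) + k) * (br t ^ k * sn k N \<psi>)"
          by (intro mult_right_mono norm_le_sn g) (auto intro!: mult_nonneg_nonneg sn_nonneg p)
        then show ?thesis using sn_nonneg[OF p, of k N] by (simp add: power_add field_simps norm_mult)
      qed
    qed
    moreover have "br x ^ k * jet N (?\<Theta> t) x \<le> ?b t" for t x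
    proof -
      have "br x ^ k * jet N (?\<Theta> t) x = norm (g t) * (br x ^ k * jet N (\<lambda>x. \<psi> (x - t)) x)"
        by (simp add: jet_cmult[OF schwartz_smooth[OF pt]])
      also have "\<dots> \<le> norm (g t) * (br t ^ k * sn k N \<psi>)"
        using order_trans[OF sn_bound[OF pt] schwartz_affine(2)[OF p, where s=1 and b="-t" and k=k and N=N, simplified]]
        by (intro mult_left_mono) auto
      finally show ?thesis .
    qed
    ultimately show "\<exists>b. integrable lborel b \<and> (\<forall>t x. br x ^ k * jet N (?\<Theta> t) x \<le> b t)"
      by (intro exI[of _ ?b] conjI allI)
  qed
  then show ?thesis by (simp add: cv_def[abs_def])
qed

lemma ft_cv:
  fixes g \<psi> :: "'n::finite cfun"
  assumes g: "schwartz g" and p: "schwartz \<psi>"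
  shows "ft (cv g \<psi>) \<xi> = ft g \<xi> * ft \<psi> \<xi>"
proof -
  let ?d = "2 * DIM(real^'n)"
  have [measurable]: "g \<in> borel_measurable borel" "\<psi> \<in> borel_measurable borel" using p g schwartz_borel by auto
  let ?C = "sn (2 * ?d) 0 g * sn ?d 0 \<psi>"
  have "(LINT x|lborel. LINT t|lborel. g t * \<psi> (x - t) * ee \<xi> x) = (LINT t|lborel. LINT x|lborel. g t * \<psi> (x - t) * ee \<xi> x)"
  proof (rule Fubini_by_bound(1))
    show "(\<lambda>(x, t). g t * \<psi> (x - t) * ee \<xi> x) \<in> borel_measurable (borel \<Otimes>\<^sub>M borel)" by measurable
    show "integrable lborel (\<lambda>x::real^'n. ?C * (1 / br x ^ ?d))" "integrable lborel (\<lambda>x::real^'n. 1 / br x ^ ?d)"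
      by (intro integrable_mult_right integrable_weight order_refl)+
    fix x t
    have "norm (g t * \<psi> (x - t) * ee \<xi> x) \<le> (sn (2 * ?d) 0 g / br t ^ (2 * ?d)) * (sn ?d 0 \<psi> / br (x - t) ^ ?d)"
      by (simp only: norm_mult norm_ee mult_1_right)
        (intro mult_mono norm_le_sn g p divide_nonneg_nonneg sn_nonneg zero_le_power br_nonneg norm_ge_zero)
    also have "\<dots> = ?C / br t ^ ?d * (1 / (br (x - t) ^ ?d * br t ^ ?d))" by (simp add: power_add mult_2)
    also have "\<dots> \<le> ?C / br t ^ ?d * (1 / br x ^ ?d)"
      using br_add_power[of "x - t" t ?d]
      by (intro mult_left_mono divide_left_mono) (auto intro!: divide_nonneg_nonneg mult_nonneg_nonneg sn_nonneg g p)
    finally show "norm (g t * \<psi> (x - t) * ee \<xi> x) \<le> ?C * (1 / br x ^ ?d) * (1 / br t ^ ?d)" by (simp add: mult.commute)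
  qed
  moreover have "(LINT x|lborel. g t * \<psi> (x - t) * ee \<xi> x) = (g t * ee \<xi> t) * ft \<psi> \<xi>" for t
    using ft_translate[OF p, of t \<xi>] by (simp add: ft_def mult.assoc)
  ultimately show ?thesis by (simp add: ft_def cv_def)
qed

section \<open>Bump functions\<close>

text \<open>The derivatives of \<open>exp (- 1/s)\<close> are again of this form, so that the class is closed under differentiation, also at the origin.\<close>

definition flat :: "real poly \<Rightarrow> real \<Rightarrow> real" where
  "flat p s = (if 0 < s then poly p (1 / s) * exp (- (1 / s)) else 0)"

lemma poly_exp_tendsto_0: "((\<lambda>x::real. poly p x * exp (- x)) \<longlongrightarrow> 0) at_top"
proof -
  have "((\<lambda>x::real. \<Sum>i\<le>degree p. coeff p i * (x ^ i / exp x)) \<longlongrightarrow> (\<Sum>i\<le>degree p. coeff p i * 0)) at_top"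
    by (intro tendsto_sum tendsto_mult tendsto_const tendsto_power_div_exp_0)
  then show ?thesis by (simp add: poly_altdef exp_minus divide_inverse[symmetric] sum_divide_distrib)
qed

lemma flat_at_0: "(flat p \<longlongrightarrow> 0) (at_right 0)"
proof -
  have "filterlim (\<lambda>s::real. 1 / s) at_top (at_right 0)"
    using filterlim_inverse_at_top_right by (simp add: inverse_eq_divide)
  then have "((\<lambda>s. poly p (1 / s) * exp (- (1 / s))) \<longlongrightarrow> 0) (at_right 0)"
    by (rule filterlim_compose[OF poly_exp_tendsto_0])
  moreover have "eventually (\<lambda>s. flat p s = poly p (1 / s) * exp (- (1 / s))) (at_right 0)"
    unfolding eventually_at by (intro exI[of _ 1]) (auto simp: flat_def)
  ultimately show ?thesis using filterlim_cong by fastforce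
qed

definition flat_deriv :: "real poly \<Rightarrow> real poly" where
  "flat_deriv p = monom 1 2 * (p - pderiv p)"

lemma flat_has_derivative: "(flat p has_real_derivative flat (flat_deriv p) s) (at s)"
proof -
  consider "0 < s" | "s < 0" | "s = 0" by linarith
  then show ?thesis
  proof cases
    case 1
    have "((\<lambda>s. poly p (1 / s) * exp (- (1 / s))) has_real_derivative flat (flat_deriv p) s) (at s)"
      using 1 by (auto intro!: derivative_eq_intros DERIV_chain2[OF poly_DERIV]
          simp: flat_def flat_deriv_def poly_monom field_simps power2_eq_square)
    moreover have "\<forall>\<^sub>F x in nhds s. flat p x = poly p (1 / x) * exp (- (1 / x))"
      using eventually_nhds_in_open[of "{0<..}" s] 1 by (auto elim!: eventually_mono simp: flat_def)
    ultimately show ?thesis by (subst DERIV_cong_ev[OF refl _ refl])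
  next
    case 2
    have "((\<lambda>s. 0) has_real_derivative flat (flat_deriv p) s) (at s)" using 2 by (simp add: flat_def)
    moreover have "\<forall>\<^sub>F x in nhds s. flat p x = 0"
      using eventually_nhds_in_open[of "{..<0}" s] 2 by (auto elim!: eventually_mono simp: flat_def)
    ultimately show ?thesis by (subst DERIV_cong_ev[OF refl _ refl])
  next
    case 3
    have "((\<lambda>h. (flat p (0 + h) - flat p 0) / h) \<longlongrightarrow> 0) (at_left 0)"
      by (rule tendsto_eventually) (auto simp: eventually_at flat_def intro!: exI[of _ 1])
    moreover have "((\<lambda>h. (flat p (0 + h) - flat p 0) / h) \<longlongrightarrow> 0) (at_right 0)"
    proof -
      have "flat (pCons 0 p) h = (flat p (0 + h) - flat p 0) / h" for h by (simp add: flat_def)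
      then have "(flat p (0 + h) - flat p 0) / h = flat (pCons 0 p) h" for h by simp
      then show ?thesis using flat_at_0[of "pCons 0 p"] by simp
    qed
    ultimately have "((\<lambda>h. (flat p (0 + h) - flat p 0) / h) \<longlongrightarrow> 0) (at 0)"
      by (simp add: filterlim_at_split)
    then show ?thesis using 3 by (simp add: DERIV_def flat_def)
  qed
qed

lemma flat_nonneg: "0 \<le> flat 1 s" and flat_le_1: "flat 1 s \<le> 1" and flat_pos_iff: "0 < flat 1 s \<longleftrightarrow> 0 < s"
  by (auto simp: flat_def)

text \<open>A smooth function that is positive exactly on the box from \<open>a\<close> to \<open>b\<close>.\<close>

definition bumpr :: "real^'n::finite \<Rightarrow> real^'n \<Rightarrow> real^'n \<Rightarrow> real" where
  "bumpr a b t = (\<Prod>i\<in>UNIV. flat 1 (t $ i - a $ i) * flat 1 (b $ i - t $ i))"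

lemma bumpr_nonneg: "0 \<le> bumpr a b t" and bumpr_le_1: "bumpr a b t \<le> 1"
  unfolding bumpr_def by (auto intro!: prod_nonneg prod_le_1 mult_nonneg_nonneg mult_le_one flat_nonneg flat_le_1)

lemma bumpr_pos_iff: "0 < bumpr a b t \<longleftrightarrow> t \<in> box a b"
proof
  assume "t \<in> box a b"
  then show "0 < bumpr a b t" unfolding bumpr_def mem_box_cart
    by (intro prod_pos ballI mult_pos_pos) (auto simp: flat_pos_iff)
next
  assume *: "0 < bumpr a b t"
  have "flat 1 (t $ i - a $ i) * flat 1 (b $ i - t $ i) \<noteq> 0" for i
    using * unfolding bumpr_def by (auto simp: less_le)
  then have "flat 1 (t $ i - a $ i) \<noteq> 0 \<and> flat 1 (b $ i - t $ i) \<noteq> 0" for i by simp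
  then have "0 < t $ i - a $ i \<and> 0 < b $ i - t $ i" for i by (meson flat_def)
  then show "t \<in> box a b" unfolding mem_box_cart by simp
qed

inductive flat_coord :: "'n::finite cfun \<Rightarrow> bool" where
  "flat_coord (\<lambda>t. c)"
| "flat_coord (\<lambda>t. complex_of_real (flat p (\<sigma> * t $ i + c)))"

lemma flat_coord_has_derivative:
  "((\<lambda>t. complex_of_real (flat p (\<sigma> * t $ i + c))) has_derivative
     (\<lambda>h. complex_of_real (flat (flat_deriv p) (\<sigma> * t $ i + c) * (\<sigma> * h $ i)))) (at t)"
proof -
  have "((\<lambda>t. \<sigma> * t $ i + c) has_derivative (\<lambda>h. \<sigma> * h $ i)) (at t)"
  proof -
    have "((\<lambda>t. t $ i) has_derivative (\<lambda>h. h $ i)) (at t)"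
      by (intro bounded_linear.has_derivative[OF bounded_linear_vec_nth] has_derivative_ident)
    then have "((\<lambda>t. \<sigma> * t $ i + c) has_derivative (\<lambda>h. \<sigma> * h $ i + 0)) (at t)"
      by (intro has_derivative_add has_derivative_mult_right has_derivative_const)
    then show ?thesis by simp
  qed
  from has_derivative_of_real[OF has_derivative_compose[OF this
      has_field_derivative_imp_has_derivative[OF flat_has_derivative]]]
  show ?thesis .
qed

lemma generated_flat_coord_smooth: "generated flat_coord f \<Longrightarrow> smooth f"
proof (rule generated_smooth[where B=flat_coord])
  fix f :: "'n::finite cfun" and x assume "flat_coord f"
  then show "f differentiable at x"
  proof cases
    case (2 p \<sigma> i c)
    show ?thesis unfolding 2 differentiable_def by (rule exI, rule flat_coord_has_derivative)
  qed simp
next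
  fix f :: "'n::finite cfun" and j assume "flat_coord f"
  then show "generated flat_coord (partial_deriv j f)"
  proof cases
    case (1 c)
    then show ?thesis by (auto simp: partial_deriv_const intro!: generated.base flat_coord.intros)
  next
    case (2 p \<sigma> i c)
    have "partial_deriv j f = (\<lambda>t. complex_of_real (flat (flat_deriv p) (\<sigma> * t $ i + c)) * complex_of_real (\<sigma> * (if i = j then 1 else 0)))"
      unfolding 2 by (rule ext, subst partial_deriv_eq[OF flat_coord_has_derivative]) (simp add: axis_def)
    then show ?thesis by (simp only:) (intro generated.mult generated.base flat_coord.intros)
  qed
qed

lemma smooth_bumpr:
  fixes a b :: "real^'n::finite"
  shows "smooth (\<lambda>t. complex_of_real (bumpr a b t))"
proof (rule generated_flat_coord_smooth)
  have *: "generated flat_coord (\<lambda>t::real^'n. complex_of_real (\<Prod>i\<in>A. flat 1 (t $ i - a $ i) * flat 1 (b $ i - t $ i)))"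
    if "finite A" for A
    using that
  proof (induction A)
    case empty
    then show ?case by (auto intro!: generated.base flat_coord.intros)
  next
    case (insert i A)
    have "generated flat_coord (\<lambda>t::real^'n. (complex_of_real (flat 1 (1 * t $ i + (- a $ i))) * complex_of_real (flat 1 ((-1) * t $ i + b $ i)))
      * complex_of_real (\<Prod>i\<in>A. flat 1 (t $ i - a $ i) * flat 1 (b $ i - t $ i)))"
      by (intro generated.mult generated.base flat_coord.intros insert.IH)
    then show ?case using insert by (simp add: algebra_simps)
  qed
  show "generated flat_coord (\<lambda>t. complex_of_real (bumpr a b t))" unfolding bumpr_def by (rule *) simp
qed

lemma test_functionI:
  assumes "smooth f" "\<And>t. f t \<noteq> 0 \<Longrightarrow> t \<in> cbox a b"
  shows "test_function f"
proof -
  have "closure {t. f t \<noteq> 0} \<subseteq> cbox a b" by (rule closure_minimal) (use assms in auto)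
  then have "compact (closure {t. f t \<noteq> 0})"
    using bounded_subset[OF bounded_cbox] by (simp add: compact_eq_bounded_closed)
  then show ?thesis using assms(1) by (simp add: test_function_def)
qed

lemma test_function_bumpr: "test_function (\<lambda>t. complex_of_real (bumpr a b t))"
proof (rule test_functionI[where a=a and b=b, OF smooth_bumpr])
  fix t assume "complex_of_real (bumpr a b t) \<noteq> 0"
  then have "t \<in> box a b" using bumpr_nonneg[of a b t] bumpr_pos_iff[of a b t] by simp
  then show "t \<in> cbox a b" using box_subset_cbox by blast
qed

lemma test_function_smooth: "test_function f \<Longrightarrow> smooth f"
  by (simp add: test_function_def)

lemma test_function_mult:
  assumes "test_function f" "smooth g" shows "test_function (\<lambda>t. f t * g t)"
proof -
  have "closure {t. f t * g t \<noteq> 0} \<subseteq> closure {t. f t \<noteq> 0}" by (rule closure_mono) auto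
  then have "compact (closure {t. f t * g t \<noteq> 0})"
    using assms(1) compact_Int_closed[of "closure {t. f t \<noteq> 0}" "closure {t. f t * g t \<noteq> 0}"]
    by (simp add: test_function_def Int_absorb1)
  then show ?thesis using assms by (simp add: test_function_def smooth_mult)
qed

lemma partial_derivs_outside_support:
  assumes "smooth f" "t \<notin> closure {t. f t \<noteq> 0}"
  shows "partial_derivs is f t = 0"
  using assms(2)
proof (induction "is" arbitrary: t)
  case Nil
  then show ?case using closure_subset[of "{t. f t \<noteq> 0}"] by auto
next
  case (Cons i "is")
  have "(partial_derivs is f has_derivative (\<lambda>h. 0)) (at t)"
  proof (rule has_derivative_transform_within_open[where s="- closure {t. f t \<noteq> 0}"])
    show "((\<lambda>x. 0) has_derivative (\<lambda>h. 0)) (at t)" by simp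
  qed (use Cons in auto)
  from partial_deriv_eq[OF this] show ?case by (simp add: partial_derivs_Cons)
qed

lemma test_function_schwartz:
  fixes f :: "'n::finite cfun"
  assumes "test_function f" shows "schwartz f"
proof (rule schwartzI)
  show sm: "smooth f" using assms by (rule test_function_smooth)
  let ?K = "closure {t. f t \<noteq> 0}"
  fix k N
  have "continuous_on ?K (\<lambda>t. br t ^ k * jet N f t)"
    unfolding br_def jet_def by (intro continuous_intros smooth_continuous smooth_partial_derivs sm)
  then have "bounded ((\<lambda>t. br t ^ k * jet N f t) ` ?K)"
    using assms unfolding test_function_def by (intro compact_imp_bounded compact_continuous_image) auto
  then obtain c where c: "\<And>t. t \<in> ?K \<Longrightarrow> norm (br t ^ k * jet N f t) \<le> c" unfolding bounded_iff by blast
  have "br t ^ k * jet N f t \<le> max c 0" for t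
  proof (cases "t \<in> ?K")
    case True
    then show ?thesis using c[of t] by simp
  next
    case False
    then have "jet N f t = 0" unfolding jet_def by (simp add: partial_derivs_outside_support[OF sm])
    then show ?thesis by simp
  qed
  then show "\<exists>c. \<forall>t. br t ^ k * jet N f t \<le> c" by blast
qed

section \<open>Cut-offs\<close>

definition chi :: "'n::finite cfun" where
  "chi t = of_real (bumpr (\<chi> i. -1) (\<chi> i. 1) t) / of_real (bumpr (\<chi> i. -1) (\<chi> i. 1) (0::real^'n))"

lemma chi_0 [simp]: "chi (0::real^'n::finite) = 1"
proof -
  have "(0::real^'n) \<in> box (\<chi> i. -1) (\<chi> i. 1)" by (simp add: mem_box_cart)
  then have "0 < bumpr (\<chi> i. -1) (\<chi> i. 1) (0::real^'n)" by (simp only: bumpr_pos_iff)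
  then show ?thesis by (simp add: chi_def)
qed

lemma chi_real: "chi t = of_real (Re (chi t))" "0 \<le> Re (chi t)"
  by (auto simp: chi_def bumpr_nonneg simp flip: of_real_divide)

lemma test_function_chi: "test_function (chi :: 'n::finite cfun)"
proof -
  have "test_function (\<lambda>t::real^'n. of_real (bumpr (\<chi> i. -1) (\<chi> i. 1) t) * (1 / complex_of_real (bumpr (\<chi> i. -1) (\<chi> i. 1) (0::real^'n))))"
    by (intro test_function_mult test_function_bumpr smooth_const)
  then show ?thesis by (simp add: chi_def[abs_def])
qed

lemmas schwartz_chi = test_function_schwartz[OF test_function_chi]

definition cutoff :: "nat \<Rightarrow> 'n::finite cfun" where
  "cutoff n t = chi ((1 / real (Suc n)) *\<^sub>R t)"

lemma smooth_cutoff: "smooth (cutoff n)"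
  using smooth_affine[OF schwartz_smooth[OF schwartz_chi], of "1 / real (Suc n)" 0] by (simp add: cutoff_def[abs_def])

lemma test_function_cutoff: "test_function (cutoff n :: 'n::finite cfun)"
proof -
  obtain R where R: "\<And>x::real^'n. chi x \<noteq> 0 \<Longrightarrow> norm x \<le> R"
  proof -
    have "bounded (closure {t::real^'n. chi t \<noteq> 0})"
      using test_function_chi[where 'n='n] by (simp add: test_function_def compact_imp_bounded)
    then have "bounded {t::real^'n. chi t \<noteq> 0}" using bounded_subset closure_subset by blast
    then show ?thesis using that unfolding bounded_iff by auto
  qed
  have "{t::real^'n. cutoff n t \<noteq> 0} \<subseteq> cball 0 (real (Suc n) * R)"
  proof
    fix t :: "real^'n" assume "t \<in> {t. cutoff n t \<noteq> 0}"
    then have "norm ((1 / real (Suc n)) *\<^sub>R t) \<le> R" by (intro R) (simp add: cutoff_def)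
    then show "t \<in> cball 0 (real (Suc n) * R)" by (simp add: field_simps)
  qed
  then have "bounded (closure {t::real^'n. cutoff n t \<noteq> 0})" by (intro bounded_closure bounded_subset[OF bounded_cball])
  then show ?thesis using smooth_cutoff by (simp add: test_function_def compact_eq_bounded_closed)
qed

lemma norm_cutoff_le: "norm (cutoff n t) \<le> sn 0 0 (chi :: 'n::finite cfun)" for t :: "real^'n"
  using norm_le_sn[OF schwartz_chi, of "(1 / real (Suc n)) *\<^sub>R t" 0] by (simp add: cutoff_def)

lemma cutoff_tendsto: "(\<lambda>n. cutoff n t) \<longlonglongrightarrow> 1"
proof -
  have "(\<lambda>n. (1 / real (Suc n)) *\<^sub>R t) \<longlonglongrightarrow> 0 *\<^sub>R t"
    by (intro tendsto_scaleR tendsto_const) (use LIMSEQ_inverse_real_of_nat in \<open>simp add: inverse_eq_divide\<close>)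
  then have "(\<lambda>n. chi ((1 / real (Suc n)) *\<^sub>R t)) \<longlonglongrightarrow> chi (0 *\<^sub>R t)"
    by (rule isCont_tendsto_compose[OF smooth_isCont[OF schwartz_smooth[OF schwartz_chi]]])
  then show ?thesis by (simp add: cutoff_def)
qed

lemma schwartz_cutoff_mult: "schwartz g \<Longrightarrow> schwartz (\<lambda>t. cutoff n t * g t)"
  by (rule schwartz_mult[OF test_function_schwartz[OF test_function_cutoff]])

text \<open>A cut-off with \<open>chi 0 = 1\<close> suffices: \<open>1 - chi (t / n)\<close> vanishes to first order at the origin, so it and
  all its derivatives are bounded by a multiple of \<open>br t / n\<close>.\<close>

lemma sn_cutoff_diff:
  fixes g :: "'n::finite cfun"
  obtains C where "0 \<le> C" "\<And>(g :: 'n cfun) n. schwartz g \<Longrightarrow>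
    sn k N (\<lambda>t. cutoff n t * g t - g t) \<le> C / real (Suc n) * sn (k + 1) N g"
proof -
  define c :: "nat \<Rightarrow> 'n cfun" where "c n = (\<lambda>t. cutoff n t - 1)" for n
  let ?B = "sn 0 (N + 1) (chi :: 'n cfun)"
  let ?J = "jet_const TYPE('n) N"
  have B: "0 \<le> ?B" by (rule sn_nonneg[OF schwartz_chi])
  have smc: "smooth (c n)" for n unfolding c_def by (intro smooth_diff smooth_cutoff smooth_const)
  have jB: "jet M chi x \<le> ?B" if "M \<le> N + 1" for M and x :: "real^'n"
    using order_trans[OF jet_mono[OF that] jet_le_sn[OF schwartz_chi, of "N + 1" x 0]] by simp
  have jc: "jet N (c n) t \<le> (?J * ?B / real (Suc n)) * br t ^ 1" for n t
  proof -
    have "jet N (c n) t \<le> real (card {is::'n list. length is \<le> N}) * (?B / real (Suc n) * br t)"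
    proof (rule jet_leI)
      fix "is" :: "'n list" assume l: "length is \<le> N"
      let ?s = "1 / real (Suc n)"
      show "norm (partial_derivs is (c n) t) \<le> ?B / real (Suc n) * br t"
      proof (cases "is = []")
        case True
        have "norm (chi (0 + ?s *\<^sub>R t) - chi 0) \<le> ?B * norm (?s *\<^sub>R t)"
          using smooth_mean_value[OF schwartz_smooth[OF schwartz_chi], of 0 "?s *\<^sub>R t" ?B, OF jB] by simp
        also have "\<dots> \<le> ?B * (?s * br t)" using B mult_left_mono[OF norm_le_br[of t], of ?s] by (intro mult_left_mono) simp_all
        finally show ?thesis using True by (simp add: c_def cutoff_def)
      next
        case False
        have "partial_derivs is (c n) t = partial_derivs is (cutoff n) t"
          unfolding c_def partial_derivs_diff[OF smooth_cutoff smooth_const] partial_derivs_const using False by simp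
        also have "\<dots> = of_real ?s ^ length is * partial_derivs is chi (?s *\<^sub>R t)"
          using partial_derivs_affine[OF schwartz_smooth[OF schwartz_chi], of "is" ?s 0] by (simp add: cutoff_def[abs_def])
        finally have "norm (partial_derivs is (c n) t) = ?s ^ length is * norm (partial_derivs is chi (?s *\<^sub>R t))"
          by (simp only: norm_mult norm_power norm_of_real abs_of_nonneg[of ?s] zero_le_divide_1_iff of_nat_0_le_iff)
        also have "\<dots> \<le> ?s ^ 1 * ?B"
          using False l by (intro mult_mono power_decreasing order_trans[OF partial_derivs_le_jet[OF l] jB]) (auto simp: Suc_le_eq)
        also have "\<dots> \<le> ?B / real (Suc n) * br t"
          using mult_left_mono[OF br_ge1[of t], of "?B / real (Suc n)"] B by simp
        finally show ?thesis .
      qed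
    qed
    also have "\<dots> \<le> ?J * (?B / real (Suc n) * br t)"
      unfolding jet_const_def using B by (intro mult_right_mono) (auto simp: mult_le_cancel_left1)
    finally show ?thesis by simp
  qed
  show ?thesis
  proof (rule that[of "?J * (?J * ?B)"])
    fix g :: "'n cfun" and n assume g: "schwartz g"
    have "sn k N (\<lambda>t. c n t * g t) \<le> ?J * ((?J * ?B / real (Suc n)) * sn (k + 1) N g)"
      by (rule sn_leI, rule schwartz_mult_bound[OF smc g jc])
    then show "sn k N (\<lambda>t. cutoff n t * g t - g t) \<le> ?J * (?J * ?B) / real (Suc n) * sn (k + 1) N g"
      by (simp add: c_def algebra_simps)
  qed (use B in simp)
qed

section \<open>Test functions separate locally integrable functions\<close>

text \<open>The positive and the negative part of \<open>f\<close> define measures that agree on boxes, an intersection-stable generator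
  of the Borel sets.\<close>

lemma AE_eq_0_if_box_integrals:
  fixes f :: "'a::euclidean_space \<Rightarrow> real"
  assumes f[measurable]: "f \<in> borel_measurable borel"
    and i: "\<And>a b. integrable lborel (\<lambda>x. indicator (box a b) x * f x)"
    and z: "\<And>a b. (LINT x|lborel. indicator (box a b) x * f x) = 0"
  shows "AE x in lborel. f x = 0"
proof -
  let ?P = "\<lambda>x. ennreal (f x)" and ?M = "\<lambda>x. ennreal (- f x)"
  have P: "emeasure (density lborel ?P) (box a b) = (\<integral>\<^sup>+x. ennreal (indicator (box a b) x * f x) \<partial>lborel)" for a b
    by (subst emeasure_density) (auto intro!: nn_integral_cong simp: indicator_def)
  have M: "emeasure (density lborel ?M) (box a b) = (\<integral>\<^sup>+x. ennreal (- (indicator (box a b) x * f x)) \<partial>lborel)" for a b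
    by (subst emeasure_density) (auto intro!: nn_integral_cong simp: indicator_def)
  have fin: "emeasure (density lborel ?P) (box a b) \<noteq> \<infinity>" "emeasure (density lborel ?M) (box a b) \<noteq> \<infinity>" for a b
    using i[of a b] unfolding P M real_integrable_def by auto
  have eq: "emeasure (density lborel ?P) (box a b) = emeasure (density lborel ?M) (box a b)" for a b
  proof -
    have "enn2real (emeasure (density lborel ?P) (box a b)) = enn2real (emeasure (density lborel ?M) (box a b))"
      using real_lebesgue_integral_def[OF i[of a b]] z[of a b] unfolding P M by simp
    then show ?thesis using fin[of a b] by (metis ennreal_enn2real infinity_ennreal_def less_top)
  qed
  have "density lborel ?P = density lborel ?M"
  proof (rule measure_eqI_generator_eq[where E="range (\<lambda>(a, b). box a b :: 'a set)" and \<Omega>=UNIV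
        and A="\<lambda>n. box (- (real n *\<^sub>R One)) (real n *\<^sub>R One)"])
    show "Int_stable (range (\<lambda>(a, b). box a b :: 'a set))"
      unfolding Int_stable_def by (auto simp: box_Int_box)
    show "sets (density lborel ?P) = sigma_sets UNIV (range (\<lambda>(a, b). box a b))"
      "sets (density lborel ?M) = sigma_sets UNIV (range (\<lambda>(a, b). box a b))"
      by (simp_all add: borel_eq_box sets_measure_of)
    show "(\<Union>n. box (- (real n *\<^sub>R One)) (real n *\<^sub>R One) :: 'a set) = UNIV" by (rule UN_box_eq_UNIV)
  qed (use eq fin in auto)
  then have "AE x in lborel. ?P x = ?M x" by (intro sigma_finite_measure.density_unique[OF sigma_finite_lborel]) auto
  then show ?thesis
  proof eventually_elim
    case (elim x)
    then show ?case by (cases "0 \<le> f x") (auto simp: ennreal_neg ennreal_eq_0_iff)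
  qed
qed

lemma AE_eq_0_if_box_integrals_complex:
  fixes h :: "'a::euclidean_space \<Rightarrow> complex"
  assumes h: "h \<in> borel_measurable lebesgue"
    and i: "\<And>a b. integrable lebesgue (\<lambda>x. indicator (box a b) x *\<^sub>R h x)"
    and z: "\<And>a b. (LINT x|lebesgue. indicator (box a b) x *\<^sub>R h x) = 0"
  shows "AE x in lebesgue. h x = 0"
proof -
  have *: "AE x in lebesgue. f x = 0"
    if f: "f \<in> borel_measurable lebesgue"
      and i: "\<And>a b. integrable lebesgue (\<lambda>x. indicator (box a b) x * f x)"
      and z: "\<And>a b. (LINT x|lebesgue. indicator (box a b) x * f x) = 0" for f :: "'a \<Rightarrow> real"
  proof -
    obtain g where g[measurable]: "g \<in> borel_measurable borel" and fg: "AE x in lborel. f x = g x"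
      using completion_ex_borel_measurable_real[OF f] by auto
    have fg': "AE x in lebesgue. f x = g x" by (rule AE_completion[OF fg])
    have gm: "g \<in> borel_measurable lebesgue" by (rule borel_measurable_AE[OF f fg'])
    have "AE x in lborel. g x = 0"
    proof (rule AE_eq_0_if_box_integrals[OF g])
      fix a b :: 'a
      have eq: "AE x in lebesgue. indicator (box a b) x * f x = indicator (box a b) x * g x"
        using fg' by eventually_elim simp
      have gm': "(\<lambda>x. indicator (box a b) x * g x) \<in> borel_measurable lborel" by measurable
      have fm: "(\<lambda>x. indicator (box a b) x * f x) \<in> borel_measurable lebesgue"
        using i[of a b] by (rule borel_measurable_integrable)
      have gm2: "(\<lambda>x. indicator (box a b) x * g x) \<in> borel_measurable lebesgue"
        by (rule borel_measurable_AE[OF fm eq])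
      show "integrable lborel (\<lambda>x. indicator (box a b) x * g x)"
        using i[of a b] integrable_cong_AE[OF fm gm2 eq] integrable_completion[OF gm'] by simp
      show "(LINT x|lborel. indicator (box a b) x * g x) = 0"
        using z[of a b] integral_cong_AE[OF fm gm2 eq] integral_completion[OF gm'] by simp
    qed
    then have "AE x in lebesgue. g x = 0" by (rule AE_completion)
    with fg' show ?thesis by eventually_elim simp
  qed
  have "AE x in lebesgue. Re (h x) = 0"
  proof (rule *)
    show "(\<lambda>x. Re (h x)) \<in> borel_measurable lebesgue" using h by measurable
    show "integrable lebesgue (\<lambda>x. indicator (box a b) x * Re (h x))" for a b
      using integrable_Re[OF i[of a b]] by simp
    show "(LINT x|lebesgue. indicator (box a b) x * Re (h x)) = 0" for a b
      using integral_Re[OF i[of a b]] z[of a b] by simp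
  qed
  moreover have "AE x in lebesgue. Im (h x) = 0"
  proof (rule *)
    show "(\<lambda>x. Im (h x)) \<in> borel_measurable lebesgue" using h by measurable
    show "integrable lebesgue (\<lambda>x. indicator (box a b) x * Im (h x))" for a b
      using integrable_Im[OF i[of a b]] by simp
    show "(LINT x|lebesgue. indicator (box a b) x * Im (h x)) = 0" for a b
      using integral_Im[OF i[of a b]] z[of a b] by simp
  qed
  ultimately show ?thesis by eventually_elim (simp add: complex_eq_iff)
qed

text \<open>With \<open>\<beta>\<close> a bump function on a box, \<open>1 - (1 - \<beta>)\<^sup>n\<close> increases to the indicator of the box.  Comparison with a
  bump function on a larger box shows that \<open>h\<close> is integrable there.\<close>

lemma AE_eq_0_if_test_integrals:
  fixes h :: "'n::finite cfun"
  assumes h: "h \<in> borel_measurable lebesgue"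
    and i: "\<And>\<theta>. test_function \<theta> \<Longrightarrow> integrable lebesgue (\<lambda>x. h x * \<theta> x)"
    and z: "\<And>\<theta>. test_function \<theta> \<Longrightarrow> (LINT x|lebesgue. h x * \<theta> x) = 0"
  shows "AE x in lebesgue. h x = 0"
proof (rule AE_eq_0_if_box_integrals_complex[OF h])
  fix a b :: "real^'n"
  let ?a = "a - (\<chi> i. 1)" and ?b = "b + (\<chi> i. 1)"
  let ?B = "bumpr ?a ?b"
  define \<beta> where "\<beta> = (\<lambda>t. complex_of_real (bumpr a b t))"
  define \<beta>' where "\<beta>' = (\<lambda>t. complex_of_real (?B t))"
  have bm: "indicator (box a b) \<in> borel_measurable (lebesgue :: (real^'n) measure)"
    by (rule borel_measurable_indicator) auto
  have hm: "(\<lambda>x. indicator (box a b) x *\<^sub>R h x) \<in> borel_measurable lebesgue"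
    using h bm by (intro borel_measurable_scaleR)
  have "\<exists>c>0. \<forall>t\<in>cbox a b. c \<le> ?B t"
  proof (cases "cbox a b = {}")
    case False
    have "continuous_on (cbox a b) (\<lambda>t. complex_of_real (?B t))"
      by (intro smooth_continuous smooth_bumpr)
    then have "continuous_on (cbox a b) (\<lambda>t. Re (complex_of_real (?B t)))"
      by (rule continuous_on_Re)
    then obtain t0 where t0: "t0 \<in> cbox a b"
      "\<And>t. t \<in> cbox a b \<Longrightarrow> ?B t0 \<le> ?B t"
      using continuous_attains_inf[OF compact_cbox False] by fastforce
    have "t0 \<in> box ?a ?b"
      using t0(1) by (auto simp: mem_box_cart intro: less_le_trans le_less_trans)
        (metis add.commute add_le_imp_le_diff diff_less_eq le_less_trans less_add_one less_diff_eq less_le_trans)+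
    then show ?thesis using t0(2) bumpr_pos_iff by blast
  qed (auto intro: exI[of _ 1])
  then obtain c where c: "0 < c" "\<And>t. t \<in> cbox a b \<Longrightarrow> c \<le> ?B t" by blast
  have i': "integrable lebesgue (\<lambda>x. (1 / c) *\<^sub>R (h x * \<beta>' x))"
    unfolding \<beta>'_def by (intro integrable_scaleR_right i test_function_bumpr)
  show I: "integrable lebesgue (\<lambda>x. indicator (box a b) x *\<^sub>R h x)"
  proof (rule Bochner_Integration.integrable_bound[OF i' hm], intro AE_I2)
    fix x
    show "norm (indicator (box a b) x *\<^sub>R h x) \<le> norm ((1 / c) *\<^sub>R (h x * \<beta>' x))"
    proof (cases "x \<in> box a b")
      case True
      then have "x \<in> cbox a b" using box_subset_cbox by blast
      from c(2)[OF this] have "norm (h x) * c \<le> norm (h x) * ?B x"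
        by (intro mult_left_mono) auto
      then show ?thesis using True c(1) bumpr_nonneg[of ?a ?b x] by (simp add: \<beta>'_def norm_mult field_simps)
    qed simp
  qed
  define \<theta> where "\<theta> n t = 1 - (1 - \<beta> t) ^ n" for n :: nat and t
  have \<theta>_real: "\<theta> n t = of_real (1 - (1 - bumpr a b t) ^ n)" for n t by (simp add: \<theta>_def \<beta>_def)
  have b01: "0 \<le> 1 - bumpr a b t" "1 - bumpr a b t \<le> 1" for t using bumpr_nonneg bumpr_le_1 by auto
  have \<theta>_out: "\<theta> n t = 0" if "t \<notin> box a b" for n t
    using that bumpr_pos_iff[of a b t] bumpr_nonneg[of a b t] by (simp add: \<theta>_def \<beta>_def)
  have test: "test_function (\<theta> n)" for n
  proof (rule test_functionI[where a=a and b=b])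
    have "smooth (\<lambda>t. (1 - \<beta> t) ^ n)"
      by (induction n) (auto simp: \<beta>_def intro!: smooth_const smooth_mult smooth_diff smooth_bumpr)
    then show "smooth (\<theta> n)" unfolding \<theta>_def by (intro smooth_diff smooth_const)
    show "\<theta> n t \<noteq> 0 \<Longrightarrow> t \<in> cbox a b" for t using \<theta>_out box_subset_cbox by blast
  qed
  have "(\<lambda>n. LINT x|lebesgue. h x * \<theta> n x) \<longlonglongrightarrow> (LINT x|lebesgue. indicator (box a b) x *\<^sub>R h x)"
  proof (rule integral_dominated_convergence[where w="\<lambda>x. norm (indicator (box a b) x *\<^sub>R h x)", OF hm])
    show "(\<lambda>x. h x * \<theta> n x) \<in> borel_measurable lebesgue" for n
      using i[OF test] by (rule borel_measurable_integrable)
    show "integrable lebesgue (\<lambda>x. norm (indicator (box a b) x *\<^sub>R h x))" using I by (rule integrable_norm)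
    show "AE x in lebesgue. (\<lambda>n. h x * \<theta> n x) \<longlonglongrightarrow> indicator (box a b) x *\<^sub>R h x"
    proof (intro AE_I2)
      fix x
      show "(\<lambda>n. h x * \<theta> n x) \<longlonglongrightarrow> indicator (box a b) x *\<^sub>R h x"
      proof (cases "x \<in> box a b")
        case True
        then have "0 < bumpr a b x" by (simp add: bumpr_pos_iff)
        then have "(\<lambda>n. (1 - bumpr a b x) ^ n) \<longlonglongrightarrow> 0" using b01[of x] by (intro LIMSEQ_power_zero) (auto simp: abs_if)
        then have "(\<lambda>n. h x * of_real (1 - (1 - bumpr a b x) ^ n)) \<longlonglongrightarrow> h x * of_real (1 - 0)"
          by (intro tendsto_mult tendsto_of_real tendsto_diff tendsto_const)
        then show ?thesis using True by (simp add: \<theta>_real)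
      qed (simp add: \<theta>_out)
    qed
    show "AE x in lebesgue. norm (h x * \<theta> n x) \<le> norm (indicator (box a b) x *\<^sub>R h x)" for n
    proof (intro AE_I2)
      fix x
      have "0 \<le> (1 - bumpr a b x) ^ n" "(1 - bumpr a b x) ^ n \<le> 1" using b01[of x] by (auto intro: power_le_one)
      then have "norm (\<theta> n x) \<le> 1" by (simp add: \<theta>_real del: of_real_diff of_real_power)
      then show "norm (h x * \<theta> n x) \<le> norm (indicator (box a b) x *\<^sub>R h x)"
        by (cases "x \<in> box a b") (auto simp: norm_mult \<theta>_out mult_left_le)
    qed
  qed
  then show "(LINT x|lebesgue. indicator (box a b) x *\<^sub>R h x) = 0"
    using z[OF test] LIMSEQ_unique by (simp add: LIMSEQ_const_iff)
qed

lemma represents_unique: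
  assumes "represents h u" "represents h' u"
  shows "AE x in lebesgue. h x = h' x"
proof -
  have "AE x in lebesgue. h x - h' x = 0"
  proof (rule AE_eq_0_if_test_integrals)
    show "(\<lambda>x. h x - h' x) \<in> borel_measurable lebesgue"
      using assms unfolding represents_def by (intro borel_measurable_diff) auto
    fix \<theta> :: "real^'a \<Rightarrow> complex" assume t: "test_function \<theta>"
    have "integrable lebesgue (\<lambda>x. h x * \<theta> x)" "integrable lebesgue (\<lambda>x. h' x * \<theta> x)"
      "(LINT x|lebesgue. h x * \<theta> x) = (LINT x|lebesgue. h' x * \<theta> x)"
      using assms t unfolding represents_def by auto
    then show "integrable lebesgue (\<lambda>x. (h x - h' x) * \<theta> x)" "(LINT x|lebesgue. (h x - h' x) * \<theta> x) = 0"
      by (simp_all add: left_diff_distrib)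
  qed
  then show ?thesis by eventually_elim simp
qed

section \<open>Fourier inversion\<close>

text \<open>Equal to \<open>(2\<pi>)\<^sup>n\<close>, but introduced as the constant that makes the inversion formula true; then it remains to see that
  it does not vanish.\<close>

definition inv_const :: "'n::finite itself \<Rightarrow> complex" where
  "inv_const _ = (LINT \<xi>|lborel. ft (chi :: 'n cfun) \<xi>)"

lemma ft_cutoff:
  fixes t :: "real^'n::finite"
  shows "ft (cutoff n) t = real (Suc n) ^ DIM(real^'n) *\<^sub>R ft chi (real (Suc n) *\<^sub>R t)"
proof -
  let ?e = "1 / real (Suc n)"
  have m: "(\<lambda>\<xi>::real^'n. chi \<xi> * ee (real (Suc n) *\<^sub>R t) \<xi>) \<in> borel_measurable borel"
    by (intro schwartz_borel schwartz_ee' schwartz_chi)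
  have "ft (cutoff n) t = (LINT \<xi>|lborel. chi (0 + ?e *\<^sub>R \<xi>) * ee (real (Suc n) *\<^sub>R t) (0 + ?e *\<^sub>R \<xi>))"
    unfolding ft_def cutoff_def by (rule Bochner_Integration.integral_cong) (simp_all add: ee_def)
  also have "\<dots> = (1 / \<bar>?e\<bar> ^ DIM(real^'n)) *\<^sub>R (LINT \<xi>|lborel. chi \<xi> * ee (real (Suc n) *\<^sub>R t) \<xi>)"
    by (rule lborel_affine_integral(1)[OF m]) simp
  finally show ?thesis by (simp add: ft_def power_one_over)
qed

text \<open>Evaluation at the origin is recovered by testing against \<open>ft (cutoff n)\<close>, which is an approximate
  identity up to the factor \<open>inv_const\<close>.\<close>

lemma integral_ft:
  fixes q :: "'n::finite cfun"
  assumes q: "schwartz q"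
  shows "(LINT \<xi>|lborel. ft q \<xi>) = inv_const TYPE('n) * q 0"
proof -
  let ?N = "\<lambda>n. real (Suc n)"
  have [measurable]: "q \<in> borel_measurable borel" "(chi :: 'n cfun) \<in> borel_measurable borel"
    "ft q \<in> borel_measurable borel" "ft (chi :: 'n cfun) \<in> borel_measurable borel"
    by (intro schwartz_borel q schwartz_chi schwartz_ft)+
  have [measurable]: "(cutoff n :: 'n cfun) \<in> borel_measurable borel" for n
    by (rule smooth_borel[OF smooth_cutoff])
  have eq: "(LINT \<xi>|lborel. ft q \<xi> * cutoff n \<xi>) = (LINT s|lborel. q ((1 / ?N n) *\<^sub>R s) * ft chi s)" for n
  proof -
    have "(LINT \<xi>|lborel. ft q \<xi> * cutoff n \<xi>) = (LINT t|lborel. q t * ft (cutoff n) t)"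
      by (rule ft_multiplication_formula[OF q test_function_schwartz[OF test_function_cutoff]])
    also have "\<dots> = ?N n ^ DIM(real^'n) *\<^sub>R (LINT t|lborel. q ((1 / ?N n) *\<^sub>R (0 + ?N n *\<^sub>R t)) * ft chi (0 + ?N n *\<^sub>R t))"
      by (simp add: ft_cutoff del: of_nat_Suc)
    also have "(LINT t|lborel. q ((1 / ?N n) *\<^sub>R (0 + ?N n *\<^sub>R t)) * ft chi (0 + ?N n *\<^sub>R t))
       = (1 / \<bar>?N n\<bar> ^ DIM(real^'n)) *\<^sub>R (LINT s|lborel. q ((1 / ?N n) *\<^sub>R s) * ft chi s)"
      by (rule lborel_affine_integral(1)) auto
    finally show ?thesis by (simp del: of_nat_Suc)
  qed
  have "(\<lambda>n. LINT \<xi>|lborel. ft q \<xi> * cutoff n \<xi>) \<longlonglongrightarrow> (LINT \<xi>|lborel. ft q \<xi> * 1)"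
  proof (rule integral_dominated_convergence[where w="\<lambda>\<xi>. norm (ft q \<xi>) * sn 0 0 (chi :: 'n cfun)"])
    show "integrable lborel (\<lambda>\<xi>. norm (ft q \<xi>) * sn 0 0 (chi :: 'n cfun))"
      by (intro integrable_mult_left integrable_norm schwartz_integrable schwartz_ft q)
    show "AE \<xi> in lborel. (\<lambda>n. ft q \<xi> * cutoff n \<xi>) \<longlonglongrightarrow> ft q \<xi> * 1"
      by (intro AE_I2 tendsto_mult tendsto_const cutoff_tendsto)
    show "AE \<xi> in lborel. norm (ft q \<xi> * cutoff n \<xi>) \<le> norm (ft q \<xi>) * sn 0 0 (chi :: 'n cfun)" for n
      by (intro AE_I2) (simp add: norm_mult mult_left_mono norm_cutoff_le)
  qed auto
  moreover have "(\<lambda>n. LINT s|lborel. q ((1 / ?N n) *\<^sub>R s) * ft chi s) \<longlonglongrightarrow> (LINT s|(lborel :: (real^'n) measure). q 0 * ft chi s)"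
  proof (rule integral_dominated_convergence[where w="\<lambda>s. sn 0 0 q * norm (ft (chi :: 'n cfun) s)"])
    show "integrable lborel (\<lambda>s. sn 0 0 q * norm (ft (chi :: 'n cfun) s))"
      by (intro integrable_mult_right integrable_norm schwartz_integrable schwartz_ft schwartz_chi)
    show "AE s in lborel. (\<lambda>n. q ((1 / ?N n) *\<^sub>R s) * ft chi s) \<longlonglongrightarrow> q 0 * ft chi s"
    proof (intro AE_I2 tendsto_mult tendsto_const)
      fix s :: "real^'n"
      have "(\<lambda>n. (1 / ?N n) *\<^sub>R s) \<longlonglongrightarrow> 0 *\<^sub>R s"
        by (intro tendsto_scaleR tendsto_const) (use LIMSEQ_inverse_real_of_nat in \<open>simp add: inverse_eq_divide\<close>)
      then show "(\<lambda>n. q ((1 / ?N n) *\<^sub>R s)) \<longlonglongrightarrow> q 0"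
        using isCont_tendsto_compose[OF smooth_isCont[OF schwartz_smooth[OF q]]] by fastforce
    qed
    show "AE s in lborel. norm (q ((1 / ?N n) *\<^sub>R s) * ft chi s) \<le> sn 0 0 q * norm (ft (chi :: 'n cfun) s)" for n
      using norm_le_sn[OF q, of _ 0] by (intro AE_I2) (simp add: norm_mult mult_right_mono)
  qed auto
  ultimately have "(LINT \<xi>|lborel. ft q \<xi> * 1) = (LINT s|(lborel :: (real^'n) measure). q 0 * ft chi s)"
    unfolding eq by (rule LIMSEQ_unique)
  then show ?thesis by (simp add: inv_const_def mult.commute)
qed

lemma continuous_AE_eq_0:
  fixes f :: "'a::euclidean_space \<Rightarrow> 'b::real_normed_vector"
  assumes "continuous_on UNIV f" "AE x in lebesgue. f x = 0"
  shows "f x = 0"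
proof -
  have "closed {x. f x = 0}" using assms(1) by (intro closed_Collect_eq) auto
  from mem_closed_if_AE_lebesgue[OF this] assms(2) show ?thesis by simp
qed

text \<open>With \<open>\<psi>\<close> the convolution of \<open>chi\<close> and its reflected conjugate, \<open>ft \<psi>\<close> is the square of \<open>\<bar>ft chi\<bar>\<close>, so that
  \<open>\<integral> ft \<psi>\<close> is positive; this value is \<open>inv_const * \<psi> 0\<close>.\<close>

lemma inv_const_nonzero: "inv_const TYPE('n::finite) \<noteq> 0"
proof
  assume 0: "inv_const TYPE('n) = 0"
  let ?c = "chi :: 'n cfun"
  let ?g = "\<lambda>t. cnj (?c (- t))"
  have g: "schwartz ?g" by (intro schwartz_cnj schwartz_translate schwartz_chi)
  have sc: "schwartz (ft ?c)" by (intro schwartz_ft schwartz_chi)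
  have "ft (cv ?c ?g) \<xi> = of_real ((norm (ft ?c \<xi>))\<^sup>2)" for \<xi>
    unfolding ft_cv[OF schwartz_chi g] ft_cnj ft_reflect[OF schwartz_chi]
    by (simp only: minus_minus complex_norm_square)
  then have "(LINT \<xi>|lborel. complex_of_real ((norm (ft ?c \<xi>))\<^sup>2)) = 0"
    using integral_ft[OF schwartz_cv[OF schwartz_chi g]] 0 by simp
  then have z: "(LINT \<xi>|lborel. (norm (ft ?c \<xi>))\<^sup>2) = 0" by (simp only: integral_complex_of_real of_real_eq_0_iff)
  have I: "integrable lborel (\<lambda>\<xi>. (norm (ft ?c \<xi>))\<^sup>2)"
    using integrable_norm[OF schwartz_integrable[OF schwartz_mult[OF sc sc]]] by (simp add: norm_mult power2_eq_square)
  then have "AE \<xi> in lborel. (norm (ft ?c \<xi>))\<^sup>2 = 0" using z integral_nonneg_eq_0_iff_AE[OF I] by simp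
  then have "AE \<xi> in lebesgue. ft ?c \<xi> = 0" by (intro AE_completion) simp
  then have "ft ?c 0 = 0" by (rule continuous_AE_eq_0[OF smooth_continuous[OF schwartz_smooth[OF sc]]])
  then have "(LINT t|lborel. complex_of_real (Re (?c t))) = 0" by (simp add: ft_def flip: chi_real(1))
  then have z: "(LINT t|lborel. Re (?c t)) = 0" by (simp only: integral_complex_of_real of_real_eq_0_iff)
  have "AE t in lborel. Re (?c t) = 0"
    using z integral_nonneg_eq_0_iff_AE[OF integrable_Re[OF schwartz_integrable[OF schwartz_chi]]] chi_real(2) by auto
  then have "AE t in lebesgue. ?c t = 0" by (intro AE_completion) (erule eventually_mono, metis chi_real(1) of_real_0)
  then have "?c 0 = 0" by (rule continuous_AE_eq_0[OF smooth_continuous[OF schwartz_smooth[OF schwartz_chi]]])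
  then show False by simp
qed

text \<open>The value at \<open>x\<close> is the value at the origin of a translate, whose transform is modulated by \<open>x\<close>.\<close>

lemma fourier_inversion:
  fixes q :: "'n::finite cfun"
  assumes q: "schwartz q"
  shows "(LINT \<xi>|lborel. ft q \<xi> * ee \<xi> (- x)) = inv_const TYPE('n) * q x"
proof -
  have "ft (\<lambda>t. q (t + x)) \<xi> = ee \<xi> (- x) * ft q \<xi>" for \<xi>
    using ft_translate[OF q, of "- x" \<xi>] by simp
  then show ?thesis using integral_ft[OF schwartz_translate(2)[OF q, of x]] by (simp add: mult.commute)
qed

section \<open>The Gabor kernel and the resolution of the identity\<close>

text \<open>The coefficients of \<open>\<theta>\<close> in the expansion into time-frequency shifts of \<open>\<phi>\<close>; on a shift of \<open>\<theta>\<close> they are the kernel of the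
  change of windows.\<close>

definition gab :: "'n::finite cfun \<Rightarrow> 'n cfun \<Rightarrow> 'n phase \<Rightarrow> complex" where
  "gab \<phi> \<theta> Y = (LINT s|lborel. cnj (tf \<phi> Y s) * \<theta> s)"

lemma gab_eq_ft: "gab \<phi> \<theta> Y = ft (\<lambda>s. cnj (\<phi> (s - fst Y)) * \<theta> s) (- snd Y)"
  unfolding gab_def ft_def tf_def
  by (rule Bochner_Integration.integral_cong) (auto simp: cnj_ee mult_ac)

lemma br_pair: "br ((a, b) - (c, d)) \<le> br (a - c) * br (b - d)"
proof -
  have "norm (a - c, b - d) \<le> norm (a - c) + norm (b - d)" by (rule norm_Pair_le)
  moreover have "0 \<le> norm (a - c) * norm (b - d)" by (rule mult_nonneg_nonneg) auto
  moreover have "br (a - c) * br (b - d) = 1 + norm (a - c) + norm (b - d) + norm (a - c) * norm (b - d)"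
    by (simp add: br_def algebra_simps)
  ultimately show ?thesis unfolding diff_Pair br_def[of "(_, _)"] by linarith
qed

text \<open>Up to a phase, \<open>gab \<phi> (tf \<theta> X) Y\<close> is the Fourier transform at \<open>\<xi> - \<eta>\<close> of a product of two Schwartz
  functions centred at \<open>x\<close> and \<open>y\<close>: the product is small when \<open>x - y\<close> is large, its Fourier transform
  when \<open>\<xi> - \<eta>\<close> is.\<close>

lemma gab_decay:
  fixes \<phi> :: "'n::finite cfun"
  assumes p: "schwartz \<phi>"
  obtains C where "0 \<le> C" "\<And>(\<theta> :: 'n cfun) X Y. schwartz \<theta> \<Longrightarrow>
    norm (gab \<phi> (tf \<theta> X) Y) \<le> C * sn (M + 2 * DIM(real^'n)) M \<theta> / br (X - Y) ^ M"
proof -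
  let ?d = "2 * DIM(real^'n)"
  let ?J = "jet_const TYPE('n) M"
  define C where "C = decay_const TYPE('n) M * (?J * sn M M \<phi> * wint TYPE(real^'n) ?d)"
  show ?thesis
  proof (rule that[of C])
    show "0 \<le> C" unfolding C_def by (intro mult_nonneg_nonneg sn_nonneg p) auto
    fix \<theta> :: "'n cfun" and X Y :: "'n phase" assume t: "schwartz \<theta>"
    obtain x \<xi> y \<eta> where XY: "X = (x, \<xi>)" "Y = (y, \<eta>)" by (metis surj_pair)
    define a where "a = (\<lambda>s. cnj (\<phi> (s - y)))"
    define b where "b = (\<lambda>s. \<theta> (s - x))"
    have sa: "schwartz a" unfolding a_def by (intro schwartz_cnj schwartz_translate p)
    have sb: "schwartz b" unfolding b_def by (intro schwartz_translate t)
    define q where "q = (\<lambda>s. a s * b s)"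
    have q: "schwartz q" unfolding q_def by (rule schwartz_mult[OF sa sb])
    have "gab \<phi> (tf \<theta> X) Y = ft (\<lambda>s. ee \<xi> s * q s) (- \<eta>)"
      unfolding gab_eq_ft by (simp add: XY tf_def q_def a_def b_def mult_ac)
    also have "\<dots> = ft q (\<xi> - \<eta>)" by (simp add: ft_modulate)
    finally have g: "gab \<phi> (tf \<theta> X) Y = ft q (\<xi> - \<eta>)" .
    let ?S = "?J * sn M M \<phi> * sn (M + ?d) M \<theta> / br (x - y) ^ M"
    have S0: "0 \<le> ?S" by (intro divide_nonneg_nonneg mult_nonneg_nonneg sn_nonneg p t) auto
    have jq: "jet M q s \<le> ?S / br (s - x) ^ ?d" for s
    proof -
      have ja: "jet M a s \<le> sn M M \<phi> / br (s - y) ^ M"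
      proof -
        have "jet M a s \<le> jet M \<phi> (s - y)"
          unfolding a_def jet_cnj[OF schwartz_smooth[OF schwartz_translate(1)[OF p]]]
          using jet_affine[OF schwartz_smooth[OF p], of 1 M "- y" s] by simp
        then show ?thesis using jet_le_sn[OF p] order_trans by blast
      qed
      have jb: "jet M b s \<le> sn (M + ?d) M \<theta> / br (s - x) ^ (M + ?d)"
        using jet_affine[OF schwartz_smooth[OF t], of 1 M "- x" s] jet_le_sn[OF t, of M "s - x" "M + ?d"]
        unfolding b_def by simp
      have "jet M q s \<le> ?J * (jet M a s * jet M b s)"
        unfolding q_def by (intro jet_mult schwartz_smooth sa sb)
      also have "\<dots> \<le> ?J * ((sn M M \<phi> / br (s - y) ^ M) * (sn (M + ?d) M \<theta> / br (s - x) ^ (M + ?d)))"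
        by (intro mult_left_mono mult_mono ja jb divide_nonneg_nonneg sn_nonneg p) auto
      also have "\<dots> = ?J * sn M M \<phi> * sn (M + ?d) M \<theta> / br (s - x) ^ ?d * (1 / (br (s - y) ^ M * br (s - x) ^ M))"
        by (simp add: power_add field_simps)
      also have "\<dots> \<le> ?J * sn M M \<phi> * sn (M + ?d) M \<theta> / br (s - x) ^ ?d * (1 / br (x - y) ^ M)"
      proof (intro mult_left_mono divide_left_mono)
        have "br (x - y) ^ M \<le> br (s - y) ^ M * br (x - s) ^ M" using br_add_power[of "s - y" "x - s" M] by simp
        then show "br (x - y) ^ M \<le> br (s - y) ^ M * br (s - x) ^ M" by (simp add: br_commute[of x s])
      qed (auto intro!: divide_nonneg_nonneg mult_nonneg_nonneg sn_nonneg p t)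
      finally show ?thesis by (simp add: field_simps)
    qed
    have iq: "(LINT s|lborel. jet M q s) \<le> ?S * wint TYPE(real^'n) ?d"
    proof -
      have w: "(\<lambda>s::real^'n. ?S * (1 / br s ^ ?d)) \<in> borel_measurable borel" by measurable
      have I: "integrable lborel (\<lambda>s. ?S * (1 / br (s::real^'n) ^ ?d))" by (intro integrable_mult_right integrable_weight order_refl)
      have "(LINT s|lborel. jet M q s) \<le> (LINT s|lborel. ?S * (1 / br (s - x) ^ ?d))"
      proof (rule integral_mono[OF jet_integrable(1)[OF q]])
        show "integrable lborel (\<lambda>s. ?S * (1 / br (s - x) ^ ?d))"
          using lborel_affine_integral(2)[OF w, of 1 "- x"] I by simp
        show "jet M q s \<le> ?S * (1 / br (s - x) ^ ?d)" for s using jq[of s] by simp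
      qed
      also have "\<dots> = (LINT s|lborel. ?S * (1 / br (s::real^'n) ^ ?d))" using lborel_shift_integral(2)[OF w, of x] by simp
      also have "\<dots> = ?S * wint TYPE(real^'n) ?d" unfolding wint_def by (rule integral_mult_right_zero)
      finally show ?thesis .
    qed
    have "br (\<xi> - \<eta>) ^ M * norm (ft q (\<xi> - \<eta>)) \<le> decay_const TYPE('n) M * (?S * wint TYPE(real^'n) ?d)"
      by (rule order_trans[OF ft_decay[OF q] mult_left_mono[OF iq]]) simp
    also have "\<dots> = C * sn (M + ?d) M \<theta> / br (x - y) ^ M" by (simp add: C_def)
    finally have 1: "norm (ft q (\<xi> - \<eta>)) \<le> C * sn (M + ?d) M \<theta> / (br (x - y) ^ M * br (\<xi> - \<eta>) ^ M)"
      by (simp add: field_simps)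
    have "br (X - Y) ^ M \<le> br (x - y) ^ M * br (\<xi> - \<eta>) ^ M"
      unfolding XY power_mult_distrib[symmetric] by (intro power_mono br_pair) auto
    then have "C * sn (M + ?d) M \<theta> / (br (x - y) ^ M * br (\<xi> - \<eta>) ^ M) \<le> C * sn (M + ?d) M \<theta> / br (X - Y) ^ M"
      using \<open>0 \<le> C\<close> sn_nonneg[OF t] by (intro divide_left_mono) auto
    with 1 show "norm (gab \<phi> (tf \<theta> X) Y) \<le> C * sn (M + ?d) M \<theta> / br (X - Y) ^ M"
      unfolding g by (rule order_trans)
  qed
qed

lemma tf_zero [simp]: "tf f 0 = f"
  by (simp add: tf_def fun_eq_iff)

lemma gab_decay0:
  assumes "schwartz \<phi>" "schwartz \<theta>"
  shows "\<exists>C. \<forall>Y. norm (gab \<phi> \<theta> Y) \<le> C / br Y ^ M"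
proof -
  obtain C where "\<And>\<theta> X Y. schwartz \<theta> \<Longrightarrow> norm (gab \<phi> (tf \<theta> X) Y) \<le> C * sn (M + 2 * DIM(real^'a)) M \<theta> / br (X - Y) ^ M"
    using gab_decay[OF assms(1)] by metis
  from this[OF assms(2), of 0] show ?thesis by auto
qed

lemma borel_compose_continuous:
  "f \<in> borel_measurable borel \<Longrightarrow> continuous_on UNIV g \<Longrightarrow> (\<lambda>x. f (g x)) \<in> borel_measurable borel"
  by (rule measurable_compose[OF borel_measurable_continuous_onI])

lemma tf_borel:
  fixes f :: "'n::finite cfun"
  assumes "f \<in> borel_measurable borel"
  shows "(\<lambda>(Y, s). tf f Y s) \<in> borel_measurable (borel \<Otimes>\<^sub>M borel)" and "(\<lambda>Y. tf f Y s) \<in> borel_measurable borel"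
proof -
  have "(\<lambda>Z::('n phase) \<times> (real^'n). ee (snd (fst Z)) (snd Z) * f (snd Z - fst (fst Z))) \<in> borel_measurable borel"
    unfolding ee_def
    by (intro borel_measurable_times borel_compose_continuous[OF assms] borel_measurable_continuous_onI continuous_intros)
  then show "(\<lambda>(Y, s). tf f Y s) \<in> borel_measurable (borel \<Otimes>\<^sub>M borel)"
    by (simp add: tf_def split_beta' borel_prod)
  show "(\<lambda>Y. tf f Y s) \<in> borel_measurable borel"
    unfolding tf_def ee_def
    by (intro borel_measurable_times borel_compose_continuous[OF assms] borel_measurable_continuous_onI continuous_intros)
qed

lemma gab_borel:
  fixes \<phi> \<theta> :: "'n::finite cfun"
  assumes "schwartz \<phi>" "schwartz \<theta>"
  shows "gab \<phi> \<theta> \<in> borel_measurable borel"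
proof -
  have t: "(\<lambda>Z. \<theta> (snd Z)) \<in> borel_measurable (borel :: (('n phase) \<times> (real^'n)) measure)"
    by (intro borel_compose_continuous[OF schwartz_borel[OF assms(2)]] continuous_intros)
  have "(\<lambda>Z. tf \<phi> (fst Z) (snd Z)) \<in> borel_measurable (borel :: (('n phase) \<times> (real^'n)) measure)"
    using tf_borel(1)[OF schwartz_borel[OF assms(1)]] by (simp add: split_beta' borel_prod)
  with t have m: "(\<lambda>Z. cnj (tf \<phi> (fst Z) (snd Z)) * \<theta> (snd Z)) \<in> borel_measurable (borel :: (('n phase) \<times> (real^'n)) measure)"
    by (intro borel_measurable_times measurable_compose[OF _ borel_measurable_continuous_onI[of cnj]] continuous_intros)
  then have "(\<lambda>(Y, s). cnj (tf \<phi> Y s) * \<theta> s) \<in> borel_measurable (borel \<Otimes>\<^sub>M lborel)"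
  proof -
    have S: "sets ((borel :: ('n phase) measure) \<Otimes>\<^sub>M (lborel :: (real^'n) measure)) = sets (borel \<Otimes>\<^sub>M borel)"
      by (rule sets_pair_measure_cong[OF refl sets_lborel])
    show ?thesis
      unfolding measurable_cong_sets[OF S refl] using m by (simp add: split_beta' borel_prod)
  qed
  from lborel.borel_measurable_lebesgue_integral[OF this] show ?thesis by (simp add: gab_def[abs_def])
qed

definition gab_const :: "'n::finite cfun \<Rightarrow> complex" where
  "gab_const \<phi> = inv_const TYPE('n) * (LINT s|lborel. \<phi> s * cnj (\<phi> s))"

lemma gab_const_nonzero:
  fixes \<phi> :: "'n::finite cfun"
  assumes "window \<phi>" shows "gab_const \<phi> \<noteq> 0"
proof
  have p: "schwartz \<phi>" using assms by (simp add: window_def)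
  assume "gab_const \<phi> = 0"
  then have "(LINT s|lborel. complex_of_real ((norm (\<phi> s))\<^sup>2)) = 0"
    using inv_const_nonzero[where 'n='n] unfolding complex_norm_square by (simp add: gab_const_def)
  then have z: "(LINT s|lborel. (norm (\<phi> s))\<^sup>2) = 0" by (simp only: integral_complex_of_real of_real_eq_0_iff)
  have I: "integrable lborel (\<lambda>s. (norm (\<phi> s))\<^sup>2)"
    using integrable_norm[OF schwartz_integrable[OF schwartz_mult[OF p p]]] by (simp add: norm_mult power2_eq_square)
  then have "AE s in lborel. (norm (\<phi> s))\<^sup>2 = 0" using z integral_nonneg_eq_0_iff_AE[OF I] by simp
  then have "AE s in lebesgue. \<phi> s = 0" by (intro AE_completion) simp
  then have "\<phi> s = 0" for s by (rule continuous_AE_eq_0[OF smooth_continuous[OF schwartz_smooth[OF p]]])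
  then show False using assms by (simp add: window_def)
qed

lemma norm_tf: "norm (tf f Y t) = norm (f (t - fst Y))"
  by (simp add: tf_def norm_mult)

text \<open>The integral over the frequency is Fourier inversion for \<open>\<theta>\<close> times a translate of the conjugate of \<open>\<phi>\<close>; the integral over the
  position then gives the squared norm of \<open>\<phi>\<close>.\<close>

lemma resolution_of_identity:
  fixes \<phi> \<theta> :: "'n::finite cfun"
  assumes p: "schwartz \<phi>" and t: "schwartz \<theta>"
  shows "(LINT Y|lborel. gab \<phi> \<theta> Y * tf \<phi> Y t) = gab_const \<phi> * \<theta> t"
proof -
  have [measurable]: "gab \<phi> \<theta> \<in> borel_measurable borel" by (rule gab_borel[OF p t])
  have pm[measurable]: "\<phi> \<in> borel_measurable borel" by (rule schwartz_borel[OF p])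
  note tf_borel(2)[OF pm, measurable]
  obtain C where C: "\<And>Y. norm (gab \<phi> \<theta> Y) \<le> C / br Y ^ (2 * DIM('n phase))"
    using gab_decay0[OF p t] by blast
  have I: "integrable lborel (\<lambda>Y. gab \<phi> \<theta> Y * tf \<phi> Y t)"
  proof (rule integrable_by_weight[OF _ _ order_refl])
    fix Y :: "'n phase"
    have C0: "0 \<le> C / br Y ^ (2 * DIM('n phase))" using C[of Y] norm_ge_zero order_trans by blast
    have "norm (gab \<phi> \<theta> Y * tf \<phi> Y t) \<le> C / br Y ^ (2 * DIM('n phase)) * sn 0 0 \<phi>"
      unfolding norm_mult norm_tf using norm_le_sn[OF p, of "t - fst Y" 0] C0 by (intro mult_mono C) auto
    then show "norm (gab \<phi> \<theta> Y * tf \<phi> Y t) \<le> (C * sn 0 0 \<phi>) / br Y ^ (2 * DIM('n phase))" by simp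
  qed measurable
  have "(LINT Y|lborel. gab \<phi> \<theta> Y * tf \<phi> Y t) = (LINT y|lborel. LINT \<eta>|lborel. gab \<phi> \<theta> (y, \<eta>) * tf \<phi> (y, \<eta>) t)"
    using lborel_pair.integral_fst[of "\<lambda>y \<eta>. gab \<phi> \<theta> (y, \<eta>) * tf \<phi> (y, \<eta>) t"] I
    by (simp add: lborel_prod split_beta')
  also have "\<dots> = (LINT y|lborel. inv_const TYPE('n) * (\<phi> (t - y) * cnj (\<phi> (t - y))) * \<theta> t)"
  proof (rule Bochner_Integration.integral_cong[OF refl])
    fix y :: "real^'n"
    let ?q = "\<lambda>s. cnj (\<phi> (s - y)) * \<theta> s"
    have q: "schwartz ?q" by (intro schwartz_mult schwartz_cnj schwartz_translate p t)
    have m: "(\<lambda>\<eta>. ft ?q \<eta> * ee \<eta> (- t)) \<in> borel_measurable borel"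
      using schwartz_borel[OF schwartz_ft(1)[OF q]] by measurable
    have "(LINT \<eta>|lborel. gab \<phi> \<theta> (y, \<eta>) * tf \<phi> (y, \<eta>) t) = (LINT \<eta>|lborel. \<phi> (t - y) * (ft ?q (- \<eta>) * ee (- \<eta>) (- t)))"
      by (simp add: gab_eq_ft tf_def ee_minus mult_ac)
    also have "\<dots> = \<phi> (t - y) * (LINT \<eta>|lborel. ft ?q (- \<eta>) * ee (- \<eta>) (- t))" by simp
    also have "\<dots> = \<phi> (t - y) * (inv_const TYPE('n) * ?q t)"
      unfolding lborel_shift_integral(4)[OF m] fourier_inversion[OF q] ..
    finally show "(LINT \<eta>|lborel. gab \<phi> \<theta> (y, \<eta>) * tf \<phi> (y, \<eta>) t) = inv_const TYPE('n) * (\<phi> (t - y) * cnj (\<phi> (t - y))) * \<theta> t"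
      by simp
  qed
  also have "\<dots> = inv_const TYPE('n) * (LINT y|lborel. \<phi> (t - y) * cnj (\<phi> (t - y))) * \<theta> t" by simp
  also have "(LINT y|lborel. \<phi> (t - y) * cnj (\<phi> (t - y))) = (LINT y|lborel. \<phi> y * cnj (\<phi> y))"
    using lborel_shift_integral(3)[OF schwartz_borel[OF schwartz_mult[OF p schwartz_cnj[OF p]]], of t] by simp
  finally show ?thesis by (simp add: gab_const_def)
qed

section \<open>Tempered distributions commute with integrals\<close>

lemma tempered_sum:
  assumes u: "tempered u" and "finite A" and s: "\<And>v. v \<in> A \<Longrightarrow> schwartz (\<psi> v)"
  shows "schwartz (\<lambda>t. \<Sum>v\<in>A. c v * \<psi> v t)" and "u (\<lambda>t. \<Sum>v\<in>A. c v * \<psi> v t) = (\<Sum>v\<in>A. c v * u (\<psi> v))"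
proof -
  have z: "schwartz (\<lambda>t::real^'a. 0)" using schwartz_cmult(1)[OF schwartz_chi, of 0] by simp
  have uz: "u (\<lambda>t. 0) = 0" using tempered_cmult[OF u z, of 0] by simp
  have "schwartz (\<lambda>t. \<Sum>v\<in>A. c v * \<psi> v t) \<and> u (\<lambda>t. \<Sum>v\<in>A. c v * \<psi> v t) = (\<Sum>v\<in>A. c v * u (\<psi> v))"
    using assms(2) s
  proof (induction A)
    case empty
    then show ?case using z uz by simp
  next
    case (insert v A)
    then have "schwartz (\<lambda>t. \<Sum>v\<in>A. c v * \<psi> v t)" "schwartz (\<psi> v)"
      "u (\<lambda>t. \<Sum>v\<in>A. c v * \<psi> v t) = (\<Sum>v\<in>A. c v * u (\<psi> v))" by auto
    then show ?case using insert(1,2)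
      by (simp add: schwartz_add(1) schwartz_cmult(1) tempered_add[OF u] tempered_cmult[OF u])
  qed
  then show "schwartz (\<lambda>t. \<Sum>v\<in>A. c v * \<psi> v t)" "u (\<lambda>t. \<Sum>v\<in>A. c v * \<psi> v t) = (\<Sum>v\<in>A. c v * u (\<psi> v))" by auto
qed

text \<open>The factor \<open>min 1 (norm (X' - X))\<close> makes the bound meaningful for distant points also, so that it can be
  integrated.\<close>

lemma sn_tf_diff_global:
  fixes f :: "'n::finite cfun"
  assumes f: "schwartz f"
  obtains C where "0 \<le> C" "\<And>X X'. sn k N (\<lambda>t. tf f X' t - tf f X t)
    \<le> C * (br X * br X') ^ (k + 1 + N) * min 1 (norm (X' - X))"
proof -
  let ?K = "k + 1 + N"
  obtain L where L: "0 \<le> L" "\<And>X X'. norm (X' - X) \<le> 1 \<Longrightarrow>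
    sn k N (\<lambda>t. tf f X' t - tf f X t) \<le> L * br X ^ ?K * norm (X' - X)" using sn_tf_diff[OF f] by blast
  define c where "c = (jet_const TYPE('n) N)\<^sup>2 * sn k N f"
  have c: "0 \<le> c" by (auto simp: c_def intro!: mult_nonneg_nonneg sn_nonneg f)
  have tf: "sn k N (tf f X) \<le> c * br X ^ ?K" for X
    by (rule order_trans[OF sn_tf_growth[OF f, of k N X, folded c_def] mult_left_mono[OF br_power_mono c]]) simp
  have mono: "br X ^ ?K \<le> (br X * br X') ^ ?K" "br X' ^ ?K \<le> (br X * br X') ^ ?K" for X X' :: "'n phase"
    using mult_left_mono[OF br_ge1[of X'], of "br X"] mult_right_mono[OF br_ge1[of X], of "br X'"]
    by (intro power_mono; simp)+
  show ?thesis
  proof (rule that[of "L + 2 * c"])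
    fix X X' :: "'n phase"
    let ?R = "(br X * br X') ^ ?K"
    show "sn k N (\<lambda>t. tf f X' t - tf f X t) \<le> (L + 2 * c) * ?R * min 1 (norm (X' - X))"
    proof (cases "norm (X' - X) \<le> 1")
      case True
      have "sn k N (\<lambda>t. tf f X' t - tf f X t) \<le> L * br X ^ ?K * norm (X' - X)" by (rule L(2)[OF True])
      also have "\<dots> \<le> (L + 2 * c) * ?R * norm (X' - X)" using L(1) c by (intro mult_right_mono mult_mono mono) auto
      finally show ?thesis using True by simp
    next
      case False
      have "sn k N (\<lambda>t. tf f X' t - tf f X t) \<le> sn k N (tf f X') + sn k N (tf f X)"
        using schwartz_add(2)[OF schwartz_tf(1)[OF f] schwartz_cmult(1)[OF schwartz_tf(1)[OF f], of "-1"], of k N X' X]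
          schwartz_cmult(2)[OF schwartz_tf(1)[OF f], of k N "-1" X] by simp
      also have "\<dots> \<le> c * ?R + c * ?R" using tf mono c by (intro add_mono order_trans[OF tf] mult_left_mono mono) auto
      also have "\<dots> \<le> (L + 2 * c) * ?R" using L(1) by (simp add: algebra_simps)
      finally show ?thesis using False by simp
    qed
  qed (use L c in simp)
qed

text \<open>The family \<open>tf f (\<tau> y)\<close> is approximated by families taking finitely many values, for which the
  claim is the linearity of \<open>u\<close>.  Dominated convergence, for the integrated Schwartz seminorms of the
  differences on one side and for the scalar integrals on the other side, gives the general case.\<close>

proposition tempered_integral:
  fixes f :: "'n::finite cfun" and \<tau> :: "'y::euclidean_space \<Rightarrow> 'n phase"
  assumes u: "tempered u" and f: "schwartz f"
    and lip: "\<And>y y'. norm (\<tau> y - \<tau> y') \<le> norm (y - y')" and \<tau>0: "\<tau> 0 = 0"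
    and a[measurable]: "a \<in> borel_measurable borel" and dec: "\<And>M. \<exists>C. \<forall>y. norm (a y) \<le> C / br y ^ M"
  shows "schwartz (\<lambda>t. LINT y|lborel. a y * tf f (\<tau> y) t)"
    and "u (\<lambda>t. LINT y|lborel. a y * tf f (\<tau> y) t) = (LINT y|lborel. a y * u (tf f (\<tau> y)))"
proof -
  let ?d = "2 * DIM('y)"
  have cont: "continuous_on UNIV \<tau>"
    unfolding continuous_on_iff by (metis lip dist_norm le_less_trans)
  have [measurable]: "\<tau> \<in> borel_measurable borel" by (rule borel_measurable_continuous_onI[OF cont])
  have br\<tau>: "br (\<tau> y) \<le> br y" for y using lip[of y 0] by (simp add: \<tau>0 br_def)
  have intw: "integrable lborel (\<lambda>y. norm (a y) * br y ^ K)" for K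
  proof -
    obtain C where C: "\<And>y. norm (a y) \<le> C / br y ^ (?d + K)" using dec[of "?d + K"] by auto
    show ?thesis
    proof (rule integrable_by_weight[OF _ _ order_refl])
      show "norm (norm (a y) * br y ^ K) \<le> C / br y ^ ?d" for y
        using mult_right_mono[OF C[of y], of "br y ^ K"] by (simp add: power_add norm_mult)
    qed measurable
  qed
  have sch: "schwartz (\<lambda>t. LINT y|lborel. a y * \<psi> y t)"
      "integrable lborel (\<lambda>y. a y * \<psi> y t)"
      "integrable lborel b \<Longrightarrow> (\<And>y. norm (a y) * sn k N (\<psi> y) \<le> b y) \<Longrightarrow> sn k N (\<lambda>t. LINT y|lborel. a y * \<psi> y t) \<le> (LINT y|lborel. b y)"
    if \<psi>: "\<And>y. schwartz (\<psi> y)" and m: "\<And>is t. (\<lambda>y. partial_derivs is (\<psi> y) t) \<in> borel_measurable borel"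
      and bd: "\<And>k N. \<exists>C K. \<forall>y. sn k N (\<psi> y) \<le> C * br y ^ K" for \<psi> and k N b t
  proof -
    have sm: "smooth (\<lambda>t. a y * \<psi> y t)" for y by (rule smooth_cmult[OF schwartz_smooth[OF \<psi>]])
    have ms: "(\<lambda>y. partial_derivs is (\<lambda>t. a y * \<psi> y t) t) \<in> borel_measurable lborel" for "is" t
      unfolding partial_derivs_cmult[OF schwartz_smooth[OF \<psi>]] using m by measurable
    have le: "br t ^ k * jet N (\<lambda>t. a y * \<psi> y t) t \<le> norm (a y) * sn k N (\<psi> y)" for y t k N
      unfolding jet_cmult[OF schwartz_smooth[OF \<psi>]]
      using mult_left_mono[OF sn_bound[OF \<psi>[of y], of t k N] norm_ge_zero[of "a y"]] by (simp add: algebra_simps)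
    have ex: "\<exists>b. integrable lborel b \<and> (\<forall>y t. br t ^ k * jet N (\<lambda>t. a y * \<psi> y t) t \<le> b y)" for k N
    proof -
      obtain C K where CK: "\<And>y. sn k N (\<psi> y) \<le> C * br y ^ K" using bd[of k N] by auto
      have "br t ^ k * jet N (\<lambda>t. a y * \<psi> y t) t \<le> C * (norm (a y) * br y ^ K)" for y t
        using order_trans[OF le[of t k N y] mult_left_mono[OF CK[of y] norm_ge_zero[of "a y"]]] by (simp add: algebra_simps)
      then show ?thesis by (intro exI[of _ "\<lambda>y. C * (norm (a y) * br y ^ K)"] conjI allI integrable_mult_right intw)
    qed
    note S = schwartz_param_integral[OF sm ms ex]
    show "schwartz (\<lambda>t. LINT y|lborel. a y * \<psi> y t)" by (rule S(1))
    show "integrable lborel (\<lambda>y. a y * \<psi> y t)" using param_family_integrable[OF S(2), of "[]"] by simp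
    show "sn k N (\<lambda>t. LINT y|lborel. a y * \<psi> y t) \<le> (LINT y|lborel. b y)"
      if "integrable lborel b" "\<And>y. norm (a y) * sn k N (\<psi> y) \<le> b y"
      by (rule S(3)[OF that(1)]) (rule order_trans[OF le that(2)])
  qed
  have bdtf: "\<exists>C K. \<forall>X. sn k N (tf f X) \<le> C * br X ^ K \<and> 0 \<le> C" for k N
    using sn_tf_growth[OF f, of k N] sn_nonneg[OF f, of k N]
    by (intro exI[of _ "(jet_const TYPE('n) N)\<^sup>2 * sn k N f"] exI[of _ "k + N"]) simp
  have mtf: "(\<lambda>y. partial_derivs is (tf f (\<sigma> y)) t) \<in> borel_measurable borel"
    if [measurable]: "\<sigma> \<in> borel_measurable borel" for \<sigma> :: "'y \<Rightarrow> 'n phase" and "is" t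
  proof -
    \<comment> \<open>Derivatives at a point are limits of tempered functionals; their continuity in \<open>X\<close> is that of \<open>tf\<close>.\<close>
    have "continuous_on UNIV (\<lambda>X. partial_derivs is (tf f X) t)"
    proof (rule tempered_tf_continuous[OF _ f])
      show "tempered (\<lambda>\<psi>. partial_derivs is \<psi> t)"
      proof (rule temperedI[where C=1 and k=0 and N="length is"])
        show "norm (partial_derivs is \<psi> t) \<le> 1 * sn 0 (length is) \<psi>" if "schwartz \<psi>" for \<psi>
          using order_trans[OF partial_derivs_le_jet[OF order_refl] jet_le_sn[OF that, where k=0]] by simp
      qed (auto simp: partial_derivs_add partial_derivs_cmult schwartz_smooth)
    qed
    then have "(\<lambda>X. partial_derivs is (tf f X) t) \<in> borel_measurable borel" by (rule borel_measurable_continuous_onI)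
    from measurable_compose[OF that this] show ?thesis .
  qed
  have bd1: "\<exists>C K. \<forall>y. sn k N (tf f (\<sigma> y)) \<le> C * br y ^ K"
    if \<sigma>: "\<And>y. br (\<sigma> y) \<le> 2 * br y" for k N and \<sigma> :: "'y \<Rightarrow> 'n phase"
  proof -
    obtain C K where CK: "\<And>X. sn k N (tf f X) \<le> C * br X ^ K" "0 \<le> C" using bdtf[of k N] by blast
    have "sn k N (tf f (\<sigma> y)) \<le> (C * 2 ^ K) * br y ^ K" for y
    proof -
      have "sn k N (tf f (\<sigma> y)) \<le> C * (2 * br y) ^ K"
        by (rule order_trans[OF CK(1) mult_left_mono[OF power_mono[OF \<sigma>] CK(2)]]) simp
      then show ?thesis by (simp add: power_mult_distrib mult_ac)
    qed
    then show ?thesis by blast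
  qed
  have br\<tau>2: "br (\<tau> y) \<le> 2 * br y" for y using br\<tau>[of y] br_ge1[of y] by linarith
  note S\<tau> = sch[of "\<lambda>y. tf f (\<tau> y)", OF schwartz_tf(1)[OF f] mtf bd1[OF br\<tau>2], simplified]
  show "schwartz (\<lambda>t. LINT y|lborel. a y * tf f (\<tau> y) t)" by (rule S\<tau>(1))
  obtain C0 N0 where u0: "0 \<le> C0" "\<And>\<psi>. schwartz \<psi> \<Longrightarrow> norm (u \<psi>) \<le> C0 * sn N0 N0 \<psi>"
    using tempered_bound[OF u] by blast
  obtain F where F: "\<And>i. simple_function borel (F i)" "\<And>y. (\<lambda>i. F i y) \<longlonglongrightarrow> y" "\<And>i y. dist (F i y) 0 \<le> 2 * dist (y::'y) 0"
    using borel_measurable_implies_sequence_metric[of "\<lambda>y::'y. y" borel 0] by auto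
  define I where "I i = (\<lambda>t. LINT y|lborel. a y * tf f (\<tau> (F i y)) t)" for i
  have Fm[measurable]: "F i \<in> borel_measurable borel" for i by (rule borel_measurable_simple_function[OF F(1)])
  have brF: "br (F i y) \<le> 2 * br y" for i y using F(3)[of i y] by (simp add: br_def)
  have brF2: "br (\<tau> (F i y)) \<le> 2 * br y" for i y using br\<tau> brF order_trans by blast
  have SI: "schwartz (I i)" for i
    unfolding I_def by (rule sch(1)[OF schwartz_tf(1)[OF f] mtf bd1[OF brF2]]) measurable
  have II: "integrable lborel (\<lambda>y. a y * tf f (\<tau> (F i y)) t)" for i t
    by (rule sch(2)[OF schwartz_tf(1)[OF f] mtf bd1[OF brF2]]) measurable
  \<comment> \<open>the case of finitely many values\<close>
  have fin: "u (I i) = (LINT y|lborel. a y * u (tf f (\<tau> (F i y))))" for i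
  proof -
    let ?V = "range (F i)"
    have V: "finite ?V" using simple_functionD(1)[OF F(1), of i] by simp
    define \<alpha> where "\<alpha> v = (LINT y|lborel. indicator (F i -` {v}) y *\<^sub>R a y)" for v
    have ia: "integrable lborel (\<lambda>y. indicator (F i -` {v}) y *\<^sub>R a y)" for v
    proof (rule Bochner_Integration.integrable_bound[OF intw[of 0]])
      have "F i -` {v} \<in> sets borel" using simple_functionD(2)[OF F(1), of i "{v}"] by simp
      then show "(\<lambda>y. indicator (F i -` {v}) y *\<^sub>R a y) \<in> borel_measurable lborel" by measurable
    qed (auto simp: indicator_def)
    have key: "(LINT y|lborel. a y * G (F i y)) = (\<Sum>v\<in>?V. \<alpha> v * G v)" for G :: "'y \<Rightarrow> complex"
    proof -
      have "(LINT y|lborel. a y * G (F i y)) = (LINT y|lborel. (\<Sum>v\<in>?V. (indicator (F i -` {v}) y *\<^sub>R a y) * G v))"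
      proof (rule Bochner_Integration.integral_cong[OF refl])
        fix y
        show "a y * G (F i y) = (\<Sum>v\<in>?V. (indicator (F i -` {v}) y *\<^sub>R a y) * G v)"
          using V by (subst sum.remove[of _ "F i y"]) (auto intro!: sum.neutral simp: indicator_def)
      qed
      also have "\<dots> = (\<Sum>v\<in>?V. \<alpha> v * G v)"
      proof -
        have "integrable lborel (\<lambda>y. (indicator (F i -` {v}) y *\<^sub>R a y) * G v)" for v
          by (rule integrable_mult_left) (rule ia)
        then show ?thesis unfolding \<alpha>_def
          by (subst Bochner_Integration.integral_sum) (simp_all only: integral_mult_left_zero)
      qed
      finally show ?thesis .
    qed
    have "I i = (\<lambda>t. \<Sum>v\<in>?V. \<alpha> v * tf f (\<tau> v) t)" unfolding I_def by (rule ext) (rule key)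
    then have "u (I i) = (\<Sum>v\<in>?V. \<alpha> v * u (tf f (\<tau> v)))" using tempered_sum(2)[OF u V schwartz_tf(1)[OF f]] by simp
    then show ?thesis using key[of "\<lambda>v. u (tf f (\<tau> v))"] by simp
  qed
  let ?I = "\<lambda>t. LINT y|lborel. a y * tf f (\<tau> y) t"
  obtain L where L: "0 \<le> L" "\<And>X X'. sn N0 N0 (\<lambda>t. tf f X' t - tf f X t)
    \<le> L * (br X * br X') ^ (N0 + 1 + N0) * min 1 (norm (X' - X))" using sn_tf_diff_global[OF f] by blast
  let ?K = "N0 + 1 + N0"
  define b where "b i y = (L * 2 ^ ?K) * (norm (a y) * br y ^ (2 * ?K)) * min 1 (norm (F i y - y))" for i y
  have lim0: "(\<lambda>i. min 1 (norm (F i y - y))) \<longlonglongrightarrow> 0" for y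
  proof -
    have "(\<lambda>i. min 1 (norm (F i y - y))) \<longlonglongrightarrow> min 1 (norm (y - y))" by (intro tendsto_intros F)
    then show ?thesis by simp
  qed
  have blim: "(\<lambda>i. LINT y|lborel. b i y) \<longlonglongrightarrow> (LINT y|(lborel::'y measure). 0)"
  proof (rule integral_dominated_convergence[where w="\<lambda>y. (L * 2 ^ ?K) * (norm (a y) * br y ^ (2 * ?K))"])
    show "integrable lborel (\<lambda>y. (L * 2 ^ ?K) * (norm (a y) * br y ^ (2 * ?K)))" by (intro integrable_mult_right intw)
    show "AE y in lborel. (\<lambda>i. b i y) \<longlonglongrightarrow> 0"
      unfolding b_def by (intro AE_I2 tendsto_mult_right_zero lim0)
    show "AE y in lborel. norm (b i y) \<le> (L * 2 ^ ?K) * (norm (a y) * br y ^ (2 * ?K))" for i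
      unfolding b_def using L(1) by (intro AE_I2) (simp add: norm_mult mult_left_le)
  qed (auto simp: b_def)
  have bint: "integrable lborel (b i)" for i
    unfolding b_def
  proof (rule Bochner_Integration.integrable_bound[OF integrable_mult_right[OF intw[of "2 * ?K"], of "L * 2 ^ ?K"]])
    show "AE y in lborel. norm ((L * 2 ^ ?K) * (norm (a y) * br y ^ (2 * ?K)) * min 1 (norm (F i y - y))) \<le> norm ((L * 2 ^ ?K) * (norm (a y) * br y ^ (2 * ?K)))"
      using L(1) by (intro AE_I2) (simp add: norm_mult mult_left_le)
  qed measurable
  have diff: "sn N0 N0 (\<lambda>t. I i t - ?I t) \<le> (LINT y|lborel. b i y)" for i
  proof -
    have eq: "(\<lambda>t. I i t - ?I t) = (\<lambda>t. LINT y|lborel. a y * (tf f (\<tau> (F i y)) t - tf f (\<tau> y) t))"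
      unfolding I_def using II S\<tau>(2) by (simp add: right_diff_distrib)
    show ?thesis unfolding eq
    proof (rule sch(3)[OF _ _ _ bint])
      show "schwartz (\<lambda>t. tf f (\<tau> (F i y)) t - tf f (\<tau> y) t)" for y by (intro schwartz_diff schwartz_tf f)
      show "(\<lambda>y. partial_derivs is (\<lambda>t. tf f (\<tau> (F i y)) t - tf f (\<tau> y) t) t) \<in> borel_measurable borel" for "is" t
        unfolding partial_derivs_diff[OF schwartz_smooth[OF schwartz_tf(1)[OF f]] schwartz_smooth[OF schwartz_tf(1)[OF f]]]
        by (intro borel_measurable_diff mtf) measurable
      have brbr: "br (\<tau> y) * br (\<tau> (F i y)) \<le> 2 * (br y)\<^sup>2" for y
        using mult_mono[OF br\<tau>[of y] brF2[of i y]] by (simp add: power2_eq_square)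
      show "\<exists>C K. \<forall>y. sn k N (\<lambda>t. tf f (\<tau> (F i y)) t - tf f (\<tau> y) t) \<le> C * br y ^ K" for k N
      proof -
        obtain L' where L': "0 \<le> L'" "\<And>X X'. sn k N (\<lambda>t. tf f X' t - tf f X t) \<le> L' * (br X * br X') ^ (k + 1 + N) * min 1 (norm (X' - X))"
          using sn_tf_diff_global[OF f] by blast
        have "sn k N (\<lambda>t. tf f (\<tau> (F i y)) t - tf f (\<tau> y) t) \<le> (L' * 2 ^ (k + 1 + N)) * br y ^ (2 * (k + 1 + N))" for y
        proof -
          have "sn k N (\<lambda>t. tf f (\<tau> (F i y)) t - tf f (\<tau> y) t) \<le> L' * (2 * (br y)\<^sup>2) ^ (k + 1 + N) * 1"
            by (rule order_trans[OF L'(2)]) (intro mult_mono power_mono brbr, use L'(1) in auto)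
          then show ?thesis by (simp only: power_mult_distrib power_mult mult_1_right mult.assoc)
        qed
        then show ?thesis by blast
      qed
      show "norm (a y) * sn N0 N0 (\<lambda>t. tf f (\<tau> (F i y)) t - tf f (\<tau> y) t) \<le> b i y" for y
      proof -
        have "sn N0 N0 (\<lambda>t. tf f (\<tau> (F i y)) t - tf f (\<tau> y) t) \<le> L * (2 * (br y)\<^sup>2) ^ ?K * min 1 (norm (F i y - y))"
          by (rule order_trans[OF L(2)]) (intro mult_mono power_mono brbr min.mono lip, use L(1) in auto)
        from mult_left_mono[OF this norm_ge_zero[of "a y"]]
        show ?thesis by (simp only: b_def power_mult_distrib power_mult mult_ac)
      qed
    qed
  qed
  have "(\<lambda>i. u (I i)) \<longlonglongrightarrow> u ?I"
  proof (rule LIM_zero_cancel, rule Lim_null_comparison)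
    show "\<forall>\<^sub>F i in sequentially. norm (u (I i) - u ?I) \<le> C0 * (LINT y|lborel. b i y)"
    proof (intro always_eventually allI)
      fix i
      have "norm (u (\<lambda>t. I i t - ?I t)) \<le> C0 * sn N0 N0 (\<lambda>t. I i t - ?I t)"
        by (rule u0(2)[OF schwartz_diff[OF SI S\<tau>(1)]])
      also have "\<dots> \<le> C0 * (LINT y|lborel. b i y)" by (rule mult_left_mono[OF diff u0(1)])
      finally show "norm (u (I i) - u ?I) \<le> C0 * (LINT y|lborel. b i y)" by (simp only: tempered_diff[OF u SI S\<tau>(1)])
    qed
    show "(\<lambda>i. C0 * (LINT y|lborel. b i y)) \<longlonglongrightarrow> 0" using tendsto_mult_right_zero[OF blim[simplified]] by simp
  qed
  moreover have "(\<lambda>i. u (I i)) \<longlonglongrightarrow> (LINT y|lborel. a y * u (tf f (\<tau> y)))"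
  proof -
    have uc: "continuous_on UNIV (\<lambda>y. u (tf f (\<tau> y)))"
      by (rule continuous_on_compose2[OF tempered_tf_continuous[OF u f] cont]) auto
    define G where "G = C0 * (jet_const TYPE('n) N0)\<^sup>2 * sn N0 N0 f"
    have G: "norm (u (tf f X)) \<le> G * br X ^ (N0 + N0)" for X
      unfolding G_def by (rule tempered_tf_growth[OF u0(2) u0(1) f])
    have G0: "0 \<le> G" unfolding G_def by (intro mult_nonneg_nonneg u0 sn_nonneg f) auto
    show ?thesis unfolding fin
    proof (rule integral_dominated_convergence[where w="\<lambda>y. (G * 2 ^ (N0 + N0)) * (norm (a y) * br y ^ (N0 + N0))"])
      have [measurable]: "(\<lambda>y. u (tf f (\<tau> y))) \<in> borel_measurable borel" by (rule borel_measurable_continuous_onI[OF uc])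
      show "(\<lambda>y. a y * u (tf f (\<tau> y))) \<in> borel_measurable lborel" by measurable
      show "(\<lambda>y. a y * u (tf f (\<tau> (F i y)))) \<in> borel_measurable lborel" for i
        using measurable_compose[OF Fm \<open>(\<lambda>y. u (tf f (\<tau> y))) \<in> borel_measurable borel\<close>, of i] by measurable
      show "integrable lborel (\<lambda>y. (G * 2 ^ (N0 + N0)) * (norm (a y) * br y ^ (N0 + N0)))" by (intro integrable_mult_right intw)
      show "AE y in lborel. (\<lambda>i. a y * u (tf f (\<tau> (F i y)))) \<longlonglongrightarrow> a y * u (tf f (\<tau> y))"
        using continuous_on_tendsto_compose[OF uc F(2)] by (intro AE_I2 tendsto_mult tendsto_const) auto
      show "AE y in lborel. norm (a y * u (tf f (\<tau> (F i y)))) \<le> (G * 2 ^ (N0 + N0)) * (norm (a y) * br y ^ (N0 + N0))" for i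
      proof (intro AE_I2)
        fix y
        have "norm (u (tf f (\<tau> (F i y)))) \<le> G * (2 * br y) ^ (N0 + N0)"
          by (rule order_trans[OF G mult_left_mono[OF power_mono[OF brF2] G0]]) simp
        from mult_left_mono[OF this norm_ge_zero[of "a y"]]
        show "norm (a y * u (tf f (\<tau> (F i y)))) \<le> (G * 2 ^ (N0 + N0)) * (norm (a y) * br y ^ (N0 + N0))"
          by (simp only: norm_mult power_mult_distrib mult_ac)
      qed
    qed
  qed
  ultimately show "u ?I = (LINT y|lborel. a y * u (tf f (\<tau> y)))" by (rule LIMSEQ_unique)
qed

text \<open>A tempered distribution may be applied under the integral in the resolution of the identity.\<close>

corollary reproducing_formula:
  fixes \<phi> \<theta> :: "'n::finite cfun"
  assumes u: "tempered u" and p: "schwartz \<phi>" and t: "schwartz \<theta>"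
  shows "(LINT Y|lborel. gab \<phi> \<theta> Y * u (tf \<phi> Y)) = gab_const \<phi> * u \<theta>"
proof -
  have "u (\<lambda>t. LINT Y|lborel. gab \<phi> \<theta> Y * tf \<phi> Y t) = (LINT Y|lborel. gab \<phi> \<theta> Y * u (tf \<phi> Y))"
    using tempered_integral(2)[OF u p, where \<tau>="\<lambda>Y::'n phase. Y" and a="gab \<phi> \<theta>"] gab_borel[OF p t] gab_decay0[OF p t] by simp
  then show ?thesis by (simp only: resolution_of_identity[OF p t] tempered_cmult[OF u t])
qed

section \<open>Pointwise estimates for short-time Fourier transforms\<close>

lemma weight_shift_bound:
  fixes f :: "'a::euclidean_space \<Rightarrow> 'b::{banach, second_countable_topology}"
  assumes f: "f \<in> borel_measurable borel" and c: "\<And>x. norm (f x) \<le> c / br (z - x) ^ k" and k: "2 * DIM('a) \<le> k"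
  shows "integrable lborel f" and "norm (LINT x|lborel. f x) \<le> c * wint TYPE('a) k"
proof -
  have m: "(\<lambda>x. f (z - x)) \<in> borel_measurable borel"
    by (intro borel_compose_continuous[OF f] continuous_intros)
  have b: "norm (f (z - x)) \<le> c / br x ^ k" for x using c[of "z - x"] by simp
  have "integrable lborel (\<lambda>x. f (z + (-1) *\<^sub>R x))" using integrable_by_weight[OF m b k] by simp
  then show "integrable lborel f" using lborel_affine_integral(2)[OF f, of "-1" z] by simp
  show "norm (LINT x|lborel. f x) \<le> c * wint TYPE('a) k"
    using integral_by_weight[OF m b k] by (simp add: lborel_shift_integral(3)[OF f])
qed

lemma nn_integral_weight_shift:
  assumes "2 * DIM('a) \<le> k"
  shows "(\<integral>\<^sup>+x. ennreal (1 / br (z - x :: 'a::euclidean_space) ^ k) \<partial>lborel) = ennreal (wint TYPE('a) k)"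
proof -
  have m: "(\<lambda>x::'a. 1 / br (z - x) ^ k) \<in> borel_measurable borel" by measurable
  have I: "integrable lborel (\<lambda>x::'a. 1 / br (z - x) ^ k)"
    by (rule weight_shift_bound(1)[OF m _ assms, of 1 z]) simp
  have m': "(\<lambda>x::'a. 1 / br x ^ k) \<in> borel_measurable borel" by measurable
  show ?thesis
    unfolding wint_def using lborel_shift_integral(3)[OF m', of z] by (subst nn_integral_eq_integral[OF I]) auto
qed

text \<open>The kernel decays faster than any power, so integration against it preserves polynomial growth around any point \<open>X\<close>,
  with a constant that does not depend on \<open>X\<close>.\<close>

lemma gab_integral_bound:
  fixes \<phi> :: "'n::finite cfun"
  assumes p: "schwartz \<phi>"
  obtains C k where "0 \<le> C" "\<And>(\<theta> :: 'n cfun) (a :: 'n phase \<Rightarrow> complex) B X Z.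
    schwartz \<theta> \<Longrightarrow> a \<in> borel_measurable borel \<Longrightarrow> (\<And>Y. norm (a Y) \<le> B * br (X - Y) ^ L) \<Longrightarrow>
    integrable lborel (\<lambda>Y. gab \<phi> (tf \<theta> Z) Y * a Y) \<and>
    norm (LINT Y|lborel. gab \<phi> (tf \<theta> Z) Y * a Y) \<le> C * sn k k \<theta> * B * br (X - Z) ^ L"
proof -
  let ?D = "2 * DIM('n phase)"
  let ?M = "L + ?D"
  let ?k = "?M + 2 * DIM(real^'n)"
  obtain C where C: "0 \<le> C" "\<And>(\<theta> :: 'n cfun) X Y. schwartz \<theta> \<Longrightarrow>
    norm (gab \<phi> (tf \<theta> X) Y) \<le> C * sn ?k ?M \<theta> / br (X - Y) ^ ?M"
    using gab_decay[OF p, where M="?M"] by auto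
  show ?thesis
  proof (rule that[of "C * wint TYPE('n phase) ?D" ?k])
    show "0 \<le> C * wint TYPE('n phase) ?D" using C by simp
    fix \<theta> :: "'n cfun" and a :: "'n phase \<Rightarrow> complex" and B X Z
    assume t: "schwartz \<theta>" and a: "a \<in> borel_measurable borel" and B: "\<And>Y. norm (a Y) \<le> B * br (X - Y) ^ L"
    have B0: "0 \<le> B" using order_trans[OF norm_ge_zero B[of X]] by simp
    let ?s = "sn ?k ?k \<theta>"
    have s: "0 \<le> ?s" by (rule sn_nonneg[OF t])
    have m: "(\<lambda>Y. gab \<phi> (tf \<theta> Z) Y * a Y) \<in> borel_measurable borel"
      by (intro borel_measurable_times a gab_borel p schwartz_tf t)
    have b: "norm (gab \<phi> (tf \<theta> Z) Y * a Y) \<le> (C * ?s * B * br (X - Z) ^ L) / br (Z - Y) ^ ?D" for Y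
    proof -
      have "norm (gab \<phi> (tf \<theta> Z) Y) \<le> C * ?s / br (Z - Y) ^ ?M"
      proof -
        have "C * sn ?k ?M \<theta> / br (Z - Y) ^ ?M \<le> C * ?s / br (Z - Y) ^ ?M"
          using C by (intro divide_right_mono mult_left_mono sn_mono t) auto
        then show ?thesis using C(2)[OF t, of Z Y] by (rule order_trans[rotated])
      qed
      moreover have "norm (a Y) \<le> B * (br (X - Z) ^ L * br (Z - Y) ^ L)"
        using order_trans[OF B[of Y] mult_left_mono[OF _ B0]] br_add_power[of "X - Z" "Z - Y" L] by simp
      ultimately have "norm (gab \<phi> (tf \<theta> Z) Y) * norm (a Y) \<le> (C * ?s / br (Z - Y) ^ ?M) * (B * (br (X - Z) ^ L * br (Z - Y) ^ L))"
        using C s by (intro mult_mono) auto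
      also have "\<dots> = (C * ?s * B * br (X - Z) ^ L) / br (Z - Y) ^ ?D" by (simp add: power_add field_simps)
      finally show ?thesis by (simp add: norm_mult)
    qed
    show "integrable lborel (\<lambda>Y. gab \<phi> (tf \<theta> Z) Y * a Y) \<and>
      norm (LINT Y|lborel. gab \<phi> (tf \<theta> Z) Y * a Y) \<le> (C * wint TYPE('n phase) ?D) * ?s * B * br (X - Z) ^ L"
      using weight_shift_bound[OF m b order_refl] by (simp add: mult_ac)
  qed
qed

lemma norm_integral_le_nn_integral:
  fixes f :: "'a \<Rightarrow> 'b::{banach, second_countable_topology}"
  shows "ennreal (norm (LINT x|M. f x)) \<le> (\<integral>\<^sup>+x. ennreal (norm (f x)) \<partial>M)"
  by (cases "integrable M f") (auto simp: integral_norm_bound_ennreal not_integrable_integral_eq)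

text \<open>Inserting \<open>F = F\<^sup>r F\<^bsup>1 - r\<^esup>\<close> into a self-improving estimate and taking out the supremum \<open>S\<close> of
  \<open>F / br (X - \<cdot>)\<^sup>L\<close> leaves \<open>S \<le> C S\<^bsup>1 - r\<^esup> d\<close>.  Polynomial growth makes
  \<open>S\<close> finite, and the conclusion is uniform in the constant of that growth.\<close>

lemma peetre:
  fixes F :: "'a::euclidean_space \<Rightarrow> real"
  assumes F[measurable]: "F \<in> borel_measurable borel" and F0: "\<And>Z. 0 \<le> F Z"
    and growth: "\<And>Z. F Z \<le> C0 * br Z ^ L" and r: "0 < r" "r \<le> 1"
    and self: "\<And>Z. ennreal (F Z) \<le> ennreal C * (\<integral>\<^sup>+Y. ennreal (F Y / br (Z - Y) ^ L) \<partial>lborel)" and C: "0 \<le> C"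
    and d: "0 \<le> d" "(\<integral>\<^sup>+Y. ennreal ((F Y / br (X - Y) ^ L) powr r) \<partial>lborel) \<le> ennreal d"
  shows "F Z \<le> (C * d) powr (1 / r) * br (X - Z) ^ L"
proof -
  have C0: "0 \<le> C0" using order_trans[OF F0 growth[of 0]] by simp
  define S where "S = (SUP Z. F Z / br (X - Z) ^ L)"
  have bdd: "bdd_above (range (\<lambda>Z. F Z / br (X - Z) ^ L))"
  proof (rule bdd_aboveI2)
    fix Z
    have "F Z \<le> C0 * (br X ^ L * br (X - Z) ^ L)"
      using order_trans[OF growth[of Z] mult_left_mono[OF _ C0]] br_diff_power[of X "X - Z" L] by simp
    then show "F Z / br (X - Z) ^ L \<le> C0 * br X ^ L" by (simp add: field_simps)
  qed
  have S: "F Z / br (X - Z) ^ L \<le> S" for Z unfolding S_def by (rule cSUP_upper[OF UNIV_I bdd])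
  have S0: "0 \<le> S" using order_trans[OF _ S[of X]] F0[of X] by simp
  have le: "F Z / br (X - Z) ^ L \<le> C * (S powr (1 - r) * d)" for Z
  proof -
    have pw: "F Y / br (X - Y) ^ L \<le> S powr (1 - r) * (F Y / br (X - Y) ^ L) powr r" for Y
    proof (cases "F Y = 0")
      case False
      let ?t = "F Y / br (X - Y) ^ L"
      have t: "0 < ?t" using False F0[of Y] by simp
      have "?t = ?t powr (1 - r) * ?t powr r" using t F0[of Y] by (simp add: powr_add[symmetric])
      also have "\<dots> \<le> S powr (1 - r) * ?t powr r" using r t S[of Y] by (intro mult_right_mono powr_mono2) auto
      finally show ?thesis .
    qed simp
    have "ennreal (F Z / br (X - Z) ^ L) = ennreal (F Z) * ennreal (1 / br (X - Z) ^ L)"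
      using F0 by (simp add: ennreal_mult[symmetric])
    also have "\<dots> \<le> ennreal C * (\<integral>\<^sup>+Y. ennreal (F Y / br (Z - Y) ^ L) \<partial>lborel) * ennreal (1 / br (X - Z) ^ L)"
      by (intro mult_right_mono self) auto
    also have "\<dots> = ennreal C * (\<integral>\<^sup>+Y. ennreal (F Y / br (Z - Y) ^ L) * ennreal (1 / br (X - Z) ^ L) \<partial>lborel)"
      by (subst nn_integral_multc) (auto simp: mult.assoc)
    also have "\<dots> \<le> ennreal C * (\<integral>\<^sup>+Y. ennreal (S powr (1 - r)) * ennreal ((F Y / br (X - Y) ^ L) powr r) \<partial>lborel)"
    proof (intro mult_left_mono nn_integral_mono)
      fix Y
      have "ennreal (F Y / br (Z - Y) ^ L) * ennreal (1 / br (X - Z) ^ L) = ennreal (F Y / (br (X - Z) ^ L * br (Z - Y) ^ L))"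
        using F0 by (simp add: ennreal_mult[symmetric] mult.commute)
      also have "\<dots> \<le> ennreal (F Y / br (X - Y) ^ L)"
        using br_add_power[of "X - Z" "Z - Y" L] F0 by (intro ennreal_leI divide_left_mono) auto
      also have "\<dots> \<le> ennreal (S powr (1 - r)) * ennreal ((F Y / br (X - Y) ^ L) powr r)"
        using pw[of Y] by (simp add: ennreal_mult[symmetric] ennreal_leI)
      finally show "ennreal (F Y / br (Z - Y) ^ L) * ennreal (1 / br (X - Z) ^ L) \<le> ennreal (S powr (1 - r)) * ennreal ((F Y / br (X - Y) ^ L) powr r)" .
    qed simp
    also have "\<dots> = ennreal C * (ennreal (S powr (1 - r)) * (\<integral>\<^sup>+Y. ennreal ((F Y / br (X - Y) ^ L) powr r) \<partial>lborel))"
      by (subst nn_integral_cmult) auto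
    also have "\<dots> \<le> ennreal C * (ennreal (S powr (1 - r)) * ennreal d)"
      by (intro mult_left_mono d) auto
    also have "\<dots> = ennreal (C * (S powr (1 - r) * d))" using C d by (simp add: ennreal_mult)
    finally show ?thesis using C d by (subst (asm) ennreal_le_iff) auto
  qed
  have "S \<le> (C * d) powr (1 / r)"
  proof (cases "S = 0")
    case False
    then have Sp: "0 < S" using S0 by simp
    have "S \<le> C * (S powr (1 - r) * d)" unfolding S_def by (rule cSUP_least) (use le in \<open>auto simp: S_def\<close>)
    moreover have "S = S powr (1 - r) * S powr r" using Sp by (simp add: powr_add[symmetric])
    ultimately have "S powr (1 - r) * S powr r \<le> S powr (1 - r) * (C * d)" by (simp add: mult_ac)
    then have "S powr r \<le> C * d" using Sp by (simp add: mult_le_cancel_left)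
    then have "(S powr r) powr (1 / r) \<le> (C * d) powr (1 / r)" using r by (intro powr_mono2) auto
    then show ?thesis using r S0 by (simp add: powr_powr)
  qed simp
  then have "F Z / br (X - Z) ^ L \<le> (C * d) powr (1 / r)" using S[of Z] by simp
  then show ?thesis by (simp add: field_simps)
qed

lemma tempered_tf_borel: "tempered u \<Longrightarrow> schwartz f \<Longrightarrow> (\<lambda>X. u (tf f X)) \<in> borel_measurable borel"
  by (intro borel_measurable_continuous_onI tempered_tf_continuous)

text \<open>The mean value property: the reproducing formula is a self-improving estimate in the sense of \<open>peetre\<close>.\<close>

lemma tempered_peetre:
  fixes \<phi> :: "'n::finite cfun"
  assumes p: "window \<phi>" and r: "0 < r" "r \<le> 1"
  obtains C where "0 \<le> C" "\<And>(u :: 'n dist) C0 X d Z. tempered u \<Longrightarrow> (\<And>Y. norm (u (tf \<phi> Y)) \<le> C0 * br Y ^ L) \<Longrightarrow> 0 \<le> d \<Longrightarrow>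
    (\<integral>\<^sup>+Y. ennreal ((norm (u (tf \<phi> Y)) / br (X - Y) ^ L) powr r) \<partial>lborel) \<le> ennreal d \<Longrightarrow>
    norm (u (tf \<phi> Z)) \<le> C * d powr (1 / r) * br (X - Z) ^ L"
proof -
  have s: "schwartz \<phi>" using p by (simp add: window_def)
  let ?c = "gab_const \<phi>"
  have c: "0 < norm ?c" using gab_const_nonzero[OF p] by simp
  obtain C' where C': "0 \<le> C'" "\<And>(\<theta> :: 'n cfun) X Y. schwartz \<theta> \<Longrightarrow>
    norm (gab \<phi> (tf \<theta> X) Y) \<le> C' * sn (L + 2 * DIM(real^'n)) L \<theta> / br (X - Y) ^ L"
    using gab_decay[OF s, where M=L] by auto
  define K where "K = C' * sn (L + 2 * DIM(real^'n)) L \<phi>"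
  define C1 where "C1 = K / norm ?c"
  have K: "0 \<le> K" unfolding K_def by (intro mult_nonneg_nonneg C' sn_nonneg s)
  have C1: "0 \<le> C1" using K by (simp add: C1_def)
  show ?thesis
  proof (rule that[of "C1 powr (1 / r)"])
    fix u :: "'n dist" and C0 X d Z
    assume u: "tempered u" and g: "\<And>Y. norm (u (tf \<phi> Y)) \<le> C0 * br Y ^ L" and d: "0 \<le> d"
      "(\<integral>\<^sup>+Y. ennreal ((norm (u (tf \<phi> Y)) / br (X - Y) ^ L) powr r) \<partial>lborel) \<le> ennreal d"
    have m[measurable]: "(\<lambda>Y. u (tf \<phi> Y)) \<in> borel_measurable borel" by (rule tempered_tf_borel[OF u s])
    have self: "ennreal (norm (u (tf \<phi> Z))) \<le> ennreal C1 * (\<integral>\<^sup>+Y. ennreal (norm (u (tf \<phi> Y)) / br (Z - Y) ^ L) \<partial>lborel)" for Z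
    proof -
      have "ennreal (norm ?c * norm (u (tf \<phi> Z))) = ennreal (norm (LINT Y|lborel. gab \<phi> (tf \<phi> Z) Y * u (tf \<phi> Y)))"
        unfolding reproducing_formula[OF u s schwartz_tf(1)[OF s]] by (simp add: norm_mult)
      also have "\<dots> \<le> (\<integral>\<^sup>+Y. ennreal (norm (gab \<phi> (tf \<phi> Z) Y * u (tf \<phi> Y))) \<partial>lborel)" by (rule norm_integral_le_nn_integral)
      also have "\<dots> \<le> (\<integral>\<^sup>+Y. ennreal K * ennreal (norm (u (tf \<phi> Y)) / br (Z - Y) ^ L) \<partial>lborel)"
      proof (rule nn_integral_mono)
        fix Y
        have "norm (gab \<phi> (tf \<phi> Z) Y) * norm (u (tf \<phi> Y)) \<le> (K / br (Z - Y) ^ L) * norm (u (tf \<phi> Y))"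
          using C'(2)[OF s, of Z Y] by (intro mult_right_mono) (auto simp: K_def)
        then show "ennreal (norm (gab \<phi> (tf \<phi> Z) Y * u (tf \<phi> Y))) \<le> ennreal K * ennreal (norm (u (tf \<phi> Y)) / br (Z - Y) ^ L)"
          using K by (simp add: ennreal_mult[symmetric] norm_mult ennreal_leI)
      qed
      also have "\<dots> = ennreal K * (\<integral>\<^sup>+Y. ennreal (norm (u (tf \<phi> Y)) / br (Z - Y) ^ L) \<partial>lborel)" by (rule nn_integral_cmult) measurable
      finally have *: "ennreal (norm ?c * norm (u (tf \<phi> Z))) \<le> ennreal K * (\<integral>\<^sup>+Y. ennreal (norm (u (tf \<phi> Y)) / br (Z - Y) ^ L) \<partial>lborel)" .
      have "ennreal (norm (u (tf \<phi> Z))) = ennreal (1 / norm ?c) * ennreal (norm ?c * norm (u (tf \<phi> Z)))"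
        using c by (simp add: ennreal_mult[symmetric])
      also have "\<dots> \<le> ennreal (1 / norm ?c) * (ennreal K * (\<integral>\<^sup>+Y. ennreal (norm (u (tf \<phi> Y)) / br (Z - Y) ^ L) \<partial>lborel))"
        by (rule mult_left_mono[OF *]) simp
      also have "\<dots> = ennreal C1 * (\<integral>\<^sup>+Y. ennreal (norm (u (tf \<phi> Y)) / br (Z - Y) ^ L) \<partial>lborel)"
        using K c by (simp add: C1_def ennreal_mult[symmetric] mult.assoc[symmetric])
      finally show ?thesis .
    qed
    have "norm (u (tf \<phi> Z)) \<le> (C1 * d) powr (1 / r) * br (X - Z) ^ L"
      by (rule peetre[OF _ _ g r self C1 d]) auto
    then show "norm (u (tf \<phi> Z)) \<le> C1 powr (1 / r) * d powr (1 / r) * br (X - Z) ^ L"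
      using C1 d by (simp add: powr_mult)
  qed simp
qed

text \<open>The reproducing formula expresses the pairing with any \<open>\<theta>\<close> by the pairings with shifts of \<open>\<phi>\<close>.\<close>

lemma tempered_change_window:
  fixes \<phi> :: "'n::finite cfun"
  assumes p: "window \<phi>"
  obtains C k where "0 \<le> C" "\<And>(u :: 'n dist) (\<theta> :: 'n cfun) B X Z. tempered u \<Longrightarrow> schwartz \<theta> \<Longrightarrow>
    (\<And>Y. norm (u (tf \<phi> Y)) \<le> B * br (X - Y) ^ L) \<Longrightarrow> norm (u (tf \<theta> Z)) \<le> C * sn k k \<theta> * B * br (X - Z) ^ L"
proof -
  have s: "schwartz \<phi>" using p by (simp add: window_def)
  let ?c = "gab_const \<phi>"
  have c: "0 < norm ?c" using gab_const_nonzero[OF p] by simp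
  obtain C k where C: "0 \<le> C" "\<And>(\<theta> :: 'n cfun) (a :: 'n phase \<Rightarrow> complex) B X Z.
    schwartz \<theta> \<Longrightarrow> a \<in> borel_measurable borel \<Longrightarrow> (\<And>Y. norm (a Y) \<le> B * br (X - Y) ^ L) \<Longrightarrow>
    integrable lborel (\<lambda>Y. gab \<phi> (tf \<theta> Z) Y * a Y) \<and>
    norm (LINT Y|lborel. gab \<phi> (tf \<theta> Z) Y * a Y) \<le> C * sn k k \<theta> * B * br (X - Z) ^ L"
    by (fact gab_integral_bound[OF s, where L=L])
  show ?thesis
  proof (rule that[of "C / norm ?c" k])
    fix u :: "'n dist" and \<theta> :: "'n cfun" and B X Z
    assume u: "tempered u" and t: "schwartz \<theta>" and B: "\<And>Y. norm (u (tf \<phi> Y)) \<le> B * br (X - Y) ^ L"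
    have "norm ?c * norm (u (tf \<theta> Z)) = norm (LINT Y|lborel. gab \<phi> (tf \<theta> Z) Y * u (tf \<phi> Y))"
      unfolding reproducing_formula[OF u s schwartz_tf(1)[OF t]] by (simp add: norm_mult)
    also have "\<dots> \<le> C * sn k k \<theta> * B * br (X - Z) ^ L"
      using C(2)[OF t tempered_tf_borel[OF u s] B] by blast
    finally show "norm (u (tf \<theta> Z)) \<le> C / norm ?c * sn k k \<theta> * B * br (X - Z) ^ L"
      using c by (simp add: field_simps)
  qed (use C c in simp)
qed

section \<open>Quasi-Young functions\<close>

text \<open>The inequality in this definition is what the convexity of \<open>t \<mapsto> \<Phi> (t\<^bsup>1/r\<^esup>)\<close> says about a point and the origin.
  It persists when \<open>r\<close> decreases, so that several quasi-Young functions can share one \<open>r\<close>.\<close>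

definition star_shaped :: "real \<Rightarrow> (real \<Rightarrow> ennreal) \<Rightarrow> bool" where
  "star_shaped r \<Phi> \<longleftrightarrow> 0 < r \<and> r \<le> 1 \<and> \<Phi> 0 = 0 \<and> (\<forall>s t. 0 \<le> s \<and> s \<le> t \<longrightarrow> \<Phi> s \<le> \<Phi> t) \<and>
     (\<forall>u\<in>{0..1}. \<forall>t\<ge>0. \<Phi> (u powr (1 / r) * t) \<le> ennreal u * \<Phi> t) \<and>
     (\<exists>t>0. \<Phi> t < \<infinity>) \<and> (\<forall>K::real. \<exists>t>0. ennreal K \<le> \<Phi> t)"

lemma quasi_young_star_shaped:
  assumes "quasi_young_function \<Phi>"
  obtains r where "star_shaped r \<Phi>"
proof -
  obtain r where r: "0 < r" "r \<le> 1" and Y: "young_function (\<lambda>t. \<Phi> (t powr (1 / r)))"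
    using assms unfolding quasi_young_function_def by blast
  let ?Y = "\<lambda>t. \<Phi> (t powr (1 / r))"
  have eq: "\<Phi> t = ?Y (t powr r)" if "0 \<le> t" for t using r that by (simp add: powr_powr)
  have Y0: "?Y 0 = 0" and cv: "\<And>s t u. 0 \<le> s \<Longrightarrow> 0 \<le> t \<Longrightarrow> u \<in> {0..1} \<Longrightarrow>
      ?Y (u * s + (1 - u) * t) \<le> ennreal u * ?Y s + ennreal (1 - u) * ?Y t"
    and fin: "\<exists>t>0. ?Y t < \<infinity>" and lim: "(?Y \<longlongrightarrow> \<infinity>) at_top"
    using Y unfolding young_function_def by auto
  have sc: "?Y (u * t) \<le> ennreal u * ?Y t" if "u \<in> {0..1}" "0 \<le> t" for u t
    using cv[of t 0 u] that Y0 by simp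
  have mono: "?Y s \<le> ?Y t" if "0 \<le> s" "s \<le> t" for s t
  proof (cases "t = 0")
    case False
    with that have "0 < t" by simp
    then have u: "s / t \<in> {0..1}" using that by simp
    have "?Y (s / t * t) \<le> ennreal (s / t) * ?Y t" by (rule sc[OF u]) (use that in simp)
    also have "\<dots> \<le> 1 * ?Y t" using u by (intro mult_right_mono) auto
    finally show ?thesis using \<open>0 < t\<close> by simp
  qed (use that in simp)
  have "star_shaped r \<Phi>"
    unfolding star_shaped_def
  proof (intro conjI allI impI ballI r)
    show "\<Phi> 0 = 0" using Y0 r by simp
    fix s t :: real assume "0 \<le> s \<and> s \<le> t"
    then have "?Y (s powr r) \<le> ?Y (t powr r)" using r by (intro mono powr_mono2) auto
    then show "\<Phi> s \<le> \<Phi> t" using eq[of s] eq[of t] \<open>0 \<le> s \<and> s \<le> t\<close> by (metis order_trans)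
  next
    fix u t :: real assume u: "u \<in> {0..1}" and t: "0 \<le> t"
    have "(u * t powr r) powr (1 / r) = u powr (1 / r) * t"
      using u t r by (simp add: powr_mult powr_powr)
    moreover have "(t powr r) powr (1 / r) = t" using t r by (simp add: powr_powr)
    ultimately show "\<Phi> (u powr (1 / r) * t) \<le> ennreal u * \<Phi> t" using sc[OF u, of "t powr r"] by simp
  next
    obtain t where t: "0 < t" "?Y t < \<infinity>" using fin by blast
    then show "\<exists>t>0. \<Phi> t < \<infinity>" by (intro exI[of _ "t powr (1 / r)"]) simp
  next
    fix K :: real
    have "\<forall>\<^sub>F t in at_top. ennreal K < ?Y t" by (rule order_tendstoD(1)[OF lim]) simp
    then have "\<forall>\<^sub>F t in at_top. ennreal K < ?Y t \<and> 0 < t" using eventually_gt_at_top by (rule eventually_conj)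
    then obtain t where "ennreal K < ?Y t" "0 < t" using eventually_happens'[OF trivial_limit_at_top_linorder] by blast
    then show "\<exists>t>0. ennreal K \<le> \<Phi> t" by (intro exI[of _ "t powr (1 / r)"]) auto
  qed
  then show thesis by (rule that)
qed

lemma star_shaped_smaller:
  assumes "star_shaped r \<Phi>" "0 < r'" "r' \<le> r"
  shows "star_shaped r' \<Phi>"
proof -
  have "\<Phi> (u powr (1 / r') * t) \<le> ennreal u * \<Phi> t" if u: "u \<in> {0..1}" and t: "0 \<le> t" for u t
  proof -
    let ?v = "u powr (r / r')"
    have vu: "?v \<le> u" using u powr_mono'[of 1 "r / r'" u] assms by (cases "u = 0") auto
    have v: "?v \<in> {0..1}" using vu u by auto
    have "u powr (1 / r') = ?v powr (1 / r)" using assms by (simp add: powr_powr star_shaped_def)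
    then have "\<Phi> (u powr (1 / r') * t) \<le> ennreal ?v * \<Phi> t"
      using assms(1) v t unfolding star_shaped_def by simp
    also have "\<dots> \<le> ennreal u * \<Phi> t" using vu by (intro mult_right_mono ennreal_leI) auto
    finally show ?thesis .
  qed
  then show ?thesis using assms unfolding star_shaped_def by auto
qed

context
  fixes r :: real and \<Phi> :: "real \<Rightarrow> ennreal"
  assumes st: "star_shaped r \<Phi>"
begin

lemma star_r: "0 < r" "r \<le> 1" and star_0: "\<Phi> 0 = 0" and star_mono: "0 \<le> s \<Longrightarrow> s \<le> t \<Longrightarrow> \<Phi> s \<le> \<Phi> t"
  and star_scale: "u \<in> {0..1} \<Longrightarrow> 0 \<le> t \<Longrightarrow> \<Phi> (u powr (1 / r) * t) \<le> ennreal u * \<Phi> t"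
  and star_finite: "\<exists>t>0. \<Phi> t < \<infinity>" and star_large: "\<exists>t>0. ennreal K \<le> \<Phi> t"
  using st unfolding star_shaped_def by auto

lemma star_ratio:
  assumes "0 \<le> s" "s \<le> t" "0 < t"
  shows "\<Phi> s \<le> ennreal ((s / t) powr r) * \<Phi> t"
proof -
  have "(s / t) powr r \<in> {0..1}" using assms star_r by (auto intro!: powr_le1)
  from star_scale[OF this, of t] show ?thesis
    using assms star_r by (simp add: powr_powr)
qed

text \<open>Beyond a point where \<open>\<Phi> \<ge> 1\<close>, star-shapedness makes \<open>\<Phi>\<close> grow at least like \<open>t\<^sup>r\<close>.\<close>

lemma star_lower: "\<exists>T>0. \<forall>t\<ge>0. ennreal (t powr r) \<le> ennreal (T powr r) * (\<Phi> t + 1)"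
proof -
  obtain T where T: "0 < T" "1 \<le> \<Phi> T" using star_large[of 1] by auto
  have "ennreal (t powr r) \<le> ennreal (T powr r) * (\<Phi> t + 1)" if t: "0 \<le> t" for t
  proof (cases "t \<le> T")
    case True
    have "ennreal (t powr r) \<le> ennreal (T powr r) * 1" using True t star_r by (simp add: powr_mono2 ennreal_leI)
    also have "\<dots> \<le> ennreal (T powr r) * (\<Phi> t + 1)" by (intro mult_left_mono) auto
    finally show ?thesis .
  next
    case False
    then have tp: "0 < t" using T by simp
    have "ennreal (t powr r) = ennreal (t powr r) * 1" by simp
    also have "\<dots> \<le> ennreal (t powr r) * (ennreal ((T / t) powr r) * \<Phi> t)"
      using T star_ratio[of T t] False by (intro mult_left_mono) auto
    also have "\<dots> = ennreal (T powr r) * \<Phi> t"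
      using T tp by (simp add: mult.assoc[symmetric] ennreal_mult[symmetric] powr_divide)
    also have "\<dots> \<le> ennreal (T powr r) * (\<Phi> t + 1)" by (intro mult_left_mono) auto
    finally show ?thesis .
  qed
  then show ?thesis using T by blast
qed

lemma star_tendsto_0:
  assumes "\<And>n. 0 \<le> t n" "t \<longlonglongrightarrow> 0"
  shows "(\<lambda>n. \<Phi> (t n)) \<longlonglongrightarrow> 0"
proof -
  obtain t0 where t0: "0 < t0" "\<Phi> t0 < \<infinity>" using star_finite by auto
  have "(\<lambda>n. ((t n / t0) powr r)) \<longlonglongrightarrow> (0 / t0) powr r"
    using assms star_r t0 by (intro tendsto_powr2 tendsto_divide tendsto_const) (auto intro: eventuallyI)
  then have "(\<lambda>n. ennreal ((t n / t0) powr r)) \<longlonglongrightarrow> ennreal 0" using star_r by (intro tendsto_ennrealI) simp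
  then have "(\<lambda>n. \<Phi> t0 * ennreal ((t n / t0) powr r)) \<longlonglongrightarrow> \<Phi> t0 * ennreal 0"
    using t0 by (intro ennreal_tendsto_cmult) auto
  then have lim: "(\<lambda>n. ennreal ((t n / t0) powr r) * \<Phi> t0) \<longlonglongrightarrow> 0" by (simp add: mult.commute)
  show ?thesis
  proof (rule tendsto_sandwich[OF _ _ tendsto_const lim])
    have "\<forall>\<^sub>F n in sequentially. t n < t0" by (rule order_tendstoD(2)[OF assms(2) t0(1)])
    then show "\<forall>\<^sub>F n in sequentially. \<Phi> (t n) \<le> ennreal ((t n / t0) powr r) * \<Phi> t0"
      by eventually_elim (use star_ratio assms t0 in auto)
  qed auto
qed

lemma star_borel: "(\<lambda>x. \<Phi> (max 0 x)) \<in> borel_measurable borel"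
proof (rule borel_measurableI_less)
  fix y
  have "is_interval {x. \<Phi> (max 0 x) < y}"
    unfolding is_interval_1
  proof (intro ballI allI impI)
    fix a b x assume "a \<in> {x. \<Phi> (max 0 x) < y}" "b \<in> {x. \<Phi> (max 0 x) < y}" "a \<le> x \<and> x \<le> b"
    then have "\<Phi> (max 0 x) \<le> \<Phi> (max 0 b)" "\<Phi> (max 0 b) < y" by (auto intro!: star_mono)
    then show "x \<in> {x. \<Phi> (max 0 x) < y}" by auto
  qed
  then show "{x \<in> space borel. \<Phi> (max 0 x) < y} \<in> sets borel"
    using real_interval_borel_measurable by auto
qed

lemma star_compose_measurable:
  assumes "g \<in> borel_measurable M" "\<And>x. 0 \<le> g x"
  shows "(\<lambda>x. \<Phi> (g x)) \<in> borel_measurable M"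
  using measurable_compose[OF assms(1) star_borel] assms(2) by (simp add: max_absorb2)

lemma star_norm_measurable:
  fixes f :: "_ \<Rightarrow> complex"
  assumes "f \<in> borel_measurable M" "0 < l"
  shows "(\<lambda>x. \<Phi> (norm (f x) / l)) \<in> borel_measurable M"
  using assms by (intro star_compose_measurable borel_measurable_divide borel_measurable_norm) auto

text \<open>A form of Jensen's inequality.  The constant \<open>2\<close> gives room for an argument from star-shapedness alone:
  for every real \<open>c \<le> \<Phi> (t / 2\<^bsup>1/r\<^esup>)\<close> the inequality \<open>2 (G / t)\<^sup>r c \<le> \<Phi> G + c\<close> holds both for small and for large \<open>G\<close>, and
  integrating it against the probability density \<open>\<rho>\<close> gives \<open>2 c \<le> \<integral> \<Phi> G \<rho> + c\<close>.\<close>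

lemma star_jensen:
  fixes G \<rho> :: "'z \<Rightarrow> real"
  assumes [measurable]: "G \<in> borel_measurable M" "\<rho> \<in> borel_measurable M" and G: "\<And>z. 0 \<le> G z" and \<rho>: "\<And>z. 0 \<le> \<rho> z"
    and prob: "(\<integral>\<^sup>+z. ennreal (\<rho> z) \<partial>M) = 1" and t: "0 \<le> t"
    and le: "ennreal (t powr r) \<le> (\<integral>\<^sup>+z. ennreal (G z powr r * \<rho> z) \<partial>M)"
  shows "\<Phi> (t / 2 powr (1 / r)) \<le> (\<integral>\<^sup>+z. \<Phi> (G z) * ennreal (\<rho> z) \<partial>M)"
proof (cases "t = 0")
  case False
  then have t: "0 < t" using t by simp
  let ?t = "t / 2 powr (1 / r)"
  have tp: "0 < ?t" using t by simp
  note m[measurable] = star_compose_measurable[OF assms(1) G]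
  have pw: "ennreal (2 * (G z / t) powr r * c) \<le> \<Phi> (G z) + ennreal c" if c: "0 \<le> c" "ennreal c \<le> \<Phi> ?t" for z c
  proof -
    have e: "2 * (G z / t) powr r = (G z / ?t) powr r"
      using G[of z] t star_r by (simp add: powr_mult powr_divide powr_powr)
    show ?thesis
    proof (cases "?t \<le> G z")
      case True
      then have Gp: "0 < G z" using tp by linarith
      have "ennreal ((G z / ?t) powr r * c) = ennreal ((G z / ?t) powr r) * ennreal c" using c by (simp add: ennreal_mult)
      also have "\<dots> \<le> ennreal ((G z / ?t) powr r) * (ennreal ((?t / G z) powr r) * \<Phi> (G z))"
        using star_ratio[of ?t "G z"] True tp Gp c by (intro mult_left_mono) (auto intro: order_trans)
      also have "\<dots> = \<Phi> (G z)"
        using tp Gp t by (simp add: mult.assoc[symmetric] ennreal_mult[symmetric] powr_mult[symmetric])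
      finally show ?thesis unfolding e by (simp add: add_increasing2)
    next
      case False
      have "G z / ?t \<le> 1" using False tp by (subst divide_le_eq_1_pos) linarith+
      then have "(G z / ?t) powr r \<le> 1" using powr_mono2[OF less_imp_le[OF star_r(1)] divide_nonneg_pos[OF G tp]] by (metis powr_one_eq_one)
      then have "(G z / ?t) powr r * c \<le> c" using c by (simp add: mult_left_le_one_le)
      then show ?thesis unfolding e by (simp add: add_increasing ennreal_leI)
    qed
  qed
  have main: "ennreal c \<le> (\<integral>\<^sup>+z. \<Phi> (G z) * ennreal (\<rho> z) \<partial>M)" if c: "0 \<le> c" "ennreal c \<le> \<Phi> ?t" for c
  proof -
    have k: "ennreal (2 * c / t powr r) * ennreal (t powr r) = ennreal (2 * c)"
      using c t by (simp add: ennreal_mult[symmetric])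
    have "ennreal (2 * c) \<le> ennreal (2 * c / t powr r) * (\<integral>\<^sup>+z. ennreal (G z powr r * \<rho> z) \<partial>M)"
      unfolding k[symmetric] by (rule mult_left_mono[OF le]) simp
    also have "\<dots> = (\<integral>\<^sup>+z. ennreal (2 * (G z / t) powr r * c) * ennreal (\<rho> z) \<partial>M)"
    proof (subst nn_integral_cmult[symmetric])
      show "(\<integral>\<^sup>+z. ennreal (2 * c / t powr r) * ennreal (G z powr r * \<rho> z) \<partial>M) = (\<integral>\<^sup>+z. ennreal (2 * (G z / t) powr r * c) * ennreal (\<rho> z) \<partial>M)"
        using c t G \<rho> by (intro nn_integral_cong) (simp add: ennreal_mult[symmetric] powr_divide mult_ac)
    qed measurable
    also have "\<dots> \<le> (\<integral>\<^sup>+z. \<Phi> (G z) * ennreal (\<rho> z) + ennreal c * ennreal (\<rho> z) \<partial>M)"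
      by (intro nn_integral_mono) (metis pw[OF c] distrib_right mult_right_mono zero_le)
    also have "\<dots> = (\<integral>\<^sup>+z. \<Phi> (G z) * ennreal (\<rho> z) \<partial>M) + ennreal c"
      using prob by (subst nn_integral_add) (auto simp: nn_integral_cmult)
    finally have "ennreal c + ennreal c \<le> (\<integral>\<^sup>+z. \<Phi> (G z) * ennreal (\<rho> z) \<partial>M) + ennreal c"
      using c by (simp add: ennreal_plus[symmetric] del: ennreal_plus)
    then have "ennreal c + ennreal c \<le> ennreal c + (\<integral>\<^sup>+z. \<Phi> (G z) * ennreal (\<rho> z) \<partial>M)" by (simp only: add.commute)
    then show ?thesis by (simp only: ennreal_add_left_cancel_le) simp
  qed
  show ?thesis
  proof (cases "\<Phi> ?t")
    case (real c)
    then show ?thesis using main[of c] by simp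
  next
    case top
    have "ennreal (real n) \<le> (\<integral>\<^sup>+z. \<Phi> (G z) * ennreal (\<rho> z) \<partial>M)" for n using main[of "real n"] top by simp
    then have "(\<integral>\<^sup>+z. \<Phi> (G z) * ennreal (\<rho> z) \<partial>M) = \<infinity>"
      by (metis ennreal_Ex_less_of_nat ennreal_of_nat_eq_real_of_nat infinity_ennreal_def less_top not_le)
    then show ?thesis by simp
  qed
qed (simp add: star_0)

section \<open>The Luxemburg quasi-norm\<close>

text \<open>The nonnegative integral of an arbitrary function is not changed by completing the measure.\<close>

lemma lnorm_alt:
  fixes f :: "'a::euclidean_space \<Rightarrow> complex"
  shows "lnorm \<Phi> f = (INF l\<in>{l. 0 < l \<and> (\<integral>\<^sup>+x. \<Phi> (norm (f x) / l) \<partial>lborel) \<le> 1}. ennreal l)"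
proof -
  have eq: "(if ennreal (norm (f x)) / ennreal l = \<infinity> then \<infinity> else \<Phi> (enn2real (ennreal (norm (f x)) / ennreal l))) = \<Phi> (norm (f x) / l)"
    if "0 < l" for x l using that by (simp add: divide_ennreal)
  have "{l. 0 < l \<and> (\<integral>\<^sup>+x. (if ennreal (norm (f x)) / ennreal l = \<infinity> then \<infinity> else \<Phi> (enn2real (ennreal (norm (f x)) / ennreal l))) \<partial>lebesgue) \<le> 1}
     = {l. 0 < l \<and> (\<integral>\<^sup>+x. \<Phi> (norm (f x) / l) \<partial>lborel) \<le> 1}"
  proof (intro Collect_cong conj_cong refl)
    fix l :: real assume "0 < l"
    then have "(\<integral>\<^sup>+x. (if ennreal (norm (f x)) / ennreal l = \<infinity> then \<infinity> else \<Phi> (enn2real (ennreal (norm (f x)) / ennreal l))) \<partial>lebesgue) = (\<integral>\<^sup>+x. \<Phi> (norm (f x) / l) \<partial>lborel)"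
      unfolding nn_integral_completion by (intro nn_integral_cong eq)
    then show "((\<integral>\<^sup>+x. (if ennreal (norm (f x)) / ennreal l = \<infinity> then \<infinity> else \<Phi> (enn2real (ennreal (norm (f x)) / ennreal l))) \<partial>lebesgue) \<le> 1) = ((\<integral>\<^sup>+x. \<Phi> (norm (f x) / l) \<partial>lborel) \<le> 1)"
      by simp
  qed
  then show ?thesis unfolding lnorm_def orlicz_norm_def Let_def by simp
qed

lemma lnorm_lessD:
  fixes f :: "'a::euclidean_space \<Rightarrow> complex"
  assumes "lnorm \<Phi> f < ennreal l"
  shows "(\<integral>\<^sup>+x. \<Phi> (norm (f x) / l) \<partial>lborel) \<le> 1" and "0 < l"
proof -
  obtain l' where l': "0 < l'" "(\<integral>\<^sup>+x. \<Phi> (norm (f x) / l') \<partial>lborel) \<le> 1" "ennreal l' < ennreal l"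
    using assms unfolding lnorm_alt INF_less_iff by auto
  have ll: "l' < l" using l' by (simp add: ennreal_less_iff)
  then show "0 < l" using l' by simp
  have "(\<integral>\<^sup>+x. \<Phi> (norm (f x) / l) \<partial>lborel) \<le> (\<integral>\<^sup>+x. \<Phi> (norm (f x) / l') \<partial>lborel)"
    using l' ll by (intro nn_integral_mono star_mono divide_left_mono) auto
  then show "(\<integral>\<^sup>+x. \<Phi> (norm (f x) / l) \<partial>lborel) \<le> 1" using l' by simp
qed

lemma lnorm_leI:
  fixes f :: "'a::euclidean_space \<Rightarrow> complex"
  assumes "0 < l" "(\<integral>\<^sup>+x. \<Phi> (norm (f x) / l) \<partial>lborel) \<le> 1"
  shows "lnorm \<Phi> f \<le> ennreal l"
  unfolding lnorm_alt by (rule INF_lower) (use assms in auto)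

lemma lnorm_mono:
  fixes f g :: "'a::euclidean_space \<Rightarrow> complex"
  assumes "AE x in lebesgue. norm (f x) \<le> c * norm (g x)" "0 < c"
  shows "lnorm \<Phi> f \<le> ennreal c * lnorm \<Phi> g"
proof (rule ennreal_le_epsilon)
  fix e :: real assume e: "0 < e" and fin: "ennreal c * lnorm \<Phi> g < top"
  have gfin: "lnorm \<Phi> g < top" using fin assms(2) by (auto simp: ennreal_mult_less_top)
  then obtain a where a: "lnorm \<Phi> g = ennreal a" "0 \<le> a" by (cases "lnorm \<Phi> g") auto
  let ?l = "a + e / c"
  have "lnorm \<Phi> g < ennreal ?l" using a e assms(2) by (simp add: ennreal_less_iff)
  note l = lnorm_lessD[OF this]
  have "lnorm \<Phi> f \<le> ennreal (c * ?l)"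
  proof (rule lnorm_leI)
    show "0 < c * ?l" using l assms(2) by simp
    have "AE x in lborel. norm (f x) \<le> c * norm (g x)" using assms(1) by (simp add: AE_completion_iff)
    then have "(\<integral>\<^sup>+x. \<Phi> (norm (f x) / (c * ?l)) \<partial>lborel) \<le> (\<integral>\<^sup>+x. \<Phi> (norm (g x) / ?l) \<partial>lborel)"
    proof (intro nn_integral_mono_AE, eventually_elim)
      case (elim x)
      have "norm (f x) / (c * ?l) \<le> (c * norm (g x)) / (c * ?l)"
        by (rule divide_right_mono[OF elim(2)]) (use l(2) assms(2) in simp)
      also have "\<dots> = norm (g x) / ?l" using assms(2) by simp
      finally have "norm (f x) / (c * ?l) \<le> norm (g x) / ?l" .
      moreover have "0 \<le> norm (f x) / (c * ?l)" by (rule divide_nonneg_pos) (use l(2) assms(2) in auto)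
      ultimately show ?case by (intro star_mono)
    qed
    then show "(\<integral>\<^sup>+x. \<Phi> (norm (f x) / (c * ?l)) \<partial>lborel) \<le> 1" using l(1) by simp
  qed
  also have "\<dots> = ennreal c * lnorm \<Phi> g + ennreal e"
    using a e assms(2) by (simp add: distrib_left ennreal_mult ennreal_plus)
  finally show "lnorm \<Phi> f \<le> ennreal c * lnorm \<Phi> g + ennreal e" .
qed

lemma lnorm_cong:
  fixes f g :: "'a::euclidean_space \<Rightarrow> complex"
  assumes "AE x in lebesgue. norm (f x) = norm (g x)"
  shows "lnorm \<Phi> f = lnorm \<Phi> g"
proof (rule antisym)
  show "lnorm \<Phi> f \<le> lnorm \<Phi> g"
    using lnorm_mono[of f 1 g] assms by (simp add: eventually_mono)
  show "lnorm \<Phi> g \<le> lnorm \<Phi> f"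
    using lnorm_mono[of g 1 f] assms by (simp add: eventually_mono)
qed

lemma lnorm_Fatou:
  fixes f :: "'a::euclidean_space \<Rightarrow> complex" and k :: "nat \<Rightarrow> 'a \<Rightarrow> complex"
  assumes m: "\<And>n. k n \<in> borel_measurable lborel" and lim: "\<And>x. (\<lambda>n. k n x) \<longlonglongrightarrow> f x" and c: "\<And>n. lnorm \<Phi> (k n) \<le> c"
  shows "lnorm \<Phi> f \<le> c"
proof (rule ennreal_le_epsilon)
  fix e :: real assume e: "0 < e" and fin: "c < top"
  then obtain a where a: "c = ennreal a" "0 \<le> a" by (cases c) auto
  let ?l = "a + e / 2" and ?l' = "a + e"
  have lt: "lnorm \<Phi> (k n) < ennreal ?l" for n
    using c[of n] a e by (auto intro: le_less_trans simp: ennreal_less_iff)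
  have "lnorm \<Phi> f \<le> ennreal ?l'"
  proof (rule lnorm_leI)
    show "0 < ?l'" using a e by simp
    have "(\<integral>\<^sup>+x. \<Phi> (norm (f x) / ?l') \<partial>lborel) \<le> (\<integral>\<^sup>+x. liminf (\<lambda>n. \<Phi> (norm (k n x) / ?l)) \<partial>lborel)"
    proof (rule nn_integral_mono)
      fix x
      show "\<Phi> (norm (f x) / ?l') \<le> liminf (\<lambda>n. \<Phi> (norm (k n x) / ?l))"
      proof (cases "f x = 0")
        case False
        have l: "0 < ?l" "0 < ?l'" "?l < ?l'" using a e by auto
        have "norm (f x) / ?l' < norm (f x) / ?l" using False l by (intro divide_strict_left_mono) auto
        moreover have "(\<lambda>n. norm (k n x) / ?l) \<longlonglongrightarrow> norm (f x) / ?l" using l by (intro tendsto_divide tendsto_norm lim tendsto_const) auto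
        ultimately have "\<forall>\<^sub>F n in sequentially. norm (f x) / ?l' < norm (k n x) / ?l" by (intro order_tendstoD(1)) auto
        then have "\<forall>\<^sub>F n in sequentially. \<Phi> (norm (f x) / ?l') \<le> \<Phi> (norm (k n x) / ?l)"
          by eventually_elim (use l in \<open>auto intro!: star_mono\<close>)
        then show ?thesis by (rule Liminf_bounded)
      qed (simp add: star_0)
    qed
    also have "\<dots> \<le> liminf (\<lambda>n. \<integral>\<^sup>+x. \<Phi> (norm (k n x) / ?l) \<partial>lborel)"
      using lnorm_lessD(2)[OF lt] m by (intro nn_integral_liminf star_norm_measurable) auto
    also have "\<dots> \<le> 1" using lnorm_lessD(1)[OF lt] by (intro Liminf_le) auto
    finally show "(\<integral>\<^sup>+x. \<Phi> (norm (f x) / ?l') \<partial>lborel) \<le> 1" .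
  qed
  then show "lnorm \<Phi> f \<le> c + ennreal e" using a e by (simp add: ennreal_plus)
qed

text \<open>Chebyshev's inequality for the modular at a small scale.\<close>

lemma lnorm_in_measure:
  fixes d :: "nat \<Rightarrow> 'a::euclidean_space \<Rightarrow> complex"
  assumes m: "\<And>n. d n \<in> borel_measurable lebesgue" and lim: "(\<lambda>n. lnorm \<Phi> (d n)) \<longlonglongrightarrow> 0" and \<delta>: "0 < \<delta>"
  shows "(\<lambda>n. emeasure lebesgue {x. \<delta> \<le> norm (d n x)}) \<longlonglongrightarrow> 0"
proof (rule order_tendstoI)
  fix a :: ennreal assume "0 < a"
  then obtain z where z: "0 < z" "z < a" using dense by blast
  then obtain e where e: "0 < e" "ennreal e < a" by (cases z) auto
  obtain t0 where t0: "0 < t0" "ennreal (1 / e) \<le> \<Phi> t0" using star_large by blast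
  let ?l = "\<delta> / t0"
  have l: "0 < ?l" using \<delta> t0 by simp
  have "\<forall>\<^sub>F n in sequentially. lnorm \<Phi> (d n) < ennreal ?l" by (rule order_tendstoD(2)[OF lim]) (use l in simp)
  then show "\<forall>\<^sub>F n in sequentially. emeasure lebesgue {x. \<delta> \<le> norm (d n x)} < a"
  proof eventually_elim
    case (elim n)
    let ?A = "{x. \<delta> \<le> norm (d n x)}"
    have A: "?A \<in> sets lebesgue"
      using measurable_sets[OF measurable_compose[OF m[of n] borel_measurable_norm], of "{\<delta>..}"] by (simp add: vimage_def)
    have "ennreal (1 / e) * emeasure lebesgue ?A = (\<integral>\<^sup>+x. ennreal (1 / e) * indicator ?A x \<partial>lebesgue)"
      using A by (simp add: nn_integral_cmult_indicator)
    also have "\<dots> \<le> (\<integral>\<^sup>+x. \<Phi> (norm (d n x) / ?l) \<partial>lebesgue)"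
    proof (rule nn_integral_mono)
      fix x
      show "ennreal (1 / e) * indicator ?A x \<le> \<Phi> (norm (d n x) / ?l)"
      proof (cases "x \<in> ?A")
        case True
        then have "t0 \<le> norm (d n x) / ?l" using l t0 \<delta> by (simp add: field_simps)
        then have "\<Phi> t0 \<le> \<Phi> (norm (d n x) / ?l)" using t0 by (intro star_mono) auto
        then show ?thesis using t0 True by simp
      qed simp
    qed
    also have "\<dots> \<le> 1" using lnorm_lessD(1)[OF elim] by (simp add: nn_integral_completion)
    finally have "ennreal e * (ennreal (1 / e) * emeasure lebesgue ?A) \<le> ennreal e * 1" by (rule mult_left_mono) simp
    then have "emeasure lebesgue ?A \<le> ennreal e" using e by (simp add: mult.assoc[symmetric] ennreal_mult[symmetric])
    then show ?case using e by simp
  qed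
qed simp

lemma lnorm_zero_AE:
  fixes f :: "'a::euclidean_space \<Rightarrow> complex"
  assumes m: "f \<in> borel_measurable lebesgue" and z: "lnorm \<Phi> f = 0"
  shows "AE x in lebesgue. f x = 0"
proof -
  have "emeasure lebesgue {x. 1 / real (Suc n) \<le> norm (f x)} = 0" for n
    using lnorm_in_measure[of "\<lambda>_. f" "1 / real (Suc n)"] m z by (simp add: LIMSEQ_const_iff)
  moreover have "{x. 1 / real (Suc n) \<le> norm (f x)} \<in> sets lebesgue" for n
    using measurable_sets[OF measurable_compose[OF m borel_measurable_norm], of "{1 / real (Suc n)..}"] by (simp add: vimage_def)
  ultimately have "{x. 1 / real (Suc n) \<le> norm (f x)} \<in> null_sets lebesgue" for n by blast
  then have N: "(\<Union>n. {x. 1 / real (Suc n) \<le> norm (f x)}) \<in> null_sets lebesgue" by (rule null_sets_UN)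
  show ?thesis
  proof (rule AE_I'[OF N])
    show "{x \<in> space lebesgue. f x \<noteq> 0} \<subseteq> (\<Union>n. {x. 1 / real (Suc n) \<le> norm (f x)})"
    proof
      fix x assume "x \<in> {x \<in> space lebesgue. f x \<noteq> 0}"
      then have "0 < norm (f x)" by simp
      then obtain n where "inverse (real (Suc n)) < norm (f x)" using reals_Archimedean by blast
      then show "x \<in> (\<Union>n. {x. 1 / real (Suc n) \<le> norm (f x)})" by (auto simp: inverse_eq_divide intro!: exI[of _ n] less_imp_le)
    qed
  qed
qed

lemma lnorm_0: "lnorm \<Phi> (\<lambda>x::'a::euclidean_space. 0) = 0"
proof -
  have "lnorm \<Phi> (\<lambda>x::'a. 0) \<le> ennreal e" if "0 < e" for e
    using that by (intro lnorm_leI) (auto simp: star_0)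
  then have "lnorm \<Phi> (\<lambda>x::'a. 0) \<le> 0"
  proof (intro ennreal_le_epsilon[of 0])
    fix e :: real assume "0 < e"
    then show "lnorm \<Phi> (\<lambda>x::'a. 0) \<le> 0 + ennreal e" using \<open>\<And>e. 0 < e \<Longrightarrow> lnorm \<Phi> (\<lambda>x::'a. 0) \<le> ennreal e\<close> by simp
  qed
  then show ?thesis by simp
qed

text \<open>By \<open>star_lower\<close>, functions in the Orlicz space are \<open>r\<close>-integrable against bounded weights of finite mass.\<close>

lemma lnorm_weighted_bound:
  obtains T where "0 < T" "\<And>(f :: 'a::euclidean_space \<Rightarrow> complex) l (w :: 'a \<Rightarrow> real). f \<in> borel_measurable lborel \<Longrightarrow> w \<in> borel_measurable lborel \<Longrightarrow>
    0 < l \<Longrightarrow> (\<integral>\<^sup>+x. \<Phi> (norm (f x) / l) \<partial>lborel) \<le> 1 \<Longrightarrow> (\<And>x. 0 \<le> w x \<and> w x \<le> 1) \<Longrightarrow>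
    (\<integral>\<^sup>+x. ennreal (norm (f x) powr r * w x) \<partial>lborel) \<le> ennreal ((T * l) powr r) * (1 + (\<integral>\<^sup>+x. ennreal (w x) \<partial>lborel))"
proof -
  obtain T where T: "0 < T" "\<And>t. 0 \<le> t \<Longrightarrow> ennreal (t powr r) \<le> ennreal (T powr r) * (\<Phi> t + 1)" using star_lower by auto
  show ?thesis
  proof (rule that[OF T(1)])
    fix f :: "'a \<Rightarrow> complex" and l :: real and w :: "'a \<Rightarrow> real"
    assume [measurable]: "f \<in> borel_measurable lborel" "w \<in> borel_measurable lborel" and l: "0 < l"
      and mod: "(\<integral>\<^sup>+x. \<Phi> (norm (f x) / l) \<partial>lborel) \<le> 1" and w: "\<And>x. 0 \<le> w x \<and> w x \<le> 1"
    note [measurable] = star_norm_measurable[OF \<open>f \<in> borel_measurable lborel\<close> l]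
    have "(\<integral>\<^sup>+x. ennreal (norm (f x) powr r * w x) \<partial>lborel) \<le> (\<integral>\<^sup>+x. ennreal ((T * l) powr r) * (\<Phi> (norm (f x) / l) + ennreal (w x)) \<partial>lborel)"
    proof (rule nn_integral_mono)
      fix x
      have "ennreal (norm (f x) powr r * w x) = ennreal (l powr r) * (ennreal ((norm (f x) / l) powr r) * ennreal (w x))"
        using l w[of x] by (simp add: ennreal_mult[symmetric] powr_divide)
      also have "\<dots> \<le> ennreal (l powr r) * ((ennreal (T powr r) * (\<Phi> (norm (f x) / l) + 1)) * ennreal (w x))"
        using l by (intro mult_left_mono mult_right_mono T) auto
      also have "\<dots> = ennreal ((T * l) powr r) * (\<Phi> (norm (f x) / l) * ennreal (w x) + ennreal (w x))"
        using l T by (simp add: powr_mult ennreal_mult algebra_simps)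
      also have "\<dots> \<le> ennreal ((T * l) powr r) * (\<Phi> (norm (f x) / l) * 1 + ennreal (w x))"
        using w[of x] by (intro mult_left_mono add_right_mono) auto
      finally show "ennreal (norm (f x) powr r * w x) \<le> ennreal ((T * l) powr r) * (\<Phi> (norm (f x) / l) + ennreal (w x))" by simp
    qed
    also have "\<dots> = ennreal ((T * l) powr r) * ((\<integral>\<^sup>+x. \<Phi> (norm (f x) / l) \<partial>lborel) + (\<integral>\<^sup>+x. ennreal (w x) \<partial>lborel))"
      by (subst nn_integral_cmult) (auto simp: nn_integral_add)
    also have "\<dots> \<le> ennreal ((T * l) powr r) * (1 + (\<integral>\<^sup>+x. ennreal (w x) \<partial>lborel))"
      by (intro mult_left_mono add_right_mono mod) auto
    finally show "(\<integral>\<^sup>+x. ennreal (norm (f x) powr r * w x) \<partial>lborel) \<le> ennreal ((T * l) powr r) * (1 + (\<integral>\<^sup>+x. ennreal (w x) \<partial>lborel))" .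
  qed
qed

end

section \<open>A majorant in the Orlicz space\<close>

lemma wint_pos:
  assumes "2 * DIM('a::euclidean_space) \<le> k" shows "0 < wint TYPE('a) k"
proof (rule ccontr)
  assume "\<not> 0 < wint TYPE('a) k"
  then have z: "(LINT x|lborel. 1 / br (x::'a) ^ k) = 0" using wint_nonneg[of "TYPE('a)" k] unfolding wint_def by linarith
  have "AE x in lborel. 1 / br (x::'a) ^ k = 0"
    using z integral_nonneg_eq_0_iff_AE[OF integrable_weight[OF assms]] by simp
  then have "AE x in lborel. (False :: bool) \<or> (x::'a) \<noteq> x" by eventually_elim simp
  then have "emeasure lborel (UNIV :: 'a set) = 0" by (subst (asm) AE_iff_measurable[of UNIV]) auto
  then show False by (simp add: emeasure_lborel_UNIV)
qed

text \<open>The quasi-norms of the slices lie below \<open>c\<close> if and only if the modular, which is measurable by Tonelli's theorem, is at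
  most one for some rational scale below \<open>c\<close>.\<close>

lemma orlicz_slice_measurable:
  fixes V :: "('a::euclidean_space) \<times> ('b::euclidean_space) \<Rightarrow> complex"
  assumes st: "star_shaped r \<Phi>" and V: "V \<in> borel_measurable borel"
  shows "(\<lambda>\<eta>. lnorm \<Phi> (\<lambda>x. V (x, \<eta>))) \<in> borel_measurable borel"
proof (rule borel_measurableI_less)
  fix y :: ennreal
  define M where "M q \<eta> = (\<integral>\<^sup>+x. \<Phi> (norm (V (x, \<eta>)) / q) \<partial>lborel)" for q \<eta>
  have Mm: "M q \<in> borel_measurable borel" if q: "0 < q" for q
  proof -
    have "(\<lambda>(\<eta>, x). V (x, \<eta>)) \<in> borel_measurable (borel \<Otimes>\<^sub>M borel)"
      unfolding split_beta' borel_prod by (intro borel_compose_continuous[OF V] continuous_intros)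
    then have "(\<lambda>(\<eta>, x). \<Phi> (norm (V (x, \<eta>)) / q)) \<in> borel_measurable (borel \<Otimes>\<^sub>M lborel)"
      using star_norm_measurable[OF st _ q, of "\<lambda>(\<eta>, x). V (x, \<eta>)"] by (simp add: split_beta')
    from lborel.borel_measurable_nn_integral[OF this] show ?thesis by (simp add: M_def[abs_def])
  qed
  have eq: "{\<eta>. lnorm \<Phi> (\<lambda>x. V (x, \<eta>)) < y} = (\<Union>q\<in>{q\<in>\<rat>. 0 < q \<and> ennreal q < y}. {\<eta>. M q \<eta> \<le> 1})"
  proof (intro set_eqI iffI)
    fix \<eta> assume "\<eta> \<in> {\<eta>. lnorm \<Phi> (\<lambda>x. V (x, \<eta>)) < y}"
    then have "lnorm \<Phi> (\<lambda>x. V (x, \<eta>)) < y" by simp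
    then obtain z where z: "lnorm \<Phi> (\<lambda>x. V (x, \<eta>)) < z" "z < y" using dense by blast
    then obtain z' where z': "z = ennreal z'" "0 \<le> z'" by (cases z) auto
    then obtain l where l: "lnorm \<Phi> (\<lambda>x. V (x, \<eta>)) = ennreal l" "0 \<le> l" "l < z'"
      using z(1) by (cases "lnorm \<Phi> (\<lambda>x. V (x, \<eta>))") (auto simp: ennreal_less_iff)
    then obtain q where q: "q \<in> \<rat>" "l < q" "q < z'" using Rats_dense_in_real by blast
    have "lnorm \<Phi> (\<lambda>x. V (x, \<eta>)) < ennreal q" using l q by (simp add: ennreal_less_iff)
    from lnorm_lessD[OF st this] have "0 < q" "M q \<eta> \<le> 1" by (auto simp: M_def)
    moreover have "ennreal q < y" using q z z' by (meson ennreal_leI less_imp_le order_le_less_trans)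
    ultimately show "\<eta> \<in> (\<Union>q\<in>{q\<in>\<rat>. 0 < q \<and> ennreal q < y}. {\<eta>. M q \<eta> \<le> 1})" using q by auto
  next
    fix \<eta> assume "\<eta> \<in> (\<Union>q\<in>{q\<in>\<rat>. 0 < q \<and> ennreal q < y}. {\<eta>. M q \<eta> \<le> 1})"
    then obtain q where "0 < q" "ennreal q < y" "M q \<eta> \<le> 1" by auto
    then show "\<eta> \<in> {\<eta>. lnorm \<Phi> (\<lambda>x. V (x, \<eta>)) < y}" using lnorm_leI[OF st, of q "\<lambda>x. V (x, \<eta>)"] by (auto simp: M_def intro: le_less_trans)
  qed
  have "(\<Union>q\<in>{q\<in>\<rat>. 0 < q \<and> ennreal q < y}. {\<eta>. M q \<eta> \<le> 1}) \<in> sets borel"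
  proof (rule sets.countable_UN'')
    show "countable {q::real. q \<in> \<rat> \<and> 0 < q \<and> ennreal q < y}"
      by (rule countable_subset[OF _ countable_rat]) auto
    fix q :: real assume "q \<in> {q\<in>\<rat>. 0 < q \<and> ennreal q < y}"
    then show "{\<eta>. M q \<eta> \<le> 1} \<in> sets borel" using measurable_sets[OF Mm, of q "{..1}"] by (simp add: vimage_def)
  qed
  then show "{\<eta> \<in> space borel. lnorm \<Phi> (\<lambda>x. V (x, \<eta>)) < y} \<in> sets borel" by (simp only: eq[symmetric]) simp
qed

text \<open>The quasi-norm of a slice, increased by one, is a scale at which the modular of the slice is at most one; being in
  \<open>L\<^bsup>\<Psi>\<^esup>\<close>, these quasi-norms are \<open>r\<close>-integrable against a weight.\<close>

lemma mixed_norm_slice_data: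
  fixes V :: "'n::finite phase \<Rightarrow> complex"
  assumes st: "star_shaped r \<Phi>" and st': "star_shaped r \<Psi>" and V: "V \<in> borel_measurable borel"
    and fin: "mixed_norm \<Phi> \<Psi> V < \<infinity>" and s: "2 * DIM(real^'n) \<le> s"
  obtains n where "n \<in> borel_measurable borel" "\<And>\<eta>. 1 \<le> n \<eta>"
    "AE \<eta> in lborel. (\<integral>\<^sup>+y. \<Phi> (norm (V (y, \<eta>)) / n \<eta>) \<partial>lborel) \<le> 1"
    "(\<integral>\<^sup>+\<eta>. ennreal (n \<eta> powr r * (1 / br \<eta> ^ s)) \<partial>lborel) < \<infinity>"
proof -
  define N where "N \<eta> = lnorm \<Phi> (\<lambda>x. V (x, \<eta>))" for \<eta>
  have N[measurable]: "N \<in> borel_measurable borel" unfolding N_def[abs_def] by (rule orlicz_slice_measurable[OF st V])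
  note r = star_r[OF st]
  let ?\<Psi> = "\<lambda>t::ennreal. if t = \<infinity> then \<infinity> else \<Psi> (enn2real t)"
  obtain \<kappa> where \<kappa>: "0 < \<kappa>" "(\<integral>\<^sup>+\<eta>. ?\<Psi> (N \<eta> / ennreal \<kappa>) \<partial>lborel) \<le> 1"
    using fin unfolding mixed_norm_def orlicz_norm_def Let_def INF_less_iff nn_integral_completion N_def by auto
  have [measurable]: "(\<lambda>\<eta>. \<Psi> (enn2real (N \<eta> / ennreal \<kappa>))) \<in> borel_measurable borel"
    by (intro star_compose_measurable[OF st']) auto
  have \<Psi>m: "(\<lambda>\<eta>. ?\<Psi> (N \<eta> / ennreal \<kappa>)) \<in> borel_measurable lborel" by measurable
  have "(\<integral>\<^sup>+\<eta>. ?\<Psi> (N \<eta> / ennreal \<kappa>) \<partial>lborel) < \<infinity>" by (rule le_less_trans[OF \<kappa>(2)]) simp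
  then have "AE \<eta> in lborel. ?\<Psi> (N \<eta> / ennreal \<kappa>) \<noteq> \<infinity>"
    by (intro nn_integral_PInf_AE[OF \<Psi>m] less_imp_neq)
  then have AEfin: "AE \<eta> in lborel. N \<eta> \<noteq> \<infinity>"
    by eventually_elim (use \<kappa> in \<open>auto simp: ennreal_top_divide\<close>)
  define n where "n \<eta> = enn2real (N \<eta>) + 1" for \<eta>
  have n[measurable]: "n \<in> borel_measurable borel" unfolding n_def[abs_def] by measurable
  have n1: "1 \<le> n \<eta>" for \<eta> by (simp add: n_def)
  have mod: "AE \<eta> in lborel. (\<integral>\<^sup>+y. \<Phi> (norm (V (y, \<eta>)) / n \<eta>) \<partial>lborel) \<le> 1"
    using AEfin
  proof eventually_elim
    case (elim \<eta>)
    then obtain a where a: "N \<eta> = ennreal a" "0 \<le> a" by (cases "N \<eta>") auto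
    then have "N \<eta> < ennreal (n \<eta>)" by (simp add: n_def ennreal_less_iff)
    then show ?case unfolding N_def by (rule lnorm_lessD(1)[OF st])
  qed
  let ?w = "\<lambda>\<eta>::real^'n. 1 / br \<eta> ^ s" and ?f = "\<lambda>\<eta>. complex_of_real (enn2real (N \<eta>))"
  obtain T where T: "0 < T" "\<And>(f :: 'n cfun) l (w :: real^'n \<Rightarrow> real). f \<in> borel_measurable lborel \<Longrightarrow> w \<in> borel_measurable lborel \<Longrightarrow>
    0 < l \<Longrightarrow> (\<integral>\<^sup>+x. \<Psi> (norm (f x) / l) \<partial>lborel) \<le> 1 \<Longrightarrow> (\<And>x. 0 \<le> w x \<and> w x \<le> 1) \<Longrightarrow>
    (\<integral>\<^sup>+x. ennreal (norm (f x) powr r * w x) \<partial>lborel) \<le> ennreal ((T * l) powr r) * (1 + (\<integral>\<^sup>+x. ennreal (w x) \<partial>lborel))"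
    by (fact lnorm_weighted_bound[OF st'])
  have "\<Psi> (enn2real (N \<eta>) / \<kappa>) \<le> ?\<Psi> (N \<eta> / ennreal \<kappa>)" for \<eta>
  proof (cases "N \<eta>")
    case (real b) then show ?thesis using \<kappa>(1) by (simp add: divide_ennreal)
  next
    case top then show ?thesis using star_0[OF st'] by simp
  qed
  then have "(\<integral>\<^sup>+\<eta>. \<Psi> (norm (?f \<eta>) / \<kappa>) \<partial>lborel) \<le> (\<integral>\<^sup>+\<eta>. ?\<Psi> (N \<eta> / ennreal \<kappa>) \<partial>lborel)" by (intro nn_integral_mono) simp
  then have mod': "(\<integral>\<^sup>+\<eta>. \<Psi> (norm (?f \<eta>) / \<kappa>) \<partial>lborel) \<le> 1" using \<kappa>(2) by (rule order_trans)
  have W: "(\<integral>\<^sup>+\<eta>. ennreal (?w \<eta>) \<partial>lborel) < \<infinity>" using nn_integral_weight_shift[OF s, of 0] by simp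
  have fm: "?f \<in> borel_measurable lborel" and wm: "?w \<in> borel_measurable lborel" by measurable
  have w01: "0 \<le> ?w \<eta> \<and> ?w \<eta> \<le> 1" for \<eta> using br_power_ge1[of \<eta> s] by simp
  have I: "(\<integral>\<^sup>+\<eta>. ennreal (norm (?f \<eta>) powr r * ?w \<eta>) \<partial>lborel) < \<infinity>"
    by (rule le_less_trans[OF T(2)[OF fm wm \<kappa>(1) mod' w01]]) (use W in \<open>simp add: ennreal_mult_less_top\<close>)
  have "(\<integral>\<^sup>+\<eta>. ennreal (n \<eta> powr r * ?w \<eta>) \<partial>lborel) \<le> (\<integral>\<^sup>+\<eta>. 2 * (ennreal (norm (?f \<eta>) powr r * ?w \<eta>) + ennreal (?w \<eta>)) \<partial>lborel)"
  proof (rule nn_integral_mono)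
    fix \<eta>
    let ?a = "enn2real (N \<eta>)"
    have "n \<eta> powr r \<le> (2 * max ?a 1) powr r" unfolding n_def using r by (intro powr_mono2) auto
    also have "\<dots> = 2 powr r * max ?a 1 powr r" by (simp add: powr_mult)
    also have "\<dots> \<le> 2 * (?a powr r + 1)"
      using r powr_mono[of r 1 2] by (intro mult_mono) (auto simp: max_def)
    finally have "ennreal (n \<eta> powr r * ?w \<eta>) \<le> ennreal (2 * (?a powr r + 1) * ?w \<eta>)" by (intro ennreal_leI mult_right_mono) auto
    also have "\<dots> = ennreal 2 * (ennreal (?a powr r * ?w \<eta>) + ennreal (?w \<eta>))"
      by (subst ennreal_plus[symmetric], simp, simp, subst ennreal_mult[symmetric], simp, simp, rule arg_cong[where f=ennreal], simp add: algebra_simps add_divide_distrib)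
    finally show "ennreal (n \<eta> powr r * ?w \<eta>) \<le> 2 * (ennreal (norm (?f \<eta>) powr r * ?w \<eta>) + ennreal (?w \<eta>))" by simp
  qed
  also have "\<dots> = 2 * ((\<integral>\<^sup>+\<eta>. ennreal (norm (?f \<eta>) powr r * ?w \<eta>) \<partial>lborel) + (\<integral>\<^sup>+\<eta>. ennreal (?w \<eta>) \<partial>lborel))"
    by (subst nn_integral_cmult, measurable, subst nn_integral_add) auto
  also have "\<dots> < \<infinity>" using I W by (simp add: ennreal_mult_less_top)
  finally have "(\<integral>\<^sup>+\<eta>. ennreal (n \<eta> powr r * ?w \<eta>) \<partial>lborel) < \<infinity>" .
  then show thesis using that[OF n n1 mod] by simp
qed

text \<open>The majorant \<open>D\<close> is an average of the functions \<open>\<bar>V (\<cdot>, \<eta>)\<bar>\<^sup>r\<close>, translated, with weights that are integrable against the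
  quasi-norms of the slices; after normalising the slices by \<open>n \<eta>\<close>, Jensen's inequality applies.\<close>

proposition majorant_in_orlicz:
  fixes V :: "'n::finite phase \<Rightarrow> complex"
  assumes st: "star_shaped r \<Phi>" and st': "star_shaped r \<Psi>" and V: "V \<in> borel_measurable borel"
    and fin: "mixed_norm \<Phi> \<Psi> V < \<infinity>" and s: "2 * DIM(real^'n) \<le> s"
  defines "D x \<equiv> (\<integral>\<^sup>+Y. ennreal (norm (V Y) powr r * (1 / (br (x - fst Y) ^ s * br (snd Y) ^ s))) \<partial>lborel)"
  shows "D x < \<infinity>" and "D \<in> borel_measurable borel" and "lnorm \<Phi> (\<lambda>x. complex_of_real (enn2real (D x) powr (1 / r))) < \<infinity>"
proof -
  let ?w = "\<lambda>y::real^'n. 1 / br y ^ s"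
  let ?W = "wint TYPE(real^'n) s"
  have W: "0 < ?W" by (rule wint_pos[OF s])
  note r = star_r[OF st]
  obtain n where n[measurable]: "n \<in> borel_measurable borel" and n1: "\<And>\<eta>. 1 \<le> n \<eta>"
    and mod: "AE \<eta> in lborel. (\<integral>\<^sup>+y. \<Phi> (norm (V (y, \<eta>)) / n \<eta>) \<partial>lborel) \<le> 1"
    and nfin: "(\<integral>\<^sup>+\<eta>. ennreal (n \<eta> powr r * ?w \<eta>) \<partial>lborel) < \<infinity>"
    using mixed_norm_slice_data[OF st st' V fin s] by blast
  have n0: "0 < n \<eta>" for \<eta> using n1[of \<eta>] by linarith
  define Z where "Z = enn2real (\<integral>\<^sup>+\<eta>. ennreal (n \<eta> powr r * ?w \<eta>) \<partial>lborel)"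
  have Z: "(\<integral>\<^sup>+\<eta>. ennreal (n \<eta> powr r * ?w \<eta>) \<partial>lborel) = ennreal Z" using nfin by (simp add: Z_def)
  have Zpos: "0 < Z"
  proof -
    have "ennreal ?W = (\<integral>\<^sup>+\<eta>. ennreal (?w \<eta>) \<partial>lborel)" using nn_integral_weight_shift[OF s, of 0] by simp
    also have "\<dots> \<le> (\<integral>\<^sup>+\<eta>. ennreal (n \<eta> powr r * ?w \<eta>) \<partial>lborel)"
      using n1 r by (intro nn_integral_mono ennreal_leI) (auto simp: mult_le_cancel_right1 ge_one_powr_ge_zero divide_right_mono)
    finally have "ennreal ?W \<le> ennreal Z" unfolding Z .
    then show ?thesis using W by (metis ennreal_le_iff2 ennreal_less_zero_iff linorder_not_le order_less_le_trans)
  qed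
  have wm[measurable]: "?w \<in> borel_measurable borel" by measurable
  have Vs: "(\<lambda>y. V (y, \<eta>)) \<in> borel_measurable borel" for \<eta>
    by (intro borel_compose_continuous[OF V] continuous_intros)
  have msnd: "(\<lambda>Y. h (snd Y)) \<in> borel_measurable borel" if "h \<in> borel_measurable borel" for h :: "real^'n \<Rightarrow> real"
    by (intro borel_compose_continuous[OF that] continuous_intros)
  have tonelli: "(\<integral>\<^sup>+Y. h Y \<partial>lborel) = (\<integral>\<^sup>+\<eta>. \<integral>\<^sup>+y. h (y, \<eta>) \<partial>lborel \<partial>lborel)"
    if "h \<in> borel_measurable borel" for h :: "'n phase \<Rightarrow> ennreal"
  proof -
    have "h \<in> borel_measurable (lborel \<Otimes>\<^sub>M lborel)" using that by (simp add: lborel_prod)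
    from lborel_pair.nn_integral_snd[OF this] show ?thesis by (simp add: lborel_prod)
  qed
  have Im: "(\<lambda>Y. norm (V Y) powr r * (1 / (br (x - fst Y) ^ s * br (snd Y) ^ s))) \<in> borel_measurable borel" for x
  proof -
    have "(\<lambda>Y::'n phase. 1 / (br (x - fst Y) ^ s * br (snd Y) ^ s)) \<in> borel_measurable borel"
      unfolding br_def by (intro borel_measurable_continuous_onI continuous_intros) (auto simp: add_nonneg_eq_0_iff)
    then show ?thesis using V by measurable
  qed
  obtain T where T: "0 < T" "\<And>(f :: 'n cfun) l (w :: real^'n \<Rightarrow> real). f \<in> borel_measurable lborel \<Longrightarrow> w \<in> borel_measurable lborel \<Longrightarrow>
    0 < l \<Longrightarrow> (\<integral>\<^sup>+x. \<Phi> (norm (f x) / l) \<partial>lborel) \<le> 1 \<Longrightarrow> (\<And>x. 0 \<le> w x \<and> w x \<le> 1) \<Longrightarrow>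
    (\<integral>\<^sup>+x. ennreal (norm (f x) powr r * w x) \<partial>lborel) \<le> ennreal ((T * l) powr r) * (1 + (\<integral>\<^sup>+x. ennreal (w x) \<partial>lborel))"
    by (fact lnorm_weighted_bound[OF st])
  show Dfin: "D x < \<infinity>" for x
  proof -
    have "D x = (\<integral>\<^sup>+\<eta>. \<integral>\<^sup>+y. ennreal (norm (V (y, \<eta>)) powr r * (1 / (br (x - y) ^ s * br \<eta> ^ s))) \<partial>lborel \<partial>lborel)"
      unfolding D_def by (subst tonelli) (use Im in auto)
    also have "\<dots> \<le> (\<integral>\<^sup>+\<eta>. ennreal (T powr r * (1 + ?W)) * ennreal (n \<eta> powr r * ?w \<eta>) \<partial>lborel)"
    proof (intro nn_integral_mono_AE, use mod in eventually_elim)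
      case (elim \<eta>)
      have wx[measurable]: "(\<lambda>y. ?w (x - y)) \<in> borel_measurable borel" by measurable
      have "(\<integral>\<^sup>+y. ennreal (norm (V (y, \<eta>)) powr r * (1 / (br (x - y) ^ s * br \<eta> ^ s))) \<partial>lborel)
         = (\<integral>\<^sup>+y. ennreal (norm (V (y, \<eta>)) powr r * ?w (x - y)) * ennreal (?w \<eta>) \<partial>lborel)"
        by (intro nn_integral_cong) (simp add: ennreal_mult[symmetric])
      also have "\<dots> = (\<integral>\<^sup>+y. ennreal (norm (V (y, \<eta>)) powr r * ?w (x - y)) \<partial>lborel) * ennreal (?w \<eta>)"
        using Vs[of \<eta>] wx by (intro nn_integral_multc) simp
      also have "\<dots> \<le> (ennreal ((T * n \<eta>) powr r) * (1 + (\<integral>\<^sup>+y. ennreal (?w (x - y)) \<partial>lborel))) * ennreal (?w \<eta>)"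
        using Vs wx n0 elim br_power_ge1 by (intro mult_right_mono T(2)) auto
      also have "\<dots> = ennreal (T powr r * (1 + ?W)) * ennreal (n \<eta> powr r * ?w \<eta>)"
      proof -
        have e: "1 + ennreal ?W = ennreal (1 + ?W)" using W by (simp add: ennreal_plus)
        show ?thesis unfolding nn_integral_weight_shift[OF s] e
          using T(1) n0[of \<eta>] W by (simp add: ennreal_mult[symmetric] powr_mult mult_ac del: ennreal_plus)
      qed
      finally show ?case .
    qed
    also have "\<dots> = ennreal (T powr r * (1 + ?W)) * ennreal Z"
      unfolding Z[symmetric] by (rule nn_integral_cmult) measurable
    also have "\<dots> < \<infinity>" by (simp add: ennreal_mult_less_top)
    finally show ?thesis .
  qed
  show Dm: "D \<in> borel_measurable borel"
  proof -
    have "(\<lambda>Z::(real^'n) \<times> ('n phase). 1 / (br (fst Z - fst (snd Z)) ^ s * br (snd (snd Z)) ^ s)) \<in> borel_measurable borel"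
      unfolding br_def by (intro borel_measurable_continuous_onI continuous_intros) (auto simp: add_nonneg_eq_0_iff)
    moreover have "(\<lambda>Z::(real^'n) \<times> ('n phase). V (snd Z)) \<in> borel_measurable borel"
      by (intro borel_compose_continuous[OF V] continuous_intros)
    ultimately have "(\<lambda>Z. ennreal (norm (V (snd Z)) powr r * (1 / (br (fst Z - fst (snd Z)) ^ s * br (snd (snd Z)) ^ s)))) \<in> borel_measurable (borel :: ((real^'n) \<times> ('n phase)) measure)"
      by measurable
    then have "(\<lambda>(x, Y). ennreal (norm (V Y) powr r * (1 / (br (x - fst Y) ^ s * br (snd Y) ^ s)))) \<in> borel_measurable (borel \<Otimes>\<^sub>M borel)"
      by (simp add: split_beta' borel_prod)
    then have "(\<lambda>(x, Y). ennreal (norm (V Y) powr r * (1 / (br (x - fst Y) ^ s * br (snd Y) ^ s)))) \<in> borel_measurable (borel \<Otimes>\<^sub>M lborel)"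
      unfolding measurable_cong_sets[OF sets_pair_measure_cong[OF refl sets_lborel] refl] .
    from lborel.borel_measurable_nn_integral[OF this] show ?thesis by (simp add: D_def[abs_def])
  qed
  define P where "P Y = n (snd Y) powr r * ?w (snd Y) / (Z * ?W)" for Y :: "'n phase"
  have Pm[measurable]: "P \<in> borel_measurable borel"
  proof -
    have "(\<lambda>\<eta>. n \<eta> powr r * ?w \<eta> / (Z * ?W)) \<in> borel_measurable borel" by measurable
    from msnd[OF this] show ?thesis by (simp add: P_def[abs_def])
  qed
  have P0: "0 \<le> P Y" for Y using Zpos W by (simp add: P_def)
  define G where "G Y = norm (V Y) / n (snd Y)" for Y
  have Gm[measurable]: "G \<in> borel_measurable borel"
    unfolding G_def[abs_def] using V msnd[OF n] by measurable
  have G0: "0 \<le> G Y" for Y using n0[of "snd Y"] by (simp add: G_def)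
  have \<Phi>G[measurable]: "(\<lambda>Y. \<Phi> (G Y)) \<in> borel_measurable borel" by (rule star_compose_measurable[OF st Gm G0])
  let ?\<rho> = "\<lambda>x Y. P Y * ?w (x - fst Y)"
  have wfst[measurable]: "(\<lambda>Y::'n phase. ?w (x - fst Y)) \<in> borel_measurable borel" for x
    by (intro borel_compose_continuous[OF wm] continuous_intros)
  have prob: "(\<integral>\<^sup>+Y. ennreal (?\<rho> x Y) \<partial>lborel) = 1" for x
  proof -
    have "(\<integral>\<^sup>+Y. ennreal (?\<rho> x Y) \<partial>lborel) = (\<integral>\<^sup>+\<eta>. \<integral>\<^sup>+y. ennreal (?\<rho> x (y, \<eta>)) \<partial>lborel \<partial>lborel)"
      by (rule tonelli) measurable
    also have "\<dots> = (\<integral>\<^sup>+\<eta>. ennreal (1 / Z) * ennreal (n \<eta> powr r * ?w \<eta>) \<partial>lborel)"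
    proof (rule nn_integral_cong)
      fix \<eta>
      have "(\<integral>\<^sup>+y. ennreal (?\<rho> x (y, \<eta>)) \<partial>lborel) = (\<integral>\<^sup>+y. ennreal (P (0, \<eta>)) * ennreal (?w (x - y)) \<partial>lborel)"
        using P0[of "(0, \<eta>)"] by (intro nn_integral_cong) (simp add: ennreal_mult[symmetric] P_def)
      also have "\<dots> = ennreal (P (0, \<eta>)) * ennreal ?W"
        unfolding nn_integral_weight_shift[OF s, symmetric, of x] by (rule nn_integral_cmult) measurable
      also have "\<dots> = ennreal (1 / Z) * ennreal (n \<eta> powr r * ?w \<eta>)"
        using Zpos W P0[of "(0, \<eta>)"] by (simp add: P_def ennreal_mult[symmetric])
      finally show "(\<integral>\<^sup>+y. ennreal (?\<rho> x (y, \<eta>)) \<partial>lborel) = ennreal (1 / Z) * ennreal (n \<eta> powr r * ?w \<eta>)" .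
    qed
    also have "\<dots> = ennreal (1 / Z) * ennreal Z" unfolding Z[symmetric] by (rule nn_integral_cmult) measurable
    also have "\<dots> = 1" using Zpos by (simp add: ennreal_mult[symmetric])
    finally show ?thesis .
  qed
  define \<Lambda> where "\<Lambda> = (2 * Z * ?W) powr (1 / r)"
  have \<Lambda>: "0 < \<Lambda>" using Zpos W by (simp add: \<Lambda>_def)
  have jensen: "\<Phi> (enn2real (D x) powr (1 / r) / \<Lambda>) \<le> (\<integral>\<^sup>+Y. \<Phi> (G Y) * ennreal (?\<rho> x Y) \<partial>lborel)" for x
  proof -
    let ?d = "enn2real (D x)"
    let ?t = "(?d / (Z * ?W)) powr (1 / r)"
    have "\<Phi> (?t / 2 powr (1 / r)) \<le> (\<integral>\<^sup>+Y. \<Phi> (G Y) * ennreal (?\<rho> x Y) \<partial>lborel)"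
    proof (rule star_jensen[OF st])
      show "G \<in> borel_measurable lborel" "?\<rho> x \<in> borel_measurable lborel" by measurable
      show "0 \<le> ?\<rho> x Y" for Y using P0[of Y] by simp
      have "ennreal (?t powr r) = ennreal (1 / (Z * ?W)) * ennreal ?d"
        using Zpos W r by (simp add: powr_powr ennreal_mult[symmetric])
      also have "ennreal ?d = D x" using Dfin[of x] by simp
      also have "ennreal (1 / (Z * ?W)) * D x = (\<integral>\<^sup>+Y. ennreal (1 / (Z * ?W)) * ennreal (norm (V Y) powr r * (1 / (br (x - fst Y) ^ s * br (snd Y) ^ s))) \<partial>lborel)"
        unfolding D_def using Im[of x] by (intro nn_integral_cmult[symmetric]) simp
      also have "\<dots> = (\<integral>\<^sup>+Y. ennreal (G Y powr r * ?\<rho> x Y) \<partial>lborel)"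
      proof (rule nn_integral_cong)
        fix Y :: "'n phase"
        have nr: "n (snd Y) powr r \<noteq> 0" using n0[of "snd Y"] by simp
        have "G Y powr r * ?\<rho> x Y = 1 / (Z * ?W) * (norm (V Y) powr r * (1 / (br (x - fst Y) ^ s * br (snd Y) ^ s)))"
          using n0[of "snd Y"] nr by (simp add: G_def P_def powr_divide)
        then show "ennreal (1 / (Z * ?W)) * ennreal (norm (V Y) powr r * (1 / (br (x - fst Y) ^ s * br (snd Y) ^ s))) = ennreal (G Y powr r * ?\<rho> x Y)"
          using Zpos W by (subst ennreal_mult[symmetric]) (auto simp del: times_divide_eq_right times_divide_eq_left)
      qed
      finally show "ennreal (?t powr r) \<le> (\<integral>\<^sup>+Y. ennreal (G Y powr r * ?\<rho> x Y) \<partial>lborel)" by simp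
    qed (use G0 prob in auto)
    also have "?t / 2 powr (1 / r) = ?d powr (1 / r) / \<Lambda>"
      using Zpos W by (simp add: \<Lambda>_def powr_divide powr_mult)
    finally show ?thesis .
  qed
  have "(\<integral>\<^sup>+x. \<Phi> (norm (complex_of_real (enn2real (D x) powr (1 / r))) / \<Lambda>) \<partial>lborel) \<le> (\<integral>\<^sup>+x. \<integral>\<^sup>+Y. \<Phi> (G Y) * ennreal (?\<rho> x Y) \<partial>lborel \<partial>lborel)"
    using jensen by (intro nn_integral_mono) simp
  also have "\<dots> = (\<integral>\<^sup>+Y. \<integral>\<^sup>+x. \<Phi> (G Y) * ennreal (?\<rho> x Y) \<partial>lborel \<partial>lborel)"
  proof (rule lborel_pair.Fubini'[symmetric])
    have 1: "(\<lambda>Z::(real^'n) \<times> ('n phase). \<Phi> (G (snd Z))) \<in> borel_measurable borel"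
      by (intro borel_compose_continuous[OF \<Phi>G] continuous_intros)
    have 2: "(\<lambda>Z::(real^'n) \<times> ('n phase). P (snd Z)) \<in> borel_measurable borel"
      by (intro borel_compose_continuous[OF Pm] continuous_intros)
    have 3: "(\<lambda>Z::(real^'n) \<times> ('n phase). ?w (fst Z - fst (snd Z))) \<in> borel_measurable borel"
      by (intro borel_compose_continuous[OF wm] continuous_intros)
    have "(\<lambda>Z::(real^'n) \<times> ('n phase). \<Phi> (G (snd Z)) * ennreal (P (snd Z) * ?w (fst Z - fst (snd Z)))) \<in> borel_measurable borel"
      using 1 2 3 by measurable
    then show "(\<lambda>(x, Y). \<Phi> (G Y) * ennreal (?\<rho> x Y)) \<in> borel_measurable (lborel \<Otimes>\<^sub>M lborel)"
      by (simp add: lborel_prod split_beta')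
  qed
  also have "\<dots> = (\<integral>\<^sup>+Y. \<Phi> (G Y) * ennreal (P Y * ?W) \<partial>lborel)"
  proof (rule nn_integral_cong)
    fix Y
    have "(\<integral>\<^sup>+x. \<Phi> (G Y) * ennreal (?\<rho> x Y) \<partial>lborel) = (\<integral>\<^sup>+x. (\<Phi> (G Y) * ennreal (P Y)) * ennreal (1 / br (fst Y - x) ^ s) \<partial>lborel)"
      using P0[of Y] by (intro nn_integral_cong) (simp add: ennreal_mult[symmetric] mult.assoc br_commute[of _ "fst Y"])
    also have "\<dots> = (\<Phi> (G Y) * ennreal (P Y)) * ennreal ?W"
      unfolding nn_integral_weight_shift[OF s, symmetric, of "fst Y"] by (rule nn_integral_cmult) measurable
    finally show "(\<integral>\<^sup>+x. \<Phi> (G Y) * ennreal (?\<rho> x Y) \<partial>lborel) = \<Phi> (G Y) * ennreal (P Y * ?W)"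
      using P0[of Y] W by (simp add: ennreal_mult mult.assoc)
  qed
  also have "\<dots> = (\<integral>\<^sup>+\<eta>. \<integral>\<^sup>+y. \<Phi> (G (y, \<eta>)) * ennreal (P (y, \<eta>) * ?W) \<partial>lborel \<partial>lborel)"
    by (rule tonelli) measurable
  also have "\<dots> \<le> (\<integral>\<^sup>+\<eta>. ennreal (1 / Z) * ennreal (n \<eta> powr r * ?w \<eta>) \<partial>lborel)"
  proof (intro nn_integral_mono_AE, use mod in eventually_elim)
    case (elim \<eta>)
    have "(\<integral>\<^sup>+y. \<Phi> (G (y, \<eta>)) * ennreal (P (y, \<eta>) * ?W) \<partial>lborel) = (\<integral>\<^sup>+y. \<Phi> (norm (V (y, \<eta>)) / n \<eta>) * ennreal (P (0, \<eta>) * ?W) \<partial>lborel)"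
      by (simp add: G_def P_def)
    also have "\<dots> = (\<integral>\<^sup>+y. \<Phi> (norm (V (y, \<eta>)) / n \<eta>) \<partial>lborel) * ennreal (P (0, \<eta>) * ?W)"
      using star_norm_measurable[OF st Vs n0] by (intro nn_integral_multc) simp
    also have "\<dots> \<le> 1 * ennreal (P (0, \<eta>) * ?W)" by (intro mult_right_mono elim) simp
    also have "\<dots> = ennreal (1 / Z) * ennreal (n \<eta> powr r * ?w \<eta>)"
      using Zpos W by (simp add: P_def ennreal_mult[symmetric])
    finally show ?case .
  qed
  also have "\<dots> = ennreal (1 / Z) * ennreal Z" unfolding Z[symmetric] by (rule nn_integral_cmult) measurable
  also have "\<dots> = 1" using Zpos by (simp add: ennreal_mult[symmetric])
  finally have "lnorm \<Phi> (\<lambda>x. complex_of_real (enn2real (D x) powr (1 / r))) \<le> ennreal \<Lambda>"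
    by (intro lnorm_leI[OF st \<Lambda>])
  also have "\<dots> < \<infinity>" by simp
  finally show "lnorm \<Phi> (\<lambda>x. complex_of_real (enn2real (D x) powr (1 / r))) < \<infinity>" .
qed

section \<open>Growth of Young functions with finite upper index\<close>

text \<open>The right derivative of a convex function is the infimum of its slopes to the right.\<close>

lemma convex_right_derivative:
  fixes y :: "real \<Rightarrow> real"
  assumes cv: "convex_on {0<..} y" and s: "0 < s"
  obtains D where "(y has_real_derivative D) (at_right s)" "\<And>s'. 0 < s' \<Longrightarrow> s' < s \<Longrightarrow> y s - D * (s - s') \<le> y s'"
proof -
  define m where "m t = (y t - y s) / (t - s)" for t
  have swap: "(a - b) / (c - d) = (b - a) / (d - c)" for a b c d :: real
    using minus_divide_divide[of "b - a" "d - c"] by simp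
  have left: "(y s - y s') / (s - s') \<le> m t" if "0 < s'" "s' < s" "s < t" for s' t
  proof -
    have "(y s' - y s) / (s' - s) \<le> (y s - y t) / (s - t)"
      by (rule order_trans[OF convex_on_slope_le(1)[OF cv] convex_on_slope_le(2)[OF cv]]) (use that s in auto)
    then show ?thesis unfolding m_def swap[of "y s" "y t"] swap[of "y s'" "y s"] .
  qed
  have mono: "m t \<le> m t'" if "s < t" "t < t'" for t t'
  proof -
    have "(y s - y t) / (s - t) \<le> (y s - y t') / (s - t')"
      by (rule convex_on_slope_le(1)[OF cv]) (use that s in auto)
    then show ?thesis unfolding m_def swap[of "y s"] .
  qed
  define D where "D = Inf (m ` {s<..})"
  have bdd: "bdd_below (m ` {s<..})" using left[of "s / 2"] s by (intro bdd_belowI2[where m="(y s - y (s / 2)) / (s - s / 2)"]) auto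
  have Dle: "D \<le> m t" if "s < t" for t unfolding D_def using that by (intro cInf_lower bdd) auto
  have "(m \<longlongrightarrow> D) (at_right s)"
  proof (rule order_tendstoI)
    fix a assume "a < D"
    then show "\<forall>\<^sub>F t in at_right s. a < m t"
      unfolding eventually_at by (intro exI[of _ 1]) (auto intro: less_le_trans Dle)
  next
    fix a assume "D < a"
    then obtain t0 where t0: "s < t0" "m t0 < a" unfolding D_def using cInf_less_iff[OF _ bdd] by auto
    have "m t < a" if "s < t" "t < t0" for t using mono[OF that] t0 by simp
    then show "\<forall>\<^sub>F t in at_right s. m t < a"
      unfolding eventually_at using t0 by (intro exI[of _ "t0 - s"]) (auto simp: dist_real_def)
  qed
  then have "(y has_real_derivative D) (at_right s)"
    by (simp add: has_field_derivative_iff m_def[abs_def])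
  moreover have "y s - D * (s - s') \<le> y s'" if "0 < s'" "s' < s" for s'
  proof -
    have "(y s - y s') / (s - s') \<le> D" unfolding D_def by (rule cInf_greatest) (use left that in auto)
    then show ?thesis using that by (simp add: field_simps)
  qed
  ultimately show thesis by (rule that)
qed

text \<open>A bound \<open>p\<close> on \<open>t \<Phi>' / \<Phi>\<close> becomes a bound \<open>p / r\<close> on the same quotient for the convex function \<open>y s = \<Phi> (s\<^bsup>1/r\<^esup>)\<close>.
  The tangent at \<open>s\<close> supports \<open>y\<close>, so going back from \<open>s\<close> to \<open>(1 - \<delta>) s\<close> loses at most half of the value if \<open>\<delta> p / r \<le> 1/2\<close>.\<close>

lemma upper_index_doubling:
  assumes q: "quasi_young_function \<Phi>" and ix: "upper_index \<Phi> < \<infinity>"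
  obtains c where "1 < c" "\<And>t. 0 \<le> t \<Longrightarrow> \<Phi> (c * t) \<le> 2 * \<Phi> t"
proof -
  obtain r where r: "0 < r" "r \<le> 1" and Y: "young_function (\<lambda>t. \<Phi> (t powr (1 / r)))"
    using q unfolding quasi_young_function_def by blast
  let ?Y = "\<lambda>t. \<Phi> (t powr (1 / r))"
  let ?\<Omega> = "{t. 0 < t \<and> 0 < \<Phi> t \<and> \<Phi> t < \<infinity>}"
  have \<Omega>: "?\<Omega> = {0<..}" using ix unfolding upper_index_def Let_def by (auto split: if_splits)
  have fin: "\<Phi> t < \<infinity>" and pos: "0 < \<Phi> t" if "0 < t" for t using \<Omega> that by auto
  have sup: "(SUP t\<in>?\<Omega>. ereal (t * right_deriv \<Phi> t / enn2real (\<Phi> t))) < \<infinity>"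
    using ix \<Omega> unfolding upper_index_def Let_def by simp
  obtain p where p: "0 < p" "\<And>t. 0 < t \<Longrightarrow> t * right_deriv \<Phi> t / enn2real (\<Phi> t) \<le> p"
  proof -
    obtain p' where p': "(SUP t\<in>?\<Omega>. ereal (t * right_deriv \<Phi> t / enn2real (\<Phi> t))) < ereal p'"
      using ereal_dense2[OF sup] by blast
    have "t * right_deriv \<Phi> t / enn2real (\<Phi> t) \<le> max p' 1" if "0 < t" for t
    proof -
      have "ereal (t * right_deriv \<Phi> t / enn2real (\<Phi> t)) \<le> (SUP t\<in>?\<Omega>. ereal (t * right_deriv \<Phi> t / enn2real (\<Phi> t)))"
        by (rule SUP_upper) (use that fin pos in auto)
      also have "\<dots> < ereal p'" by (rule p')
      finally show ?thesis by simp
    qed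
    then show thesis using that[of "max p' 1"] by simp
  qed
  define y where "y s = enn2real (?Y s)" for s
  have yY: "?Y s = ennreal (y s)" if "0 < s" for s using fin[of "s powr (1 / r)"] that by (simp add: y_def)
  have ypos: "0 < y s" if "0 < s" for s
    using pos[of "s powr (1 / r)"] yY[OF that] that by (metis ennreal_less_zero_iff powr_gt_zero less_irrefl)
  have cv: "convex_on {0<..} y"
  proof (rule convex_onI)
    fix u a b :: real assume u: "0 < u" "u < 1" and ab: "a \<in> {0<..}" "b \<in> {0<..}"
    have ab': "0 < (1 - u) * a + u * b" using u ab by (simp add: add_pos_pos)
    have "ennreal (y ((1 - u) * a + u * b)) = ?Y (u * b + (1 - u) * a)"
      using yY[OF ab'] by (simp add: add.commute)
    also have "\<dots> \<le> ennreal u * ?Y b + ennreal (1 - u) * ?Y a"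
      using Y u ab unfolding young_function_def by auto
    also have "\<dots> = ennreal ((1 - u) * y a + u * y b)"
      using u ab ypos[of a] ypos[of b] yY[of a] yY[of b] by (simp add: ennreal_mult[symmetric] ennreal_plus[symmetric] add.commute del: ennreal_plus)
    finally show "y ((1 - u) *\<^sub>R a + u *\<^sub>R b) \<le> (1 - u) * y a + u * y b"
      using u ab ypos[of a] ypos[of b] by (subst (asm) ennreal_le_iff) auto
  qed (simp add: convex_real_interval)
  define \<delta> where "\<delta> = 1 / (2 * (p / r + 1))"
  have pr: "0 < p / r" using p r by simp
  have \<delta>: "0 < \<delta>" "\<delta> < 1" "\<delta> * (p / r) \<le> 1 / 2"
  proof -
    have "0 < 1 / (2 * (a + 1)) \<and> 1 / (2 * (a + 1)) < 1 \<and> 1 / (2 * (a + 1)) * a \<le> 1 / 2" if "0 < a" for a :: real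
      using that by (auto simp: field_simps)
    from this[OF pr] show "0 < \<delta>" "\<delta> < 1" "\<delta> * (p / r) \<le> 1 / 2" unfolding \<delta>_def by blast+
  qed
  have key: "y s \<le> 2 * y ((1 - \<delta>) * s)" if s: "0 < s" for s
  proof -
    obtain D where D: "(y has_real_derivative D) (at_right s)" "\<And>s'. 0 < s' \<Longrightarrow> s' < s \<Longrightarrow> y s - D * (s - s') \<le> y s'"
      using convex_right_derivative[OF cv s] by blast
    define t where "t = s powr (1 / r)"
    have t: "0 < t" "t powr r = s" using s r by (auto simp: t_def powr_powr)
    have "((\<lambda>t. t powr r) has_real_derivative r * t powr (r - 1)) (at t within {t<..})"
      using t by (auto intro!: derivative_eq_intros)
    moreover have "(y has_real_derivative D) (at (t powr r) within (\<lambda>t. t powr r) ` {t<..})"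
      unfolding t(2) by (rule has_field_derivative_subset[OF D(1)]) (use t r in \<open>auto intro!: powr_less_mono2\<close>)
    ultimately have "(y \<circ> (\<lambda>t. t powr r) has_real_derivative D * (r * t powr (r - 1))) (at t within {t<..})"
      by (intro DERIV_image_chain)
    then have "((\<lambda>t. enn2real (\<Phi> t)) has_real_derivative D * (r * t powr (r - 1))) (at t within {t<..})"
    proof -
      have e: "(y \<circ> (\<lambda>t. t powr r)) x = enn2real (\<Phi> x)" if "0 < x" for x using that r by (simp add: y_def powr_powr)
      have "\<forall>\<^sub>F x in at t within {t<..}. ((y \<circ> (\<lambda>t. t powr r)) x - (y \<circ> (\<lambda>t. t powr r)) t) / (x - t) = (enn2real (\<Phi> x) - enn2real (\<Phi> t)) / (x - t)"
        unfolding eventually_at by (intro exI[of _ 1] conjI ballI impI) (use e t in auto)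
      from tendsto_cong[OF this] show ?thesis
        using \<open>(y \<circ> (\<lambda>t. t powr r) has_real_derivative D * (r * t powr (r - 1))) (at t within {t<..})\<close>
        by (simp add: has_field_derivative_iff)
    qed
    then have "right_deriv \<Phi> t = D * (r * t powr (r - 1))"
      unfolding right_deriv_def has_real_derivative_iff_has_vector_derivative
      by (intro vector_derivative_within) auto
    moreover have "t * t powr (r - 1) = s" using t by (simp add: powr_mult_base)
    ultimately have "t * right_deriv \<Phi> t = r * (s * D)" by (simp add: mult_ac)
    moreover have "enn2real (\<Phi> t) = y s" by (simp add: y_def t_def)
    ultimately have "r * (s * D) / y s \<le> p" using p(2)[OF t(1)] by simp
    then have sD: "s * D \<le> p / r * y s" using ypos[OF s] r by (simp add: field_simps)
    have "D * (s - (1 - \<delta>) * s) = \<delta> * (s * D)" by (simp add: algebra_simps)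
    also have "\<dots> \<le> \<delta> * (p / r * y s)" by (intro mult_left_mono sD) (use \<delta> in simp)
    also have "\<dots> = (\<delta> * (p / r)) * y s" by simp
    also have "\<dots> \<le> 1 / 2 * y s" using \<delta>(3) ypos[OF s] by (intro mult_right_mono) auto
    finally have "D * (s - (1 - \<delta>) * s) \<le> 1 / 2 * y s" .
    moreover have "y s - D * (s - (1 - \<delta>) * s) \<le> y ((1 - \<delta>) * s)" using \<delta> s by (intro D(2)) (auto simp: algebra_simps)
    ultimately show ?thesis by simp
  qed
  define c where "c = (1 / (1 - \<delta>)) powr (1 / r)"
  have c: "1 < c" unfolding c_def using \<delta> r by (intro gr_one_powr) (auto simp: field_simps)
  have "\<Phi> (c * t) \<le> 2 * \<Phi> t" if t: "0 \<le> t" for t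
  proof (cases "t = 0")
    case True
    have "\<Phi> 0 = 0" using Y r by (simp add: young_function_def)
    then show ?thesis using True by simp
  next
    case False
    then have t: "0 < t" using t by simp
    define s where "s = (c * t) powr r"
    have ct: "0 < c * t" using c t by simp
    have s: "0 < s" "s powr (1 / r) = c * t" using ct r by (auto simp: s_def powr_powr)
    have "c powr r = 1 / (1 - \<delta>)" using \<delta> r by (simp add: c_def powr_powr)
    then have "(1 - \<delta>) * s = t powr r" using \<delta> c t by (simp add: s_def powr_mult)
    then have "((1 - \<delta>) * s) powr (1 / r) = t" using t r by (simp add: powr_powr)
    then have "\<Phi> t = ennreal (y ((1 - \<delta>) * s))" using yY[of "(1 - \<delta>) * s"] \<delta> s by simp
    moreover have "\<Phi> (c * t) = ennreal (y s)" using yY[OF s(1)] s(2) by simp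
    moreover have "ennreal (y s) \<le> 2 * ennreal (y ((1 - \<delta>) * s))"
      using key[OF s(1)] ypos[of "(1 - \<delta>) * s"] \<delta> s by (simp add: ennreal_mult'[symmetric] ennreal_leI flip: ennreal_numeral)
    ultimately show ?thesis by simp
  qed
  with c show thesis by (rule that)
qed

text \<open>By doubling, the modular of \<open>g\<close> is finite at every scale, and dominated convergence applies to the modulars of \<open>d n\<close> at every
  scale.  Without doubling the theorem fails, for example in \<open>L\<^bsup>\<infinity>\<^esup>\<close>.\<close>

lemma lnorm_dominated_convergence:
  fixes g :: "'a::euclidean_space \<Rightarrow> complex"
  assumes st: "star_shaped r \<Phi>" and q: "quasi_young_function \<Phi>" and ix: "upper_index \<Phi> < \<infinity>"
    and g: "lnorm \<Phi> g < \<infinity>" and m: "\<And>n. d n \<in> borel_measurable lborel" and gm: "g \<in> borel_measurable lborel"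
    and dom: "\<And>n x. norm (d n x) \<le> norm (g x)" and lim: "\<And>x. (\<lambda>n. d n x) \<longlonglongrightarrow> (0::complex)"
  shows "(\<lambda>n. lnorm \<Phi> (d n)) \<longlonglongrightarrow> 0"
proof -
  obtain c where c: "1 < c" "\<And>t. 0 \<le> t \<Longrightarrow> \<Phi> (c * t) \<le> 2 * \<Phi> t" using upper_index_doubling[OF q ix] by blast
  have ck: "\<Phi> (c ^ k * t) \<le> 2 ^ k * \<Phi> t" if "0 \<le> t" for k t
  proof (induction k)
    case (Suc k)
    have "\<Phi> (c * (c ^ k * t)) \<le> 2 * \<Phi> (c ^ k * t)" using c that by (intro c) auto
    also have "\<dots> \<le> 2 * (2 ^ k * \<Phi> t)" by (intro mult_left_mono Suc) simp
    finally show ?case by (simp add: mult.assoc)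
  qed simp
  obtain l where l: "lnorm \<Phi> g < ennreal l"
  proof -
    obtain a where "lnorm \<Phi> g = ennreal a" "0 \<le> a" using g by (cases "lnorm \<Phi> g") auto
    then show thesis using that[of "a + 1"] by (simp add: ennreal_less_iff)
  qed
  note l' = lnorm_lessD[OF st l]
  have small: "\<forall>\<^sub>F n in sequentially. lnorm \<Phi> (d n) \<le> ennreal e" if e: "0 < e" for e
  proof -
    obtain k where k: "l / e \<le> c ^ k" using real_arch_pow[OF c(1), of "l / e"] less_imp_le by blast
    have "\<Phi> (norm (g x) / e) \<le> 2 ^ k * \<Phi> (norm (g x) / l)" for x
    proof -
      have "norm (g x) / e = (l / e) * (norm (g x) / l)" using l'(2) by simp
      also have "\<dots> \<le> c ^ k * (norm (g x) / l)" using k l'(2) by (intro mult_right_mono) auto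
      finally have "\<Phi> (norm (g x) / e) \<le> \<Phi> (c ^ k * (norm (g x) / l))" using e by (intro star_mono[OF st]) auto
      also have "\<dots> \<le> 2 ^ k * \<Phi> (norm (g x) / l)" using l'(2) by (intro ck) auto
      finally show ?thesis .
    qed
    then have "(\<integral>\<^sup>+x. \<Phi> (norm (g x) / e) \<partial>lborel) \<le> (\<integral>\<^sup>+x. 2 ^ k * \<Phi> (norm (g x) / l) \<partial>lborel)" by (intro nn_integral_mono)
    also have "\<dots> = 2 ^ k * (\<integral>\<^sup>+x. \<Phi> (norm (g x) / l) \<partial>lborel)"
      by (intro nn_integral_cmult star_norm_measurable[OF st gm l'(2)])
    also have "\<dots> \<le> 2 ^ k * 1" by (intro mult_left_mono l') simp
    also have "\<dots> < \<infinity>" by (simp add: power_less_top_ennreal)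
    finally have fin: "(\<integral>\<^sup>+x. \<Phi> (norm (g x) / e) \<partial>lborel) < \<infinity>" .
    have "(\<lambda>n. \<integral>\<^sup>+x. \<Phi> (norm (d n x) / e) \<partial>lborel) \<longlonglongrightarrow> (\<integral>\<^sup>+x. 0 \<partial>(lborel :: 'a measure))"
    proof (rule nn_integral_dominated_convergence[OF _ _ _ _ fin])
      show "AE x in lborel. \<Phi> (norm (d n x) / e) \<le> \<Phi> (norm (g x) / e)" for n
        using e dom by (intro AE_I2 star_mono[OF st] divide_right_mono) auto
      show "AE x in lborel. (\<lambda>n. \<Phi> (norm (d n x) / e)) \<longlonglongrightarrow> 0"
      proof (intro AE_I2 star_tendsto_0[OF st])
        fix x
        show "(\<lambda>n. norm (d n x) / e) \<longlonglongrightarrow> 0"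
          using tendsto_divide[OF tendsto_norm[OF lim[of x]] tendsto_const, of e] e by simp
      qed (use e in auto)
    qed (use star_norm_measurable[OF st m e] star_norm_measurable[OF st gm e] in auto)
    then have "\<forall>\<^sub>F n in sequentially. (\<integral>\<^sup>+x. \<Phi> (norm (d n x) / e) \<partial>lborel) < 1" by (intro order_tendstoD(2)) auto
    then show ?thesis by eventually_elim (intro lnorm_leI[OF st e] less_imp_le)
  qed
  show ?thesis
  proof (rule order_tendstoI)
    fix a :: ennreal assume "0 < a"
    then obtain z where z: "0 < z" "z < a" using dense by blast
    then obtain e where e: "z = ennreal e" "0 < e" by (cases z) auto
    show "\<forall>\<^sub>F n in sequentially. lnorm \<Phi> (d n) < a"
      using small[OF e(2)] by eventually_elim (use z e in \<open>auto intro: le_less_trans\<close>)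
  qed simp
qed

section \<open>The kernel form of a Fourier multiplier\<close>

lemma lebesgue_integral_borel:
  fixes f :: "'a::euclidean_space \<Rightarrow> 'b::{banach, second_countable_topology}"
  assumes "f \<in> borel_measurable borel"
  shows "(LINT x|lebesgue. f x) = (LINT x|lborel. f x)" "integrable lebesgue f \<longleftrightarrow> integrable lborel f"
  using assms by (simp_all add: integral_completion integrable_completion)

lemma borel_imp_lebesgue: "f \<in> borel_measurable borel \<Longrightarrow> f \<in> borel_measurable lebesgue"
  by (rule measurable_completion) simp

lemma fourier_ft:
  fixes f :: "'n::finite cfun"
  assumes "schwartz f" shows "fourier f \<xi> = ft_const TYPE('n) * ft f \<xi>"
  unfolding fourier_def ft_def ee_def[symmetric]
  by (subst lebesgue_integral_borel) (auto intro: schwartz_borel schwartz_ee' assms)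

lemma inv_fourier_ft:
  fixes f :: "'n::finite cfun"
  assumes "schwartz f" shows "inv_fourier f x = ft_const TYPE('n) * ft f (- x)"
proof -
  have e: "f \<xi> * exp (\<i> * complex_of_real (x \<bullet> \<xi>)) = f \<xi> * ee (- x) \<xi>" for \<xi>
    by (simp add: ee_def inner_commute)
  show ?thesis unfolding inv_fourier_def ft_def e
    by (subst lebesgue_integral_borel) (auto intro: schwartz_borel schwartz_ee' assms)
qed

lemma schwartz_inv_fourier:
  fixes f :: "'n::finite cfun"
  assumes "schwartz f" shows "schwartz (inv_fourier f)"
  using schwartz_cmult(1)[OF schwartz_translate(4)[OF schwartz_ft(1)[OF assms]], of "ft_const TYPE('n)"] inv_fourier_ft[OF assms]
  by presburger

lemma multiplier_ft:
  fixes g \<theta> :: "'n::finite cfun"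
  assumes m: "tempered m" and g: "schwartz g" and t: "schwartz \<theta>"
  shows "multiplier m g \<theta> = (ft_const TYPE('n))\<^sup>2 * m (\<lambda>\<xi>. ft g \<xi> * ft \<theta> (- \<xi>))"
proof -
  have S: "schwartz (\<lambda>\<xi>. ft g \<xi> * ft \<theta> (- \<xi>))" by (intro schwartz_mult schwartz_ft schwartz_translate g t)
  have "multiplier m g \<theta> = m (\<lambda>\<xi>. fourier g \<xi> * inv_fourier \<theta> \<xi>)"
    by (simp add: multiplier_def dist_inv_fourier_def dist_times_def)
  also have "(\<lambda>\<xi>. fourier g \<xi> * inv_fourier \<theta> \<xi>) = (\<lambda>\<xi>. (ft_const TYPE('n))\<^sup>2 * (ft g \<xi> * ft \<theta> (- \<xi>)))"
    by (simp add: fun_eq_iff fourier_ft[OF g] inv_fourier_ft[OF t] power2_eq_square)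
  also have "m \<dots> = (ft_const TYPE('n))\<^sup>2 * m (\<lambda>\<xi>. ft g \<xi> * ft \<theta> (- \<xi>))" by (rule tempered_cmult[OF m S])
  finally show ?thesis .
qed

text \<open>The convolution of \<open>g\<close> with the inverse Fourier transform of \<open>m\<close>, a continuous function of polynomial growth that
  represents \<open>multiplier m g\<close>.\<close>

definition kconv :: "'n::finite dist \<Rightarrow> 'n cfun \<Rightarrow> 'n cfun" where
  "kconv m g x = (ft_const TYPE('n))\<^sup>2 * m (tf (ft g) (0, - x))"

lemma kconv_continuous:
  fixes g :: "'n::finite cfun"
  assumes "tempered m" "schwartz g" shows "continuous_on UNIV (kconv m g)"
  unfolding kconv_def[abs_def]
  by (intro continuous_intros continuous_on_compose2[OF tempered_tf_continuous[OF assms(1) schwartz_ft(1)[OF assms(2)]]]) auto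

lemmas kconv_borel = borel_measurable_continuous_onI[OF kconv_continuous]

lemma kconv_bound:
  fixes m :: "'n::finite dist"
  assumes m: "tempered m"
  obtains C k N where "0 \<le> C" "\<And>(g :: 'n cfun) x. schwartz g \<Longrightarrow> norm (kconv m g x) \<le> C * sn k N g * br x ^ N"
proof -
  obtain C0 N where C0: "0 \<le> C0" "\<And>\<psi>. schwartz \<psi> \<Longrightarrow> norm (m \<psi>) \<le> C0 * sn N N \<psi>" using tempered_bound[OF m] by blast
  obtain C1 where C1: "0 \<le> C1" "\<And>q :: 'n cfun. schwartz q \<Longrightarrow> sn N N (ft q) \<le> C1 * sn (2 * DIM(real^'n) + N) N q"
    using schwartz_ft(2)[OF schwartz_chi, where k=N and N=N] by blast
  let ?c = "norm ((ft_const TYPE('n))\<^sup>2)"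
  let ?J = "(jet_const TYPE('n) N)\<^sup>2"
  show ?thesis
  proof (rule that[of "?c * (C0 * ?J * C1)" "2 * DIM(real^'n) + N" N])
    fix g :: "'n cfun" and x assume g: "schwartz g"
    have "norm (m (tf (ft g) (0, - x))) \<le> C0 * sn N N (tf (ft g) (0, - x))" by (intro C0 schwartz_tf schwartz_ft g)
    also have "\<dots> \<le> C0 * (?J * br (0::real^'n) ^ N * br (- x) ^ N * sn N N (ft g))"
      using schwartz_tf(2)[OF schwartz_ft(1)[OF g], of N N "(0, - x)"] C0(1) by (intro mult_left_mono) auto
    also have "\<dots> \<le> C0 * (?J * br (0::real^'n) ^ N * br (- x) ^ N * (C1 * sn (2 * DIM(real^'n) + N) N g))"
      by (intro mult_left_mono C1 g C0) auto
    finally have "norm (m (tf (ft g) (0, - x))) \<le> C0 * ?J * C1 * sn (2 * DIM(real^'n) + N) N g * br x ^ N" by (simp add: mult_ac)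
    from mult_left_mono[OF this, of ?c]
    show "norm (kconv m g x) \<le> ?c * (C0 * ?J * C1) * sn (2 * DIM(real^'n) + N) N g * br x ^ N"
      by (simp add: kconv_def norm_mult mult_ac)
  qed (use C0 C1 in simp)
qed

lemma kconv_diff:
  fixes m :: "'n::finite dist"
  assumes m: "tempered m" and g: "schwartz g" "schwartz h"
  shows "kconv m (\<lambda>t. g t - h t) x = kconv m g x - kconv m h x"
proof -
  have "tf (ft (\<lambda>t. g t - h t)) (0, - x) = (\<lambda>\<xi>. tf (ft g) (0, - x) \<xi> - tf (ft h) (0, - x) \<xi>)"
    by (simp add: fun_eq_iff tf_def ft_diff[OF g] right_diff_distrib)
  then show ?thesis
    unfolding kconv_def using tempered_diff[OF m schwartz_tf(1)[OF schwartz_ft(1)[OF g(1)]] schwartz_tf(1)[OF schwartz_ft(1)[OF g(2)]]]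
    by (simp add: right_diff_distrib)
qed

text \<open>The pairing with \<open>\<theta>\<close> may be exchanged with the action of \<open>m\<close>, as \<open>ft \<theta> (- \<xi>)\<close> is a superposition of characters in \<open>\<xi>\<close>.\<close>

lemma multiplier_kconv:
  fixes g \<theta> :: "'n::finite cfun"
  assumes m: "tempered m" and g: "schwartz g" and t: "schwartz \<theta>"
  shows "multiplier m g \<theta> = (LINT x|lborel. kconv m g x * \<theta> x)"
proof -
  have "m (\<lambda>\<xi>. LINT x|lborel. \<theta> x * tf (ft g) (0, - x) \<xi>) = (LINT x|lborel. \<theta> x * m (tf (ft g) (0, - x)))"
  proof (rule tempered_integral(2)[OF m schwartz_ft(1)[OF g]])
    show "norm ((0::real^'n, - y) - (0, - y')) \<le> norm (y - y')" for y y' :: "real^'n"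
      by (simp add: norm_Pair norm_minus_commute)
    show "\<theta> \<in> borel_measurable borel" by (rule schwartz_borel[OF t])
    show "\<exists>C. \<forall>y. norm (\<theta> y) \<le> C / br y ^ M" for M using norm_le_sn[OF t] by blast
  qed (simp add: zero_prod_def)
  moreover have "(LINT x|lborel. \<theta> x * tf (ft g) (0, - x) \<xi>) = ft g \<xi> * ft \<theta> (- \<xi>)" for \<xi>
  proof -
    have "\<theta> x * tf (ft g) (0, - x) \<xi> = ft g \<xi> * (\<theta> x * ee (- \<xi>) x)" for x
      by (simp add: tf_def ee_def inner_commute)
    then show ?thesis unfolding ft_def[of \<theta>] by (simp only: integral_mult_right_zero)
  qed
  ultimately have "m (\<lambda>\<xi>. ft g \<xi> * ft \<theta> (- \<xi>)) = (LINT x|lborel. \<theta> x * m (tf (ft g) (0, - x)))" by simp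
  then show ?thesis unfolding multiplier_ft[OF m g t] kconv_def
    by (simp add: mult.assoc mult.commute[of "\<theta> _"])
qed

lemma kconv_times_integrable:
  fixes g \<theta> :: "'n::finite cfun"
  assumes m: "tempered m" and g: "schwartz g" and t: "schwartz \<theta>"
  shows "integrable lborel (\<lambda>x. kconv m g x * \<theta> x)"
proof -
  obtain C k N where C: "0 \<le> C" "\<And>(g :: 'n cfun) x. schwartz g \<Longrightarrow> norm (kconv m g x) \<le> C * sn k N g * br x ^ N"
    using kconv_bound[OF m] by blast
  show ?thesis
  proof (rule integrable_by_weight[OF _ _ order_refl])
    show "(\<lambda>x. kconv m g x * \<theta> x) \<in> borel_measurable borel"
      by (intro borel_measurable_times kconv_borel m g schwartz_borel t)
    fix x :: "real^'n"
    have "norm (kconv m g x * \<theta> x) \<le> (C * sn k N g * br x ^ N) * (sn (2 * DIM(real^'n) + N) 0 \<theta> / br x ^ (2 * DIM(real^'n) + N))"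
      unfolding norm_mult using C(1) sn_nonneg[OF g] by (intro mult_mono C g norm_le_sn t) auto
    then show "norm (kconv m g x * \<theta> x) \<le> (C * sn k N g * sn (2 * DIM(real^'n) + N) 0 \<theta>) / br x ^ (2 * DIM(real^'n))"
      by (simp add: power_add field_simps)
  qed
qed

lemma kconv_represents:
  fixes g :: "'n::finite cfun"
  assumes m: "tempered m" and g: "schwartz g"
  shows "represents (kconv m g) (multiplier m g)"
  unfolding represents_def
proof (intro conjI allI impI)
  show "kconv m g \<in> borel_measurable lebesgue" by (intro borel_imp_lebesgue kconv_borel m g)
  fix \<theta> :: "'n cfun" assume "test_function \<theta>"
  then have t: "schwartz \<theta>" by (rule test_function_schwartz)
  have b: "(\<lambda>x. kconv m g x * \<theta> x) \<in> borel_measurable borel"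
    by (intro borel_measurable_times kconv_borel m g schwartz_borel t)
  show "integrable lebesgue (\<lambda>x. kconv m g x * \<theta> x)" "multiplier m g \<theta> = (LINT x|lebesgue. kconv m g x * \<theta> x)"
    using kconv_times_integrable[OF m g t] multiplier_kconv[OF m g t] by (simp_all add: lebesgue_integral_borel[OF b])
qed

lemma kconv_cutoff:
  fixes m :: "'n::finite dist"
  assumes m: "tempered m" and g: "schwartz g"
  obtains C N where "0 \<le> C" "\<And>j x. norm (kconv m (\<lambda>t. cutoff j t * g t) x - kconv m g x) \<le> C / real (Suc j) * br x ^ N"
proof -
  obtain C k N where C: "0 \<le> C" "\<And>(g :: 'n cfun) x. schwartz g \<Longrightarrow> norm (kconv m g x) \<le> C * sn k N g * br x ^ N"
    using kconv_bound[OF m] by blast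
  obtain C' where C': "0 \<le> C'" "\<And>(g :: 'n cfun) n. schwartz g \<Longrightarrow>
    sn k N (\<lambda>t. cutoff n t * g t - g t) \<le> C' / real (Suc n) * sn (k + 1) N g"
    using sn_cutoff_diff[of k N] by blast
  show ?thesis
  proof (rule that[of "C * C' * sn (k + 1) N g" N])
    show "0 \<le> C * C' * sn (k + 1) N g" using C C' sn_nonneg[OF g] by simp
    fix j x
    have sc: "schwartz (\<lambda>t. cutoff j t * g t)" by (rule schwartz_cutoff_mult[OF g])
    have "norm (kconv m (\<lambda>t. cutoff j t * g t) x - kconv m g x) \<le> C * sn k N (\<lambda>t. cutoff j t * g t - g t) * br x ^ N"
      unfolding kconv_diff[OF m sc g, symmetric] by (rule C(2)[OF schwartz_diff[OF sc g]])
    also have "\<dots> \<le> C * (C' / real (Suc j) * sn (k + 1) N g) * br x ^ N"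
      by (intro mult_left_mono mult_right_mono C' g C) auto
    finally show "norm (kconv m (\<lambda>t. cutoff j t * g t) x - kconv m g x) \<le> C * C' * sn (k + 1) N g / real (Suc j) * br x ^ N"
      by (simp add: mult_ac)
  qed
qed

lemma kconv_cutoff_tendsto:
  fixes m :: "'n::finite dist"
  assumes m: "tempered m" and g: "schwartz g"
  shows "(\<lambda>j. kconv m (\<lambda>t. cutoff j t * g t) x) \<longlonglongrightarrow> kconv m g x"
proof -
  obtain C N where C: "0 \<le> C" "\<And>j x. norm (kconv m (\<lambda>t. cutoff j t * g t) x - kconv m g x) \<le> C / real (Suc j) * br x ^ N"
    using kconv_cutoff[OF m g] by blast
  show ?thesis
  proof (rule LIM_zero_cancel, rule Lim_null_comparison)
    show "\<forall>\<^sub>F j in sequentially. norm (kconv m (\<lambda>t. cutoff j t * g t) x - kconv m g x) \<le> (C * br x ^ N) * inverse (real (Suc j))"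
      using C(2) by (intro always_eventually allI) (simp add: divide_inverse mult_ac)
    show "(\<lambda>j. (C * br x ^ N) * inverse (real (Suc j))) \<longlonglongrightarrow> 0"
      using tendsto_mult_right_zero[OF LIMSEQ_inverse_real_of_nat] by blast
  qed
qed

definition conv :: "'n dist \<Rightarrow> 'n::finite cfun \<Rightarrow> 'n cfun" where
  "conv u \<psi> x = u (\<lambda>y. \<psi> (x - y))"

lemma conv_tf: "conv u \<psi> x = u (tf (\<lambda>t. \<psi> (- t)) (x, 0))"
  by (simp add: conv_def tf_def[abs_def])

lemma conv_multiplier:
  fixes f \<psi> :: "'n::finite cfun"
  assumes m: "tempered m" and f: "schwartz f" and p: "schwartz \<psi>"
  shows "conv (multiplier m f) \<psi> x = kconv m (cv f \<psi>) x"
proof -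
  have "ft (\<lambda>t. \<psi> (x - t)) (- \<xi>) = ee (- x) \<xi> * ft \<psi> \<xi>" for \<xi>
  proof -
    have "ft (\<lambda>t. (\<lambda>s. \<psi> (- s)) (t - x)) (- \<xi>) = ee (- \<xi>) x * ft (\<lambda>s. \<psi> (- s)) (- \<xi>)"
      by (rule ft_translate[OF schwartz_translate(4)[OF p]])
    then show ?thesis by (simp add: ft_reflect[OF p] ee_swap[of "- \<xi>"] ee_minus ee_swap[of x])
  qed
  then have "(\<lambda>\<xi>. ft f \<xi> * ft (\<lambda>t. \<psi> (x - t)) (- \<xi>)) = tf (ft (cv f \<psi>)) (0, - x)"
    by (simp add: fun_eq_iff tf_def ft_cv[OF f p] mult_ac)
  then show ?thesis
    unfolding conv_def kconv_def multiplier_ft[OF m f schwartz_translate(3)[OF p]] by simp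
qed

text \<open>The order of the distribution \<open>multiplier m f\<close> is determined by \<open>m\<close>; only the constant depends on \<open>f\<close>.\<close>

lemma multiplier_tempered:
  fixes m :: "'n::finite dist"
  assumes m: "tempered m"
  obtains k N where "\<And>f :: 'n cfun. schwartz f \<Longrightarrow> tempered (multiplier m f) \<and>
    (\<exists>C\<ge>0. \<forall>\<theta>. schwartz \<theta> \<longrightarrow> norm (multiplier m f \<theta>) \<le> C * sn k N \<theta>)"
proof -
  obtain C0 N where C0: "0 \<le> C0" "\<And>\<psi>. schwartz \<psi> \<Longrightarrow> norm (m \<psi>) \<le> C0 * sn N N \<psi>" using tempered_bound[OF m] by blast
  obtain C1 where C1: "0 \<le> C1" "\<And>q :: 'n cfun. schwartz q \<Longrightarrow> sn N N (ft q) \<le> C1 * sn (2 * DIM(real^'n) + N) N q"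
    using schwartz_ft(2)[OF schwartz_chi, where k=N and N=N] by blast
  let ?c = "norm ((ft_const TYPE('n))\<^sup>2)" and ?k = "2 * DIM(real^'n) + N"
  show ?thesis
  proof (rule that[of ?k N])
    fix f :: "'n cfun" assume f: "schwartz f"
    have ff: "schwartz (ft f)" by (rule schwartz_ft(1)[OF f])
    define C where "C = ?c * (C0 * (jet_const TYPE('n) N * (sn 0 N (ft f) * C1)))"
    have C: "0 \<le> C" unfolding C_def using C0 C1 sn_nonneg[OF ff] by simp
    have bound: "norm (multiplier m f \<theta>) \<le> C * sn ?k N \<theta>" if t: "schwartz \<theta>" for \<theta>
    proof -
      have tr: "schwartz (\<lambda>\<xi>. ft \<theta> (- \<xi>))" by (intro schwartz_translate schwartz_ft t)
      have S: "schwartz (\<lambda>\<xi>. ft f \<xi> * ft \<theta> (- \<xi>))" by (rule schwartz_mult[OF ff tr])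
      have "sn N N (\<lambda>\<xi>. ft f \<xi> * ft \<theta> (- \<xi>)) \<le> jet_const TYPE('n) N * (sn 0 N (ft f) * sn (N + 0) N (\<lambda>\<xi>. ft \<theta> (- \<xi>)))"
        by (rule sn_leI, rule schwartz_mult_bound[OF schwartz_smooth[OF ff] tr]) (use jet_le_sn[OF ff, where k=0] in simp)
      also have "\<dots> \<le> jet_const TYPE('n) N * (sn 0 N (ft f) * (C1 * sn ?k N \<theta>))"
        using schwartz_affine(2)[OF schwartz_ft(1)[OF t], where s="-1" and b=0 and k=N and N=N] C1(2)[OF t] sn_nonneg[OF ff]
        by (intro mult_left_mono) auto
      finally have "C0 * sn N N (\<lambda>\<xi>. ft f \<xi> * ft \<theta> (- \<xi>)) \<le> C0 * (jet_const TYPE('n) N * (sn 0 N (ft f) * (C1 * sn ?k N \<theta>)))"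
        by (rule mult_left_mono[OF _ C0(1)])
      with C0(2)[OF S] have "norm (m (\<lambda>\<xi>. ft f \<xi> * ft \<theta> (- \<xi>))) \<le> C0 * (jet_const TYPE('n) N * (sn 0 N (ft f) * (C1 * sn ?k N \<theta>)))"
        by (rule order_trans)
      from mult_left_mono[OF this, of ?c] show ?thesis
        unfolding multiplier_ft[OF m f t] by (simp add: C_def norm_mult mult_ac)
    qed
    have "tempered (multiplier m f)"
    proof (rule temperedI[OF _ _ bound C])
      fix \<psi> \<eta> :: "'n cfun" and c assume p: "schwartz \<psi>"
      have Sp: "schwartz (\<lambda>\<xi>. ft f \<xi> * ft \<psi> (- \<xi>))" by (intro schwartz_mult ff schwartz_translate schwartz_ft p)
      { assume e: "schwartz \<eta>"
        have Se: "schwartz (\<lambda>\<xi>. ft f \<xi> * ft \<eta> (- \<xi>))" by (intro schwartz_mult ff schwartz_translate schwartz_ft e)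
        show "multiplier m f (\<lambda>x. \<psi> x + \<eta> x) = multiplier m f \<psi> + multiplier m f \<eta>"
          unfolding multiplier_ft[OF m f p] multiplier_ft[OF m f e] multiplier_ft[OF m f schwartz_add(1)[OF p e]]
          using tempered_add[OF m Sp Se] by (simp add: ft_add[OF p e] distrib_left) }
      show "multiplier m f (\<lambda>x. c * \<psi> x) = c * multiplier m f \<psi>"
        unfolding multiplier_ft[OF m f p] multiplier_ft[OF m f schwartz_cmult(1)[OF p]]
        using tempered_cmult[OF m Sp, of c] by (simp add: ft_cmult mult_ac)
    qed
    then show "tempered (multiplier m f) \<and> (\<exists>C\<ge>0. \<forall>\<theta>. schwartz \<theta> \<longrightarrow> norm (multiplier m f \<theta>) \<le> C * sn ?k N \<theta>)"
      using bound C by blast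
  qed
qed

section \<open>Boundedness on Schwartz functions\<close>

text \<open>For a test function \<open>t\<close> the product in \<open>times_hat\<close> is the distributional product with the Fourier transform of \<open>t\<close>.\<close>

lemma times_hat_test:
  fixes t \<theta> :: "'n::finite cfun"
  assumes m: "tempered m" and w: "represents w (dist_fourier (dist_times m (inv_fourier \<theta>)))" and t: "test_function t"
  shows "(LINT x|lebesgue. t x * w x) = multiplier m t \<theta>" "integrable lebesgue (\<lambda>x. t x * w x)"
  using w t by (auto simp: represents_def multiplier_def dist_inv_fourier_def dist_times_def dist_fourier_def mult.commute)

text \<open>The constant sequence in the first case, and the product for test functions in the second, show that both definitions
  of the multiplier agree with the distributional one.\<close>

lemma orlicz_multiplier_test:
  fixes t :: "'n::finite cfun"
  assumes m: "tempered m" and st1: "star_shaped r \<Phi>\<^sub>1" and st2: "star_shaped r \<Phi>\<^sub>2"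
    and t: "test_function t" and h: "orlicz_multiplier m \<Phi>\<^sub>1 \<Phi>\<^sub>2 t h"
  shows "AE x in lebesgue. kconv m t x = h x"
proof (cases "upper_index \<Phi>\<^sub>1 < \<infinity>")
  case True
  have s: "schwartz t" by (rule test_function_schwartz[OF t])
  have "(\<lambda>n::nat. lnorm \<Phi>\<^sub>1 (\<lambda>x. t x - t x)) \<longlonglongrightarrow> 0" by (simp add: lnorm_0[OF st1])
  then have "\<exists>k. (\<forall>n::nat. k n \<in> orlicz_space \<Phi>\<^sub>2 \<and> represents (k n) (multiplier m t)) \<and> (\<lambda>n. lnorm \<Phi>\<^sub>2 (\<lambda>x. k n x - h x)) \<longlonglongrightarrow> 0"
    using h True t unfolding orlicz_multiplier_def by (auto dest!: spec[of _ "\<lambda>_::nat. t"])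
  then obtain k where k: "\<And>n::nat. k n \<in> orlicz_space \<Phi>\<^sub>2 \<and> represents (k n) (multiplier m t)" "(\<lambda>n. lnorm \<Phi>\<^sub>2 (\<lambda>x. k n x - h x)) \<longlonglongrightarrow> 0"
    by blast
  have eq: "AE x in lebesgue. k n x = kconv m t x" for n
    using represents_unique[OF conjunct2[OF k(1)] kconv_represents[OF m s]] .
  have "lnorm \<Phi>\<^sub>2 (\<lambda>x. k n x - h x) = lnorm \<Phi>\<^sub>2 (\<lambda>x. kconv m t x - h x)" for n
    by (rule lnorm_cong[OF st2]) (use eq[of n] in eventually_elim, simp)
  then have z: "lnorm \<Phi>\<^sub>2 (\<lambda>x. kconv m t x - h x) = 0" using k(2) by (simp add: LIMSEQ_const_iff)
  have hm: "h \<in> borel_measurable lebesgue" using h by (auto simp: orlicz_multiplier_def orlicz_space_def)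
  have "(\<lambda>x. kconv m t x - h x) \<in> borel_measurable lebesgue"
    by (intro borel_measurable_diff borel_imp_lebesgue kconv_borel m s hm)
  from lnorm_zero_AE[OF st2 this z] show ?thesis by eventually_elim simp
next
  case False
  then obtain q where q: "times_hat m t q" "represents h (dist_inv_fourier q)"
    using h unfolding orlicz_multiplier_def by auto
  have "represents h (multiplier m t)"
    unfolding represents_def
  proof (intro conjI allI impI)
    show "h \<in> borel_measurable lebesgue" using q(2) by (simp add: represents_def)
    fix \<theta> :: "'n cfun" assume th: "test_function \<theta>"
    show "integrable lebesgue (\<lambda>x. h x * \<theta> x)" using q(2) th by (simp add: represents_def)
    obtain w where w: "represents w (dist_fourier (dist_times m (inv_fourier \<theta>)))" "q (inv_fourier \<theta>) = (LINT x|lebesgue. t x * w x)"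
      using q(1) schwartz_inv_fourier[OF test_function_schwartz[OF th]] unfolding times_hat_def by blast
    have "(LINT x|lebesgue. h x * \<theta> x) = q (inv_fourier \<theta>)" using q(2) th by (simp add: represents_def dist_inv_fourier_def)
    then show "multiplier m t \<theta> = (LINT x|lebesgue. h x * \<theta> x)" using w(2) times_hat_test(1)[OF m w(1) t] by simp
  qed
  then show ?thesis using represents_unique[OF kconv_represents[OF m test_function_schwartz[OF t]]] by blast
qed

text \<open>Schwartz functions are reached from test functions by cutting off and Fatou's lemma, without any approximation in the
  quasi-norm of \<open>L\<^bsup>\<Phi>\<^sub>1\<^esup>\<close>.\<close>

lemma schwartz_multiplier_bound:
  fixes m :: "'n::finite dist"
  assumes m: "tempered m" and st1: "star_shaped r \<Phi>\<^sub>1" and st2: "star_shaped r \<Phi>\<^sub>2"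
    and bd: "orlicz_multiplier_bounded m \<Phi>\<^sub>1 \<Phi>\<^sub>2"
  obtains C where "0 < C" "\<And>g :: 'n cfun. schwartz g \<Longrightarrow> lnorm \<Phi>\<^sub>2 (kconv m g) \<le> ennreal C * lnorm \<Phi>\<^sub>1 g"
proof -
  obtain C where C: "0 < C" "\<And>g. g \<in> orlicz_space \<Phi>\<^sub>1 \<Longrightarrow> \<exists>h. orlicz_multiplier m \<Phi>\<^sub>1 \<Phi>\<^sub>2 g h \<and> lnorm \<Phi>\<^sub>2 h \<le> ennreal C * lnorm \<Phi>\<^sub>1 g"
    using bd unfolding orlicz_multiplier_bounded_def by blast
  have test: "lnorm \<Phi>\<^sub>2 (kconv m t) \<le> ennreal C * lnorm \<Phi>\<^sub>1 t" if t: "test_function t" for t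
  proof (cases "lnorm \<Phi>\<^sub>1 t < \<infinity>")
    case True
    have "t \<in> orlicz_space \<Phi>\<^sub>1"
      using True borel_imp_lebesgue[OF schwartz_borel[OF test_function_schwartz[OF t]]] by (simp add: orlicz_space_def)
    then obtain h where h: "orlicz_multiplier m \<Phi>\<^sub>1 \<Phi>\<^sub>2 t h" "lnorm \<Phi>\<^sub>2 h \<le> ennreal C * lnorm \<Phi>\<^sub>1 t" using C(2) by blast
    have "lnorm \<Phi>\<^sub>2 (kconv m t) = lnorm \<Phi>\<^sub>2 h"
      by (rule lnorm_cong[OF st2]) (use orlicz_multiplier_test[OF m st1 st2 t h(1)] in eventually_elim, simp)
    then show ?thesis using h(2) by simp
  next
    case False
    then have "lnorm \<Phi>\<^sub>1 t = top" by (simp add: less_top[symmetric])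
    then show ?thesis using C(1) by (simp add: ennreal_mult_top)
  qed
  let ?B = "sn 0 0 (chi :: 'n cfun)"
  have B: "0 < ?B" using norm_le_sn[OF schwartz_chi[where 'n='n], of 0 0 0] by simp
  show ?thesis
  proof (rule that[of "C * ?B"])
    fix g :: "'n cfun" assume g: "schwartz g"
    show "lnorm \<Phi>\<^sub>2 (kconv m g) \<le> ennreal (C * ?B) * lnorm \<Phi>\<^sub>1 g"
    proof (rule lnorm_Fatou[OF st2])
      fix j
      have sc: "schwartz (\<lambda>t. cutoff j t * g t)" by (rule schwartz_cutoff_mult[OF g])
      show "kconv m (\<lambda>t. cutoff j t * g t) \<in> borel_measurable lborel" using kconv_borel[OF m sc] by simp
      have "lnorm \<Phi>\<^sub>2 (kconv m (\<lambda>t. cutoff j t * g t)) \<le> ennreal C * lnorm \<Phi>\<^sub>1 (\<lambda>t. cutoff j t * g t)"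
        by (rule test[OF test_function_mult[OF test_function_cutoff schwartz_smooth[OF g]]])
      also have "\<dots> \<le> ennreal C * (ennreal ?B * lnorm \<Phi>\<^sub>1 g)"
        by (intro mult_left_mono lnorm_mono[OF st1] AE_I2) (auto simp: norm_mult B norm_cutoff_le intro!: mult_right_mono)
      finally show "lnorm \<Phi>\<^sub>2 (kconv m (\<lambda>t. cutoff j t * g t)) \<le> ennreal (C * ?B) * lnorm \<Phi>\<^sub>1 g"
        using C(1) B by (simp add: ennreal_mult mult.assoc)
    qed (rule kconv_cutoff_tendsto[OF m g])
  qed (use C B in simp)
qed

section \<open>Distributions dominated by an envelope\<close>

lemma stft_tf: "stft \<phi> f Y = ft_const TYPE('n) * f (tf (\<lambda>t. cnj (\<phi> t)) Y)" for f :: "'n::finite dist"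
  by (cases Y) (simp add: stft_def tf_def[abs_def] ee_def mult.commute)

lemma ft_const_nonzero: "ft_const TYPE('n::finite) \<noteq> 0"
  by (simp add: ft_const_def)

lemma window_cnj: "window \<phi> \<Longrightarrow> window (\<lambda>t. cnj (\<phi> t))"
  by (auto simp: window_def schwartz_cnj)

lemma stft_continuous:
  fixes f :: "'n::finite dist"
  assumes "tempered f" "schwartz \<phi>" shows "continuous_on UNIV (stft \<phi> f)"
  unfolding stft_tf[abs_def] by (intro continuous_intros tempered_tf_continuous schwartz_cnj assms)

lemma br_pair_power: "br x ^ j * br \<eta> ^ k \<le> br (x, \<eta>) ^ (j + k)"
  unfolding power_add using br_fst[of "(x, \<eta>)"] br_snd[of "(x, \<eta>)"]
  by (intro mult_mono power_mono) (auto simp: br_nonneg)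

lemma powr_phase_weight:
  assumes "0 < r" "real (j + k) / r \<le> real L" "0 \<le> a"
  shows "(a / br (x, \<eta>) ^ L) powr r \<le> a powr r * (1 / (br x ^ j * br \<eta> ^ k))"
proof -
  let ?b = "br (x, \<eta>)"
  have b: "1 \<le> ?b" by (rule br_ge1)
  have "br x ^ j * br \<eta> ^ k \<le> ?b ^ (j + k)" by (rule br_pair_power)
  also have "\<dots> = ?b powr real (j + k)" by (rule powr_realpow[symmetric]) (use b in linarith)
  also have "\<dots> \<le> ?b powr (real L * r)" using assms b by (intro powr_mono) (auto simp: field_simps)
  also have "\<dots> = (?b ^ L) powr r" using b by (simp add: powr_powr[symmetric] powr_realpow)
  finally have "1 / (?b ^ L) powr r \<le> 1 / (br x ^ j * br \<eta> ^ k)"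
    by (intro divide_left_mono mult_pos_pos) (auto simp: zero_less_power)
  then have "a powr r * (1 / (?b ^ L) powr r) \<le> a powr r * (1 / (br x ^ j * br \<eta> ^ k))" by (rule mult_left_mono) simp
  then show ?thesis using b assms(3) by (simp add: powr_divide)
qed

lemma br_pair_zero: "br (0, \<eta>) = br \<eta>"
  by (simp add: br_def norm_Pair)

text \<open>The growth allowed in the phase space estimates below is the same around every point \<open>(x, 0)\<close>;
  only the constant depends on \<open>x\<close>, and it lies in the Orlicz space.  In this form, everything that
  is needed of \<open>f\<close> survives the passage to other windows and to the approximations of \<open>f\<close>.\<close>

proposition orlicz_envelope:
  fixes f :: "'n::finite dist"
  assumes f: "tempered f" and p: "window \<phi>" and st: "star_shaped r \<Phi>" and st': "star_shaped r \<Psi>"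
    and fin: "mixed_norm \<Phi> \<Psi> (stft \<phi> f) < \<infinity>"
  obtains E :: "real^'n \<Rightarrow> real" and L where "E \<in> borel_measurable borel" "\<And>x. 0 \<le> E x" "lnorm \<Phi> (\<lambda>x. complex_of_real (E x)) < \<infinity>"
    "\<And>x Y. norm (f (tf (\<lambda>t. cnj (\<phi> t)) Y)) \<le> E x * br ((x, 0) - Y) ^ L"
proof -
  let ?\<omega> = "\<lambda>t. cnj (\<phi> t)" and ?s = "2 * DIM(real^'n)"
  have w: "window ?\<omega>" and s: "schwartz \<phi>" and ws: "schwartz ?\<omega>" using window_cnj[OF p] p by (auto simp: window_def)
  note r = star_r[OF st]
  obtain C0 N where C0: "0 \<le> C0" "\<And>\<psi>. schwartz \<psi> \<Longrightarrow> norm (f \<psi>) \<le> C0 * sn N N \<psi>"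
    using tempered_bound[OF f] by blast
  define V where "V = stft \<phi> f"
  have V: "V \<in> borel_measurable borel"
    unfolding V_def by (rule borel_measurable_continuous_onI[OF stft_continuous[OF f s]])
  define c where "c = norm (ft_const TYPE('n))"
  have c: "0 < c" using ft_const_nonzero by (simp add: c_def)
  have Vf: "norm (f (tf ?\<omega> Y)) = norm (V Y) / c" for Y
    using c by (simp add: V_def stft_tf norm_mult c_def)
  define D where "D = (\<lambda>x::real^'n. \<integral>\<^sup>+Y. ennreal (norm (V Y) powr r * (1 / (br (x - fst Y) ^ ?s * br (snd Y) ^ ?s))) \<partial>lborel)"
  have Dfin: "D x < \<infinity>" and Dm: "D \<in> borel_measurable borel"
    and DE: "lnorm \<Phi> (\<lambda>x. complex_of_real (enn2real (D x) powr (1 / r))) < \<infinity>" for x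
    using majorant_in_orlicz[OF st st' V fin[folded V_def], of ?s] unfolding D_def by auto
  \<comment> \<open>\<open>br\<^bsup>L r\<^esup>\<close> must dominate the product of the two weights, and \<open>L\<close> the growth of the pairings with \<open>f\<close>\<close>
  obtain L where L: "real (?s + ?s) / r \<le> real L" "real (N + N) \<le> real L"
    using real_arch_simple[of "max (real (?s + ?s) / r) (real (N + N))"] by auto
  obtain C1 where C1: "0 \<le> C1" "\<And>(u :: 'n dist) C0 X d Z. tempered u \<Longrightarrow> (\<And>Y. norm (u (tf ?\<omega> Y)) \<le> C0 * br Y ^ L) \<Longrightarrow> 0 \<le> d \<Longrightarrow>
    (\<integral>\<^sup>+Y. ennreal ((norm (u (tf ?\<omega> Y)) / br (X - Y) ^ L) powr r) \<partial>lborel) \<le> ennreal d \<Longrightarrow>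
    norm (u (tf ?\<omega> Z)) \<le> C1 * d powr (1 / r) * br (X - Z) ^ L"
    by (fact tempered_peetre[OF w r, where L=L])
  define K where "K = C0 * (jet_const TYPE('n) N)\<^sup>2 * sn N N ?\<omega>"
  have growth: "norm (f (tf ?\<omega> Y)) \<le> K * br Y ^ L" for Y
  proof -
    have "norm (f (tf ?\<omega> Y)) \<le> K * br Y ^ (N + N)" unfolding K_def by (rule tempered_tf_growth[OF C0(2) C0(1) ws])
    also have "\<dots> \<le> K * br Y ^ L"
      using L(2) C0(1) sn_nonneg[OF ws] by (intro mult_left_mono br_power_mono) (auto simp: K_def)
    finally show ?thesis .
  qed
  define d where "d x = (1 / c) powr r * enn2real (D x)" for x
  have est: "norm (f (tf ?\<omega> Y)) \<le> C1 * d x powr (1 / r) * br ((x, 0) - Y) ^ L" for x Y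
  proof (rule C1(2)[OF f growth])
    show "0 \<le> d x" by (simp add: d_def)
    have "(\<integral>\<^sup>+Y. ennreal ((norm (f (tf ?\<omega> Y)) / br ((x, 0) - Y) ^ L) powr r) \<partial>lborel)
      \<le> (\<integral>\<^sup>+Y. ennreal ((1 / c) powr r) * ennreal (norm (V Y) powr r * (1 / (br (x - fst Y) ^ ?s * br (snd Y) ^ ?s))) \<partial>lborel)"
    proof (rule nn_integral_mono)
      fix Y :: "'n phase"
      obtain y \<eta> where Y: "Y = (y, \<eta>)" by (cases Y)
      have "(norm (f (tf ?\<omega> Y)) / br ((x, 0) - Y) ^ L) powr r = (1 / c) powr r * (norm (V Y) / br (x - y, - \<eta>) ^ L) powr r"
        using c by (simp add: Vf Y powr_divide powr_mult)
      also have "\<dots> \<le> (1 / c) powr r * (norm (V Y) powr r * (1 / (br (x - y) ^ ?s * br (- \<eta>) ^ ?s)))"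
        using L(1) by (intro mult_left_mono powr_phase_weight r) auto
      also have "\<dots> = (1 / c) powr r * (norm (V Y) powr r * (1 / (br (x - fst Y) ^ ?s * br (snd Y) ^ ?s)))" by (simp add: Y br_def)
      finally show "ennreal ((norm (f (tf ?\<omega> Y)) / br ((x, 0) - Y) ^ L) powr r)
        \<le> ennreal ((1 / c) powr r) * ennreal (norm (V Y) powr r * (1 / (br (x - fst Y) ^ ?s * br (snd Y) ^ ?s)))"
        by (subst ennreal_mult[symmetric]) (auto intro!: ennreal_leI simp: br_nonneg)
    qed
    also have "\<dots> = ennreal ((1 / c) powr r) * D x"
      unfolding D_def
    proof (rule nn_integral_cmult)
      have "(\<lambda>Y::'n phase. 1 / (br (x - fst Y) ^ ?s * br (snd Y) ^ ?s)) \<in> borel_measurable borel"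
        unfolding br_def by (intro borel_measurable_continuous_onI continuous_intros) (auto simp: add_nonneg_eq_0_iff)
      then show "(\<lambda>Y. ennreal (norm (V Y) powr r * (1 / (br (x - fst Y) ^ ?s * br (snd Y) ^ ?s)))) \<in> borel_measurable lborel"
        using V by measurable
    qed
    also have "\<dots> = ennreal (d x)"
    proof -
      have "D x = ennreal (enn2real (D x))" using Dfin[of x] by simp
      then show ?thesis unfolding d_def by (metis ennreal_mult enn2real_nonneg powr_ge_zero)
    qed
    finally show "(\<integral>\<^sup>+Y. ennreal ((norm (f (tf ?\<omega> Y)) / br ((x, 0) - Y) ^ L) powr r) \<partial>lborel) \<le> ennreal (d x)" .
  qed
  define E where "E x = C1 * d x powr (1 / r)" for x
  have Eb: "E x = (C1 / c) * enn2real (D x) powr (1 / r)" for x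
    using r c by (simp add: E_def d_def powr_mult powr_powr)
  show ?thesis
  proof (rule that[of E L])
    show "E \<in> borel_measurable borel" unfolding Eb[abs_def] using Dm by measurable
    show "0 \<le> E x" for x using C1(1) by (simp add: E_def)
    have "lnorm \<Phi> (\<lambda>x. complex_of_real (E x)) \<le> ennreal (C1 / c + 1) * lnorm \<Phi> (\<lambda>x. complex_of_real (enn2real (D x) powr (1 / r)))"
    proof (rule lnorm_mono[OF st])
      show "AE x in lebesgue. norm (complex_of_real (E x)) \<le> (C1 / c + 1) * norm (complex_of_real (enn2real (D x) powr (1 / r)))"
        using C1(1) c by (intro AE_I2) (simp add: Eb norm_mult norm_divide distrib_right del: of_real_mult of_real_divide)
      show "0 < C1 / c + 1" using C1(1) c by (simp add: add_nonneg_pos)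
    qed
    also have "\<dots> < \<infinity>" using DE by (simp add: ennreal_mult_less_top)
    finally show "lnorm \<Phi> (\<lambda>x. complex_of_real (E x)) < \<infinity>" .
  qed (use est E_def in auto)
qed

text \<open>The functions \<open>conv f \<psi>\<close> are the pairings at the points \<open>(x, 0)\<close>, where the envelope reduces to \<open>E x\<close>.\<close>

lemma conv_envelope:
  fixes f :: "'n::finite dist"
  assumes f: "tempered f" and w: "window \<omega>" and e: "\<And>x Y. norm (f (tf \<omega> Y)) \<le> E x * br ((x, 0) - Y) ^ L"
  obtains C k where "0 \<le> C" "\<And>\<psi> x. schwartz \<psi> \<Longrightarrow> norm (conv f \<psi> x) \<le> C * sn k k (\<lambda>t. \<psi> (- t)) * E x"
proof -
  obtain C k where C: "0 \<le> C" "\<And>(u :: 'n dist) (\<theta> :: 'n cfun) B X Z. tempered u \<Longrightarrow> schwartz \<theta> \<Longrightarrow>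
    (\<And>Y. norm (u (tf \<omega> Y)) \<le> B * br (X - Y) ^ L) \<Longrightarrow> norm (u (tf \<theta> Z)) \<le> C * sn k k \<theta> * B * br (X - Z) ^ L"
    by (fact tempered_change_window[OF w])
  have 1: "norm (f (tf \<theta> Z)) \<le> C * sn k k \<theta> * E x * br ((x, 0) - Z) ^ L" if "schwartz \<theta>" for \<theta> x Z
    by (rule C(2)[OF f that e])
  show ?thesis
  proof (rule that[OF C(1)])
    fix \<psi> :: "'n cfun" and x assume "schwartz \<psi>"
    from 1[OF schwartz_translate(4)[OF this], of "(x, 0)" x]
    show "norm (conv f \<psi> x) \<le> C * sn k k (\<lambda>t. \<psi> (- t)) * E x" by (simp add: conv_tf br_def)
  qed
qed

lemma conv_continuous:
  fixes f :: "'n::finite dist"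
  assumes f: "tempered f" and p: "schwartz \<psi>"
  shows "continuous_on UNIV (conv f \<psi>)"
proof -
  have "continuous_on UNIV (\<lambda>x::real^'n. f (tf (\<lambda>t. \<psi> (- t)) (x, 0)))"
    by (rule continuous_on_compose2[OF tempered_tf_continuous[OF f schwartz_translate(4)[OF p]]]) (auto intro!: continuous_intros)
  then show ?thesis by (simp add: conv_tf[abs_def])
qed

lemma tempered_pairing:
  fixes \<theta> :: "'n::finite cfun"
  assumes t: "schwartz \<theta>"
  shows "tempered (\<lambda>\<psi>. LINT t|lborel. \<psi> t * \<theta> t)"
proof (rule temperedI)
  have i: "integrable lborel (\<lambda>t. \<psi> t * \<theta> t)" if "schwartz \<psi>" for \<psi> :: "'n cfun"
    by (rule schwartz_integrable[OF schwartz_mult[OF that t]])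
  show "(LINT t|lborel. (\<psi> t + \<eta> t) * \<theta> t) = (LINT t|lborel. \<psi> t * \<theta> t) + (LINT t|lborel. \<eta> t * \<theta> t)"
    if "schwartz \<psi>" "schwartz \<eta>" for \<psi> \<eta> using i that by (simp add: distrib_right)
  show "(LINT t|lborel. c * \<psi> t * \<theta> t) = c * (LINT t|lborel. \<psi> t * \<theta> t)" if "schwartz \<psi>" for c \<psi>
    by (simp add: mult.assoc)
  show "norm (LINT t|lborel. \<psi> t * \<theta> t) \<le> (LINT t|lborel. norm (\<theta> t)) * sn 0 0 \<psi>" if p: "schwartz \<psi>" for \<psi>
  proof -
    have "norm (LINT t|lborel. \<psi> t * \<theta> t) \<le> (LINT t|lborel. norm (\<theta> t) * sn 0 0 \<psi>)"
      using norm_le_sn[OF p, of _ 0 0] schwartz_integrable[OF t] i[OF p]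
      by (intro norm_integral_le) (auto simp: norm_mult mult.commute[of "norm (\<theta> _)"] intro!: mult_right_mono)
    then show ?thesis by simp
  qed
  show "0 \<le> (LINT t|lborel. norm (\<theta> t))" by simp
qed

text \<open>Cutting off the reproducing formula in phase space approximates \<open>f\<close> by Schwartz functions
  that have the same envelope up to a constant, as the Gabor kernel preserves polynomial growth.\<close>

lemma envelope_approximation:
  fixes f :: "'n::finite dist" and E :: "real^'n \<Rightarrow> real"
  assumes f: "tempered f" and w: "window \<omega>" and e: "\<And>x Y. norm (f (tf \<omega> Y)) \<le> E x * br ((x, 0) - Y) ^ L"
  obtains g :: "nat \<Rightarrow> 'n cfun" and C k where "\<And>n. schwartz (g n)"
    "\<And>\<theta>. schwartz \<theta> \<Longrightarrow> (\<lambda>n. LINT t|lborel. g n t * \<theta> t) \<longlonglongrightarrow> f \<theta>" "0 \<le> C"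
    "\<And>n \<theta> x Z. schwartz \<theta> \<Longrightarrow> norm (LINT t|lborel. g n t * tf \<theta> Z t) \<le> C * sn k k \<theta> * E x * br ((x, 0) - Z) ^ L"
proof -
  have s: "schwartz \<omega>" using w by (simp add: window_def)
  define a where "a n Y = f (tf \<omega> Y) * indicator (cball 0 (real n)) Y" for n and Y :: "'n phase"
  define \<tau> where "\<tau> Y = (fst Y, - snd Y)" for Y :: "'n phase"
  define G where "G = gab_const \<omega>"
  have G: "G \<noteq> 0" unfolding G_def by (rule gab_const_nonzero[OF w])
  define g where "g n t = (1 / G) * (LINT Y|lborel. a n Y * tf (\<lambda>t. cnj (\<omega> t)) (\<tau> Y) t)" for n t
  have fm: "(\<lambda>Y. f (tf \<omega> Y)) \<in> borel_measurable borel" by (rule tempered_tf_borel[OF f s])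
  have am: "a n \<in> borel_measurable borel" for n unfolding a_def by (intro borel_measurable_times fm borel_measurable_indicator) auto
  have dec: "\<exists>C. \<forall>Y. norm (a n Y) \<le> C / br Y ^ M" for n M
  proof (intro exI allI)
    fix Y :: "'n phase"
    have E0: "0 \<le> E 0" using order_trans[OF norm_ge_zero e[of 0 0]] by (simp add: br_def zero_prod_def[symmetric])
    show "norm (a n Y) \<le> E 0 * (1 + real n) ^ (L + M) / br Y ^ M"
    proof (cases "Y \<in> cball 0 (real n)")
      case True
      have b: "br Y \<le> 1 + real n" using True by (simp add: br_def)
      have "norm (a n Y) * br Y ^ M \<le> (E 0 * br Y ^ L) * br Y ^ M"
        using e[of Y 0] True by (intro mult_right_mono) (auto simp: a_def br_nonneg zero_prod_def[symmetric] br_minus)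
      also have "\<dots> \<le> E 0 * (1 + real n) ^ (L + M)"
        unfolding mult.assoc power_add[symmetric] by (intro mult_left_mono power_mono b E0) (simp add: br_nonneg)
      finally show ?thesis by (simp add: pos_le_divide_eq br_pos)
    qed (use E0 in \<open>simp add: a_def br_nonneg\<close>)
  qed
  have \<tau>: "norm (\<tau> Y - \<tau> Y') \<le> norm (Y - Y')" and \<tau>0: "\<tau> 0 = 0" for Y Y'
    by (auto simp: \<tau>_def norm_Pair fst_diff snd_diff norm_minus_commute norm_prod_def dist_norm zero_prod_def)
  have gs: "schwartz (g n)" for n
    unfolding g_def[abs_def] by (intro schwartz_cmult tempered_integral(1)[OF f schwartz_cnj[OF s] \<tau> \<tau>0 am dec])
  have cnj: "tf (\<lambda>t. cnj (\<omega> t)) (\<tau> Y) t = cnj (tf \<omega> Y t)" for Y t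
    by (simp add: tf_def \<tau>_def cnj_ee)
  have pair: "(LINT t|lborel. g n t * \<theta> t) = (1 / G) * (LINT Y|lborel. gab \<omega> \<theta> Y * a n Y)" if t: "schwartz \<theta>" for n \<theta>
  proof -
    have "(LINT t|lborel. (LINT Y|lborel. a n Y * tf (\<lambda>t. cnj (\<omega> t)) (\<tau> Y) t) * \<theta> t) = (LINT Y|lborel. a n Y * gab \<omega> \<theta> Y)"
      using tempered_integral(2)[OF tempered_pairing[OF t] schwartz_cnj[OF s] \<tau> \<tau>0 am dec, of n] by (simp add: cnj gab_def)
    then show ?thesis by (simp add: g_def mult.assoc mult.commute[of _ "gab _ _ _"])
  qed
  obtain C k where C: "0 \<le> C" "\<And>(\<theta> :: 'n cfun) (a :: 'n phase \<Rightarrow> complex) B X Z.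
    schwartz \<theta> \<Longrightarrow> a \<in> borel_measurable borel \<Longrightarrow> (\<And>Y. norm (a Y) \<le> B * br (X - Y) ^ L) \<Longrightarrow>
    integrable lborel (\<lambda>Y. gab \<omega> (tf \<theta> Z) Y * a Y) \<and>
    norm (LINT Y|lborel. gab \<omega> (tf \<theta> Z) Y * a Y) \<le> C * sn k k \<theta> * B * br (X - Z) ^ L"
    by (fact gab_integral_bound[OF s])
  have ae: "norm (a n Y) \<le> norm (f (tf \<omega> Y))" for n Y by (auto simp: a_def norm_mult indicator_def)
  show ?thesis
  proof (rule that[OF gs])
    fix \<theta> :: "'n cfun" assume t: "schwartz \<theta>"
    have "(\<lambda>n. LINT Y|lborel. gab \<omega> \<theta> Y * a n Y) \<longlonglongrightarrow> (LINT Y|lborel. gab \<omega> \<theta> Y * f (tf \<omega> Y))"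
    proof (rule integral_dominated_convergence)
      show "integrable lborel (\<lambda>Y. norm (gab \<omega> \<theta> Y * f (tf \<omega> Y)))"
        using C(2)[OF t fm, of "E 0" "(0, 0)" 0] e by (intro integrable_norm) simp
      show "AE Y in lborel. (\<lambda>n. gab \<omega> \<theta> Y * a n Y) \<longlonglongrightarrow> gab \<omega> \<theta> Y * f (tf \<omega> Y)"
      proof (intro AE_I2 tendsto_mult tendsto_const)
        fix Y :: "'n phase"
        obtain n0 where n0: "norm Y \<le> real n0" using real_arch_simple by blast
        have "\<forall>\<^sub>F n in sequentially. a n Y = f (tf \<omega> Y)"
          using eventually_ge_at_top[of n0] by eventually_elim (use n0 in \<open>simp add: a_def\<close>)
        then show "(\<lambda>n. a n Y) \<longlonglongrightarrow> f (tf \<omega> Y)" by (rule tendsto_eventually)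
      qed
      show "AE Y in lborel. norm (gab \<omega> \<theta> Y * a n Y) \<le> norm (gab \<omega> \<theta> Y * f (tf \<omega> Y))" for n
        using ae by (intro AE_I2) (auto simp: norm_mult intro!: mult_left_mono)
    qed (use gab_borel[OF s t] am fm in measurable)
    then have "(\<lambda>n. (1 / G) * (LINT Y|lborel. gab \<omega> \<theta> Y * a n Y)) \<longlonglongrightarrow> (1 / G) * (G * f \<theta>)"
      unfolding reproducing_formula[OF f s t] G_def by (intro tendsto_intros)
    then show "(\<lambda>n. LINT t|lborel. g n t * \<theta> t) \<longlonglongrightarrow> f \<theta>" using G by (simp add: pair[OF t])
  next
    show "0 \<le> C / norm G" using C(1) by simp
    fix n \<theta> x Z assume t: "schwartz (\<theta> :: 'n cfun)"
    have "norm (LINT Y|lborel. gab \<omega> (tf \<theta> Z) Y * a n Y) \<le> C * sn k k \<theta> * E x * br ((x, 0) - Z) ^ L"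
      using C(2)[OF t am, where X="(x, 0)" and B="E x" and Z=Z] ae e by (meson order_trans)
    then show "norm (LINT t|lborel. g n t * tf \<theta> Z t) \<le> C / norm G * sn k k \<theta> * E x * br ((x, 0) - Z) ^ L"
      by (simp add: pair[OF schwartz_tf(1)[OF t]] norm_mult norm_divide divide_right_mono)
  qed
qed

text \<open>Slices of the short-time Fourier transform are convolutions with the reflected modulated window.\<close>

lemma norm_conv_atom:
  fixes u :: "'n::finite dist"
  assumes u: "tempered u" and s: "schwartz \<omega>"
  shows "norm (conv u (\<lambda>t. tf \<omega> (0, \<eta>) (- t)) x) = norm (u (tf \<omega> (x, \<eta>)))"
proof -
  have "(\<lambda>y. tf \<omega> (0, \<eta>) (- (x - y))) = (\<lambda>y. ee \<eta> (- x) * tf \<omega> (x, \<eta>) y)"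
    by (rule ext) (simp add: tf_def ee_add2[symmetric] mult.assoc[symmetric])
  then show ?thesis unfolding conv_def using tempered_cmult[OF u schwartz_tf(1)[OF s]] by (simp add: norm_mult)
qed

lemma norm_cv_atom: "norm (cv g (\<lambda>t. tf \<omega> (0, \<eta>) (- t)) x) = norm (LINT t|lborel. g t * tf \<omega> (x, \<eta>) t)"
  for g :: "'n::finite cfun"
proof -
  have "g t * tf \<omega> (0, \<eta>) (- (x - t)) = ee \<eta> (- x) * (g t * tf \<omega> (x, \<eta>) t)" for t
    using ee_add2[of \<eta> "- x" t] by (simp add: tf_def)
  then show ?thesis unfolding cv_def by (simp only: integral_mult_right_zero norm_mult norm_ee mult_1)
qed

text \<open>The hypothesis on the multiplier enters here: it controls \<open>m(D)g\<close>, convolved with each atom, in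
  \<open>L\<^bsup>\<Phi>\<^sub>2\<^esup>\<close>, with a constant that grows polynomially in the frequency.  The mean value property
  turns these integral bounds into pointwise ones.\<close>

lemma multiplier_uniformly_tempered:
  fixes E :: "real^'n::finite \<Rightarrow> real"
  assumes m: "tempered m" and st1: "star_shaped r \<Phi>\<^sub>1" and st2: "star_shaped r \<Phi>\<^sub>2" and w: "window \<omega>"
    and A: "0 \<le> A" "\<And>g :: 'n cfun. schwartz g \<Longrightarrow> lnorm \<Phi>\<^sub>2 (kconv m g) \<le> ennreal A * lnorm \<Phi>\<^sub>1 g"
    and E: "\<And>x. 0 \<le> E x" "lnorm \<Phi>\<^sub>1 (\<lambda>x. complex_of_real (E x)) < \<infinity>" and C: "0 \<le> C"
  obtains B k where "0 \<le> B" "\<And>g \<theta>. schwartz g \<Longrightarrow>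
    (\<And>x Z. norm (LINT t|lborel. g t * tf \<omega> Z t) \<le> C * E x * br ((x, 0) - Z) ^ L) \<Longrightarrow>
    schwartz \<theta> \<Longrightarrow> norm (multiplier m g \<theta>) \<le> B * sn k k \<theta>"
proof -
  let ?s = "2 * DIM(real^'n)" and ?W = "wint TYPE(real^'n) (2 * DIM(real^'n))"
  have ws: "schwartz \<omega>" using w by (simp add: window_def)
  note r = star_r[OF st1]
  have W: "0 < ?W" by (rule wint_pos) simp
  obtain T where T: "0 < T" "\<And>(f :: 'n cfun) l (w :: real^'n \<Rightarrow> real). f \<in> borel_measurable lborel \<Longrightarrow> w \<in> borel_measurable lborel \<Longrightarrow>
    0 < l \<Longrightarrow> (\<integral>\<^sup>+x. \<Phi>\<^sub>2 (norm (f x) / l) \<partial>lborel) \<le> 1 \<Longrightarrow> (\<And>x. 0 \<le> w x \<and> w x \<le> 1) \<Longrightarrow>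
    (\<integral>\<^sup>+x. ennreal (norm (f x) powr r * w x) \<partial>lborel) \<le> ennreal ((T * l) powr r) * (1 + (\<integral>\<^sup>+x. ennreal (w x) \<partial>lborel))"
    by (fact lnorm_weighted_bound[OF st2])
  obtain k0 N where kN: "\<And>f :: 'n cfun. schwartz f \<Longrightarrow> tempered (multiplier m f) \<and>
    (\<exists>C\<ge>0. \<forall>\<theta>. schwartz \<theta> \<longrightarrow> norm (multiplier m f \<theta>) \<le> C * sn k0 N \<theta>)"
    by (fact multiplier_tempered[OF m])
  define e where "e = enn2real (lnorm \<Phi>\<^sub>1 (\<lambda>x. complex_of_real (E x)))"
  have e: "lnorm \<Phi>\<^sub>1 (\<lambda>x. complex_of_real (E x)) = ennreal e" "0 \<le> e" using E(2) by (auto simp: e_def)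
  \<comment> \<open>strictly above the quasi-norm of the slice at \<open>\<eta>\<close>, so that the modular at this scale is at most one\<close>
  define l where "l \<eta> = (A * ((C + 1) * e) + 1) * br \<eta> ^ L" for \<eta> :: "real^'n"
  have l0: "0 < l \<eta>" for \<eta> unfolding l_def using A(1) C e(2) by (intro mult_pos_pos add_nonneg_pos) (auto simp: br_pos)
  define d where "d = (T * (A * ((C + 1) * e) + 1)) powr r * (1 + ?W) * ?W"
  \<comment> \<open>room for an integrable weight in both variables besides the growth \<open>br \<eta> ^ L\<close> of the slices\<close>
  obtain L' where L': "real (?s + ?s + L) / r \<le> real L'" "real (k0 + N) \<le> real L'"
    using real_arch_simple[of "max (real (?s + ?s + L) / r) (real (k0 + N))"] by auto
  obtain C1 where C1: "0 \<le> C1" "\<And>(u :: 'n dist) C0 X d Z. tempered u \<Longrightarrow> (\<And>Y. norm (u (tf \<omega> Y)) \<le> C0 * br Y ^ L') \<Longrightarrow> 0 \<le> d \<Longrightarrow>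
    (\<integral>\<^sup>+Y. ennreal ((norm (u (tf \<omega> Y)) / br (X - Y) ^ L') powr r) \<partial>lborel) \<le> ennreal d \<Longrightarrow>
    norm (u (tf \<omega> Z)) \<le> C1 * d powr (1 / r) * br (X - Z) ^ L'"
    by (fact tempered_peetre[OF w r, where L=L'])
  obtain C2 k where C2: "0 \<le> C2" "\<And>(u :: 'n dist) (\<theta> :: 'n cfun) B X Z. tempered u \<Longrightarrow> schwartz \<theta> \<Longrightarrow>
    (\<And>Y. norm (u (tf \<omega> Y)) \<le> B * br (X - Y) ^ L') \<Longrightarrow> norm (u (tf \<theta> Z)) \<le> C2 * sn k k \<theta> * B * br (X - Z) ^ L'"
    by (fact tempered_change_window[OF w])
  have d0: "0 \<le> d" using W by (simp add: d_def)
  have main: "norm (multiplier m g \<theta>) \<le> (C2 * (C1 * d powr (1 / r))) * sn k k \<theta>"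
    if g: "schwartz g" and gb: "\<And>x Z. norm (LINT t|lborel. g t * tf \<omega> Z t) \<le> C * E x * br ((x, 0) - Z) ^ L" and t: "schwartz \<theta>"
    for g \<theta> :: "'n cfun"
  proof -
    define u where "u = multiplier m g"
    have u: "tempered u" using kN[OF g] by (simp add: u_def)
    define atm where "atm \<eta> t = tf \<omega> (0, \<eta>) (- t)" for \<eta> t
    have atm: "schwartz (atm \<eta>)" for \<eta> unfolding atm_def by (intro schwartz_translate(4) schwartz_tf(1) ws)
    define F where "F Y = norm (u (tf \<omega> Y))" for Y
    have F0: "0 \<le> F Y" for Y by (simp add: F_def)
    have Fm: "F \<in> borel_measurable borel"
      unfolding F_def using tempered_tf_borel[OF u ws] by measurable
    have Fk: "F (y, \<eta>) = norm (kconv m (cv g (atm \<eta>)) y)" for y \<eta>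
      unfolding conv_multiplier[OF m g atm, symmetric] u_def[symmetric] F_def atm_def
      by (rule norm_conv_atom[OF u ws, symmetric])
    have slice: "(\<integral>\<^sup>+y. ennreal (F (y, \<eta>) powr r * (1 / br y ^ ?s)) \<partial>lborel) \<le> ennreal ((T * l \<eta>) powr r * (1 + ?W))" for \<eta>
    proof -
      have "lnorm \<Phi>\<^sub>1 (cv g (atm \<eta>)) \<le> ennreal ((C + 1) * br \<eta> ^ L) * lnorm \<Phi>\<^sub>1 (\<lambda>x. complex_of_real (E x))"
      proof (rule lnorm_mono[OF st1 AE_I2])
        fix x
        have "norm (cv g (atm \<eta>) x) \<le> C * E x * br ((x, 0) - (x, \<eta>)) ^ L"
          unfolding atm_def norm_cv_atom by (rule gb)
        also have "\<dots> \<le> (C + 1) * br \<eta> ^ L * E x"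
          using E(1)[of x] by (simp add: br_pair_zero br_minus br_nonneg algebra_simps)
        finally show "norm (cv g (atm \<eta>) x) \<le> (C + 1) * br \<eta> ^ L * norm (complex_of_real (E x))" using E(1) by simp
        show "0 < (C + 1) * br \<eta> ^ L" using C by (intro mult_pos_pos) (auto simp: br_pos)
      qed
      then have "lnorm \<Phi>\<^sub>2 (kconv m (cv g (atm \<eta>))) \<le> ennreal A * (ennreal ((C + 1) * br \<eta> ^ L) * ennreal e)"
        using order_trans[OF A(2)[OF schwartz_cv[OF g atm]] mult_left_mono] e(1) by fastforce
      also have "\<dots> = ennreal (A * ((C + 1) * br \<eta> ^ L * e))"
        using A(1) C e(2) by (simp add: ennreal_mult br_nonneg)
      also have "\<dots> < ennreal (l \<eta>)"
        using br_pos[of \<eta>] l0[of \<eta>] A(1) C e(2) by (intro ennreal_lessI) (auto simp: l_def algebra_simps)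
      finally have "lnorm \<Phi>\<^sub>2 (kconv m (cv g (atm \<eta>))) < ennreal (l \<eta>)" .
      from lnorm_lessD(1)[OF st2 this] have mod: "(\<integral>\<^sup>+x. \<Phi>\<^sub>2 (norm (kconv m (cv g (atm \<eta>)) x) / l \<eta>) \<partial>lborel) \<le> 1" .
      have km: "kconv m (cv g (atm \<eta>)) \<in> borel_measurable lborel"
        using borel_measurable_continuous_onI[OF kconv_continuous[OF m schwartz_cv[OF g atm]]] by simp
      have wm: "(\<lambda>y::real^'n. 1 / br y ^ ?s) \<in> borel_measurable lborel" by measurable
      have "(\<integral>\<^sup>+y. ennreal (norm (kconv m (cv g (atm \<eta>)) y) powr r * (1 / br y ^ ?s)) \<partial>lborel)
        \<le> ennreal ((T * l \<eta>) powr r) * (1 + (\<integral>\<^sup>+x. ennreal (1 / br (x::real^'n) ^ ?s) \<partial>lborel))"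
        by (rule T(2)[OF km wm l0 mod]) (use br_power_ge1[of _ ?s] in \<open>auto simp: br_nonneg divide_le_eq_1\<close>)
      also have "(\<integral>\<^sup>+x. ennreal (1 / br (x::real^'n) ^ ?s) \<partial>lborel) = ennreal ?W"
        using nn_integral_weight_shift[of ?s "0::real^'n"] by (simp add: br_minus)
      also have "ennreal ((T * l \<eta>) powr r) * (1 + ennreal ?W) = ennreal ((T * l \<eta>) powr r * (1 + ?W))"
        using W by (simp add: ennreal_mult)
      finally show ?thesis unfolding Fk .
    qed
    have int: "(\<integral>\<^sup>+Y. ennreal ((F Y / br (0 - Y) ^ L') powr r) \<partial>lborel) \<le> ennreal d"
    proof -
      have "(\<integral>\<^sup>+Y. ennreal ((F Y / br (0 - Y) ^ L') powr r) \<partial>lborel)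
        \<le> (\<integral>\<^sup>+Y. ennreal (F Y powr r * (1 / br (fst Y) ^ ?s)) * ennreal (1 / br (snd Y) ^ (?s + L)) \<partial>lborel)"
      proof (rule nn_integral_mono)
        fix Y :: "'n phase"
        have "(F Y / br Y ^ L') powr r \<le> F Y powr r * (1 / (br (fst Y) ^ ?s * br (snd Y) ^ (?s + L)))"
          using powr_phase_weight[OF r(1) _ F0, of ?s "?s + L" L' Y "fst Y" "snd Y"] L'(1) by (simp add: add.assoc)
        then show "ennreal ((F Y / br (0 - Y) ^ L') powr r) \<le> ennreal (F Y powr r * (1 / br (fst Y) ^ ?s)) * ennreal (1 / br (snd Y) ^ (?s + L))"
          by (subst ennreal_mult[symmetric]) (auto intro!: ennreal_leI simp: br_nonneg br_minus)
      qed
      also have "\<dots> = (\<integral>\<^sup>+\<eta>. \<integral>\<^sup>+y. ennreal (F (y, \<eta>) powr r * (1 / br y ^ ?s)) * ennreal (1 / br \<eta> ^ (?s + L)) \<partial>lborel \<partial>lborel)"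
      proof -
        have "(\<lambda>Y::'n phase. 1 / br (fst Y) ^ ?s) \<in> borel_measurable borel" "(\<lambda>Y::'n phase. 1 / br (snd Y) ^ (?s + L)) \<in> borel_measurable borel"
          unfolding br_def by (intro borel_measurable_continuous_onI continuous_intros; auto simp: add_nonneg_eq_0_iff)+
        then have "(\<lambda>Y. ennreal (F Y powr r * (1 / br (fst Y) ^ ?s)) * ennreal (1 / br (snd Y) ^ (?s + L))) \<in> borel_measurable borel"
          using Fm by measurable
        then have "(\<lambda>Y. ennreal (F Y powr r * (1 / br (fst Y) ^ ?s)) * ennreal (1 / br (snd Y) ^ (?s + L))) \<in> borel_measurable (lborel \<Otimes>\<^sub>M lborel)"
          by (simp add: lborel_prod)
        from lborel_pair.nn_integral_snd[OF this] show ?thesis by (simp add: lborel_prod)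
      qed
      also have "\<dots> \<le> (\<integral>\<^sup>+\<eta>. ennreal ((T * (A * ((C + 1) * e) + 1)) powr r * (1 + ?W)) * ennreal (1 / br (\<eta>::real^'n) ^ ?s) \<partial>lborel)"
      proof (rule nn_integral_mono)
        fix \<eta> :: "real^'n"
        have [measurable]: "(\<lambda>y. F (y, \<eta>)) \<in> borel_measurable borel" by (intro borel_compose_continuous[OF Fm] continuous_intros)
        have "(\<integral>\<^sup>+y. ennreal (F (y, \<eta>) powr r * (1 / br y ^ ?s)) * ennreal (1 / br \<eta> ^ (?s + L)) \<partial>lborel)
          = (\<integral>\<^sup>+y. ennreal (F (y, \<eta>) powr r * (1 / br y ^ ?s)) \<partial>lborel) * ennreal (1 / br \<eta> ^ (?s + L))"
          by (rule nn_integral_multc) measurable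
        also have "\<dots> \<le> ennreal ((T * l \<eta>) powr r * (1 + ?W)) * ennreal (1 / br \<eta> ^ (?s + L))"
          by (intro mult_right_mono slice) simp
        also have "\<dots> \<le> ennreal ((T * (A * ((C + 1) * e) + 1)) powr r * (1 + ?W)) * ennreal (1 / br \<eta> ^ ?s)"
        proof -
          let ?K = "T * (A * ((C + 1) * e) + 1)"
          have K: "0 \<le> ?K" using T(1) A(1) C e(2) by simp
          have "(T * l \<eta>) powr r = ?K powr r * (br \<eta> ^ L) powr r"
            unfolding l_def using K by (simp add: powr_mult[symmetric] br_nonneg mult.assoc)
          also have "\<dots> \<le> ?K powr r * (br \<eta> ^ L)"
            using powr_mono[OF r(2) br_power_ge1[of \<eta> L]] br_power_ge1[of \<eta> L] by (intro mult_left_mono) auto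
          finally have "(T * l \<eta>) powr r * (1 + ?W) * (1 / br \<eta> ^ (?s + L)) \<le> (?K powr r * (br \<eta> ^ L)) * (1 + ?W) * (1 / br \<eta> ^ (?s + L))"
            using W by (intro mult_right_mono) (auto simp: br_nonneg)
          also have "\<dots> = ?K powr r * (1 + ?W) * (1 / br \<eta> ^ ?s)"
            using br_pos[of \<eta>] by (simp add: power_add field_simps)
          finally show ?thesis using W by (subst (1 2) ennreal_mult[symmetric]) (auto intro!: ennreal_leI simp: br_nonneg)
        qed
        finally show "(\<integral>\<^sup>+y. ennreal (F (y, \<eta>) powr r * (1 / br y ^ ?s)) * ennreal (1 / br \<eta> ^ (?s + L)) \<partial>lborel)
          \<le> ennreal ((T * (A * ((C + 1) * e) + 1)) powr r * (1 + ?W)) * ennreal (1 / br \<eta> ^ ?s)" .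
      qed
      also have "\<dots> = ennreal ((T * (A * ((C + 1) * e) + 1)) powr r * (1 + ?W)) * ennreal ?W"
      proof -
        have "(\<integral>\<^sup>+x. ennreal (1 / br (x::real^'n) ^ ?s) \<partial>lborel) = ennreal ?W"
          using nn_integral_weight_shift[of ?s "0::real^'n"] by (simp add: br_minus)
        then show ?thesis by (subst nn_integral_cmult) auto
      qed
      also have "\<dots> = ennreal d" unfolding d_def using W by (subst ennreal_mult[symmetric]) auto
      finally show ?thesis .
    qed
    obtain K where K: "0 \<le> K" "\<And>\<theta>. schwartz \<theta> \<Longrightarrow> norm (u \<theta>) \<le> K * sn k0 N \<theta>" using kN[OF g] unfolding u_def by blast
    have growth: "norm (u (tf \<omega> Y)) \<le> (K * (jet_const TYPE('n) N)\<^sup>2 * sn k0 N \<omega>) * br Y ^ L'" for Y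
    proof -
      have "norm (u (tf \<omega> Y)) \<le> (K * (jet_const TYPE('n) N)\<^sup>2 * sn k0 N \<omega>) * br Y ^ (k0 + N)"
        by (rule tempered_tf_growth[OF K(2) K(1) ws])
      also have "\<dots> \<le> (K * (jet_const TYPE('n) N)\<^sup>2 * sn k0 N \<omega>) * br Y ^ L'"
        using L'(2) K(1) sn_nonneg[OF ws] by (intro mult_left_mono br_power_mono) auto
      finally show ?thesis .
    qed
    have "norm (u (tf \<omega> Y)) \<le> C1 * d powr (1 / r) * br (0 - Y) ^ L'" for Y
      by (rule C1(2)[OF u growth d0]) (use int in \<open>simp add: F_def\<close>)
    from C2(2)[OF u t this, where Z=0] show ?thesis by (simp add: u_def br_def mult_ac)
  qed
  show ?thesis
    by (rule that[OF _ main]) (use C1(1) C2(1) in auto)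
qed

section \<open>The multiplier on the modulation space\<close>

section \<open>Identifying limits of multipliers\<close>

text \<open>Convergence in the quasi-norm implies convergence in measure; on the support of \<open>\<theta>\<close> the functions \<open>k n\<close> are uniformly bounded, hence so
  is \<open>h\<close>, and the set where \<open>k n\<close> and \<open>h\<close> are not close contributes little to the integral.\<close>

lemma pairing_limit_in_measure:
  fixes h \<theta> :: "'a::euclidean_space \<Rightarrow> complex" and k :: "nat \<Rightarrow> 'a \<Rightarrow> complex"
  assumes st: "star_shaped r \<Phi>" and km[measurable]: "\<And>n. k n \<in> borel_measurable lebesgue" and hm[measurable]: "h \<in> borel_measurable lebesgue"
    and lim: "(\<lambda>n. lnorm \<Phi> (\<lambda>x. k n x - h x)) \<longlonglongrightarrow> 0" and ti: "integrable lebesgue \<theta>" and M: "\<And>x. norm (\<theta> x) \<le> M"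
    and bd: "\<And>n x. \<theta> x \<noteq> 0 \<Longrightarrow> norm (k n x) \<le> B" and B: "0 \<le> B"
  shows "integrable lebesgue (\<lambda>x. h x * \<theta> x)" "(\<lambda>n. LINT x|lebesgue. k n x * \<theta> x) \<longlonglongrightarrow> (LINT x|lebesgue. h x * \<theta> x)"
proof -
  have tm[measurable]: "\<theta> \<in> borel_measurable lebesgue" using ti by simp
  have M0: "0 \<le> M" using M[of undefined] norm_ge_zero order_trans by blast
  let ?A = "\<lambda>\<delta> n. {x. \<delta> \<le> norm (k n x - h x)}"
  have meas: "(\<lambda>n. emeasure lebesgue (?A \<delta> n)) \<longlonglongrightarrow> 0" if "0 < \<delta>" for \<delta>
    by (rule lnorm_in_measure[OF st _ lim that]) measurable
  have Am: "?A \<delta> n \<in> sets lebesgue" for \<delta> n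
  proof -
    have "{x \<in> space lebesgue. \<delta> \<le> norm (k n x - h x)} \<in> sets lebesgue" by measurable
    then show ?thesis by simp
  qed
  let ?S = "{x. \<theta> x \<noteq> 0 \<and> B + 1 < norm (h x)}"
  have Sm: "?S \<in> sets lebesgue"
  proof -
    have "{x \<in> space lebesgue. \<theta> x \<noteq> 0 \<and> B + 1 < norm (h x)} \<in> sets lebesgue" by measurable
    then show ?thesis by simp
  qed
  have "emeasure lebesgue ?S \<le> emeasure lebesgue (?A 1 n)" for n
  proof (rule emeasure_mono[OF _ Am], safe)
    fix x assume "\<theta> x \<noteq> 0" "B + 1 < norm (h x)"
    then show "1 \<le> norm (k n x - h x)" using bd[of x n] norm_triangle_ineq2[of "h x" "k n x"] by (simp add: norm_minus_commute)
  qed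
  then have "emeasure lebesgue ?S \<le> 0" by (intro LIMSEQ_le_const[OF meas[of 1]]) auto
  then have null: "AE x in lebesgue. x \<notin> ?S" using Sm by (intro AE_not_in) (simp add: null_sets_def)
  show hi: "integrable lebesgue (\<lambda>x. h x * \<theta> x)"
  proof (rule Bochner_Integration.integrable_bound)
    show "integrable lebesgue (\<lambda>x. (B + 1) * norm (\<theta> x))" using ti by simp
    show "AE x in lebesgue. norm (h x * \<theta> x) \<le> norm ((B + 1) * norm (\<theta> x))"
    proof (use null in eventually_elim)
      case (elim x)
      show ?case by (cases "\<theta> x = 0") (use elim B in \<open>auto simp: norm_mult intro!: mult_right_mono\<close>)
    qed
  qed measurable
  have ki: "integrable lebesgue (\<lambda>x. k n x * \<theta> x)" for n
  proof (rule Bochner_Integration.integrable_bound)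
    show "integrable lebesgue (\<lambda>x. B * norm (\<theta> x))" using ti by simp
    show "AE x in lebesgue. norm (k n x * \<theta> x) \<le> norm (B * norm (\<theta> x))"
    proof (rule AE_I2)
      fix x
      show "norm (k n x * \<theta> x) \<le> norm (B * norm (\<theta> x))"
        by (cases "\<theta> x = 0") (use B bd[of x n] in \<open>auto simp: norm_mult intro!: mult_right_mono\<close>)
    qed
  qed measurable
  define T where "T = (LINT x|lebesgue. norm (\<theta> x))"
  have T0: "0 \<le> T" by (simp add: T_def)
  have T: "(\<integral>\<^sup>+x. ennreal (norm (\<theta> x)) \<partial>lebesgue) = ennreal T"
    unfolding T_def by (rule nn_integral_eq_integral) (use ti in auto)
  define K where "K = (2 * B + 1) * M"
  have K0: "0 \<le> K" using B M0 by (simp add: K_def)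
  have est: "ennreal (norm ((LINT x|lebesgue. k n x * \<theta> x) - (LINT x|lebesgue. h x * \<theta> x))) \<le> ennreal (\<delta> * T) + ennreal K * emeasure lebesgue (?A \<delta> n)"
    if d: "0 < \<delta>" for n \<delta>
  proof -
    have "(LINT x|lebesgue. k n x * \<theta> x) - (LINT x|lebesgue. h x * \<theta> x) = (LINT x|lebesgue. (k n x - h x) * \<theta> x)"
      using ki hi by (simp add: left_diff_distrib)
    then have "ennreal (norm ((LINT x|lebesgue. k n x * \<theta> x) - (LINT x|lebesgue. h x * \<theta> x))) \<le> (\<integral>\<^sup>+x. ennreal (norm ((k n x - h x) * \<theta> x)) \<partial>lebesgue)"
      by (simp only: norm_integral_le_nn_integral)
    also have "\<dots> \<le> (\<integral>\<^sup>+x. ennreal \<delta> * ennreal (norm (\<theta> x)) + ennreal K * indicator (?A \<delta> n) x \<partial>lebesgue)"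
    proof (intro nn_integral_mono_AE, use null in eventually_elim)
      case (elim x)
      show ?case
      proof (cases "x \<in> ?A \<delta> n")
        case True
        have "norm ((k n x - h x) * \<theta> x) \<le> K"
        proof (cases "\<theta> x = 0")
          case False
          then have "norm (k n x - h x) \<le> 2 * B + 1" using elim bd[of x n] norm_triangle_ineq4[of "k n x" "h x"] by auto
          then show ?thesis unfolding norm_mult K_def using M B by (intro mult_mono) auto
        qed (use K0 in simp)
        then show ?thesis using True by (simp add: add_increasing ennreal_leI)
      next
        case False
        then have "norm ((k n x - h x) * \<theta> x) \<le> \<delta> * norm (\<theta> x)" by (auto simp: norm_mult intro!: mult_right_mono)
        then show ?thesis using False d by (simp add: ennreal_mult[symmetric] ennreal_leI)
      qed
    qed
    also have "\<dots> = ennreal (\<delta> * T) + ennreal K * emeasure lebesgue (?A \<delta> n)"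
      using Am d T0 by (subst nn_integral_add) (auto simp: nn_integral_cmult nn_integral_cmult_indicator T ennreal_mult intro!: borel_measurable_indicator)
    finally show ?thesis .
  qed
  show "(\<lambda>n. LINT x|lebesgue. k n x * \<theta> x) \<longlonglongrightarrow> (LINT x|lebesgue. h x * \<theta> x)"
  proof (rule tendstoI)
    fix e :: real assume e: "0 < e"
    define \<delta> where "\<delta> = e / (2 * (T + 1))"
    define a where "a = e / (2 * (K + 1))"
    have d: "0 < \<delta>" "0 < a" using e T0 K0 by (auto simp: \<delta>_def a_def)
    have *: "\<delta> * T < e / 2" "K * a < e / 2"
      using e T0 K0 by (auto simp: \<delta>_def a_def field_simps)
    have "\<forall>\<^sub>F n in sequentially. emeasure lebesgue (?A \<delta> n) < ennreal a" by (rule order_tendstoD(2)[OF meas[OF d(1)]]) (use d in simp)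
    then show "\<forall>\<^sub>F n in sequentially. dist (LINT x|lebesgue. k n x * \<theta> x) (LINT x|lebesgue. h x * \<theta> x) < e"
    proof eventually_elim
      case (elim n)
      have "ennreal (norm ((LINT x|lebesgue. k n x * \<theta> x) - (LINT x|lebesgue. h x * \<theta> x))) \<le> ennreal (\<delta> * T) + ennreal K * ennreal a"
        by (rule order_trans[OF est[OF d(1)]]) (use elim in \<open>auto intro!: add_left_mono mult_left_mono\<close>)
      also have "\<dots> = ennreal (\<delta> * T + K * a)" using d T0 K0 by (simp add: ennreal_mult)
      finally have "norm ((LINT x|lebesgue. k n x * \<theta> x) - (LINT x|lebesgue. h x * \<theta> x)) \<le> \<delta> * T + K * a"
        by (rule iffD1[OF ennreal_le_iff, rotated]) (use d T0 K0 in simp)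
      then show ?case using * unfolding dist_norm by linarith
    qed
  qed
qed

lemma test_function_support:
  assumes "test_function \<theta>" obtains R where "1 \<le> R" "\<And>x. \<theta> x \<noteq> 0 \<Longrightarrow> br x \<le> R"
proof -
  have "bounded (closure {x. \<theta> x \<noteq> 0})" using assms by (simp add: test_function_def compact_imp_bounded)
  then have "bounded {x. \<theta> x \<noteq> 0}" using bounded_subset closure_subset by blast
  then obtain R0 where "\<And>x. \<theta> x \<noteq> 0 \<Longrightarrow> norm x \<le> R0" by (auto simp: bounded_iff)
  then show ?thesis using that[of "1 + max 0 R0"] by (fastforce simp: br_def)
qed

context
  fixes m :: "'n::finite dist" and r and \<Phi>\<^sub>1 \<Phi>\<^sub>2 and E :: "real^'n \<Rightarrow> real"
  assumes m: "tempered m" and st1: "star_shaped r \<Phi>\<^sub>1" and st2: "star_shaped r \<Phi>\<^sub>2"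
    and q1: "upper_index \<Phi>\<^sub>1 < \<infinity> \<Longrightarrow> quasi_young_function \<Phi>\<^sub>1" and ex: "\<And>g. g \<in> orlicz_space \<Phi>\<^sub>1 \<Longrightarrow> \<exists>h. orlicz_multiplier m \<Phi>\<^sub>1 \<Phi>\<^sub>2 g h"
    and E: "E \<in> borel_measurable borel" "\<And>x. 0 \<le> E x" "lnorm \<Phi>\<^sub>1 (\<lambda>x. complex_of_real (E x)) < \<infinity>"
begin

text \<open>Both ways of defining \<open>m(D)G\<close> are reached by the same test functions.  If the upper index is
  finite, dominated convergence holds in the Orlicz space, so that they approximate \<open>G\<close> in norm, and
  norm convergence of the images implies convergence in measure.  Otherwise \<open>m(D)G\<close> is tested by
  integrating \<open>G\<close> against a function \<open>w\<close>, and \<open>E * w\<close> is integrable because \<open>m(D)E\<close> is defined as well.\<close>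

lemma test_multiplier_limit:
  fixes t :: "nat \<Rightarrow> 'n::finite cfun"
  assumes K: "0 \<le> K" and t: "\<And>n. test_function (t n)" and tE: "\<And>n x. norm (t n x) \<le> K * E x" and tG: "\<And>x. (\<lambda>n. t n x) \<longlonglongrightarrow> G x"
    and h: "orlicz_multiplier m \<Phi>\<^sub>1 \<Phi>\<^sub>2 G h" and th: "test_function \<theta>" and B: "0 \<le> B" "\<And>n x. \<theta> x \<noteq> 0 \<Longrightarrow> norm (kconv m (t n) x) \<le> B"
  shows "integrable lebesgue (\<lambda>x. h x * \<theta> x)" "(\<lambda>n. LINT x|lborel. kconv m (t n) x * \<theta> x) \<longlonglongrightarrow> (LINT x|lebesgue. h x * \<theta> x)"
proof -
  have ts: "schwartz (t n)" for n by (rule test_function_schwartz[OF t])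
  have s: "schwartz \<theta>" by (rule test_function_schwartz[OF th])
  have tm: "t n \<in> borel_measurable borel" for n by (rule schwartz_borel[OF ts])
  have Gm: "G \<in> borel_measurable borel" by (rule borel_measurable_LIMSEQ_metric[OF tm tG])
  have GE: "norm (G x) \<le> K * E x" for x
    by (rule LIMSEQ_le_const2[OF tendsto_norm[OF tG]]) (use tE in auto)
  have km: "kconv m (t n) \<in> borel_measurable borel" for n by (rule kconv_borel[OF m ts])
  have hm: "h \<in> borel_measurable lebesgue" using h by (auto simp: orlicz_multiplier_def orlicz_space_def)
  have leb: "(LINT x|lborel. kconv m (t n) x * \<theta> x) = (LINT x|lebesgue. kconv m (t n) x * \<theta> x)" for n
    by (rule lebesgue_integral_borel(1)[symmetric]) (use km schwartz_borel[OF s] in measurable)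
  have "integrable lebesgue (\<lambda>x. h x * \<theta> x) \<and> (\<lambda>n. LINT x|lebesgue. kconv m (t n) x * \<theta> x) \<longlonglongrightarrow> (LINT x|lebesgue. h x * \<theta> x)"
  proof (cases "upper_index \<Phi>\<^sub>1 < \<infinity>")
    case True
    have "(\<lambda>n. lnorm \<Phi>\<^sub>1 (\<lambda>x. t n x - G x)) \<longlonglongrightarrow> 0"
    proof (rule lnorm_dominated_convergence[OF st1 q1[OF True] True, where g="\<lambda>x. complex_of_real (2 * K * E x)"])
      have "lnorm \<Phi>\<^sub>1 (\<lambda>x. complex_of_real (2 * K * E x)) \<le> ennreal (2 * K + 1) * lnorm \<Phi>\<^sub>1 (\<lambda>x. complex_of_real (E x))"
        using K E(2) by (intro lnorm_mono[OF st1] AE_I2) (auto simp: norm_mult distrib_right)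
      also have "\<dots> < \<infinity>" using E(3) by (simp add: ennreal_mult_less_top)
      finally show "lnorm \<Phi>\<^sub>1 (\<lambda>x. complex_of_real (2 * K * E x)) < \<infinity>" .
      show "(\<lambda>x. t n x - G x) \<in> borel_measurable lborel" for n using tm Gm by measurable
      show "(\<lambda>x. complex_of_real (2 * K * E x)) \<in> borel_measurable lborel" using E(1) by measurable
      show "norm (t n x - G x) \<le> norm (complex_of_real (2 * K * E x))" for n x
        using norm_triangle_ineq4[of "t n x" "G x"] tE[of n x] GE[of x] K E(2)[of x] by (simp add: norm_mult)
      show "(\<lambda>n. t n x - G x) \<longlonglongrightarrow> 0" for x using tG[of x] by (simp add: LIM_zero)
    qed
    then have "\<exists>k. (\<forall>n. k n \<in> orlicz_space \<Phi>\<^sub>2 \<and> represents (k n) (multiplier m (t n))) \<and> (\<lambda>n. lnorm \<Phi>\<^sub>2 (\<lambda>x. k n x - h x)) \<longlonglongrightarrow> 0"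
      using h t True unfolding orlicz_multiplier_def by (auto dest!: spec[of _ t])
    then obtain k where k: "\<And>n. represents (k n) (multiplier m (t n))" "(\<lambda>n. lnorm \<Phi>\<^sub>2 (\<lambda>x. k n x - h x)) \<longlonglongrightarrow> 0"
      by blast
    have "lnorm \<Phi>\<^sub>2 (\<lambda>x. k n x - h x) = lnorm \<Phi>\<^sub>2 (\<lambda>x. kconv m (t n) x - h x)" for n
      by (rule lnorm_cong[OF st2]) (use represents_unique[OF k(1) kconv_represents[OF m ts], of n] in eventually_elim, simp)
    then have "(\<lambda>n. lnorm \<Phi>\<^sub>2 (\<lambda>x. kconv m (t n) x - h x)) \<longlonglongrightarrow> 0" using k(2) by simp
    moreover have "integrable lebesgue \<theta>" using lebesgue_integral_borel(2)[OF schwartz_borel[OF s]] schwartz_integrable[OF s] by simp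
    moreover have "norm (\<theta> x) \<le> sn 0 0 \<theta>" for x using norm_le_sn[OF s, of x 0] by simp
    ultimately show ?thesis
      using pairing_limit_in_measure[OF st2 borel_imp_lebesgue[OF km] hm, where \<theta>=\<theta> and M="sn 0 0 \<theta>" and B=B] B by auto
  next
    case False
    have inv: "schwartz (inv_fourier \<theta>)" by (rule schwartz_inv_fourier[OF s])
    obtain q where q: "times_hat m G q" "represents h (dist_inv_fourier q)"
      using h False unfolding orlicz_multiplier_def by auto
    obtain w where w: "represents w (dist_fourier (dist_times m (inv_fourier \<theta>)))" "q (inv_fourier \<theta>) = (LINT x|lebesgue. G x * w x)"
      using q(1) inv unfolding times_hat_def by blast
    have "(\<lambda>x. complex_of_real (E x)) \<in> orlicz_space \<Phi>\<^sub>1"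
    proof -
      have "(\<lambda>x. complex_of_real (E x)) \<in> borel_measurable borel" using E(1) by measurable
      then show ?thesis using E(3) borel_imp_lebesgue by (auto simp: orlicz_space_def)
    qed
    then obtain hE where "orlicz_multiplier m \<Phi>\<^sub>1 \<Phi>\<^sub>2 (\<lambda>x. complex_of_real (E x)) hE" using ex by blast
    then obtain qE where "times_hat m (\<lambda>x. complex_of_real (E x)) qE" using False unfolding orlicz_multiplier_def by auto
    then obtain w' where w': "represents w' (dist_fourier (dist_times m (inv_fourier \<theta>)))" "integrable lebesgue (\<lambda>x. complex_of_real (E x) * w' x)"
      using inv unfolding times_hat_def by blast
    have wm: "w \<in> borel_measurable lebesgue" "w' \<in> borel_measurable lebesgue" using w(1) w'(1) by (auto simp: represents_def)
    have Gl: "G \<in> borel_measurable lebesgue" "t n \<in> borel_measurable lebesgue" for n by (intro borel_imp_lebesgue Gm tm)+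
    have "AE x in lebesgue. w x = w' x" by (rule represents_unique[OF w(1) w'(1)])
    then have bnd: "AE x in lebesgue. norm (t n x * w x) \<le> K * norm (complex_of_real (E x) * w' x)" for n
      by eventually_elim (use tE E(2) in \<open>simp add: norm_mult mult.assoc[symmetric] mult_right_mono\<close>)
    have "(\<lambda>n. LINT x|lebesgue. t n x * w x) \<longlonglongrightarrow> (LINT x|lebesgue. G x * w x)"
    proof (rule integral_dominated_convergence[where w="\<lambda>x. K * norm (complex_of_real (E x) * w' x)"])
      show "AE x in lebesgue. (\<lambda>n. t n x * w x) \<longlonglongrightarrow> G x * w x" by (intro AE_I2 tendsto_intros tG)
      show "integrable lebesgue (\<lambda>x. K * norm (complex_of_real (E x) * w' x))" by (intro integrable_mult_right integrable_norm w'(2))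
    qed (use bnd in \<open>auto intro!: borel_measurable_times Gl wm\<close>)
    moreover have "(LINT x|lebesgue. t n x * w x) = (LINT x|lebesgue. kconv m (t n) x * \<theta> x)" for n
      unfolding times_hat_test(1)[OF m w(1) t] multiplier_kconv[OF m ts s] by (rule leb)
    moreover have "(LINT x|lebesgue. G x * w x) = (LINT x|lebesgue. h x * \<theta> x)" "integrable lebesgue (\<lambda>x. h x * \<theta> x)"
      using q(2) th w(2) by (auto simp: represents_def dist_inv_fourier_def)
    ultimately show ?thesis by simp
  qed
  then show "integrable lebesgue (\<lambda>x. h x * \<theta> x)" "(\<lambda>n. LINT x|lborel. kconv m (t n) x * \<theta> x) \<longlonglongrightarrow> (LINT x|lebesgue. h x * \<theta> x)"
    unfolding leb by auto
qed

text \<open>The sequence is replaced by one of test functions with the same limit and the same kind of majorant.\<close>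

lemma schwartz_multiplier_limit:
  fixes s :: "nat \<Rightarrow> 'n::finite cfun"
  assumes K: "0 \<le> K" and s: "\<And>n. schwartz (s n)" and sE: "\<And>n x. norm (s n x) \<le> K * E x" and sG: "\<And>x. (\<lambda>n. s n x) \<longlonglongrightarrow> G x"
    and h: "orlicz_multiplier m \<Phi>\<^sub>1 \<Phi>\<^sub>2 G h" and th: "test_function \<theta>" and B: "0 \<le> B" "\<And>n x. \<theta> x \<noteq> 0 \<Longrightarrow> norm (kconv m (s n) x) \<le> B"
  shows "integrable lebesgue (\<lambda>x. h x * \<theta> x)" "(\<lambda>n. LINT x|lborel. kconv m (s n) x * \<theta> x) \<longlonglongrightarrow> (LINT x|lebesgue. h x * \<theta> x)"
proof -
  have ths: "schwartz \<theta>" by (rule test_function_schwartz[OF th])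
  obtain R where R: "1 \<le> R" "\<And>x. \<theta> x \<noteq> 0 \<Longrightarrow> br x \<le> R" using test_function_support[OF th] by blast
  \<comment> \<open>the cutoffs may depend on \<open>\<theta>\<close>: only their effect on its support matters\<close>
  have "\<exists>j. n \<le> j \<and> (\<forall>x. \<theta> x \<noteq> 0 \<longrightarrow> norm (kconv m (\<lambda>t. cutoff j t * s n t) x - kconv m (s n) x) \<le> 1 / real (Suc n))" for n
  proof -
    obtain C N where C: "0 \<le> C" "\<And>j x. norm (kconv m (\<lambda>t. cutoff j t * s n t) x - kconv m (s n) x) \<le> C / real (Suc j) * br x ^ N"
      using kconv_cutoff[OF m s] by blast
    obtain j where j: "C * R ^ N * real (Suc n) \<le> real j" using real_arch_simple by blast
    show ?thesis
    proof (intro exI conjI allI impI)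
      fix x assume x: "\<theta> x \<noteq> 0"
      have "norm (kconv m (\<lambda>t. cutoff (n + j) t * s n t) x - kconv m (s n) x) \<le> C / real (Suc (n + j)) * br x ^ N" by (rule C(2))
      also have "\<dots> \<le> C / real (Suc (n + j)) * R ^ N"
        using C(1) R(2)[OF x] by (intro mult_left_mono power_mono) (auto simp: br_nonneg)
      also have "\<dots> \<le> 1 / real (Suc n)" using j by (simp add: field_simps)
      finally show "norm (kconv m (\<lambda>t. cutoff (n + j) t * s n t) x - kconv m (s n) x) \<le> 1 / real (Suc n)" .
    qed simp
  qed
  then obtain j where j: "\<And>n. n \<le> j n" "\<And>n x. \<theta> x \<noteq> 0 \<Longrightarrow> norm (kconv m (\<lambda>t. cutoff (j n) t * s n t) x - kconv m (s n) x) \<le> 1 / real (Suc n)"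
    by metis
  define t where "t n = (\<lambda>x. cutoff (j n) x * s n x)" for n
  have t: "test_function (t n)" for n
    unfolding t_def by (rule test_function_mult[OF test_function_cutoff schwartz_smooth[OF s]])
  have ts: "schwartz (t n)" for n by (rule test_function_schwartz[OF t])
  let ?b = "sn 0 0 (chi :: 'n cfun)"
  have b0: "0 \<le> ?b" by (rule sn_nonneg[OF schwartz_chi])
  have tE: "norm (t n x) \<le> (?b * K) * E x" for n x
    unfolding t_def norm_mult mult.assoc by (intro mult_mono norm_cutoff_le sE b0) simp
  have jlim: "filterlim j at_top sequentially"
    by (rule filterlim_at_top_mono[OF filterlim_ident]) (use j(1) in simp)
  have tG: "(\<lambda>n. t n x) \<longlonglongrightarrow> G x" for x
    using tendsto_mult[OF filterlim_compose[OF cutoff_tendsto jlim] sG, of x x] by (simp add: t_def)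
  have kd: "norm (kconv m (t n) x - kconv m (s n) x) \<le> 1 / real (Suc n)" if "\<theta> x \<noteq> 0" for n x
    using j(2)[OF that] by (simp add: t_def)
  have kB: "norm (kconv m (t n) x) \<le> B + 1" if "\<theta> x \<noteq> 0" for n x
  proof -
    have "1 / real (Suc n) \<le> 1" by simp
    then show ?thesis using kd[OF that, of n] B(2)[OF that, of n] norm_triangle_ineq2[of "kconv m (t n) x" "kconv m (s n) x"] by linarith
  qed
  have K': "0 \<le> ?b * K" and B': "0 \<le> B + 1" using b0 K B(1) by auto
  show "integrable lebesgue (\<lambda>x. h x * \<theta> x)" by (rule test_multiplier_limit(1)[OF K' t tE tG h th B' kB])
  have 1: "(\<lambda>n. LINT x|lborel. kconv m (t n) x * \<theta> x) \<longlonglongrightarrow> (LINT x|lebesgue. h x * \<theta> x)"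
    by (rule test_multiplier_limit(2)[OF K' t tE tG h th B' kB])
  have 2: "(\<lambda>n. (LINT x|lborel. kconv m (s n) x * \<theta> x) - (LINT x|lborel. kconv m (t n) x * \<theta> x)) \<longlonglongrightarrow> 0"
  proof (rule Lim_null_comparison)
    show "\<forall>\<^sub>F n in sequentially. norm ((LINT x|lborel. kconv m (s n) x * \<theta> x) - (LINT x|lborel. kconv m (t n) x * \<theta> x)) \<le> (1 / real (Suc n)) * (LINT x|lborel. norm (\<theta> x))"
    proof (rule always_eventually, rule allI)
      fix n
      have i: "integrable lborel (\<lambda>x. kconv m (s n) x * \<theta> x)" "integrable lborel (\<lambda>x. kconv m (t n) x * \<theta> x)"
        by (intro kconv_times_integrable m s ts ths)+
      have "norm (LINT x|lborel. kconv m (s n) x * \<theta> x - kconv m (t n) x * \<theta> x) \<le> (LINT x|lborel. (1 / real (Suc n)) * norm (\<theta> x))"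
      proof (rule norm_integral_le)
        show "integrable lborel (\<lambda>x. (1 / real (Suc n)) * norm (\<theta> x))" by (intro integrable_mult_right integrable_norm schwartz_integrable ths)
        show "norm (kconv m (s n) x * \<theta> x - kconv m (t n) x * \<theta> x) \<le> (1 / real (Suc n)) * norm (\<theta> x)" for x
        proof (cases "\<theta> x = 0")
          case False
          then show ?thesis unfolding left_diff_distrib[symmetric] norm_mult using kd[OF False, of n]
            by (intro mult_right_mono) (auto simp: norm_minus_commute)
        qed simp
      qed (use i in simp)
      then show "norm ((LINT x|lborel. kconv m (s n) x * \<theta> x) - (LINT x|lborel. kconv m (t n) x * \<theta> x)) \<le> (1 / real (Suc n)) * (LINT x|lborel. norm (\<theta> x))"
        using i by simp
    qed
    have "(\<lambda>n. 1 / real (Suc n)) \<longlonglongrightarrow> 0" using LIMSEQ_inverse_real_of_nat by (simp add: inverse_eq_divide)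
    from tendsto_mult_left_zero[OF this] show "(\<lambda>n. (1 / real (Suc n)) * (LINT x|lborel. norm (\<theta> x))) \<longlonglongrightarrow> 0" .
  qed
  show "(\<lambda>n. LINT x|lborel. kconv m (s n) x * \<theta> x) \<longlonglongrightarrow> (LINT x|lebesgue. h x * \<theta> x)"
    using tendsto_add[OF 2 1] by simp
qed

end

text \<open>The value at the origin is close to the average over a small ball, uniformly in \<open>n\<close>, and the averages converge.\<close>

lemma equicontinuous_pairings_convergent:
  fixes F :: "nat \<Rightarrow> 'n::finite cfun"
  assumes c: "\<And>n. continuous_on UNIV (F n)" and eq: "\<And>n x. norm x \<le> 1 \<Longrightarrow> norm (F n x - F n 0) \<le> K * norm x" and K: "0 \<le> K"
    and p: "\<And>n \<theta>. test_function \<theta> \<Longrightarrow> integrable lborel (\<lambda>x. F n x * \<theta> x)" "\<And>\<theta>. test_function \<theta> \<Longrightarrow> convergent (\<lambda>n. LINT x|lborel. F n x * \<theta> x)"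
  shows "convergent (\<lambda>n. F n 0)"
proof (rule Cauchy_convergent, rule CauchyI)
  fix e :: real assume e: "0 < e"
  define \<delta> where "\<delta> = min 1 (e / (4 * (K + 1)))"
  have d: "0 < \<delta>" "\<delta> \<le> 1" using e K by (auto simp: \<delta>_def)
  have "K * \<delta> \<le> K * (e / (4 * (K + 1)))" using K by (intro mult_left_mono) (auto simp: \<delta>_def)
  also have "\<dots> < e / 4" using e K by (simp add: field_simps)
  finally have Kd: "K * \<delta> < e / 4" .
  obtain a b :: "real^'n" where ab: "0 \<in> box a b" "box a b \<subseteq> ball 0 \<delta>" using rational_boxes[OF d(1), of 0] by blast
  define \<theta> where "\<theta> t = complex_of_real (bumpr a b t)" for t
  have th: "test_function \<theta>" unfolding \<theta>_def by (rule test_function_bumpr)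
  have ti: "integrable lborel \<theta>" by (rule schwartz_integrable[OF test_function_schwartz[OF th]])
  define T where "T = (LINT x|lborel. bumpr a b x)"
  have bi: "integrable lborel (bumpr a b)" using ti by (simp add: \<theta>_def[abs_def] complex_of_real_integrable_eq)
  have T: "0 < T"
  proof -
    have "T \<noteq> 0"
    proof
      assume "T = 0"
      then have "AE x in lborel. bumpr a b x = 0"
        unfolding T_def by (rule iffD1[OF integral_nonneg_eq_0_iff_AE[OF bi AE_I2[OF bumpr_nonneg]]])
      then have "AE x in lebesgue. \<theta> x = 0" using AE_completion unfolding \<theta>_def by fastforce
      from continuous_AE_eq_0[OF smooth_continuous[OF test_function_smooth[OF th]] this, of 0]
      show False using ab(1) bumpr_pos_iff[of a b 0] by (simp add: \<theta>_def)
    qed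
    moreover have "0 \<le> T" unfolding T_def by (intro integral_nonneg_AE AE_I2 bumpr_nonneg)
    ultimately show ?thesis by simp
  qed
  have supp: "norm x \<le> \<delta>" if "\<theta> x \<noteq> 0" for x
    using that ab(2) bumpr_pos_iff[of a b x] bumpr_nonneg[of a b x] by (force simp: \<theta>_def)
  have close: "norm ((LINT x|lborel. F n x * \<theta> x) - F n 0 * T) \<le> K * \<delta> * T" for n
  proof -
    have tT: "(LINT x|lborel. \<theta> x) = T" unfolding \<theta>_def T_def by simp
    have "(LINT x|lborel. F n x * \<theta> x) - F n 0 * T = (LINT x|lborel. (F n x - F n 0) * \<theta> x)"
      unfolding left_diff_distrib by (subst Bochner_Integration.integral_diff) (use p(1)[OF th] ti tT in auto)
    also have "norm \<dots> \<le> (LINT x|lborel. K * \<delta> * bumpr a b x)"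
    proof (rule norm_integral_le)
      show "integrable lborel (\<lambda>x. (F n x - F n 0) * \<theta> x)" using p(1)[OF th] ti by (simp add: left_diff_distrib)
      show "norm ((F n x - F n 0) * \<theta> x) \<le> K * \<delta> * bumpr a b x" for x
      proof (cases "\<theta> x = 0")
        case True then show ?thesis using K d bumpr_nonneg[of a b x] by simp
      next
        case False
        have "norm (F n x - F n 0) \<le> K * \<delta>"
          using eq[of x n] supp[OF False] d(2) mult_left_mono[OF supp[OF False] K] by linarith
        then show ?thesis using bumpr_nonneg[of a b x] by (auto simp: norm_mult \<theta>_def intro: mult_right_mono)
      qed
    qed (use bi in simp)
    finally show ?thesis by (simp add: T_def)
  qed
  have Cy: "Cauchy (\<lambda>n. LINT x|lborel. F n x * \<theta> x)" by (rule convergent_Cauchy[OF p(2)[OF th]])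
  have "0 < e / 2 * T" using e T by simp
  from CauchyD[OF Cy this] obtain M where M: "\<And>i j. M \<le> i \<Longrightarrow> M \<le> j \<Longrightarrow> norm ((LINT x|lborel. F i x * \<theta> x) - (LINT x|lborel. F j x * \<theta> x)) < e / 2 * T"
    by blast
  show "\<exists>M. \<forall>i\<ge>M. \<forall>j\<ge>M. norm (F i 0 - F j 0) < e"
  proof (intro exI allI impI)
    fix i j assume ij: "M \<le> i" "M \<le> j"
    let ?I = "\<lambda>n. LINT x|lborel. F n x * \<theta> x"
    have "F i 0 * T - F j 0 * T = (?I i - ?I j) - (?I i - F i 0 * T) + (?I j - F j 0 * T)" by simp
    also have "norm \<dots> \<le> norm (?I i - ?I j) + norm (?I i - F i 0 * T) + norm (?I j - F j 0 * T)"
      by (rule order_trans[OF norm_triangle_ineq]) (intro add_mono norm_triangle_ineq4 order_refl)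
    also have "\<dots> < e / 2 * T + K * \<delta> * T + K * \<delta> * T" using M[OF ij] close[of i] close[of j] by linarith
    also have "\<dots> < e * T" using mult_strict_right_mono[OF Kd T] by (simp add: algebra_simps)
    finally have "norm (F i 0 - F j 0) * T < e * T" using T by (simp add: left_diff_distrib[symmetric] norm_mult)
    then show "norm (F i 0 - F j 0) < e" using T by simp
  qed
qed

section \<open>Construction of the image\<close>

text \<open>The multiplier applied to the approximations of \<open>f\<close> gives distributions that are bounded and
  equicontinuous, uniformly in the index.  So they converge as soon as their averages over small balls
  do, and the limits of these averages are known from the multiplier on the Orlicz space.\<close>

proposition multiplier_image:
  fixes f :: "'n::finite dist" and E :: "real^'n \<Rightarrow> real"
  assumes m: "tempered m" and st1: "star_shaped r \<Phi>\<^sub>1" and st2: "star_shaped r \<Phi>\<^sub>2"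
    and q1: "upper_index \<Phi>\<^sub>1 < \<infinity> \<Longrightarrow> quasi_young_function \<Phi>\<^sub>1" and bd: "orlicz_multiplier_bounded m \<Phi>\<^sub>1 \<Phi>\<^sub>2"
    and f: "tempered f" and w: "window \<omega>"
    and E: "E \<in> borel_measurable borel" "\<And>x. 0 \<le> E x" "lnorm \<Phi>\<^sub>1 (\<lambda>x. complex_of_real (E x)) < \<infinity>"
    and e: "\<And>x Y. norm (f (tf \<omega> Y)) \<le> E x * br ((x, 0) - Y) ^ L"
  obtains U where "tempered U" "\<And>\<psi> h. schwartz \<psi> \<Longrightarrow> orlicz_multiplier m \<Phi>\<^sub>1 \<Phi>\<^sub>2 (conv f \<psi>) h \<Longrightarrow> AE x in lebesgue. h x = conv U \<psi> x"
    "\<And>\<psi>. schwartz \<psi> \<Longrightarrow> conv f \<psi> \<in> orlicz_space \<Phi>\<^sub>1"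
proof -
  have ws: "schwartz \<omega>" using w by (simp add: window_def)
  have ex: "\<exists>h. orlicz_multiplier m \<Phi>\<^sub>1 \<Phi>\<^sub>2 g h" if "g \<in> orlicz_space \<Phi>\<^sub>1" for g
    using bd that unfolding orlicz_multiplier_bounded_def by blast
  obtain A where A: "0 < A" "\<And>g :: 'n cfun. schwartz g \<Longrightarrow> lnorm \<Phi>\<^sub>2 (kconv m g) \<le> ennreal A * lnorm \<Phi>\<^sub>1 g"
    using schwartz_multiplier_bound[OF m st1 st2 bd] by blast
  obtain C0 k0 where C0: "0 \<le> C0" "\<And>\<psi> x. schwartz \<psi> \<Longrightarrow> norm (conv f \<psi> x) \<le> C0 * sn k0 k0 (\<lambda>t. \<psi> (- t)) * E x"
    using conv_envelope[OF f w e] by metis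
  have orl: "conv f \<psi> \<in> orlicz_space \<Phi>\<^sub>1" if p: "schwartz \<psi>" for \<psi>
  proof -
    let ?c = "C0 * sn k0 k0 (\<lambda>t. \<psi> (- t))"
    have c: "0 \<le> ?c" using C0(1) sn_nonneg[OF schwartz_translate(4)[OF p]] by simp
    have "lnorm \<Phi>\<^sub>1 (conv f \<psi>) \<le> ennreal (?c + 1) * lnorm \<Phi>\<^sub>1 (\<lambda>x. complex_of_real (E x))"
    proof (rule lnorm_mono[OF st1 AE_I2])
      show "norm (conv f \<psi> x) \<le> (?c + 1) * norm (complex_of_real (E x))" for x
        using C0(2)[OF p, of x] E(2)[of x] by (simp add: distrib_right)
      show "0 < ?c + 1" using c by linarith
    qed
    also have "\<dots> < \<infinity>" using E(3) by (simp add: ennreal_mult_less_top)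
    finally show ?thesis
      using borel_imp_lebesgue[OF borel_measurable_continuous_onI[OF conv_continuous[OF f p]]] by (simp add: orlicz_space_def)
  qed
  obtain g :: "nat \<Rightarrow> 'n cfun" and C1 k1 where g: "\<And>n. schwartz (g n)"
    and gf: "\<And>\<theta>. schwartz \<theta> \<Longrightarrow> (\<lambda>n. LINT t|lborel. g n t * \<theta> t) \<longlonglongrightarrow> f \<theta>" and C1: "0 \<le> C1"
    and gE: "\<And>n \<theta> x Z. schwartz \<theta> \<Longrightarrow> norm (LINT t|lborel. g n t * tf \<theta> Z t) \<le> C1 * sn k1 k1 \<theta> * E x * br ((x, 0) - Z) ^ L"
    by (fact envelope_approximation[OF f w e])
  have C1': "0 \<le> C1 * sn k1 k1 \<omega>" using C1 sn_nonneg[OF ws] by simp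
  obtain B k where B: "0 \<le> B" and B': "\<And>g \<theta>. schwartz g \<Longrightarrow>
    (\<And>x Z. norm (LINT t|lborel. g t * tf \<omega> Z t) \<le> C1 * sn k1 k1 \<omega> * E x * br ((x, 0) - Z) ^ L) \<Longrightarrow>
    schwartz \<theta> \<Longrightarrow> norm (multiplier m g \<theta>) \<le> B * sn k k \<theta>"
    using multiplier_uniformly_tempered[OF m st1 st2 w less_imp_le[OF A(1)] A(2) E(2,3) C1', where L=L] by blast
  define u where "u n = multiplier m (g n)" for n
  have u: "tempered (u n)" for n using multiplier_tempered[OF m] g unfolding u_def by metis
  have ub: "norm (u n \<theta>) \<le> B * sn k k \<theta>" if "schwartz \<theta>" for n \<theta>
    unfolding u_def by (rule B'[OF g gE[OF ws] that])
  have uk: "conv (u n) \<psi> = kconv m (cv (g n) \<psi>)" if "schwartz \<psi>" for n \<psi>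
    unfolding u_def by (rule ext, rule conv_multiplier[OF m g that])
  define b where "b \<psi> = B * (jet_const TYPE('n) k)\<^sup>2 * sn k k (\<lambda>t. \<psi> (- t))" for \<psi> :: "'n cfun"
  have b0: "0 \<le> b \<psi>" if "schwartz \<psi>" for \<psi> unfolding b_def using B sn_nonneg[OF schwartz_translate(4)[OF that]] by simp
  have cb: "norm (conv (u n) \<psi> x) \<le> b \<psi> * br x ^ (k + k)" if p: "schwartz \<psi>" for n \<psi> x
    using tempered_tf_growth[where u="u n" and X="(x, 0)", OF ub B schwartz_translate(4)[OF p]] by (simp add: conv_tf b_def br_def norm_Pair)
  have pairing: "integrable lebesgue (\<lambda>x. h x * \<theta> x) \<and> (\<lambda>n. LINT x|lborel. conv (u n) \<psi> x * \<theta> x) \<longlonglongrightarrow> (LINT x|lebesgue. h x * \<theta> x)"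
    if p: "schwartz \<psi>" and h: "orlicz_multiplier m \<Phi>\<^sub>1 \<Phi>\<^sub>2 (conv f \<psi>) h" and th: "test_function \<theta>" for \<psi> h \<theta>
  proof -
    obtain R where R: "1 \<le> R" "\<And>x. \<theta> x \<noteq> 0 \<Longrightarrow> br x \<le> R" using test_function_support[OF th] by blast
    let ?K = "C1 * sn k1 k1 (\<lambda>t. \<psi> (- t))"
    have K: "0 \<le> ?K" using C1 sn_nonneg[OF schwartz_translate(4)[OF p]] by simp
    have s: "schwartz (cv (g n) \<psi>)" for n by (rule schwartz_cv[OF g p])
    have sE: "norm (cv (g n) \<psi> x) \<le> ?K * E x" for n x
      using gE[OF schwartz_translate(4)[OF p], of n "(x, 0)" x] by (simp add: tf_def cv_def br_def ee_def)
    have sG: "(\<lambda>n. cv (g n) \<psi> x) \<longlonglongrightarrow> conv f \<psi> x" for x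
      using gf[OF schwartz_translate(3)[OF p]] by (simp add: cv_def conv_def)
    have bd: "norm (kconv m (cv (g n) \<psi>) x) \<le> b \<psi> * R ^ (k + k)" if "\<theta> x \<noteq> 0" for n x
      unfolding uk[OF p, symmetric]
      by (rule order_trans[OF cb[OF p]]) (intro mult_left_mono power_mono R(2)[OF that] b0[OF p] br_nonneg)
    have "0 \<le> b \<psi> * R ^ (k + k)" using b0[OF p] R(1) by simp
    from schwartz_multiplier_limit[OF m st1 st2 q1 ex E K s sE sG h th this bd]
    show ?thesis unfolding uk[OF p] by simp
  qed
  have conv: "convergent (\<lambda>n. u n \<theta>)" if t: "schwartz \<theta>" for \<theta>
  proof -
    let ?\<psi> = "\<lambda>t. \<theta> (- t)"
    have p: "schwartz ?\<psi>" by (rule schwartz_translate(4)[OF t])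
    obtain c where c: "0 \<le> c" "\<And>X X'. norm (X' - X) \<le> 1 \<Longrightarrow> sn k k (\<lambda>s. tf \<theta> X' s - tf \<theta> X s) \<le> c * br X ^ (k + 1 + k) * norm (X' - X)"
      by (fact sn_tf_diff[OF t])
    obtain h where h: "orlicz_multiplier m \<Phi>\<^sub>1 \<Phi>\<^sub>2 (conv f ?\<psi>) h" using ex[OF orl[OF p]] by blast
    have "convergent (\<lambda>n. conv (u n) ?\<psi> 0)"
    proof (rule equicontinuous_pairings_convergent)
      show "continuous_on UNIV (conv (u n) ?\<psi>)" for n by (rule conv_continuous[OF u p])
      show "0 \<le> B * c" using B c(1) by simp
      show "norm (conv (u n) ?\<psi> x - conv (u n) ?\<psi> 0) \<le> B * c * norm x" if x: "norm x \<le> 1" for n x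
      proof -
        have "conv (u n) ?\<psi> x - conv (u n) ?\<psi> 0 = u n (\<lambda>s. tf \<theta> (x, 0) s - tf \<theta> 0 s)"
          using tempered_diff[OF u schwartz_tf(1)[OF t] schwartz_tf(1)[OF t], of n "(x, 0)" 0] by (simp add: conv_def tf_def[abs_def] ee_def)
        also have "norm \<dots> \<le> B * sn k k (\<lambda>s. tf \<theta> (x, 0) s - tf \<theta> 0 s)"
          by (rule ub[OF schwartz_diff[OF schwartz_tf(1)[OF t] schwartz_tf(1)[OF t]]])
        also have "\<dots> \<le> B * (c * norm x)"
          using c(2)[of "(x, 0)" 0] x B by (intro mult_left_mono) (auto simp: norm_Pair br_def)
        finally show ?thesis by (simp add: mult.assoc)
      qed
      fix \<theta>' :: "'n cfun" assume th: "test_function \<theta>'"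
      show "integrable lborel (\<lambda>x. conv (u n) ?\<psi> x * \<theta>' x)" for n
        unfolding uk[OF p] by (rule kconv_times_integrable[OF m schwartz_cv[OF g p] test_function_schwartz[OF th]])
      show "convergent (\<lambda>n. LINT x|lborel. conv (u n) ?\<psi> x * \<theta>' x)"
        using pairing[OF p h th] unfolding convergent_def by blast
    qed
    then show ?thesis by (simp add: conv_def)
  qed
  define U where "U \<theta> = lim (\<lambda>n. u n \<theta>)" for \<theta>
  have lim: "(\<lambda>n. u n \<theta>) \<longlonglongrightarrow> U \<theta>" if "schwartz \<theta>" for \<theta>
    using conv[OF that] unfolding U_def by (simp add: convergent_LIMSEQ_iff)
  have U: "tempered U"
  proof (rule temperedI[where C=B and k=k and N=k])
    fix \<psi> \<eta> :: "'n cfun" and c assume p: "schwartz \<psi>"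
    { assume q: "schwartz \<eta>"
      show "U (\<lambda>x. \<psi> x + \<eta> x) = U \<psi> + U \<eta>"
        by (rule LIMSEQ_unique[OF lim[OF schwartz_add(1)[OF p q]]])
          (use tendsto_add[OF lim[OF p] lim[OF q]] in \<open>simp add: tempered_add[OF u p q]\<close>) }
    show "U (\<lambda>x. c * \<psi> x) = c * U \<psi>"
      by (rule LIMSEQ_unique[OF lim[OF schwartz_cmult(1)[OF p]]])
        (use tendsto_mult_left[OF lim[OF p], of c] in \<open>simp add: tempered_cmult[OF u p]\<close>)
    show "norm (U \<psi>) \<le> B * sn k k \<psi>"
      by (rule LIMSEQ_le_const2[OF tendsto_norm[OF lim[OF p]]]) (use ub[OF p] in auto)
  qed (rule B)
  show ?thesis
  proof (rule that[OF U _ orl])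
    fix \<psi> h assume p: "schwartz \<psi>" and h: "orlicz_multiplier m \<Phi>\<^sub>1 \<Phi>\<^sub>2 (conv f \<psi>) h"
    have hm: "h \<in> borel_measurable lebesgue" using h by (auto simp: orlicz_multiplier_def orlicz_space_def)
    have Um: "conv U \<psi> \<in> borel_measurable borel" by (rule borel_measurable_continuous_onI[OF conv_continuous[OF U p]])
    have cl: "(\<lambda>n. conv (u n) \<psi> x) \<longlonglongrightarrow> conv U \<psi> x" for x
      unfolding conv_def by (rule lim[OF schwartz_translate(3)[OF p]])
    have key: "integrable lebesgue (\<lambda>x. (h x - conv U \<psi> x) * \<theta> x) \<and> (LINT x|lebesgue. (h x - conv U \<psi> x) * \<theta> x) = 0"
      if th: "test_function \<theta>" for \<theta>
    proof -
      have t: "schwartz \<theta>" by (rule test_function_schwartz[OF th])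
      obtain R where R: "1 \<le> R" "\<And>x. \<theta> x \<noteq> 0 \<Longrightarrow> br x \<le> R" using test_function_support[OF th] by blast
      let ?D = "\<lambda>x. b \<psi> * R ^ (k + k) * norm (\<theta> x)"
      have Di: "integrable lborel ?D" by (intro integrable_mult_right integrable_norm schwartz_integrable t)
      have D: "norm (conv (u n) \<psi> x * \<theta> x) \<le> ?D x" for n x
      proof (cases "\<theta> x = 0")
        case False
        have "norm (conv (u n) \<psi> x) \<le> b \<psi> * R ^ (k + k)"
          by (rule order_trans[OF cb[OF p]]) (intro mult_left_mono power_mono R(2)[OF False] b0[OF p] br_nonneg)
        then show ?thesis by (simp add: norm_mult mult_right_mono)
      qed simp
      have um: "conv (u n) \<psi> \<in> borel_measurable borel" for n by (rule borel_measurable_continuous_onI[OF conv_continuous[OF u p]])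
      note dc = integrable_dominated_convergence[where s="\<lambda>n x. conv (u n) \<psi> x * \<theta> x" and f="\<lambda>x. conv U \<psi> x * \<theta> x" and M=lborel and w="?D"]
        integral_dominated_convergence[where s="\<lambda>n x. conv (u n) \<psi> x * \<theta> x" and f="\<lambda>x. conv U \<psi> x * \<theta> x" and M=lborel and w="?D"]
      have mm: "(\<lambda>x. conv U \<psi> x * \<theta> x) \<in> borel_measurable borel" "(\<lambda>x. conv (u n) \<psi> x * \<theta> x) \<in> borel_measurable borel" for n
        by (intro borel_measurable_times Um um schwartz_borel t)+
      have Ui: "integrable lborel (\<lambda>x. conv U \<psi> x * \<theta> x)" and Ul: "(\<lambda>n. LINT x|lborel. conv (u n) \<psi> x * \<theta> x) \<longlonglongrightarrow> (LINT x|lborel. conv U \<psi> x * \<theta> x)"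
        by (rule dc; use mm Di D in \<open>auto intro!: tendsto_mult cl\<close>)+
      have "(LINT x|lebesgue. h x * \<theta> x) = (LINT x|lebesgue. conv U \<psi> x * \<theta> x)"
        unfolding lebesgue_integral_borel(1)[OF mm(1)] by (rule LIMSEQ_unique[OF _ Ul]) (use pairing[OF p h th] in blast)
      moreover have "integrable lebesgue (\<lambda>x. conv U \<psi> x * \<theta> x)" using Ui lebesgue_integral_borel(2)[OF mm(1)] by blast
      ultimately show ?thesis using pairing[OF p h th] by (simp add: left_diff_distrib)
    qed
    have "AE x in lebesgue. h x - conv U \<psi> x = 0"
      by (rule AE_eq_0_if_test_integrals) (use key hm borel_imp_lebesgue[OF Um] in auto)
    then show "AE x in lebesgue. h x = conv U \<psi> x" by eventually_elim simp
  qed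
qed

text \<open>The multiplier is determined up to null sets only, which allows its values to be replaced by continuous functions.\<close>

lemma orlicz_multiplier_cong:
  assumes st2: "star_shaped r \<Phi>\<^sub>2" and h: "orlicz_multiplier m \<Phi>\<^sub>1 \<Phi>\<^sub>2 g h" and ae: "AE x in lebesgue. h x = h' x" and h'm: "h' \<in> borel_measurable lebesgue"
  shows "orlicz_multiplier m \<Phi>\<^sub>1 \<Phi>\<^sub>2 g h'"
proof -
  have hm: "h \<in> borel_measurable lebesgue" using h by (auto simp: orlicz_multiplier_def orlicz_space_def)
  have "lnorm \<Phi>\<^sub>2 (\<lambda>x. a x - h' x) = lnorm \<Phi>\<^sub>2 (\<lambda>x. a x - h x)" for a
    by (rule lnorm_cong[OF st2]) (use ae in eventually_elim, simp)
  moreover have "lnorm \<Phi>\<^sub>2 h' = lnorm \<Phi>\<^sub>2 h" by (rule lnorm_cong[OF st2]) (use ae in eventually_elim, simp)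
  moreover have "represents h' v" if "represents h v" for v
    unfolding represents_def
  proof (intro conjI allI impI h'm)
    fix \<psi> :: "real^'a \<Rightarrow> complex" assume t: "test_function \<psi>"
    have pm: "\<psi> \<in> borel_measurable lebesgue" by (intro borel_imp_lebesgue schwartz_borel test_function_schwartz t)
    have i: "integrable lebesgue (\<lambda>x. h x * \<psi> x)" "v \<psi> = (LINT x|lebesgue. h x * \<psi> x)" using that t by (auto simp: represents_def)
    have e: "AE x in lebesgue. h x * \<psi> x = h' x * \<psi> x" using ae by eventually_elim simp
    have mm: "(\<lambda>x. h x * \<psi> x) \<in> borel_measurable lebesgue" "(\<lambda>x. h' x * \<psi> x) \<in> borel_measurable lebesgue"
      by (intro borel_measurable_times hm h'm pm)+
    show "integrable lebesgue (\<lambda>x. h' x * \<psi> x)" using i(1) integrable_cong_AE[OF mm e] by simp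
    show "v \<psi> = (LINT x|lebesgue. h' x * \<psi> x)" using i(2) integral_cong_AE[OF mm e] by simp
  qed
  ultimately show ?thesis using h h'm unfolding orlicz_multiplier_def orlicz_space_def by (auto split: if_splits)
qed

lemma orlicz_norm_mono:
  fixes a b :: "'a::euclidean_space \<Rightarrow> ennreal"
  assumes st: "star_shaped r \<Psi>" and c: "0 < c" and ab: "\<And>x. a x \<le> ennreal c * b x"
  shows "orlicz_norm \<Psi> a \<le> ennreal c * orlicz_norm \<Psi> b"
proof -
  define \<Psi>' where "\<Psi>' = (\<lambda>t. if t = \<infinity> then \<infinity> else \<Psi> (enn2real t))"
  have mono: "\<Psi>' s \<le> \<Psi>' t" if "s \<le> t" for s t
  proof (cases "t = \<infinity>")
    case False
    then have "s \<noteq> \<infinity>" "enn2real s \<le> enn2real t" using that by (auto simp: top_unique enn2real_mono less_top)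
    then show ?thesis using False star_mono[OF st] by (simp add: \<Psi>'_def)
  qed (simp add: \<Psi>'_def)
  have on: "orlicz_norm \<Psi> g = (INF l\<in>{l::real. 0 < l \<and> (\<integral>\<^sup>+x. \<Psi>' (g x / ennreal l) \<partial>lebesgue) \<le> 1}. ennreal l)" for g :: "'a \<Rightarrow> ennreal"
    by (simp add: orlicz_norm_def \<Psi>'_def Let_def)
  have "ennreal (1 / c) * orlicz_norm \<Psi> a \<le> orlicz_norm \<Psi> b"
    unfolding on[of b]
  proof (rule INF_greatest)
    fix l assume "l \<in> {l::real. 0 < l \<and> (\<integral>\<^sup>+x. \<Psi>' (b x / ennreal l) \<partial>lebesgue) \<le> 1}"
    then have l: "0 < l" "(\<integral>\<^sup>+x. \<Psi>' (b x / ennreal l) \<partial>lebesgue) \<le> 1" by auto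
    have "a x / ennreal (c * l) \<le> b x / ennreal l" for x
    proof -
      have "a x / ennreal (c * l) \<le> ennreal c * b x / ennreal (c * l)" by (rule divide_right_mono_ennreal[OF ab])
      also have "\<dots> = b x / ennreal l"
        using c l(1) by (cases "b x") (auto simp: ennreal_mult[symmetric] divide_ennreal ennreal_mult_top ennreal_top_divide)
      finally show ?thesis .
    qed
    then have "(\<integral>\<^sup>+x. \<Psi>' (a x / ennreal (c * l)) \<partial>lebesgue) \<le> (\<integral>\<^sup>+x. \<Psi>' (b x / ennreal l) \<partial>lebesgue)"
      by (intro nn_integral_mono mono)
    then have "orlicz_norm \<Psi> a \<le> ennreal (c * l)"
      unfolding on using c l by (intro INF_lower) auto
    then have "ennreal (1 / c) * orlicz_norm \<Psi> a \<le> ennreal (1 / c) * ennreal (c * l)" by (rule mult_left_mono) simp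
    also have "\<dots> = ennreal l" using c l(1) by (simp add: ennreal_mult[symmetric])
    finally show "ennreal (1 / c) * orlicz_norm \<Psi> a \<le> ennreal l" .
  qed
  then have "ennreal c * (ennreal (1 / c) * orlicz_norm \<Psi> a) \<le> ennreal c * orlicz_norm \<Psi> b" by (rule mult_left_mono) simp
  moreover have "ennreal c * (ennreal (1 / c) * orlicz_norm \<Psi> a) = orlicz_norm \<Psi> a"
    using c by (simp add: mult.assoc[symmetric] ennreal_mult[symmetric])
  ultimately show ?thesis by simp
qed

section \<open>Short-time Fourier transforms as convolutions\<close>

lemma stft'_conv: "stft' \<phi> f (x, \<xi>) = ft_const TYPE('n) * conv f (\<lambda>t. tf (\<lambda>t. cnj (\<phi> t)) (0, \<xi>) (- t)) x" for f :: "'n::finite dist"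
  by (simp add: stft'_def conv_def tf_def ee_def mult.commute inner_diff_left algebra_simps)

lemma norm_stft':
  fixes f :: "'n::finite dist"
  assumes "tempered f" "schwartz \<phi>" shows "norm (stft' \<phi> f (x, \<xi>)) = norm (stft \<phi> f (x, \<xi>))"
  using norm_conv_atom[OF assms(1) schwartz_cnj[OF assms(2)], of \<xi> x] by (simp only: stft'_conv stft_tf norm_mult)

lemma stft'_conv_schwartz:
  fixes f :: "'n::finite dist"
  assumes f: "tempered f" and p: "schwartz \<phi>"
  obtains \<psi> where "schwartz \<psi>" "\<And>(f :: 'n dist) x. tempered f \<Longrightarrow> stft' \<phi> f (x, \<xi>) = conv f \<psi> x"
proof (rule that)
  have s: "schwartz (tf (\<lambda>t. cnj (\<phi> t)) (0, \<xi>))" by (intro schwartz_tf schwartz_cnj p)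
  show "schwartz (\<lambda>t. ft_const TYPE('n) * tf (\<lambda>t. cnj (\<phi> t)) (0, \<xi>) (- t))" by (intro schwartz_cmult schwartz_translate s)
  fix f :: "'n dist" and x assume f: "tempered f"
  show "stft' \<phi> f (x, \<xi>) = conv f (\<lambda>t. ft_const TYPE('n) * tf (\<lambda>t. cnj (\<phi> t)) (0, \<xi>) (- t)) x"
    unfolding stft'_conv conv_def using tempered_cmult[OF f schwartz_translate(1)[OF s]] by simp
qed

text \<open>For almost all frequencies the slices of \<open>v\<close> and \<open>U\<close> agree almost everywhere.  By continuity they agree everywhere; at the origin of
  phase space this says that \<open>v\<close> and \<open>U\<close> agree on the conjugate of the window, which is arbitrary.\<close>

lemma modulation_multiplier_unique:
  fixes f U v :: "'n::finite dist"
  assumes f: "tempered f" and U: "tempered U" and v: "modulation_multiplier m \<Phi>\<^sub>1 \<Phi>\<^sub>2 f v"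
    and uniq: "\<And>\<psi> h. schwartz \<psi> \<Longrightarrow> orlicz_multiplier m \<Phi>\<^sub>1 \<Phi>\<^sub>2 (conv f \<psi>) h \<Longrightarrow> AE x in lebesgue. h x = conv U \<psi> x"
  shows "dist_eq v U"
  unfolding dist_eq_def
proof (intro allI impI)
  fix \<theta> :: "'n cfun" assume t: "schwartz \<theta>"
  have vt: "tempered v" using v by (simp add: modulation_multiplier_def)
  show "v \<theta> = U \<theta>"
  proof (cases "\<exists>x. \<theta> x \<noteq> 0")
    case False
    then have "\<theta> = (\<lambda>x. 0 * \<theta> x)" by auto
    then show ?thesis using tempered_cmult[OF vt t, of 0] tempered_cmult[OF U t, of 0] by simp
  next
    case True
    define \<phi> where "\<phi> x = cnj (\<theta> x)" for x
    have p: "window \<phi>" "schwartz \<phi>" using True schwartz_cnj[OF t] by (auto simp: window_def \<phi>_def[abs_def])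
    have \<theta>: "(\<lambda>t. cnj (\<phi> t)) = \<theta>" by (simp add: \<phi>_def)
    have "AE \<xi> in lebesgue. v (tf \<theta> (0, \<xi>)) - U (tf \<theta> (0, \<xi>)) = 0"
    proof -
      have "AE \<xi> in lebesgue. orlicz_multiplier m \<Phi>\<^sub>1 \<Phi>\<^sub>2 (\<lambda>x. stft' \<phi> f (x, \<xi>)) (\<lambda>x. stft' \<phi> v (x, \<xi>))"
        using v p(1) unfolding modulation_multiplier_def by blast
      then show ?thesis
      proof eventually_elim
        case (elim \<xi>)
        obtain \<psi> where s: "schwartz \<psi>" and \<psi>: "\<And>(f :: 'n dist) x. tempered f \<Longrightarrow> stft' \<phi> f (x, \<xi>) = conv f \<psi> x"
          using stft'_conv_schwartz[OF f p(2)] by blast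
        have "AE x in lebesgue. conv v \<psi> x = conv U \<psi> x"
          using uniq[OF s] elim unfolding \<psi>[OF f] \<psi>[OF vt] by blast
        then have "AE x in lebesgue. conv v \<psi> x - conv U \<psi> x = 0" by eventually_elim simp
        from continuous_AE_eq_0[OF continuous_on_diff[OF conv_continuous[OF vt s] conv_continuous[OF U s]] this, of 0]
        have "stft' \<phi> v (0, \<xi>) = stft' \<phi> U (0, \<xi>)" by (simp add: \<psi>[OF vt] \<psi>[OF U])
        then show ?case using ft_const_nonzero[where 'n='n] by (simp add: stft'_conv conv_def \<theta>)
      qed
    qed
    moreover have "continuous_on UNIV (\<lambda>\<xi>. v (tf \<theta> (0, \<xi>)) - U (tf \<theta> (0, \<xi>)))"
      by (intro continuous_on_diff continuous_on_compose2[OF tempered_tf_continuous[OF vt t]]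
        continuous_on_compose2[OF tempered_tf_continuous[OF U t]]) (auto intro!: continuous_intros)
    ultimately have "v (tf \<theta> (0, 0)) - U (tf \<theta> (0, 0)) = 0" using continuous_AE_eq_0 by blast
    then show ?thesis by (simp add: zero_prod_def[symmetric])
  qed
qed

lemma young_imp_quasi_young:
  assumes y: "young_function \<Phi>" shows "quasi_young_function \<Phi>"
proof -
  have "young_function (\<lambda>t. \<Phi> (t powr (1 / 1)))"
    unfolding young_function_def
  proof (intro conjI allI ballI impI)
    fix s t u :: real assume "0 \<le> s" "0 \<le> t" "u \<in> {0..1}"
    then show "\<Phi> ((u * s + (1 - u) * t) powr (1 / 1)) \<le> ennreal u * \<Phi> (s powr (1 / 1)) + ennreal (1 - u) * \<Phi> (t powr (1 / 1))"
      using y by (simp add: young_function_def)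
  next
    show "\<Phi> (0 powr (1 / 1)) = 0" using y by (simp add: young_function_def)
    obtain t where "0 < t" "\<Phi> t < \<infinity>" using y by (auto simp: young_function_def)
    then show "\<exists>t>0. \<Phi> (t powr (1 / 1)) < \<infinity>" by (intro exI[of _ t]) simp
    have "(\<Phi> \<longlongrightarrow> \<infinity>) at_top" using y by (simp add: young_function_def)
    then show "((\<lambda>t. \<Phi> (t powr (1 / 1))) \<longlongrightarrow> \<infinity>) at_top"
      by (rule Lim_transform_eventually) (use eventually_ge_at_top[of 0] in eventually_elim, simp)
  qed
  then show ?thesis unfolding quasi_young_function_def by (intro exI[of _ 1]) simp
qed

theorem theorem3p2:
  fixes \<Phi>\<^sub>1 \<Phi>\<^sub>2 \<Psi> :: "real \<Rightarrow> ennreal"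
    and m :: "'n::finite dist"
    and \<phi> :: "real^'n \<Rightarrow> complex"
  assumes "(quasi_young_function \<Phi>\<^sub>1 \<and> upper_index \<Phi>\<^sub>1 < \<infinity>) \<or> young_function \<Phi>\<^sub>1"
    and "quasi_young_function \<Phi>\<^sub>2"
    and "quasi_young_function \<Psi>"
    and "tempered m"
    and "window \<phi>"
    and "orlicz_multiplier_bounded m \<Phi>\<^sub>1 \<Phi>\<^sub>2"
  shows "modulation_multiplier_bounded \<phi> m \<Phi>\<^sub>1 \<Phi>\<^sub>2 \<Psi>"
proof -
  have q1: "quasi_young_function \<Phi>\<^sub>1" using assms(1) young_imp_quasi_young by blast
  have p: "schwartz \<phi>" using assms(5) by (simp add: window_def)
  note w = window_cnj[OF assms(5)]
  obtain r1 where r1: "star_shaped r1 \<Phi>\<^sub>1" using quasi_young_star_shaped[OF q1] by blast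
  obtain r2 where r2: "star_shaped r2 \<Phi>\<^sub>2" using quasi_young_star_shaped[OF assms(2)] by blast
  obtain r3 where r3: "star_shaped r3 \<Psi>" using quasi_young_star_shaped[OF assms(3)] by blast
  define r where "r = min r1 (min r2 r3)"
  have r: "0 < r" "r \<le> r1" "r \<le> r2" "r \<le> r3" using star_r(1)[OF r1] star_r(1)[OF r2] star_r(1)[OF r3] by (auto simp: r_def)
  note st1 = star_shaped_smaller[OF r1 r(1,2)] and st2 = star_shaped_smaller[OF r2 r(1,3)] and st = star_shaped_smaller[OF r3 r(1,4)]
  obtain C where C: "0 < C" "\<And>g. g \<in> orlicz_space \<Phi>\<^sub>1 \<Longrightarrow> \<exists>h. orlicz_multiplier m \<Phi>\<^sub>1 \<Phi>\<^sub>2 g h \<and> lnorm \<Phi>\<^sub>2 h \<le> ennreal C * lnorm \<Phi>\<^sub>1 g"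
    using assms(6) unfolding orlicz_multiplier_bounded_def by blast
  show ?thesis
    unfolding modulation_multiplier_bounded_def
  proof (intro exI[of _ C] conjI ballI C(1))
    fix f assume "f \<in> modulation_space \<phi> \<Phi>\<^sub>1 \<Psi>"
    then have f: "tempered f" and fin: "mixed_norm \<Phi>\<^sub>1 \<Psi> (stft \<phi> f) < \<infinity>" by (auto simp: modulation_space_def mixed_space_def)
    obtain E :: "real^'n \<Rightarrow> real" and L where E: "E \<in> borel_measurable borel" "\<And>x. 0 \<le> E x" "lnorm \<Phi>\<^sub>1 (\<lambda>x. complex_of_real (E x)) < \<infinity>"
      and e: "\<And>x Y. norm (f (tf (\<lambda>t. cnj (\<phi> t)) Y)) \<le> E x * br ((x, 0) - Y) ^ L"
      by (fact orlicz_envelope[OF f assms(5) st1 st fin])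
    obtain U where U: "tempered U" and uniq: "\<And>\<psi> h. schwartz \<psi> \<Longrightarrow> orlicz_multiplier m \<Phi>\<^sub>1 \<Phi>\<^sub>2 (conv f \<psi>) h \<Longrightarrow> AE x in lebesgue. h x = conv U \<psi> x"
      and orl: "\<And>\<psi>. schwartz \<psi> \<Longrightarrow> conv f \<psi> \<in> orlicz_space \<Phi>\<^sub>1"
      by (fact multiplier_image[OF assms(4) st1 st2 q1 assms(6) f w E e])
    have image: "orlicz_multiplier m \<Phi>\<^sub>1 \<Phi>\<^sub>2 (conv f \<psi>) (conv U \<psi>) \<and> lnorm \<Phi>\<^sub>2 (conv U \<psi>) \<le> ennreal C * lnorm \<Phi>\<^sub>1 (conv f \<psi>)"
      if s: "schwartz \<psi>" for \<psi>
    proof -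
      obtain h where h: "orlicz_multiplier m \<Phi>\<^sub>1 \<Phi>\<^sub>2 (conv f \<psi>) h" "lnorm \<Phi>\<^sub>2 h \<le> ennreal C * lnorm \<Phi>\<^sub>1 (conv f \<psi>)"
        using C(2)[OF orl[OF s]] by blast
      note ae = uniq[OF s h(1)]
      have "conv U \<psi> \<in> borel_measurable lebesgue"
        by (rule borel_imp_lebesgue[OF borel_measurable_continuous_onI[OF conv_continuous[OF U s]]])
      moreover have "lnorm \<Phi>\<^sub>2 h = lnorm \<Phi>\<^sub>2 (conv U \<psi>)" by (rule lnorm_cong[OF st2]) (use ae in eventually_elim, simp)
      ultimately show ?thesis using orlicz_multiplier_cong[OF st2 h(1) ae] h(2) by simp
    qed
    have mm: "modulation_multiplier m \<Phi>\<^sub>1 \<Phi>\<^sub>2 f U"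
      unfolding modulation_multiplier_def
    proof (intro conjI allI impI AE_I2 U)
      fix \<phi>' :: "real^'n \<Rightarrow> complex" and \<xi> assume "window \<phi>'"
      then have p': "schwartz \<phi>'" by (simp add: window_def)
      obtain \<psi> where s: "schwartz \<psi>" and \<psi>: "\<And>(f :: 'n dist) x. tempered f \<Longrightarrow> stft' \<phi>' f (x, \<xi>) = conv f \<psi> x"
        using stft'_conv_schwartz[OF f p'] by blast
      show "orlicz_multiplier m \<Phi>\<^sub>1 \<Phi>\<^sub>2 (\<lambda>x. stft' \<phi>' f (x, \<xi>)) (\<lambda>x. stft' \<phi>' U (x, \<xi>))"
        unfolding \<psi>[OF f] \<psi>[OF U] using image[OF s] by simp
    qed
    have slice: "lnorm \<Phi>\<^sub>2 (\<lambda>x. stft \<phi> U (x, \<xi>)) \<le> ennreal C * lnorm \<Phi>\<^sub>1 (\<lambda>x. stft \<phi> f (x, \<xi>))" for \<xi>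
    proof -
      obtain \<psi> where s: "schwartz \<psi>" and \<psi>: "\<And>(f :: 'n dist) x. tempered f \<Longrightarrow> stft' \<phi> f (x, \<xi>) = conv f \<psi> x"
        using stft'_conv_schwartz[OF f p] by blast
      have "lnorm \<Phi>\<^sub>2 (\<lambda>x. stft \<phi> U (x, \<xi>)) = lnorm \<Phi>\<^sub>2 (conv U \<psi>)" "lnorm \<Phi>\<^sub>1 (\<lambda>x. stft \<phi> f (x, \<xi>)) = lnorm \<Phi>\<^sub>1 (conv f \<psi>)"
        by (intro lnorm_cong[OF st2] lnorm_cong[OF st1] AE_I2; simp add: norm_stft'[OF _ p, symmetric] \<psi> U f)+
      then show ?thesis using image[OF s] by simp
    qed
    have bound: "modulation_norm \<phi> \<Phi>\<^sub>2 \<Psi> U \<le> ennreal C * modulation_norm \<phi> \<Phi>\<^sub>1 \<Psi> f"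
      unfolding modulation_norm_def mixed_norm_def by (rule orlicz_norm_mono[OF st C(1) slice])
    also have "\<dots> < \<infinity>" using fin by (simp add: modulation_norm_def ennreal_mult_less_top)
    finally have "U \<in> modulation_space \<phi> \<Phi>\<^sub>2 \<Psi>"
      using U borel_imp_lebesgue[OF borel_measurable_continuous_onI[OF stft_continuous[OF U p]]]
      by (simp add: modulation_space_def mixed_space_def modulation_norm_def)
    then show "\<exists>u\<in>modulation_space \<phi> \<Phi>\<^sub>2 \<Psi>. modulation_multiplier m \<Phi>\<^sub>1 \<Phi>\<^sub>2 f u \<and>
        (\<forall>v. modulation_multiplier m \<Phi>\<^sub>1 \<Phi>\<^sub>2 f v \<longrightarrow> dist_eq v u) \<and> modulation_norm \<phi> \<Phi>\<^sub>2 \<Psi> u \<le> ennreal C * modulation_norm \<phi> \<Phi>\<^sub>1 \<Psi> f"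
      using mm bound modulation_multiplier_unique[OF f U _ uniq] by blast
  qed
qed

end
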